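(* Let $\Omega_2=\{(x,y)\in\mathbb{R}^2 : x>0\}$ with the Friedlander operator $\Delta_F=\partial_x^2+(1+x)\partial_y^2$ and Dirichlet boundary condition on $x=0$. Let $1\le q\le\infty$, $2\le r\le\infty$, and set $\beta=2\left(\frac12-\frac1r\right)-\frac1q$. Suppose that the Strichartz estimate holds for $(q,r)$ on $\Omega_2$, i.e. there exist $t_0\in(0,\infty)$ and $C>0$ such that for all $h\in(0,1)$ and all solutions $u$ of the wave equation $(\partial_t^2-\Delta_F)u=0$ on $\Omega_2$ with $u|_{x=0}=0$, $$h^{\beta}\,\|\chi(hD_t)u\|_{L^q([-t_0,t_0],L^r(\Omega_2))}\le C\left(\|u|_{t=0}\|_{L^2(\Omega_2)}+\|hD_tu|_{t=0}\|_{L^2(\Omega_2)}\right).$$ Then $$\frac1q\le\left(\frac12-\frac1{10}\right)\left(\frac12-\frac1r\right).$$ In particular, if $r=+\infty$, then $q\ge5$.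
   Context: $D_t=-i\partial_t$. The function $\chi\in C_0^\infty$ is a fixed smooth truncation in a neighborhood of $1$ (equal to $1$ near $1$), and $\chi(hD_t)$ is the corresponding Fourier multiplier in the time variable, acting on the solution $u$ defined for all $t\in\mathbb{R}$. The spaces $L^2(\Omega_2)$, $L^r(\Omega_2)$ are taken with respect to $dx\,dy$; the operator $-\Delta_F$ with Dirichlet boundary condition is the corresponding positive self-adjoint operator on $L^2(\Omega_2)$. The domain $\Omega_2$ carries the metric $g_F$ inherited from $\Delta_F$. By convention $1/\infty=0$. *)

theory Defs
  imports "HOL-Analysis.Analysis" "HOL-Probability.Essential_Supremum"
begin

section \<open>Mixed Lebesgue norms\<close>

definition ennreal_powr :: "ennreal \<Rightarrow> real \<Rightarrow> ennreal" where
  "ennreal_powr a s = (if a = \<infinity> then \<infinity> else ennreal (enn2real a powr s))"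

text \<open>Only used for exponents p with 1 \<le> p \<le> \<infinity>. The argument is already nonnegative and extended
  real valued, so that the norms can be iterated.\<close>

definition Lp_norm :: "ennreal \<Rightarrow> 'a measure \<Rightarrow> ('a \<Rightarrow> ennreal) \<Rightarrow> ennreal" where
  "Lp_norm p M f =
     (if p = \<infinity> then esssup M f
      else ennreal_powr (\<integral>\<^sup>+ x. ennreal_powr (f x) (enn2real p) \<partial>M) (1 / enn2real p))"


section \<open>Smooth functions\<close>

coinductive smooth :: "('a::euclidean_space \<Rightarrow> 'b::real_normed_vector) \<Rightarrow> bool" where
  "\<lbrakk>\<And>x. f differentiable (at x); \<And>v. smooth (\<lambda>x. frechet_derivative f (at x) v)\<rbrakk> \<Longrightarrow> smooth f"

definition Cc_infinity :: "'a::euclidean_space set \<Rightarrow> ('a \<Rightarrow> 'b::real_normed_vector) set" where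
  "Cc_infinity S =
     {f. smooth f \<and> compact (closure {x. f x \<noteq> 0}) \<and> closure {x. f x \<noteq> 0} \<subseteq> S}"


section \<open>The half plane and the Friedlander operator\<close>

definition Omega2 :: "(real \<times> real) set" where
  "Omega2 = {(x, y). x > 0}"

definition M\<Omega> :: "(real \<times> real) measure" where
  "M\<Omega> = restrict_space lborel Omega2"

definition Lr_norm :: "ennreal \<Rightarrow> (real \<times> real \<Rightarrow> complex) \<Rightarrow> ennreal" where
  "Lr_norm r f = Lp_norm r M\<Omega> (\<lambda>z. ennreal (norm (f z)))"

definition L2_Omega :: "(real \<times> real \<Rightarrow> complex) set" where
  "L2_Omega = {f \<in> borel_measurable M\<Omega>. Lr_norm 2 f < \<infinity>}"

definition L2_inner :: "(real \<times> real \<Rightarrow> complex) \<Rightarrow> (real \<times> real \<Rightarrow> complex) \<Rightarrow> complex" where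
  "L2_inner f g = (LINT z|M\<Omega>. f z * cnj (g z))"

definition dx :: "(real \<times> real \<Rightarrow> complex) \<Rightarrow> real \<times> real \<Rightarrow> complex" where
  "dx f z = frechet_derivative f (at z) (1, 0)"

definition dy :: "(real \<times> real \<Rightarrow> complex) \<Rightarrow> real \<times> real \<Rightarrow> complex" where
  "dy f z = frechet_derivative f (at z) (0, 1)"

definition Friedlander :: "(real \<times> real \<Rightarrow> complex) \<Rightarrow> real \<times> real \<Rightarrow> complex" where
  "Friedlander f z = dx (dx f) z + of_real (1 + fst z) * dy (dy f) z"

text \<open>The form domain of the Dirichlet operator: the closure of the test functions in the norm
  whose square is the sum of the squared \<open>L\<^sup>2\<close> norms of \<open>f\<close>, \<open>\<partial>\<^sub>x f\<close> and \<open>\<surd>(1 + x) \<partial>\<^sub>y f\<close>.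
  The functions \<open>f1\<close> and \<open>f2\<close> are the limits of the two derivative terms. Membership in this space
  is what expresses the boundary condition on \<open>x = 0\<close>.\<close>

definition H10 :: "(real \<times> real \<Rightarrow> complex) set" where
  "H10 = {f \<in> L2_Omega. \<exists>f1\<in>L2_Omega. \<exists>f2\<in>L2_Omega. \<exists>\<phi> :: nat \<Rightarrow> real \<times> real \<Rightarrow> complex.
      (\<forall>n. \<phi> n \<in> Cc_infinity Omega2) \<and>
      (\<lambda>n. Lr_norm 2 (\<lambda>z. \<phi> n z - f z)) \<longlonglongrightarrow> 0 \<and>
      (\<lambda>n. Lr_norm 2 (\<lambda>z. dx (\<phi> n) z - f1 z)) \<longlonglongrightarrow> 0 \<and>
      (\<lambda>n. Lr_norm 2 (\<lambda>z. of_real (sqrt (1 + fst z)) * dy (\<phi> n) z - f2 z)) \<longlonglongrightarrow> 0}"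

text \<open>The graph of the positive self-adjoint operator \<open>-\<Delta>\<^sub>F\<close> on \<open>L\<^sup>2\<close> with Dirichlet condition
  (Friedrichs extension): \<open>f\<close> is in its domain if \<open>f\<close> is in the form domain and
  \<open>-\<Delta>\<^sub>F f\<close>, taken in the sense of distributions, is a function \<open>g\<close> in \<open>L\<^sup>2\<close>.\<close>

definition neg_Friedlander_D :: "(real \<times> real \<Rightarrow> complex) \<Rightarrow> (real \<times> real \<Rightarrow> complex) \<Rightarrow> bool" where
  "neg_Friedlander_D f g \<longleftrightarrow> f \<in> H10 \<and> g \<in> L2_Omega \<and>
     (\<forall>\<psi> \<in> Cc_infinity Omega2. L2_inner f (\<lambda>z. - Friedlander \<psi> z) = L2_inner g \<psi>)"


section \<open>Solutions of the wave equation\<close>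

text \<open>\<open>wave_solution u u1\<close>: \<open>u\<close> is a solution, for all times, of the Dirichlet problem with
  \<open>u|\<^sub>t\<^sub>=\<^sub>0 = u 0\<close> and \<open>\<partial>\<^sub>t u|\<^sub>t\<^sub>=\<^sub>0 = u1\<close> both in \<open>L\<^sup>2\<close>. For such data \<open>u\<close> is continuous in time with
  values in \<open>L\<^sup>2\<close>, while \<open>\<partial>\<^sub>t u\<close> and \<open>\<partial>\<^sub>t\<^sup>2 u\<close> only take values in larger spaces; the equation is
  therefore tested against the domain of the self-adjoint operator:
  \<open>d\<^sup>2/dt\<^sup>2 \<langle>u(t), v\<rangle> = - \<langle>u(t), -\<Delta>\<^sub>F v\<rangle>\<close>. In terms of functional calculus for \<open>A = -\<Delta>\<^sub>F\<close> these are the functions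
  \<open>cos (t \<surd>A) (u 0) + (sin (t \<surd>A) / \<surd>A) u1\<close>. Joint measurability selects a good
  representative of the \<open>L\<^sup>2\<close>-valued function, so that the time integral below makes sense
  for almost every point.\<close>

definition wave_solution ::
    "(real \<Rightarrow> real \<times> real \<Rightarrow> complex) \<Rightarrow> (real \<times> real \<Rightarrow> complex) \<Rightarrow> bool" where
  "wave_solution u u1 \<longleftrightarrow>
     (\<lambda>(t, z). u t z) \<in> borel_measurable (lborel \<Otimes>\<^sub>M M\<Omega>) \<and>
     u1 \<in> L2_Omega \<and> (\<forall>t. u t \<in> L2_Omega) \<and>
     (\<forall>t. ((\<lambda>s. Lr_norm 2 (\<lambda>z. u s z - u t z)) \<longlongrightarrow> 0) (at t)) \<and>
     (\<forall>v Av. neg_Friedlander_D v Av \<longrightarrow>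
        (\<exists>p :: real \<Rightarrow> complex.
           (\<forall>t. ((\<lambda>s. L2_inner (u s) v) has_vector_derivative p t) (at t)) \<and>
           (\<forall>t. (p has_vector_derivative - L2_inner (u t) Av) (at t)) \<and>
           p 0 = L2_inner u1 v))"


section \<open>Fourier multipliers in time\<close>

text \<open>\<open>m(D\<^sub>t) u\<close> for \<open>D\<^sub>t = -\<i> \<partial>\<^sub>t\<close>: multiplication of the Fourier transform by \<open>m(\<tau>)\<close>, written as
  convolution with the inverse Fourier transform of \<open>m\<close>. For \<open>m\<close> smooth with compact
  support the kernel is a Schwartz function, and solutions \<open>u\<close> grow at most linearly in \<open>L\<^sup>2\<close>, so
  the integral converges for almost all points of the domain.\<close>

definition inv_Fourier :: "(real \<Rightarrow> complex) \<Rightarrow> real \<Rightarrow> complex" where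
  "inv_Fourier m t = of_real (1 / (2 * pi)) * (LINT \<tau>|lborel. exp (\<i> * of_real (t * \<tau>)) * m \<tau>)"

definition time_multiplier ::
    "(real \<Rightarrow> complex) \<Rightarrow> (real \<Rightarrow> 'a \<Rightarrow> complex) \<Rightarrow> real \<Rightarrow> 'a \<Rightarrow> complex" where
  "time_multiplier m u t z = (LINT s|lborel. inv_Fourier m (t - s) * u s z)"


section \<open>The Strichartz estimate\<close>

definition strichartz_beta :: "ennreal \<Rightarrow> ennreal \<Rightarrow> real" where
  "strichartz_beta q r = 2 * (1/2 - enn2real (1 / r)) - enn2real (1 / q)"

definition LqLr_norm ::
    "ennreal \<Rightarrow> ennreal \<Rightarrow> real \<Rightarrow> (real \<Rightarrow> real \<times> real \<Rightarrow> complex) \<Rightarrow> ennreal" where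
  "LqLr_norm q r t0 w = Lp_norm q (restrict_space lborel {- t0..t0}) (\<lambda>t. Lr_norm r (w t))"

definition strichartz_estimate :: "(real \<Rightarrow> real) \<Rightarrow> ennreal \<Rightarrow> ennreal \<Rightarrow> bool" where
  "strichartz_estimate chi q r \<longleftrightarrow>
     (\<exists>t0 > 0. \<exists>C > 0. \<forall>h. 0 < h \<and> h < 1 \<longrightarrow>
        (\<forall>u u1. wave_solution u u1 \<longrightarrow>
           ennreal (h powr strichartz_beta q r)
             * LqLr_norm q r t0 (time_multiplier (\<lambda>\<tau>. of_real (chi (h * \<tau>))) u)
           \<le> ennreal C
             * (Lr_norm 2 (u 0) + Lr_norm 2 (\<lambda>z. of_real h * (- \<i> * u1 z)))))"

end

theory Submission
  imports Defs "HOL-Probability.Probability"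
begin

text \<open>The estimate is tested on one family of waves, indexed by a small parameter \<open>\<epsilon>\<close>, at the frequency scale
\<open>h = \<epsilon>^6\<close>. If \<open>A\<close> denotes the decaying solution of \<open>A'' = s A\<close> and \<open>-\<omega>\<close> is one of its zeros, then
\<open>exp (\<i> y \<eta>) A (\<eta>^(2/3) x - \<omega>)\<close> vanishes on \<open>x = 0\<close> and is an eigenfunction of the Friedlander operator for the
eigenvalue \<open>- (\<eta>^2 + \<omega> \<eta>^(4/3))\<close>. Integrating over \<open>\<eta>\<close> in an interval gives a gallery mode, an exact solution
that travels along the boundary with time frequency \<open>sqrt (\<eta>^2 + \<omega> \<eta>^(4/3))\<close>. The test wave, called \<open>beam\<close>,
is a sum of such modes over about \<open>\<epsilon>^(-3)\<close> consecutive zeros, with the interval of \<open>\<eta>\<close> chosen for each zero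
so that all modes have their turning point close to \<open>x = \<epsilon>^2\<close>.

The gain comes from coherence. The zeros satisfy
\<open>2/3 \<omega>^(3/2) = k \<pi> - \<theta> + O(1/k)\<close> (\<open>airy_zeros\<close>). Expanding the frequency around the common turning point
(\<open>eikonal_taylor\<close>, \<open>freq_approx\<close>) shows that the phase accumulated at time \<open>t\<close> is \<open>\<eta> Y + t F1 (k \<pi> - \<theta>)\<close> up to a small error,
with \<open>Y\<close> independent of \<open>k\<close> and of \<open>\<eta>\<close> and \<open>F1\<close> of size \<open>1/(2\<epsilon>)\<close>. Whenever \<open>t F1\<close> is within \<open>\<epsilon>\<close> of an even integer, all modes are therefore in phase
up to one common factor (\<open>phase_alignment\<close>): the wave refocuses into a box of size \<open>\<epsilon>^4\<close> by \<open>\<epsilon>^6\<close> around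
\<open>(\<epsilon>^2, - Y)\<close>. These windows have total length of order \<open>\<epsilon>\<close> in a fixed time interval. On the box all
factors \<open>A (\<eta>^(2/3) x - \<omega>)\<close> are at least \<open>A 2 > 0\<close>, so the modes add up without cancellation: pairing the wave with a positive
bump of mass of order \<open>\<epsilon>^10\<close> gives at least a constant times \<open>\<Lambda> \<epsilon>^10\<close>, where \<open>\<Lambda>\<close> is the total length of the
\<open>\<eta>\<close>-intervals (\<open>beam_concentration\<close>, \<open>packet_overlap\<close>). By duality the \<open>L^r\<close> norm is at least of order
\<open>\<Lambda> \<epsilon>^(10/r)\<close> at these times.

The initial data are small by comparison: modes belonging to the same \<open>\<eta>\<close> and to different zeros are orthogonal in \<open>x\<close>,
and Plancherel in \<open>y\<close> then bounds the \<open>L^2\<close> norm of the data by a constant times \<open>\<epsilon>^(3/2) \<Lambda>^(1/2)\<close> (\<open>mode_sum_norm\<close>). The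
frequencies lie where the truncation \<open>chi (h \<tau>)\<close> equals \<open>1\<close>, so the multiplier does not change the
wave (\<open>beam_frequency_localized\<close>). Since \<open>\<Lambda>\<close> is at least of order \<open>\<epsilon>^(-7)\<close>, inserting everything into the
Strichartz estimate bounds \<open>\<epsilon>\<close> to the power \<open>2 (1/2 - 1/r) - 5/q\<close> as \<open>\<epsilon>\<close> tends to \<open>0\<close>, and the exponent has to be nonnegative.

The remaining work is to show that the modes are solutions in the required weak sense. This is Green's formula
against an arbitrary element of the operator domain (\<open>green_identity\<close>), where the
Dirichlet condition of the mode enters through its smallness in a strip along the boundary.\<close>

section \<open>Smooth functions and a smooth step\<close>

text \<open>The coinductive notion of smoothness, cut off after \<open>n\<close> derivatives, so that closure properties can be proved by
induction on \<open>n\<close>.\<close>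

primrec Ck :: "nat \<Rightarrow> ('a::euclidean_space \<Rightarrow> 'b::real_normed_vector) \<Rightarrow> bool" where
  "Ck 0 f = True"
| "Ck (Suc n) f = ((\<forall>x. f differentiable (at x)) \<and> (\<forall>v. Ck n (\<lambda>x. frechet_derivative f (at x) v)))"

lemma smooth_imp_Ck: "smooth f \<Longrightarrow> Ck n f"
proof (induction n arbitrary: f)
  case (Suc n)
  from Suc.prems show ?case by (cases rule: smooth.cases) (auto intro: Suc.IH)
qed simp

lemma Ck_imp_smooth: assumes "\<And>n. Ck n f" shows "smooth f"
proof -
  have "\<forall>n. Ck n f" using assms by blast
  then show ?thesis
  proof (coinduction arbitrary: f rule: smooth.coinduct)
    case smooth
    have "Ck (Suc n) f" for n using smooth by blast
    then show ?case by auto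
  qed
qed

lemma Ck_SucI:
  assumes "\<And>x. (f has_derivative D x) (at x)" "\<And>v. Ck n (\<lambda>x. D x v)"
  shows "Ck (Suc n) f"
proof -
  have "frechet_derivative f (at x) = D x" for x using frechet_derivative_at[OF assms(1)] by simp
  then show ?thesis using assms by (auto simp: differentiable_def)
qed

lemma Ck_SucD: "Ck (Suc n) f \<Longrightarrow> (f has_derivative frechet_derivative f (at x)) (at x)"
  by (simp add: frechet_derivative_works)

lemma smooth_has_derivative: "smooth f \<Longrightarrow> (f has_derivative frechet_derivative f (at x)) (at x)"
  by (rule Ck_SucD[OF smooth_imp_Ck[of _ "Suc 0"]])

lemma smooth_derivative: "smooth f \<Longrightarrow> smooth (\<lambda>x. frechet_derivative f (at x) v)"
  by (cases rule: smooth.cases) auto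

lemma smooth_continuous: "smooth f \<Longrightarrow> continuous_on S f"
  by (meson has_derivative_continuous continuous_at_imp_continuous_on smooth_has_derivative)

lemma Ck_mono: "Ck (Suc n) f \<Longrightarrow> Ck n f"
proof (induction n arbitrary: f)
  case (Suc n)
  then have "\<And>v. Ck (Suc n) (\<lambda>x. frechet_derivative f (at x) v)" by simp
  then have "\<And>v. Ck n (\<lambda>x. frechet_derivative f (at x) v)" using Suc.IH by blast
  then show ?case using Suc.prems by simp
qed simp

lemma Ck_const: "Ck n (\<lambda>x. c)"
proof (induction n arbitrary: c)
  case (Suc n) show ?case by (rule Ck_SucI[OF has_derivative_const]) (rule Suc)
qed simp

lemma Ck_bounded_linear: "bounded_linear l \<Longrightarrow> Ck n f \<Longrightarrow> Ck n (\<lambda>x. l (f x))"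
proof (induction n arbitrary: f)
  case (Suc n)
  show ?case
    by (rule Ck_SucI[OF bounded_linear.has_derivative[OF Suc.prems(1) Ck_SucD[OF Suc.prems(2)]]])
       (use Suc in auto)
qed simp

lemma Ck_linear: "bounded_linear l \<Longrightarrow> Ck n l"
proof (induction n)
  case (Suc n)
  show ?case by (rule Ck_SucI[OF bounded_linear_imp_has_derivative[OF Suc.prems]]) (rule Ck_const)
qed simp

lemma Ck_add: "Ck n f \<Longrightarrow> Ck n g \<Longrightarrow> Ck n (\<lambda>x. f x + g x)"
proof (induction n arbitrary: f g)
  case (Suc n)
  show ?case
    by (rule Ck_SucI[OF has_derivative_add[OF Ck_SucD[OF Suc.prems(1)] Ck_SucD[OF Suc.prems(2)]]])
       (use Suc in auto)
qed simp

lemma Ck_mult: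
  fixes f g :: "'a::euclidean_space \<Rightarrow> 'b::real_normed_algebra"
  shows "Ck n f \<Longrightarrow> Ck n g \<Longrightarrow> Ck n (\<lambda>x. f x * g x)"
proof (induction n arbitrary: f g)
  case (Suc n)
  show ?case
    by (rule Ck_SucI[OF has_derivative_mult[OF Ck_SucD[OF Suc.prems(1)] Ck_SucD[OF Suc.prems(2)]]])
       (use Suc Ck_mono[OF Suc.prems(1)] Ck_mono[OF Suc.prems(2)] in \<open>auto intro!: Ck_add\<close>)
qed simp

lemma has_derivative_real_scale:
  fixes p :: "real \<Rightarrow> 'b::real_normed_vector"
  assumes "(p has_derivative D) (at x)" shows "D t = t *\<^sub>R D 1"
  using linear_scale[OF has_derivative_linear[OF assms], of t 1] by simp

lemma Ck_compose_affine:
  fixes p :: "real \<Rightarrow> 'b::real_normed_vector" and l :: "'a::euclidean_space \<Rightarrow> real"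
  assumes l: "bounded_linear l"
  shows "Ck n p \<Longrightarrow> Ck n (\<lambda>z. p (l z + c))"
proof (induction n arbitrary: p)
  case (Suc n)
  have d: "((\<lambda>z. p (l z + c)) has_derivative (\<lambda>v. l v *\<^sub>R frechet_derivative p (at (l z + c)) 1)) (at z)" for z
  proof -
    have "((\<lambda>z. l z + c) has_derivative l) (at z)"
      using has_derivative_add[OF bounded_linear_imp_has_derivative[OF l] has_derivative_const] by simp
    from has_derivative_compose[OF this Ck_SucD[OF Suc.prems]]
    show ?thesis by (subst (asm) has_derivative_real_scale[OF Ck_SucD[OF Suc.prems]])
  qed
  show ?case
    by (rule Ck_SucI[OF d], rule Ck_bounded_linear[OF bounded_linear_scaleR_right])
       (use Suc in auto)
qed simp

lemma smooth_const: "smooth (\<lambda>x. c)"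
  by (rule Ck_imp_smooth, rule Ck_const)

lemma smooth_bounded_linear: "bounded_linear l \<Longrightarrow> smooth f \<Longrightarrow> smooth (\<lambda>x. l (f x))"
  by (rule Ck_imp_smooth, rule Ck_bounded_linear, assumption, erule smooth_imp_Ck)

lemma smooth_linear: "bounded_linear l \<Longrightarrow> smooth l"
  by (rule Ck_imp_smooth, erule Ck_linear)

lemma smooth_add: "smooth f \<Longrightarrow> smooth g \<Longrightarrow> smooth (\<lambda>x. f x + g x)"
  by (rule Ck_imp_smooth, rule Ck_add) (erule smooth_imp_Ck)+

lemma smooth_mult:
  fixes f g :: "'a::euclidean_space \<Rightarrow> 'b::real_normed_algebra"
  shows "smooth f \<Longrightarrow> smooth g \<Longrightarrow> smooth (\<lambda>x. f x * g x)"
  by (rule Ck_imp_smooth, rule Ck_mult) (erule smooth_imp_Ck)+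

lemma smooth_compose_affine:
  fixes p :: "real \<Rightarrow> 'b::real_normed_vector" and l :: "'a::euclidean_space \<Rightarrow> real"
  shows "bounded_linear l \<Longrightarrow> smooth p \<Longrightarrow> smooth (\<lambda>z. p (l z + c))"
  by (rule Ck_imp_smooth, rule Ck_compose_affine, assumption, erule smooth_imp_Ck)

text \<open>Two functions that agree near \<open>c\<close> can be glued there: near \<open>c\<close> the glued function is either of them, and the same applies to the
derivatives.\<close>

lemma Ck_glue:
  fixes p q :: "real \<Rightarrow> 'b::real_normed_vector"
  assumes d: "d > 0"
  shows "Ck n p \<Longrightarrow> Ck n q \<Longrightarrow> (\<And>x. \<bar>x - c\<bar> < d \<Longrightarrow> p x = q x) \<Longrightarrow> Ck n (\<lambda>x. if x \<le> c then p x else q x)"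
proof (induction n arbitrary: p q)
  case (Suc n)
  let ?f = "\<lambda>x. if x \<le> c then p x else q x"
  let ?D = "\<lambda>x. if x \<le> c then frechet_derivative p (at x) else frechet_derivative q (at x)"
  have ball: "open {x. \<bar>x - c\<bar> < d}" by (intro open_Collect_less continuous_intros)
  have eq: "frechet_derivative p (at x) = frechet_derivative q (at x)" if "\<bar>x - c\<bar> < d" for x
  proof -
    have "(q has_derivative frechet_derivative p (at x)) (at x)"
      by (rule has_derivative_transform_within_open[OF Ck_SucD[OF Suc.prems(1)] ball])
         (use that Suc.prems(3) in auto)
    then show ?thesis using frechet_derivative_at by metis
  qed
  have "(?f has_derivative ?D x) (at x)" for x
  proof (cases "x < c + d")
    case True
    have "(?f has_derivative frechet_derivative p (at x)) (at x)"
    proof (rule has_derivative_transform_within_open[OF Ck_SucD[OF Suc.prems(1)], of "{..<c + d}"])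
      fix y assume "y \<in> {..<c + d}"
      then show "p y = ?f y" using Suc.prems(3)[of y] by auto
    qed (use True in auto)
    then show ?thesis using eq[of x] True by auto
  next
    case False
    have "(?f has_derivative frechet_derivative q (at x)) (at x)"
      by (rule has_derivative_transform_within_open[OF Ck_SucD[OF Suc.prems(2)], of "{c<..}"])
         (use False d in auto)
    then show ?thesis using False d by auto
  qed
  then show ?case
  proof (rule Ck_SucI)
    fix v
    have "Ck n (\<lambda>x. if x \<le> c then frechet_derivative p (at x) v else frechet_derivative q (at x) v)"
      by (rule Suc.IH) (use Suc.prems eq in auto)
    then show "Ck n (\<lambda>x. ?D x v)" unfolding if_distribR .
  qed
qed simp

text \<open>The truncation \<open>chi\<close> has compact support and equals \<open>1\<close> near \<open>1\<close>. Following it up to \<open>1\<close> and staying there yields a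
smooth transition from \<open>0\<close> to \<open>1\<close>, which an affine change of variable moves to the interval from \<open>1/2\<close> to \<open>1\<close>. This supplies
all cutoffs below without constructing a bump function by hand.\<close>

lemma smooth_step_exists:
  fixes chi :: "real \<Rightarrow> real"
  assumes chi: "chi \<in> Cc_infinity UNIV" and e1: "eventually (\<lambda>\<tau>. chi \<tau> = 1) (nhds 1)"
  shows "\<exists>s :: real \<Rightarrow> real. smooth s \<and> (\<forall>x\<le>1/2. s x = 0) \<and> (\<forall>x\<ge>1. s x = 1)"
proof -
  have sm: "smooth chi" and cpt: "compact (closure {x. chi x \<noteq> 0})" using chi by (auto simp: Cc_infinity_def)
  obtain B where B: "\<And>x. x \<in> closure {x. chi x \<noteq> 0} \<Longrightarrow> norm x \<le> B"
    using compact_imp_bounded[OF cpt] bounded_iff by blast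
  have zero: "chi x = 0" if "\<bar>x\<bar> > B" for x using B[of x] closure_subset[of "{x. chi x \<noteq> 0}"] that by auto
  obtain d where d: "d > 0" "\<And>x. \<bar>x - 1\<bar> < d \<Longrightarrow> chi x = 1"
    using e1 by (auto simp: eventually_nhds_metric dist_real_def)
  have B1: "B \<ge> 1" using zero[of 1] d(2)[of 1] d(1) by (cases "B < 1") auto
  define p where "p = (\<lambda>x. if x \<le> 1 then chi x else 1)"
  have ps: "smooth p" unfolding p_def
    by (rule Ck_imp_smooth, rule Ck_glue[OF d(1)]) (auto intro: smooth_imp_Ck sm Ck_const d(2))
  \<comment> \<open>the affine map fixes \<open>1\<close> and sends \<open>1/2\<close> to the left of the support\<close>
  define K where "K = 2 * (B + 2)"
  define s where "s = (\<lambda>x. p (K * x + (1 - K)))"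
  have "smooth s" unfolding s_def by (rule smooth_compose_affine[OF bounded_linear_mult_right ps])
  moreover have "s x = 0" if "x \<le> 1/2" for x
  proof -
    have "K * x \<le> K * (1/2)" using that B1 by (intro mult_left_mono) (auto simp: K_def)
    then have "K * x + (1 - K) \<le> - B - 1" by (simp add: K_def)
    then show ?thesis using zero[of "K * x + (1 - K)"] B1 by (simp add: s_def p_def)
  qed
  moreover have "s x = 1" if "x \<ge> 1" for x
  proof -
    have "K \<ge> 0" using B1 by (simp add: K_def)
    then have "K * x + (1 - K) \<ge> 1" using mult_left_mono[OF that, of K] by simp
    then show ?thesis using d(2)[of 1] d(1) by (auto simp: s_def p_def)
  qed
  ultimately show ?thesis by blast
qed

section \<open>The decaying Airy function\<close>

text \<open>Power series coefficients of the solution of \<open>f'' = x f\<close> with \<open>f 0 = a\<close> and \<open>f' 0 = b\<close>.\<close>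

fun airy_coeff :: "real \<Rightarrow> real \<Rightarrow> nat \<Rightarrow> real" where
  "airy_coeff a b 0 = a"
| "airy_coeff a b (Suc 0) = b"
| "airy_coeff a b (Suc (Suc 0)) = 0"
| "airy_coeff a b (Suc (Suc (Suc n))) = airy_coeff a b n / ((real n + 2) * (real n + 3))"

definition airy_sol :: "real \<Rightarrow> real \<Rightarrow> real \<Rightarrow> real" where
  "airy_sol a b x = (\<Sum>n. airy_coeff a b n * x ^ n)"

definition airy_sol' :: "real \<Rightarrow> real \<Rightarrow> real \<Rightarrow> real" where
  "airy_sol' a b x = (\<Sum>n. diffs (airy_coeff a b) n * x ^ n)"

text \<open>From index \<open>n\<close> to \<open>n + 3\<close> the terms are multiplied by \<open>K^3 / ((n + 2) (n + 3))\<close>, which is at most \<open>1\<close> once \<open>n\<close> exceeds \<open>K^3\<close>.\<close>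

lemma airy_coeff_bound:
  fixes K :: real assumes "K > 0"
  shows "\<exists>C. \<forall>n. \<bar>airy_coeff a b n\<bar> * K ^ n \<le> C"
proof -
  obtain N :: nat where N: "K ^ 3 \<le> real N" using real_arch_simple by blast
  define C where "C = (\<Sum>i<N+3. \<bar>airy_coeff a b i\<bar> * K ^ i)"
  have "\<bar>airy_coeff a b n\<bar> * K ^ n \<le> C" for n
  proof (induction n rule: less_induct)
    case (less n)
    show ?case
    proof (cases "n < N + 3")
      case True
      then show ?thesis unfolding C_def
        using assms by (intro member_le_sum) auto
    next
      case False
      define m where "m = n - 3"
      have n: "n = Suc (Suc (Suc m))" and m: "m \<ge> N" using False by (auto simp: m_def)
      have "real N \<le> real m" using m by simp
      also have "\<dots> \<le> (real m + 2) * (real m + 3)" by (simp add: algebra_simps)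
      finally have K: "K ^ 3 \<le> (real m + 2) * (real m + 3)" using N by linarith
      have "\<bar>airy_coeff a b n\<bar> * K ^ n = (\<bar>airy_coeff a b m\<bar> * K ^ m) * (K ^ 3 / ((real m + 2) * (real m + 3)))"
        by (simp add: n abs_divide abs_mult power3_eq_cube)
      also have "\<dots> \<le> (\<bar>airy_coeff a b m\<bar> * K ^ m) * 1"
        using K assms by (intro mult_left_mono) (auto simp: divide_le_eq_1)
      also have "\<dots> \<le> C" using less[of m] n by simp
      finally show ?thesis .
    qed
  qed
  then show ?thesis by blast
qed

lemma airy_summable: "summable (\<lambda>n. airy_coeff a b n * x ^ n)"
proof -
  define K where "K = \<bar>x\<bar> + 1"
  have K: "K > 0" by (simp add: K_def)
  obtain C where C: "\<And>n. \<bar>airy_coeff a b n\<bar> * K ^ n \<le> C"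
    using airy_coeff_bound[OF K] by blast
  have "norm (airy_coeff a b n * x ^ n) \<le> C * (\<bar>x\<bar> / K) ^ n" for n
  proof -
    have "norm (airy_coeff a b n * x ^ n) = (\<bar>airy_coeff a b n\<bar> * K ^ n) * (\<bar>x\<bar> / K) ^ n"
      using K by (simp add: abs_mult power_abs power_divide)
    also have "\<dots> \<le> C * (\<bar>x\<bar> / K) ^ n" using K C[of n] by (intro mult_right_mono) auto
    finally show ?thesis .
  qed
  then show ?thesis
  proof (rule summable_comparison_test'[where N = 0, rotated])
    show "summable (\<lambda>n. C * (\<bar>x\<bar> / K) ^ n)"
      by (intro summable_mult summable_geometric) (auto simp: K_def)
  qed
qed

lemma airy_sol_deriv: "(airy_sol a b has_real_derivative airy_sol' a b x) (at x)"
  unfolding airy_sol_def[abs_def] airy_sol'_def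
  by (rule termdiffs_strong_converges_everywhere) (rule airy_summable)

lemma airy_sol'_deriv: "(airy_sol' a b has_real_derivative x * airy_sol a b x) (at x)"
proof -
  let ?c = "airy_coeff a b"
  have s1: "summable (\<lambda>n. diffs ?c n * y ^ n)" for y
    by (rule termdiff_converges_all) (rule airy_summable)
  have s2: "summable (\<lambda>n. diffs (diffs ?c) n * y ^ n)" for y
    by (rule termdiff_converges_all) (rule s1)
  have d0: "diffs (diffs ?c) 0 = 0" by (simp add: diffs_def numeral_2_eq_2)
  have dS: "diffs (diffs ?c) (Suc n) = ?c n" for n
  proof -
    have "diffs (diffs ?c) (Suc n) = ((real n + 2) * (real n + 3)) * ?c (Suc (Suc (Suc n)))"
      by (simp add: diffs_def algebra_simps del: airy_coeff.simps)
    then show ?thesis by simp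
  qed
  have "(airy_sol' a b has_real_derivative (\<Sum>n. diffs (diffs ?c) n * x ^ n)) (at x)"
    unfolding airy_sol'_def[abs_def] by (rule termdiffs_strong_converges_everywhere) (rule s1)
  also have "(\<Sum>n. diffs (diffs ?c) n * x ^ n) = (\<Sum>n. diffs (diffs ?c) (Suc n) * x ^ (Suc n))"
    using suminf_split_head[OF s2[of x]] d0 by simp
  also have "\<dots> = (\<Sum>n. x * (?c n * x ^ n))" by (simp add: dS algebra_simps)
  also have "\<dots> = x * airy_sol a b x"
    unfolding airy_sol_def by (rule suminf_mult) (rule airy_summable)
  finally show ?thesis .
qed

lemma airy_sol_0: "airy_sol a b 0 = a" "airy_sol' a b 0 = b"
  by (simp_all add: airy_sol_def airy_sol'_def diffs_def)

lemma airy_coeff_nonneg: "a \<ge> 0 \<Longrightarrow> b \<ge> 0 \<Longrightarrow> airy_coeff a b n \<ge> 0"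
  by (induction a b n rule: airy_coeff.induct) auto

lemma airy_sol_lower:
  assumes "a \<ge> 0" "b \<ge> 0" "x \<ge> 0"
  shows "airy_sol a b x \<ge> a + b * x" "airy_sol' a b x \<ge> b"
proof -
  have "(\<Sum>n<2. airy_coeff a b n * x ^ n) \<le> airy_sol a b x"
    unfolding airy_sol_def
    by (rule sum_le_suminf) (auto simp: airy_summable airy_coeff_nonneg assms)
  then show "airy_sol a b x \<ge> a + b * x" by (simp add: numeral_2_eq_2)
  have "(\<Sum>n<1. diffs (airy_coeff a b) n * x ^ n) \<le> airy_sol' a b x"
    unfolding airy_sol'_def
    by (rule sum_le_suminf[OF termdiff_converges_all[OF airy_summable]])
       (auto simp: airy_coeff_nonneg assms diffs_def)
  then show "airy_sol' a b x \<ge> b" by (simp add: diffs_def)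
qed

lemma airy_wronskian: "airy_sol 1 0 x * airy_sol' 0 1 x - airy_sol' 1 0 x * airy_sol 0 1 x = 1"
proof -
  let ?W = "\<lambda>x. airy_sol 1 0 x * airy_sol' 0 1 x - airy_sol' 1 0 x * airy_sol 0 1 x"
  have "(?W has_real_derivative 0) (at x)" for x
    by (auto intro!: derivative_eq_intros airy_sol_deriv airy_sol'_deriv simp: algebra_simps)
  then have "?W x = ?W 0" by (intro DERIV_isconst_all) auto
  then show ?thesis by (simp add: airy_sol_0)
qed

text \<open>The quotient \<open>f / g\<close> of the two basic solutions decreases to a limit; subtracting this multiple of \<open>g\<close> from \<open>f\<close>
leaves the solution that decays. It is the classical Airy function normalised by \<open>airy 0 = 1\<close>.\<close>

definition airy_ratio :: real where
  "airy_ratio = (INF s\<in>{0<..}. airy_sol 1 0 s / airy_sol 0 1 s)"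

definition airy :: "real \<Rightarrow> real" where
  "airy s = airy_sol 1 0 s - airy_ratio * airy_sol 0 1 s"

definition airy' :: "real \<Rightarrow> real" where
  "airy' s = airy_sol' 1 0 s - airy_ratio * airy_sol' 0 1 s"

lemma airy_deriv: "(airy has_real_derivative airy' s) (at s)"
  unfolding airy_def[abs_def] airy'_def
  by (auto intro!: derivative_eq_intros airy_sol_deriv)

lemma airy'_deriv: "(airy' has_real_derivative s * airy s) (at s)"
  unfolding airy_def airy'_def[abs_def]
  by (auto intro!: derivative_eq_intros airy_sol'_deriv simp: algebra_simps)

text \<open>By the Wronskian, \<open>f / g\<close> is strictly decreasing and \<open>f' / g'\<close> is increasing and stays below it. Their common bound
\<open>airy_ratio\<close> therefore lies strictly below \<open>f / g\<close> and above \<open>f' / g'\<close>, which are the two claims.\<close>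

lemma airy_pos_decreasing:
  assumes "s \<ge> 0" shows "airy s > 0" "airy' s \<le> 0"
proof -
  let ?f = "airy_sol 1 0" and ?f' = "airy_sol' 1 0" and ?g = "airy_sol 0 1" and ?g' = "airy_sol' 0 1"
  have fp: "?f s \<ge> 1" if "s \<ge> 0" for s using airy_sol_lower(1)[of 1 0 s] that by simp
  have gp: "?g s > 0" if "s > 0" for s using airy_sol_lower(1)[of 0 1 s] that by simp
  have g'p: "?g' s > 0" if "s \<ge> 0" for s using airy_sol_lower(2)[of 0 1 s] that by simp
  have dec: "?f t / ?g t < ?f s / ?g s" if "0 < s" "s < t" for s t
  proof (rule DERIV_neg_imp_decreasing[OF \<open>s < t\<close>])
    fix x assume "s \<le> x" "x \<le> t"
    then have g: "?g x > 0" using gp that by auto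
    have "((\<lambda>x. ?f x / ?g x) has_real_derivative (?f' x * ?g x - ?f x * ?g' x) / (?g x * ?g x)) (at x)"
      using g by (intro DERIV_divide airy_sol_deriv) auto
    moreover have "(?f' x * ?g x - ?f x * ?g' x) / (?g x * ?g x) < 0"
      using airy_wronskian[of x] g by (intro divide_neg_pos) (auto simp: algebra_simps)
    ultimately show "\<exists>y. ((\<lambda>x. ?f x / ?g x) has_real_derivative y) (at x) \<and> y < 0" by blast
  qed
  have inc: "?f' s / ?g' s \<le> ?f' t / ?g' t" if "0 \<le> s" "s \<le> t" for s t
  proof (rule DERIV_nonneg_imp_nondecreasing[OF \<open>s \<le> t\<close>])
    fix x assume "s \<le> x" "x \<le> t"
    then have x: "x \<ge> 0" and g: "?g' x > 0" using g'p that by auto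
    have "((\<lambda>x. ?f' x / ?g' x) has_real_derivative
        (x * ?f x * ?g' x - ?f' x * (x * ?g x)) / (?g' x * ?g' x)) (at x)"
      using g by (intro DERIV_divide airy_sol'_deriv) auto
    moreover have "x * ?f x * ?g' x - ?f' x * (x * ?g x) = x"
      using arg_cong[OF airy_wronskian[of x], of "\<lambda>u. x * u"] by (simp add: algebra_simps)
    ultimately show "\<exists>y. ((\<lambda>x. ?f' x / ?g' x) has_real_derivative y) (at x) \<and> 0 \<le> y"
      using x g by (metis divide_nonneg_pos mult_pos_pos)
  qed
  have cross: "?f' s / ?g' s < ?f s / ?g s" if "s > 0" for s
    using gp[OF that] g'p[of s] that airy_wronskian[of s] by (simp add: field_simps)
  have bdd: "bdd_below ((\<lambda>s. ?f s / ?g s) ` {0<..})"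
  proof (rule bdd_belowI2[of _ 0])
    fix s :: real assume "s \<in> {0<..}"
    then show "0 \<le> ?f s / ?g s" using fp[of s] gp[of s] by auto
  qed
  have low: "airy_ratio \<le> ?f s / ?g s" if "s > 0" for s
    unfolding airy_ratio_def using that by (intro cINF_lower bdd) auto
  show "airy s > 0"
  proof (cases "s = 0")
    case True then show ?thesis by (simp add: airy_def airy_sol_0)
  next
    case False
    then have s: "s > 0" using assms by simp
    have "airy_ratio < ?f s / ?g s" using low[of "s+1"] dec[of s "s+1"] s by simp
    then show ?thesis using gp[OF s] by (simp add: airy_def field_simps)
  qed
  have "?f' s / ?g' s \<le> airy_ratio" unfolding airy_ratio_def
  proof (rule cINF_greatest)
    fix t :: real assume "t \<in> {0<..}"
    then have t: "t > 0" by simp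
    show "?f' s / ?g' s \<le> ?f t / ?g t"
    proof (cases "s \<le> t")
      case True then show ?thesis using inc[of s t] cross[OF t] assms by simp
    next
      case False then show ?thesis using cross[of s] dec[of t s] t by simp
    qed
  qed auto
  then show "airy' s \<le> 0" using g'p[OF assms] by (simp add: airy'_def field_simps)
qed

lemma airy_antimono:
  assumes "0 \<le> s" "s \<le> t" shows "airy t \<le> airy s"
proof (rule DERIV_nonpos_imp_nonincreasing[OF assms(2)])
  fix x assume "s \<le> x"
  then show "\<exists>y. (airy has_real_derivative y) (at x) \<and> y \<le> 0"
    using airy_deriv[of x] airy_pos_decreasing(2)[of x] assms by auto
qed

lemma airy'_mono:
  assumes "0 \<le> s" "s \<le> t" shows "airy' s \<le> airy' t"
proof (rule DERIV_nonneg_imp_nondecreasing[OF assms(2)])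
  fix x assume "s \<le> x"
  then show "\<exists>y. (airy' has_real_derivative y) (at x) \<and> 0 \<le> y"
    using airy'_deriv[of x] airy_pos_decreasing(1)[of x] assms
    by (intro exI[of _ "x * airy x"]) auto
qed

text \<open>If \<open>D = A + A'\<close> were positive at some \<open>s \<ge> 1\<close>, then \<open>D' \<ge> D\<close> from there on, and \<open>D\<close> would grow beyond the bound \<open>A \<le> 1\<close>.
Hence \<open>A exp\<close> decreases on \<open>s \<ge> 1\<close>. The bound for the derivative comes from the mean value theorem and the convexity of \<open>A\<close>.\<close>

lemma airy_decay: "\<exists>C>0. \<forall>s\<ge>0. \<bar>airy s\<bar> \<le> C * exp (- s) \<and> \<bar>airy' s\<bar> \<le> C * exp (- s)"
proof -
  have A0: "airy 0 = 1" by (simp add: airy_def airy_sol_0)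
  have le1: "airy s \<le> 1" if "s \<ge> 0" for s using airy_antimono[of 0 s] that A0 by simp
  define D where "D = (\<lambda>s. airy s + airy' s)"
  have Dd: "(D has_real_derivative (airy' s + s * airy s)) (at s)" for s
    unfolding D_def by (auto intro!: derivative_eq_intros airy_deriv airy'_deriv)
  have D0: "D s \<le> 0" if s: "s \<ge> 1" for s
  proof (rule ccontr)
    assume "\<not> D s \<le> 0"
    then have p: "D s > 0" by simp
    \<comment> \<open>at distance \<open>1 / D s\<close> the linear lower bound already exceeds \<open>1\<close>\<close>
    define t where "t = s + 1 / D s"
    have st: "s \<le> t" using p by (simp add: t_def)
    have "D s * exp (- s) \<le> D t * exp (- t)"
    proof (rule DERIV_nonneg_imp_nondecreasing[OF st])
      fix x assume x: "s \<le> x" "x \<le> t"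
      have "((\<lambda>x. D x * exp (- x)) has_real_derivative (airy' x + x * airy x) * exp (- x) - D x * exp (- x)) (at x)"
        by (auto intro!: derivative_eq_intros Dd simp: algebra_simps)
      moreover have "(airy' x + x * airy x) * exp (- x) - D x * exp (- x) = (x - 1) * airy x * exp (- x)"
        by (simp add: D_def algebra_simps)
      moreover have "(x - 1) * airy x * exp (- x) \<ge> 0" using x s airy_pos_decreasing(1)[of x] by simp
      ultimately show "\<exists>y. ((\<lambda>x. D x * exp (- x)) has_real_derivative y) (at x) \<and> 0 \<le> y" by metis
    qed
    then have "D s * exp (- s) * exp t \<le> D t * exp (- t) * exp t" by (intro mult_right_mono) auto
    then have "D s * exp (t - s) \<le> D t" by (simp add: exp_diff exp_minus field_simps)
    moreover have "D s * exp (t - s) \<ge> D s * (1 + (t - s))" using p exp_ge_add_one_self[of "t - s"]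
      by (intro mult_left_mono) auto
    moreover have "D s * (1 + (t - s)) = D s + 1" using p by (simp add: t_def field_simps)
    moreover have "D t \<le> 1" using le1[of t] airy_pos_decreasing(2)[of t] st s by (simp add: D_def)
    ultimately show False using p by linarith
  qed
  have dec: "airy s \<le> exp (1 - s)" if s: "s \<ge> 0" for s
  proof (cases "s \<le> 1")
    case True then show ?thesis using le1[OF s] one_le_exp_iff[of "1 - s"] by linarith
  next
    case False
    have "airy s * exp s \<le> airy 1 * exp 1"
    proof (rule DERIV_nonpos_imp_nonincreasing[of 1 s "\<lambda>x. airy x * exp x"])
      fix x assume x: "1 \<le> x" "x \<le> s"
      have "((\<lambda>x. airy x * exp x) has_real_derivative D x * exp x) (at x)"
        unfolding D_def by (auto intro!: derivative_eq_intros airy_deriv simp: algebra_simps)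
      moreover have "D x * exp x \<le> 0" using D0[of x] x by (simp add: mult_nonpos_nonneg)
      ultimately show "\<exists>y. ((\<lambda>x. airy x * exp x) has_real_derivative y) (at x) \<and> y \<le> 0" by blast
    qed (use False in auto)
    also have "\<dots> \<le> exp 1" using le1[of 1] by simp
    finally show ?thesis by (simp add: exp_diff field_simps)
  qed
  define C where "C = exp 2 + \<bar>airy' 0\<bar> * exp 1"
  have "\<bar>airy s\<bar> \<le> C * exp (- s) \<and> \<bar>airy' s\<bar> \<le> C * exp (- s)" if s: "s \<ge> 0" for s
  proof
    have "exp (1 - s) = exp 1 * exp (- s)" by (simp add: mult_exp_exp)
    also have "\<dots> \<le> C * exp (- s)" unfolding C_def
      by (intro mult_right_mono) (auto intro!: add_increasing2)
    finally show "\<bar>airy s\<bar> \<le> C * exp (- s)" using dec[OF s] airy_pos_decreasing(1)[OF s] by simp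
    show "\<bar>airy' s\<bar> \<le> C * exp (- s)"
    proof (cases "s \<le> 1")
      case True
      have "\<bar>airy' s\<bar> \<le> \<bar>airy' 0\<bar>"
        using airy'_mono[of 0 s] airy_pos_decreasing(2)[of s] airy_pos_decreasing(2)[of 0] s by simp
      also have "\<dots> \<le> \<bar>airy' 0\<bar> * exp (1 - s)" using True mult_left_mono[of 1 "exp (1 - s)" "\<bar>airy' 0\<bar>"] by simp
      also have "exp (1 - s) = exp 1 * exp (- s)" by (simp add: mult_exp_exp)
      also have "\<bar>airy' 0\<bar> * (exp 1 * exp (- s)) \<le> C * exp (- s)" by (simp add: C_def algebra_simps)
      finally show ?thesis .
    next
      case False
      then have "s - 1 < s" by simp
      from MVT2[OF this, of airy airy'] obtain z where
        z: "s - 1 < z" "z < s" "airy s - airy (s - 1) = (s - (s - 1)) * airy' z"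
        using airy_deriv by auto
      have "airy' z \<le> airy' s" using airy'_mono[of z s] z False by simp
      then have "- airy' s \<le> airy (s - 1)" using z airy_pos_decreasing(1)[of s] s by simp
      also have "\<dots> \<le> exp (1 - (s - 1))" using dec[of "s - 1"] False by simp
      also have "\<dots> = exp 2 * exp (- s)" by (simp add: mult_exp_exp)
      also have "\<dots> \<le> C * exp (- s)" by (simp add: C_def)
      finally show ?thesis using airy_pos_decreasing(2)[of s] s by simp
    qed
  qed
  moreover have "C > 0" by (simp add: C_def add_pos_nonneg)
  ultimately show ?thesis by blast
qed

section \<open>Zeros of the Airy function\<close>

text \<open>The function \<open>X\<close> plus or minus \<open>D w^(-3/2)\<close> is monotone, so \<open>X\<close> converges and the error is what is left to
integrate.\<close>

lemma derivative_bound_imp_limit: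
  fixes X X' :: "real \<Rightarrow> real"
  assumes d: "\<And>w. w \<ge> 1 \<Longrightarrow> (X has_real_derivative X' w) (at w)"
    and b: "\<And>w. w \<ge> 1 \<Longrightarrow> \<bar>X' w\<bar> \<le> D * (3/2) * w powr (-5/2)"
    and D: "D \<ge> 0"
  shows "\<exists>L. \<forall>w\<ge>1. \<bar>X w - L\<bar> \<le> D * w powr (-3/2)"
proof -
  define U where "U = (\<lambda>w. X w - D * w powr (-3/2))"
  define V where "V = (\<lambda>w. X w + D * w powr (-3/2))"
  have Ud: "(U has_real_derivative X' w + D * (3/2) * w powr (-5/2)) (at w)" if "w \<ge> 1" for w
    unfolding U_def using that by (auto intro!: derivative_eq_intros d)
  have Vd: "(V has_real_derivative X' w - D * (3/2) * w powr (-5/2)) (at w)" if "w \<ge> 1" for w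
    unfolding V_def using that by (auto intro!: derivative_eq_intros d)
  have Um: "U v \<le> U w" if "1 \<le> v" "v \<le> w" for v w
  proof (rule DERIV_nonneg_imp_nondecreasing[OF that(2)])
    fix x assume "v \<le> x"
    then show "\<exists>y. (U has_real_derivative y) (at x) \<and> 0 \<le> y"
      using Ud[of x] b[of x] that by (intro exI conjI) auto
  qed
  have Vm: "V w \<le> V v" if "1 \<le> v" "v \<le> w" for v w
  proof (rule DERIV_nonpos_imp_nonincreasing[OF that(2)])
    fix x assume "v \<le> x"
    then show "\<exists>y. (V has_real_derivative y) (at x) \<and> y \<le> 0"
      using Vd[of x] b[of x] that by (intro exI conjI) auto
  qed
  have UV: "U v \<le> V w" if "1 \<le> v" "1 \<le> w" for v w
  proof -
    have "U v \<le> U (max v w)" using that by (intro Um) auto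
    also have "\<dots> \<le> V (max v w)" using D by (simp add: U_def V_def)
    also have "\<dots> \<le> V w" using that by (intro Vm) auto
    finally show ?thesis .
  qed
  define L where "L = (SUP v\<in>{1..}. U v)"
  have bdd: "bdd_above (U ` {1..})" using UV[of _ 1] by (intro bdd_aboveI2[of _ _ "V 1"]) auto
  have "\<bar>X w - L\<bar> \<le> D * w powr (-3/2)" if w: "w \<ge> 1" for w
  proof -
    have "U w \<le> L" unfolding L_def using w by (intro cSUP_upper bdd) auto
    moreover have "L \<le> V w" unfolding L_def using UV w by (intro cSUP_least) auto
    ultimately show ?thesis by (simp add: U_def V_def)
  qed
  then show ?thesis by blast
qed

text \<open>The Liouville transformation: in the variable \<open>\<zeta> = 2/3 w^(3/2)\<close> the rescaled function \<open>P = w^(1/4) A (- w)\<close> satisfies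
\<open>P'' + P = O(\<zeta>^(-2)) P\<close>, and \<open>R\<close> is the derivative of \<open>P\<close> with respect to \<open>\<zeta>\<close>. The perturbation is integrable, so \<open>P\<close> behaves like
a pure oscillation.\<close>

definition liou_zeta :: "real \<Rightarrow> real" where "liou_zeta w = 2/3 * w powr (3/2)"

definition liou_P :: "real \<Rightarrow> real" where "liou_P w = w powr (1/4) * airy (- w)"

definition liou_R :: "real \<Rightarrow> real" where
  "liou_R w = - (w powr (-1/4)) * airy' (- w) + 1/4 * w powr (-5/4) * airy (- w)"

lemma liou_zeta_deriv: "w > 0 \<Longrightarrow> (liou_zeta has_real_derivative w powr (1/2)) (at w)"
  unfolding liou_zeta_def[abs_def] by (auto intro!: derivative_eq_intros)

lemma airy_neg_deriv:
  "((\<lambda>w. airy (- w)) has_real_derivative - airy' (- w)) (at w)"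
  "((\<lambda>w. airy' (- w)) has_real_derivative w * airy (- w)) (at w)"
proof -
  have m: "(uminus has_real_derivative -1) (at w)" for w :: real
    by (auto intro!: derivative_eq_intros)
  show "((\<lambda>w. airy (- w)) has_real_derivative - airy' (- w)) (at w)"
    using DERIV_chain2[OF airy_deriv m] by simp
  show "((\<lambda>w. airy' (- w)) has_real_derivative w * airy (- w)) (at w)"
    using DERIV_chain2[OF airy'_deriv m] by simp
qed

lemma powr_mult_real: "w > (0::real) \<Longrightarrow> w * w powr p = w powr (1 + p)"
  using powr_add[of w 1 p] by simp

lemma liou_P_deriv: "w > 0 \<Longrightarrow> (liou_P has_real_derivative w powr (1/2) * liou_R w) (at w)"
proof -
  assume w: "w > 0"
  have "(liou_P has_real_derivative 1/4 * w powr (-3/4) * airy (- w) + w powr (1/4) * (- airy' (- w))) (at w)"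
    unfolding liou_P_def[abs_def] using w
    by (auto intro!: derivative_eq_intros airy_neg_deriv)
  moreover have "w powr (1/2) * w powr (-1/4) = w powr (1/4)" "w powr (1/2) * w powr (-5/4) = w powr (-3/4)"
    by (simp_all flip: powr_add)
  then have "w powr (1/2) * liou_R w = 1/4 * w powr (-3/4) * airy (- w) + w powr (1/4) * (- airy' (- w))"
    by (simp add: liou_R_def algebra_simps)
  ultimately show ?thesis by simp
qed

lemma liou_R_deriv: "w > 0 \<Longrightarrow> (liou_R has_real_derivative
    - (w powr (1/2)) * liou_P w - 5/16 * w powr (-5/2) * liou_P w) (at w)"
proof -
  assume w: "w > 0"
  have "(liou_R has_real_derivative
     1/4 * w powr (-5/4) * airy' (- w) - w powr (-1/4) * (w * airy (- w))
     - 5/16 * w powr (-9/4) * airy (- w) - 1/4 * w powr (-5/4) * airy' (- w)) (at w)"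
    unfolding liou_R_def[abs_def] using w
    by (auto intro!: derivative_eq_intros airy_neg_deriv simp: algebra_simps add_divide_distrib diff_divide_distrib)
  moreover have "w powr (1/2) * w powr (1/4) = w powr (3/4)" "w powr (-5/2) * w powr (1/4) = w powr (-9/4)"
     "w powr (-1/4) * w = w powr (3/4)"
    using w powr_mult_real[of w "-1/4"] powr_add[of w "1/2" "1/4"] powr_add[of w "-5/2" "1/4"]
    by (simp_all add: mult.commute)
  then have "- (w powr (1/2)) * liou_P w - 5/16 * w powr (-5/2) * liou_P w =
      1/4 * w powr (-5/4) * airy' (- w) - w powr (-1/4) * (w * airy (- w))
     - 5/16 * w powr (-9/4) * airy (- w) - 1/4 * w powr (-5/4) * airy' (- w)"
    by (simp add: liou_P_def algebra_simps)
  ultimately show ?thesis by simp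
qed

definition liou_E :: "real \<Rightarrow> real" where "liou_E w = (liou_P w)\<^sup>2 + (liou_R w)\<^sup>2"

lemma liou_E_deriv: "w > 0 \<Longrightarrow> (liou_E has_real_derivative - (5/8) * w powr (-5/2) * liou_P w * liou_R w) (at w)"
  unfolding liou_E_def[abs_def]
  by (auto intro!: derivative_eq_intros liou_P_deriv liou_R_deriv simp: algebra_simps power2_eq_square)

lemma airy_nontrivial: "airy s \<noteq> 0 \<or> airy' s \<noteq> 0"
proof (rule ccontr)
  assume "\<not> ?thesis"
  then have z: "airy s = 0" "airy' s = 0" by auto
  let ?W = "\<lambda>x. airy x * airy_sol' 0 1 x - airy' x * airy_sol 0 1 x"
  have "(?W has_real_derivative 0) (at x)" for x
    by (auto intro!: derivative_eq_intros airy_sol_deriv airy_sol'_deriv airy_deriv airy'_deriv simp: algebra_simps)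
  then have "?W s = ?W 0" by (intro DERIV_isconst_all) auto
  then show False using z by (simp add: airy_def airy'_def airy_sol_0)
qed

text \<open>Gronwall: the logarithmic derivative of the energy is bounded by \<open>5/16 w^(-5/2)\<close>, which has a finite integral on \<open>w \<ge> 1\<close>. The
lower bound is nontrivial because \<open>A\<close> and \<open>A'\<close> have no common zero.\<close>

lemma liou_E_bounds: "\<exists>m M. 0 < m \<and> (\<forall>w\<ge>1. m \<le> liou_E w \<and> liou_E w \<le> M)"
proof -
  have PR: "\<bar>5/8 * w powr (-5/2) * liou_P w * liou_R w\<bar> \<le> 5/16 * w powr (-5/2) * liou_E w" if "w > 0" for w
  proof -
    have "2 * \<bar>liou_P w * liou_R w\<bar> \<le> liou_E w"
      using sum_squares_bound[of "\<bar>liou_P w\<bar>" "\<bar>liou_R w\<bar>"] by (simp add: liou_E_def abs_mult)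
    then have "5/16 * w powr (-5/2) * (2 * \<bar>liou_P w * liou_R w\<bar>) \<le> 5/16 * w powr (-5/2) * liou_E w"
      by (intro mult_left_mono) auto
    then show ?thesis by (simp add: abs_mult)
  qed
  have E1: "liou_E 1 > 0"
    using airy_nontrivial[of "-1"] by (auto simp: liou_E_def liou_P_def liou_R_def sum_power2_gt_zero_iff)
  \<comment> \<open>integrating factors: their logarithmic derivatives are \<open>- 5/16 w^(-5/2)\<close> and \<open>5/16 w^(-5/2)\<close>\<close>
  define g where "g = (\<lambda>w::real. exp (5/24 * w powr (-3/2)))"
  have gd: "(g has_real_derivative - (5/16) * w powr (-5/2) * g w) (at w)" if "w > 0" for w
    unfolding g_def using that by (auto intro!: derivative_eq_intros)
  define g2 where "g2 = (\<lambda>w::real. exp (- (5/24 * w powr (-3/2))))"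
  have gi: "(g2 has_real_derivative (5/16) * w powr (-5/2) * g2 w) (at w)" if "w > 0" for w
    unfolding g2_def using that by (auto intro!: derivative_eq_intros)
  have g20: "g2 w > 0" and g21: "g2 w \<le> 1" for w by (simp_all add: g2_def)
  have g0: "g w > 0" for w by (simp add: g_def)
  have g1: "g w \<ge> 1" for w by (simp add: g_def)
  have up: "liou_E w \<le> liou_E 1 * g 1" if "w \<ge> 1" for w
  proof -
    have "liou_E w * g w \<le> liou_E 1 * g 1"
    proof (rule DERIV_nonpos_imp_nonincreasing[OF that])
      fix x :: real assume x: "1 \<le> x"
      have "((\<lambda>w. liou_E w * g w) has_real_derivative
         (- (5/8) * x powr (-5/2) * liou_P x * liou_R x - 5/16 * x powr (-5/2) * liou_E x) * g x) (at x)"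
        using x by (auto intro!: derivative_eq_intros liou_E_deriv gd simp: algebra_simps)
      moreover have "- (5/8) * x powr (-5/2) * liou_P x * liou_R x - 5/16 * x powr (-5/2) * liou_E x \<le> 0"
        using abs_le_D2[OF PR[of x]] x by linarith
      then have "(- (5/8) * x powr (-5/2) * liou_P x * liou_R x - 5/16 * x powr (-5/2) * liou_E x) * g x \<le> 0"
        using g0[of x] by (intro mult_nonpos_nonneg) linarith+
      ultimately show "\<exists>y. ((\<lambda>w. liou_E w * g w) has_real_derivative y) (at x) \<and> y \<le> 0" by blast
    qed
    moreover have "liou_E w * 1 \<le> liou_E w * g w" using g1 by (intro mult_left_mono) (auto simp: liou_E_def)
    ultimately show ?thesis by linarith
  qed
  have lo: "liou_E 1 * g2 1 \<le> liou_E w" if "w \<ge> 1" for w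
  proof -
    have "liou_E 1 * g2 1 \<le> liou_E w * g2 w"
    proof (rule DERIV_nonneg_imp_nondecreasing[OF that])
      fix x :: real assume x: "1 \<le> x"
      have "((\<lambda>w. liou_E w * g2 w) has_real_derivative
         (- (5/8) * x powr (-5/2) * liou_P x * liou_R x + 5/16 * x powr (-5/2) * liou_E x) * g2 x) (at x)"
        using x by (auto intro!: derivative_eq_intros liou_E_deriv gi simp: algebra_simps)
      moreover have "0 \<le> - (5/8) * x powr (-5/2) * liou_P x * liou_R x + 5/16 * x powr (-5/2) * liou_E x"
        using abs_le_D1[OF PR[of x]] x by linarith
      then have "(- (5/8) * x powr (-5/2) * liou_P x * liou_R x + 5/16 * x powr (-5/2) * liou_E x) * g2 x \<ge> 0"
        using g20[of x] by (intro mult_nonneg_nonneg) linarith+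
      ultimately show "\<exists>y. ((\<lambda>w. liou_E w * g2 w) has_real_derivative y) (at x) \<and> 0 \<le> y" by blast
    qed
    also have "\<dots> \<le> liou_E w * 1" using g21[of w] by (intro mult_left_mono) (auto simp: liou_E_def)
    finally show ?thesis by simp
  qed
  have "0 < liou_E 1 * g2 1" using E1 g20[of 1] by simp
  then show ?thesis using up lo by blast
qed

text \<open>Variation of constants: rotating \<open>(P, R)\<close> back by the angle \<open>\<zeta>\<close> gives amplitudes whose derivatives are
\<open>O(w^(-5/2))\<close>. They converge, not both to \<open>0\<close> since the energy stays away from \<open>0\<close>.\<close>

lemma liou_asymptotics:
  "\<exists>r \<theta> D. r > 0 \<and> D > 0 \<and> (\<forall>w\<ge>1. \<bar>liou_P w - r * sin (liou_zeta w + \<theta>)\<bar> \<le> D * w powr (-3/2))"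
proof -
  obtain m M where m: "0 < m" and E: "\<And>w. w \<ge> 1 \<Longrightarrow> m \<le> liou_E w \<and> liou_E w \<le> M"
    using liou_E_bounds by blast
  define D where "D = 5/24 * sqrt M"
  have M: "M > 0" using m E[of 1] by auto
  then have D: "D > 0" by (simp add: D_def)
  have P: "\<bar>liou_P w\<bar> \<le> sqrt M" if "w \<ge> 1" for w
  proof -
    have "(liou_P w)\<^sup>2 \<le> M" using E[OF that] unfolding liou_E_def by (smt (verit) zero_le_power2)
    then show ?thesis by (metis real_sqrt_abs real_sqrt_le_iff)
  qed
  \<comment> \<open>\<open>(X, Y)\<close> is \<open>(R, P)\<close> rotated by \<open>\<zeta>\<close>; both would be constant without the perturbation\<close>
  define X where "X = (\<lambda>w. liou_R w * cos (liou_zeta w) + liou_P w * sin (liou_zeta w))"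
  define Y where "Y = (\<lambda>w. liou_P w * cos (liou_zeta w) - liou_R w * sin (liou_zeta w))"
  have Xd: "(X has_real_derivative - (5/16 * w powr (-5/2) * liou_P w * cos (liou_zeta w))) (at w)" if "w \<ge> 1" for w
    unfolding X_def using that
    by (auto intro!: derivative_eq_intros liou_P_deriv liou_R_deriv liou_zeta_deriv simp: algebra_simps)
  have Yd: "(Y has_real_derivative 5/16 * w powr (-5/2) * liou_P w * sin (liou_zeta w)) (at w)" if "w \<ge> 1" for w
    unfolding Y_def using that
    by (auto intro!: derivative_eq_intros liou_P_deriv liou_R_deriv liou_zeta_deriv simp: algebra_simps)
  have bd: "\<bar>5/16 * w powr (-5/2) * liou_P w * c\<bar> \<le> D * (3/2) * w powr (-5/2)" if "w \<ge> 1" "\<bar>c\<bar> \<le> 1" for w c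
  proof -
    have "\<bar>liou_P w * c\<bar> \<le> sqrt M * 1" unfolding abs_mult using P[OF that(1)] that(2) M by (intro mult_mono) auto
    then have "5/16 * w powr (-5/2) * \<bar>liou_P w * c\<bar> \<le> 5/16 * w powr (-5/2) * sqrt M" by (intro mult_left_mono) auto
    then show ?thesis by (simp add: D_def abs_mult algebra_simps)
  qed
  obtain LX where LX: "\<And>w. w \<ge> 1 \<Longrightarrow> \<bar>X w - LX\<bar> \<le> D * w powr (-3/2)"
    using derivative_bound_imp_limit[of X "\<lambda>w. - (5/16 * w powr (-5/2) * liou_P w * cos (liou_zeta w))" D]
      Xd bd[of _ "cos _"] D by (auto simp: less_imp_le)
  obtain LY where LY: "\<And>w. w \<ge> 1 \<Longrightarrow> \<bar>Y w - LY\<bar> \<le> D * w powr (-3/2)"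
    using derivative_bound_imp_limit[of Y "\<lambda>w. 5/16 * w powr (-5/2) * liou_P w * sin (liou_zeta w)" D]
      Yd bd[of _ "sin _"] D by (auto simp: less_imp_le)
  have XYE: "(X w)\<^sup>2 + (Y w)\<^sup>2 = liou_E w" for w
  proof -
    have "(X w)\<^sup>2 + (Y w)\<^sup>2 = liou_E w * ((cos (liou_zeta w))\<^sup>2 + (sin (liou_zeta w))\<^sup>2)"
      unfolding X_def Y_def liou_E_def by algebra
    then show ?thesis by simp
  qed
  have nz: "LX \<noteq> 0 \<or> LY \<noteq> 0"
  proof (rule ccontr)
    assume "\<not> ?thesis"
    then have z: "LX = 0" "LY = 0" by auto
    define w where "w = 1 + 2 * D\<^sup>2 / m"
    have w: "w \<ge> 1" "w > 2 * D\<^sup>2 / m" using m by (auto simp: w_def)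
    have p: "w powr (-3/2) * w powr (-3/2) \<le> 1 / w"
    proof -
      have "w powr (-3/2) * w powr (-3/2) = w powr (-3)" by (simp flip: powr_add)
      also have "\<dots> \<le> w powr (-1)" using w by (intro powr_mono) auto
      finally show ?thesis using w by (simp add: powr_minus_divide)
    qed
    have "(X w)\<^sup>2 \<le> (D * w powr (-3/2))\<^sup>2" "(Y w)\<^sup>2 \<le> (D * w powr (-3/2))\<^sup>2"
      using LX[OF w(1)] LY[OF w(1)] z D by (auto intro!: abs_le_square_iff[THEN iffD1] simp: abs_mult)
    then have "m \<le> 2 * (D * w powr (-3/2))\<^sup>2" using E[OF w(1)] XYE[of w] by linarith
    also have "\<dots> = 2 * D\<^sup>2 * (w powr (-3/2) * w powr (-3/2))" by (simp add: power2_eq_square)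
    also have "\<dots> \<le> 2 * D\<^sup>2 * (1 / w)" using p by (intro mult_left_mono) auto
    also have "\<dots> < m" using w m by (simp add: field_simps)
    finally show False by simp
  qed
  define r where "r = sqrt (LX\<^sup>2 + LY\<^sup>2)"
  have "LX\<^sup>2 + LY\<^sup>2 > 0" using nz by (simp add: sum_power2_gt_zero_iff)
  then have r: "r > 0" by (simp add: r_def)
  have "r\<^sup>2 = LX\<^sup>2 + LY\<^sup>2" by (simp add: r_def)
  then have "(LX / r)\<^sup>2 + (LY / r)\<^sup>2 = r\<^sup>2 / r\<^sup>2" unfolding power_divide by (metis add_divide_distrib)
  then have "(LX / r)\<^sup>2 + (LY / r)\<^sup>2 = 1" using r by simp
  then obtain \<theta> where t: "LX / r = cos \<theta>" "LY / r = sin \<theta>" using sincos_total_2pi_le by metis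
  have L: "LX = r * cos \<theta>" "LY = r * sin \<theta>" using t r by (auto simp: field_simps)
  have "\<bar>liou_P w - r * sin (liou_zeta w + \<theta>)\<bar> \<le> (2 * D) * w powr (-3/2)" if w: "w \<ge> 1" for w
  proof -
    let ?z = "liou_zeta w"
    have "liou_P w = liou_P w * ((sin ?z)\<^sup>2 + (cos ?z)\<^sup>2)" by simp
    also have "\<dots> = X w * sin ?z + Y w * cos ?z" unfolding X_def Y_def by algebra
    finally have "liou_P w - r * sin (?z + \<theta>) = (X w - LX) * sin ?z + (Y w - LY) * cos ?z"
      by (simp add: L sin_add algebra_simps)
    also have "\<bar>\<dots>\<bar> \<le> \<bar>X w - LX\<bar> * \<bar>sin ?z\<bar> + \<bar>Y w - LY\<bar> * \<bar>cos ?z\<bar>"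
      by (metis abs_mult abs_triangle_ineq)
    also have "\<dots> \<le> \<bar>X w - LX\<bar> * 1 + \<bar>Y w - LY\<bar> * 1" by (intro add_mono mult_left_mono) auto
    finally show ?thesis using LX[OF w] LY[OF w] by (simp add: mult.assoc)
  qed
  then show ?thesis using r D by (intro exI[of _ r] exI[of _ \<theta>] exI[of _ "2 * D"]) auto
qed

text \<open>Near \<open>\<zeta> = k \<pi> - \<theta>\<close> the main term \<open>r sin (\<zeta> + \<theta>)\<close> changes sign and dominates the error at distance \<open>C / k\<close>; the
intermediate value theorem gives the zero. At a zero the energy reduces to \<open>A'^2 / sqrt \<omega>\<close>, hence the bound on the derivative.\<close>

lemma airy_zeros:
  "\<exists>\<theta> C k0 \<omega>. C > 0 \<and> (\<forall>k\<ge>k0. (\<omega> k :: real) \<ge> 1 \<and> airy (- \<omega> k) = 0 \<and>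
     \<bar>liou_zeta (\<omega> k) - (real k * pi - \<theta>)\<bar> \<le> C / real k \<and>
     (airy' (- \<omega> k))\<^sup>2 \<le> C * sqrt (\<omega> k))"
proof -
  obtain r \<theta> D where r: "r > 0" and D: "D > 0"
    and as: "\<And>w. w \<ge> 1 \<Longrightarrow> \<bar>liou_P w - r * sin (liou_zeta w + \<theta>)\<bar> \<le> D * w powr (-3/2)"
    using liou_asymptotics by blast
  obtain m M where m: "0 < m" and E: "\<And>w. w \<ge> 1 \<Longrightarrow> m \<le> liou_E w \<and> liou_E w \<le> M"
    using liou_E_bounds by blast
  define C where "C = 4 * D / r"
  have C: "C > 0" using r D by (simp add: C_def)
  obtain k0 :: nat where k0: "2 + \<bar>\<theta>\<bar> + C \<le> real k0" using real_arch_simple by blast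
  \<comment> \<open>the inverse of \<open>liou_zeta\<close>\<close>
  define W where "W = (\<lambda>z::real. (3/2 * z) powr (2/3))"
  have Wz: "liou_zeta (W z) = z" if "z > 0" for z
    using that by (simp add: W_def liou_zeta_def powr_powr)
  have W1: "W z \<ge> 1" if "z \<ge> 1" for z
    using that by (auto simp: W_def intro!: ge_one_powr_ge_zero)
  have W32: "W z powr (-3/2) = 2/3 / z" if "z > 0" for z
    using that by (simp add: W_def powr_powr powr_minus_divide)
  have Wc: "continuous_on {0<..} W" unfolding W_def by (intro continuous_intros) auto
  have Pc: "continuous_on {0<..} liou_P"
    using liou_P_deriv by (intro continuous_at_imp_continuous_on ballI DERIV_isCont) auto
  have main: "\<exists>w\<ge>1. airy (- w) = 0 \<and> \<bar>liou_zeta w - (real k * pi - \<theta>)\<bar> \<le> C / real k" if k: "k \<ge> k0" for k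
  proof -
    have kr: "real k \<ge> 2 + \<bar>\<theta>\<bar> + C" using k k0 by linarith
    then have k1: "real k \<ge> 1" using C by linarith
    have "2 * real k \<le> real k * pi" using pi_ge_two k1 by (simp add: mult.commute)
    then have kpi: "real k * pi - \<theta> - 1 \<ge> real k" using kr C by linarith
    define c where "c = C / real k"
    have c: "0 < c" "c \<le> 1" using C kr k1 by (auto simp: c_def divide_le_eq_1)
    have sc: "sin c > c / 2"
    proof -
      obtain x where x: "0 < x" "x < c" "sin c - sin 0 = (c - 0) * cos x"
        using MVT2[of 0 c sin cos] c DERIV_sin by auto
      have "pi / 3 > 1" using pi_gt3 by simp
      then have "cos (pi / 3) < cos x" using x c by (intro cos_monotone_0_pi) auto
      then show ?thesis using x c by (simp add: cos_60 field_simps)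
    qed
    \<comment> \<open>at distance \<open>c\<close> from \<open>k \<pi> - \<theta>\<close> the main term dominates, with opposite signs on the two sides\<close>
    have sgn: "(-1)^k * s * liou_P (W (real k * pi - \<theta> + s * c)) > 0" if s: "s = 1 \<or> s = -1" for s :: real
    proof -
      define z where "z = real k * pi - \<theta> + s * c"
      have z: "z \<ge> real k" using kpi s c by (auto simp: z_def)
      then have z0: "z > 0" "z \<ge> 1" using k1 by auto
      have "sin (z + \<theta>) = (-1)^k * s * sin c"
        using s by (auto simp: z_def sin_add sin_diff sin_npi cos_npi algebra_simps)
      then have e: "\<bar>liou_P (W z) - r * ((-1)^k * s * sin c)\<bar> \<le> D * (2/3 / z)"
        using as[OF W1[OF z0(2)]] Wz[OF z0(1)] W32[OF z0(1)] by simp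
      have "D * (2/3 / z) \<le> D * (1 / real k)" using z k1 D z0 by (intro mult_left_mono frac_le) auto
      also have "\<dots> < r * (c / 2)" using r D k1 by (simp add: c_def C_def field_simps)
      also have "\<dots> < r * sin c" using sc r by simp
      finally have b: "D * (2/3 / z) < r * sin c" .
      have u: "((-1::real)^k * s) = 1 \<or> ((-1::real)^k * s) = -1"
        using s by (cases "even k") auto
      from u show ?thesis
      proof
        assume q: "((-1::real)^k * s) = 1" show ?thesis using e b unfolding z_def[symmetric] q by simp
      next
        assume q: "((-1::real)^k * s) = -1" show ?thesis using e b unfolding z_def[symmetric] q by simp
      qed
    qed
    let ?a = "real k * pi - \<theta> - c" and ?b = "real k * pi - \<theta> + c"
    let ?F = "\<lambda>z. (-1)^k * liou_P (W z)"
    have "W ` {?a..?b} \<subseteq> {0<..}"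
    proof (rule image_subsetI)
      fix z assume "z \<in> {?a..?b}"
      then have "z \<ge> 1" using kpi k1 c by auto
      then show "W z \<in> {0<..}" using W1[of z] by auto
    qed
    moreover have "{?a..?b} \<subseteq> {0<..}" using kpi k1 c by auto
    ultimately have "continuous_on {?a..?b} (\<lambda>z. liou_P (W z))"
      by (intro continuous_on_compose2[OF Pc] continuous_on_subset[OF Wc]) auto
    then have Fc: "continuous_on {?a..?b} ?F" by (intro continuous_intros)
    have "?F ?a \<le> 0" "0 \<le> ?F ?b" using sgn[of "-1"] sgn[of 1] by auto
    then obtain z where z: "?a \<le> z" "z \<le> ?b" "?F z = 0"
      using IVT'[of ?F ?a 0 ?b] Fc c by auto
    have z1: "z \<ge> 1" using z kpi k1 c by linarith
    have "airy (- W z) = 0" using z(3) W1[OF z1] by (auto simp: liou_P_def)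
    moreover have "\<bar>liou_zeta (W z) - (real k * pi - \<theta>)\<bar> \<le> C / real k"
      using z Wz[of z] z1 by (auto simp: c_def)
    ultimately show ?thesis using W1[OF z1] by blast
  qed
  then obtain \<omega> where om: "\<And>k. k \<ge> k0 \<Longrightarrow> \<omega> k \<ge> 1 \<and> airy (- \<omega> k) = 0 \<and>
      \<bar>liou_zeta (\<omega> k) - (real k * pi - \<theta>)\<bar> \<le> C / real k" by metis
  have der: "(airy' (- \<omega> k))\<^sup>2 \<le> M * sqrt (\<omega> k)" if "k \<ge> k0" for k
  proof -
    let ?w = "\<omega> k"
    have w: "?w \<ge> 1" "airy (- ?w) = 0" using om[OF that] by auto
    have "(liou_R ?w)\<^sup>2 \<le> M" using E[OF w(1)] unfolding liou_E_def by (smt (verit) zero_le_power2)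
    moreover have "(liou_R ?w)\<^sup>2 = (?w powr (-1/4))\<^sup>2 * (airy' (- ?w))\<^sup>2" by (simp add: liou_R_def w power_mult_distrib)
    moreover have "(?w powr (-1/4))\<^sup>2 = 1 / sqrt ?w"
      using w by (simp add: power2_eq_square powr_add[symmetric] powr_minus_divide powr_half_sqrt[symmetric])
    ultimately have "1 / sqrt ?w * (airy' (- ?w))\<^sup>2 \<le> M" by simp
    then show ?thesis using w by (simp add: pos_divide_le_eq)
  qed
  have MM: "M * sqrt (\<omega> k) \<le> max C M * sqrt (\<omega> k)" and CC: "C / real k \<le> max C M / real k" if "k \<ge> k0" for k
    using om[OF that] by (auto intro!: mult_right_mono divide_right_mono)
  have "0 < max C M \<and> (\<forall>k\<ge>k0. \<omega> k \<ge> 1 \<and> airy (- \<omega> k) = 0 \<and>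
     \<bar>liou_zeta (\<omega> k) - (real k * pi - \<theta>)\<bar> \<le> max C M / real k \<and>
     (airy' (- \<omega> k))\<^sup>2 \<le> max C M * sqrt (\<omega> k))"
    using om der MM CC C by (meson order_trans max.strict_coboundedI1)
  then show ?thesis by blast
qed

section \<open>Fourier transform on the line\<close>

text \<open>The form in which Fubini is applied throughout: domination by a product of integrable functions of one variable each.\<close>

lemma integrable_pair_product_bound:
  fixes F :: "'a \<times> 'b \<Rightarrow> complex"
  assumes "sigma_finite_measure M1" "sigma_finite_measure M2"
    and F: "F \<in> borel_measurable (M1 \<Otimes>\<^sub>M M2)"
    and a: "integrable M1 a" and b: "integrable M2 b"
    and bd: "\<And>x y. norm (F (x, y)) \<le> a x * (b y :: real)"
  shows "integrable (M1 \<Otimes>\<^sub>M M2) F"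
proof -
  interpret M1: sigma_finite_measure M1 by fact
  interpret M2: sigma_finite_measure M2 by fact
  interpret P: pair_sigma_finite M1 M2 ..
  have [measurable]: "a \<in> borel_measurable M1" "b \<in> borel_measurable M2" using a b by auto
  have "integrable (M1 \<Otimes>\<^sub>M M2) (\<lambda>(x, y). a x * b y)"
  proof (rule P.Fubini_integrable)
    show "(\<lambda>(x, y). a x * b y) \<in> borel_measurable (M1 \<Otimes>\<^sub>M M2)" by measurable
    show "integrable M1 (\<lambda>x. LINT y|M2. norm (case (x, y) of (x, y) \<Rightarrow> a x * b y))"
      using a b by (simp add: abs_mult)
    show "AE x in M1. integrable M2 (\<lambda>y. case (x, y) of (x, y) \<Rightarrow> a x * b y)"
      using b by simp
  qed
  then show ?thesis
    by (rule Bochner_Integration.integrable_bound[OF _ F]) (auto intro!: AE_I2 order_trans[OF bd])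
qed

lemma integral_norm_le_nn_integral:
  fixes f :: "'a \<Rightarrow> 'b::{banach, second_countable_topology}"
  shows "ennreal (norm (integral\<^sup>L M f)) \<le> (\<integral>\<^sup>+x. ennreal (norm (f x)) \<partial>M)"
proof (cases "integrable M f")
  case True then show ?thesis by (rule integral_norm_bound_ennreal)
next
  case False then show ?thesis by (simp add: not_integrable_integral_eq)
qed

lemma cnj_measurable [measurable]: "cnj \<in> borel_measurable borel"
  by (intro borel_measurable_continuous_onI continuous_intros)

lemma iexp_diff: "exp (\<i> * of_real (y * (a - b))) = exp (\<i> * of_real (y * a)) * exp (- (\<i> * of_real (y * b)))"
  by (simp add: mult_exp_exp algebra_simps)

lemma gaussian_integrable: "e > 0 \<Longrightarrow> integrable lborel (\<lambda>y::real. exp (- (e * y)\<^sup>2 / 2))"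
proof -
  assume e: "e > 0"
  have "integrable lborel (\<lambda>y. sqrt (2 * pi) * std_normal_density y)" by simp
  then have "integrable lborel (\<lambda>y::real. exp (- y\<^sup>2 / 2))" by (simp add: std_normal_density_def)
  from lborel_integrable_real_affine[OF this, of e 0] e show ?thesis by simp
qed

lemma gaussian_fourier:
  assumes e: "e > 0"
  shows "(LINT y|lborel. exp (\<i> * of_real (y * \<xi>)) * of_real (exp (- (e * y)\<^sup>2 / 2)))
    = of_real (sqrt (2 * pi) / e * exp (- (\<xi> / e)\<^sup>2 / 2))"
proof -
  have *: "(LINT y|lborel. exp (\<i> * of_real (y * t)) * of_real (exp (- y\<^sup>2 / 2))) = of_real (sqrt (2 * pi) * exp (- t\<^sup>2 / 2))" for t :: real
  proof -
    have "of_real (exp (- t\<^sup>2 / 2)) = char std_normal_distribution t" by (simp add: char_std_normal_distribution)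
    also have "\<dots> = (LINT x|lborel. std_normal_density x *\<^sub>R iexp (t * x))"
      unfolding char_def by (rule integral_density) auto
    also have "\<dots> = (LINT x|lborel. of_real (1 / sqrt (2 * pi)) * (exp (\<i> * of_real (x * t)) * of_real (exp (- x\<^sup>2 / 2))))"
      by (intro Bochner_Integration.integral_cong) (auto simp: std_normal_density_def scaleR_conv_of_real mult_ac)
    also have "\<dots> = of_real (1 / sqrt (2 * pi)) * (LINT x|lborel. (exp (\<i> * of_real (x * t)) * of_real (exp (- x\<^sup>2 / 2))))"
      by (rule integral_mult_right_zero)
    finally have "of_real (sqrt (2 * pi)) * of_real (exp (- t\<^sup>2 / 2)) = of_real (sqrt (2 * pi)) * (of_real (1 / sqrt (2 * pi)) * (LINT x|lborel. (exp (\<i> * of_real (x * t)) * of_real (exp (- x\<^sup>2 / 2)))))"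
      by simp
    then show ?thesis by (simp flip: mult.assoc of_real_mult)
  qed
  have "of_real (sqrt (2 * pi) * exp (- (\<xi> / e)\<^sup>2 / 2)) = (LINT y|lborel. exp (\<i> * of_real (y * (\<xi> / e))) * of_real (exp (- y\<^sup>2 / 2)))"
    by (rule *[symmetric])
  also have "\<dots> = \<bar>e\<bar> *\<^sub>R (LINT y|lborel. exp (\<i> * of_real ((0 + e * y) * (\<xi> / e))) * of_real (exp (- (0 + e * y)\<^sup>2 / 2)))"
    using e by (intro lborel_integral_real_affine) auto
  finally have "of_real (sqrt (2 * pi) * exp (- (\<xi> / e)\<^sup>2 / 2)) = of_real e * (LINT y|lborel. exp (\<i> * of_real (y * \<xi>)) * of_real (exp (- (e * y)\<^sup>2 / 2)))"
    using e by (simp add: scaleR_conv_of_real)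
  then show ?thesis using e by (simp add: field_simps)
qed

lemma gaussian_total:
  assumes e: "e > 0"
  shows "integrable lborel (\<lambda>\<xi>. sqrt (2 * pi) / e * exp (- (\<xi> / e)\<^sup>2 / 2))"
    "(LINT \<xi>|lborel. sqrt (2 * pi) / e * exp (- (\<xi> / e)\<^sup>2 / 2)) = 2 * pi"
proof -
  have i: "integrable lborel (\<lambda>y::real. exp (- (1 / e * y)\<^sup>2 / 2))"
    using gaussian_integrable[of "1 / e"] e by simp
  then show "integrable lborel (\<lambda>\<xi>. sqrt (2 * pi) / e * exp (- (\<xi> / e)\<^sup>2 / 2))" by simp
  have "complex_of_real (LINT y|lborel. exp (- (1 / e * y)\<^sup>2 / 2)) = of_real (sqrt (2 * pi) / (1 / e))"
    using gaussian_fourier[of "1 / e" 0] e by simp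
  then have "(LINT y|lborel. exp (- (1 / e * y)\<^sup>2 / 2)) = sqrt (2 * pi) / (1 / e)" by (simp only: of_real_eq_iff)
  then show "(LINT \<xi>|lborel. sqrt (2 * pi) / e * exp (- (\<xi> / e)\<^sup>2 / 2)) = 2 * pi"
    using e by simp
qed

text \<open>The Fourier integral with the sign that suits superpositions \<open>exp (\<i> y \<eta>)\<close>, without normalising factor.\<close>

definition ft :: "(real \<Rightarrow> complex) \<Rightarrow> real \<Rightarrow> complex" where
  "ft q y = (LINT \<eta>|lborel. exp (\<i> * of_real (y * \<eta>)) * q \<eta>)"

lemma iexp_norm: "norm (exp (\<i> * of_real x)) = 1" by (simp add: norm_exp_i_times)

lemma ft_measurable [measurable]:
  assumes [measurable]: "q \<in> borel_measurable borel" shows "ft q \<in> borel_measurable borel"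
  unfolding ft_def[abs_def] by measurable

lemma ft_bound: "integrable lborel q \<Longrightarrow> norm (ft q y) \<le> (LINT \<eta>|lborel. norm (q \<eta>))"
  unfolding ft_def by (rule order_trans[OF integral_norm_bound]) (simp add: norm_mult iexp_norm)

lemma ft_integrand_integrable: "integrable lborel q \<Longrightarrow> integrable lborel (\<lambda>\<eta>. exp (\<i> * of_real (y * \<eta>)) * q \<eta>)"
  by (rule Bochner_Integration.integrable_bound[of _ q]) (auto simp: norm_mult iexp_norm)

text \<open>The Gaussian weight makes Fubini applicable. Integrating out \<open>y\<close> turns the left side into the quadratic form with
kernel \<open>g (\<eta> - \<zeta>)\<close>, where \<open>g\<close> is the transform of the weight, a positive function of integral \<open>2 \<pi>\<close>; Schur's test finishes.\<close>

lemma plancherel_gaussian: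
  assumes q: "integrable lborel q" and q2: "integrable lborel (\<lambda>x. (norm (q x))\<^sup>2)" and e: "e > 0"
  shows "(LINT y|lborel. (norm (ft q y))\<^sup>2 * exp (- (e * y)\<^sup>2 / 2)) \<le> 2 * pi * (LINT x|lborel. (norm (q x))\<^sup>2)"
proof -
  have qm [measurable]: "q \<in> borel_measurable borel" using q by auto
  define w where "w = (\<lambda>y::real. exp (- (e * y)\<^sup>2 / 2))"
  define g where "g = (\<lambda>\<xi>. sqrt (2 * pi) / e * exp (- (\<xi> / e)\<^sup>2 / 2))"
  have [measurable]: "w \<in> borel_measurable borel" "g \<in> borel_measurable borel" by (simp_all add: w_def g_def)
  have wi: "integrable lborel w" unfolding w_def using gaussian_integrable[OF e] .
  have gi: "integrable lborel g" unfolding g_def using gaussian_total(1)[OF e] .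
  have g0: "g x \<ge> 0" for x using e by (simp add: g_def)
  have w0: "w x \<ge> 0" for x by (simp add: w_def)
  have gI: "(LINT x|lborel. g x) = 2 * pi" unfolding g_def using gaussian_total(2)[OF e] .
  have wg: "(LINT y|lborel. exp (\<i> * of_real (y * \<xi>)) * of_real (w y)) = of_real (g \<xi>)" for \<xi>
    unfolding w_def g_def using gaussian_fourier[OF e] .
  define N where "N = (LINT x|lborel. norm (q x))"
  have N0: "N \<ge> 0" by (simp add: N_def)
  define Q where "Q = ft q"
  have Qm [measurable]: "Q \<in> borel_measurable borel" by (simp add: Q_def)
  have QN: "norm (Q y) \<le> N" for y unfolding Q_def N_def using ft_bound[OF q] .
  have sf: "sigma_finite_measure (lborel :: real measure)" by (rule lborel.sigma_finite_measure_axioms)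
  \<comment> \<open>insert the definition of the second factor \<open>ft q\<close>\<close>
  have F1: "(LINT y|lborel. of_real (w y) * cnj (Q y) * Q y)
     = (LINT \<eta>|lborel. q \<eta> * (LINT y|lborel. of_real (w y) * cnj (Q y) * exp (\<i> * of_real (y * \<eta>))))"
  proof -
    have "(LINT y|lborel. of_real (w y) * cnj (Q y) * Q y)
       = (LINT y|lborel. LINT \<eta>|lborel. of_real (w y) * cnj (Q y) * (exp (\<i> * of_real (y * \<eta>)) * q \<eta>))"
      unfolding Q_def by (subst (2) ft_def) (simp only: integral_mult_right_zero)
    also have "\<dots> = (LINT \<eta>|lborel. LINT y|lborel. of_real (w y) * cnj (Q y) * (exp (\<i> * of_real (y * \<eta>)) * q \<eta>))"
    proof (rule lborel_pair.Fubini_integral[symmetric])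
      show "integrable (lborel \<Otimes>\<^sub>M lborel) (\<lambda>(y, \<eta>). of_real (w y) * cnj (Q y) * (exp (\<i> * of_real (y * \<eta>)) * q \<eta>))"
      proof (rule integrable_pair_product_bound[OF sf sf, where a = "\<lambda>y. N * w y" and b = "\<lambda>\<eta>. norm (q \<eta>)"])
        fix y \<eta> show "norm (case (y, \<eta>) of (y, \<eta>) \<Rightarrow> of_real (w y) * cnj (Q y) * (exp (\<i> * of_real (y * \<eta>)) * q \<eta>)) \<le> N * w y * norm (q \<eta>)"
          using mult_right_mono[OF QN w0, of y y] w0[of y]
          by (auto simp: norm_mult iexp_norm mult.commute[of "w y"] intro!: mult_right_mono)
      qed (use wi q in auto)
    qed
    also have "\<dots> = (LINT \<eta>|lborel. q \<eta> * (LINT y|lborel. of_real (w y) * cnj (Q y) * exp (\<i> * of_real (y * \<eta>))))"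
    proof -
      have "(LINT y|lborel. of_real (w y) * cnj (Q y) * (exp (\<i> * of_real (y * \<eta>)) * q \<eta>))
        = q \<eta> * (LINT y|lborel. of_real (w y) * cnj (Q y) * exp (\<i> * of_real (y * \<eta>)))" for \<eta>
        by (subst integral_mult_right_zero[symmetric]) (simp only: mult_ac)
      then show ?thesis by simp
    qed
    finally show ?thesis .
  qed
  \<comment> \<open>insert the definition of \<open>cnj (ft q)\<close>; the \<open>y\<close>-integral is now the transform of the weight\<close>
  have F2: "(LINT y|lborel. of_real (w y) * cnj (Q y) * exp (\<i> * of_real (y * \<eta>)))
     = (LINT \<zeta>|lborel. cnj (q \<zeta>) * of_real (g (\<eta> - \<zeta>)))" for \<eta>
  proof -
    have c: "cnj (Q y) = (LINT \<zeta>|lborel. exp (- (\<i> * of_real (y * \<zeta>))) * cnj (q \<zeta>))" for y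
    proof -
      have "cnj (Q y) = (LINT \<zeta>|lborel. cnj (exp (\<i> * of_real (y * \<zeta>)) * q \<zeta>))"
        unfolding Q_def ft_def by (rule Bochner_Integration.integral_cnj[symmetric])
      also have "\<dots> = (LINT \<zeta>|lborel. exp (- (\<i> * of_real (y * \<zeta>))) * cnj (q \<zeta>))"
        by (simp add: exp_cnj)
      finally show ?thesis .
    qed
    have "(LINT y|lborel. of_real (w y) * cnj (Q y) * exp (\<i> * of_real (y * \<eta>)))
       = (LINT y|lborel. of_real (w y) * exp (\<i> * of_real (y * \<eta>)) * (LINT \<zeta>|lborel. exp (- (\<i> * of_real (y * \<zeta>))) * cnj (q \<zeta>)))"
      unfolding c by (simp only: mult_ac)
    also have "\<dots> = (LINT y|lborel. LINT \<zeta>|lborel. of_real (w y) * exp (\<i> * of_real (y * \<eta>)) * (exp (- (\<i> * of_real (y * \<zeta>))) * cnj (q \<zeta>)))"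
      by (simp only: integral_mult_right_zero)
    also have "\<dots> = (LINT \<zeta>|lborel. LINT y|lborel. of_real (w y) * exp (\<i> * of_real (y * \<eta>)) * (exp (- (\<i> * of_real (y * \<zeta>))) * cnj (q \<zeta>)))"
    proof (rule lborel_pair.Fubini_integral[symmetric])
      show "integrable (lborel \<Otimes>\<^sub>M lborel) (\<lambda>(y, \<zeta>). of_real (w y) * exp (\<i> * of_real (y * \<eta>)) * (exp (- (\<i> * of_real (y * \<zeta>))) * cnj (q \<zeta>)))"
      proof (rule integrable_pair_product_bound[OF sf sf, where a = w and b = "\<lambda>\<eta>. norm (q \<eta>)"])
        have n: "norm (exp (- (\<i> * (of_real y * of_real z)))) = 1" for y z :: real
          using iexp_norm[of "- (y * z)"] by simp
        fix y \<zeta> show "norm (case (y, \<zeta>) of (y, \<zeta>) \<Rightarrow> of_real (w y) * exp (\<i> * of_real (y * \<eta>)) * (exp (- (\<i> * of_real (y * \<zeta>))) * cnj (q \<zeta>))) \<le> w y * norm (q \<zeta>)"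
          using w0[of y] iexp_norm[of "y * \<eta>"] n[of y \<zeta>] by (simp add: norm_mult)
      qed (use wi q in auto)
    qed
    also have "\<dots> = (LINT \<zeta>|lborel. cnj (q \<zeta>) * (LINT y|lborel. exp (\<i> * of_real (y * (\<eta> - \<zeta>))) * of_real (w y)))"
    proof -
      have "of_real (w y) * exp (\<i> * of_real (y * \<eta>)) * (exp (- (\<i> * of_real (y * \<zeta>))) * cnj (q \<zeta>))
         = cnj (q \<zeta>) * (exp (\<i> * of_real (y * (\<eta> - \<zeta>))) * of_real (w y))" for y \<zeta>
        unfolding iexp_diff by (simp only: mult_ac)
      then show ?thesis by (simp only: integral_mult_right_zero)
    qed
    finally show ?thesis by (simp only: wg)
  qed
  have "complex_of_real (LINT y|lborel. (norm (Q y))\<^sup>2 * w y) = (LINT y|lborel. of_real (w y) * cnj (Q y) * Q y)"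
  proof -
    have "complex_of_real ((norm (Q y))\<^sup>2 * w y) = of_real (w y) * cnj (Q y) * Q y" for y
      by (simp only: of_real_mult complex_norm_square mult_ac)
    then show ?thesis by (subst integral_complex_of_real[symmetric]) (simp only:)
  qed
  also have "\<dots> = (LINT \<eta>|lborel. q \<eta> * (LINT \<zeta>|lborel. cnj (q \<zeta>) * of_real (g (\<eta> - \<zeta>))))"
    by (simp only: F1 F2)
  finally have "(LINT y|lborel. (norm (Q y))\<^sup>2 * w y) = norm (LINT \<eta>|lborel. q \<eta> * (LINT \<zeta>|lborel. cnj (q \<zeta>) * of_real (g (\<eta> - \<zeta>))))"
    using w0 by (metis (no_types, lifting) abs_of_nonneg integral_nonneg_AE AE_I2 mult_nonneg_nonneg norm_of_real zero_le_power2)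
  then have "ennreal (LINT y|lborel. (norm (Q y))\<^sup>2 * w y)
     \<le> (\<integral>\<^sup>+\<eta>. norm (q \<eta> * (LINT \<zeta>|lborel. cnj (q \<zeta>) * of_real (g (\<eta> - \<zeta>)))) \<partial>lborel)"
    by (simp only: integral_norm_le_nn_integral)
  also have "\<dots> \<le> (\<integral>\<^sup>+\<eta>. (\<integral>\<^sup>+\<zeta>. ennreal ((norm (q \<eta>))\<^sup>2 / 2) * ennreal (g (\<eta> - \<zeta>)) + ennreal ((norm (q \<zeta>))\<^sup>2 / 2) * ennreal (g (\<eta> - \<zeta>)) \<partial>lborel) \<partial>lborel)"
  proof (rule nn_integral_mono)
    fix \<eta>
    have "ennreal (norm (q \<eta> * (LINT \<zeta>|lborel. cnj (q \<zeta>) * of_real (g (\<eta> - \<zeta>)))))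
      \<le> ennreal (norm (q \<eta>)) * (\<integral>\<^sup>+\<zeta>. norm (cnj (q \<zeta>) * of_real (g (\<eta> - \<zeta>))) \<partial>lborel)"
      by (subst norm_mult, subst ennreal_mult[OF norm_ge_zero norm_ge_zero],
          rule mult_left_mono[OF integral_norm_le_nn_integral]) simp
    also have "\<dots> = (\<integral>\<^sup>+\<zeta>. ennreal (norm (q \<eta>)) * norm (cnj (q \<zeta>) * of_real (g (\<eta> - \<zeta>))) \<partial>lborel)"
      by (rule nn_integral_cmult[symmetric]) measurable
    also have "\<dots> \<le> (\<integral>\<^sup>+\<zeta>. ennreal ((norm (q \<eta>))\<^sup>2 / 2) * ennreal (g (\<eta> - \<zeta>)) + ennreal ((norm (q \<zeta>))\<^sup>2 / 2) * ennreal (g (\<eta> - \<zeta>)) \<partial>lborel)"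
    proof (rule nn_integral_mono)
      fix \<zeta>
      have "norm (q \<eta>) * norm (q \<zeta>) \<le> (norm (q \<eta>))\<^sup>2 / 2 + (norm (q \<zeta>))\<^sup>2 / 2"
        using sum_squares_bound[of "norm (q \<eta>)" "norm (q \<zeta>)"] by simp
      then have "norm (q \<eta>) * norm (q \<zeta>) * g (\<eta> - \<zeta>) \<le> ((norm (q \<eta>))\<^sup>2 / 2 + (norm (q \<zeta>))\<^sup>2 / 2) * g (\<eta> - \<zeta>)"
        using g0 by (intro mult_right_mono)
      then have "ennreal (norm (q \<eta>) * norm (q \<zeta>) * g (\<eta> - \<zeta>)) \<le> ennreal ((norm (q \<eta>))\<^sup>2 / 2 * g (\<eta> - \<zeta>) + (norm (q \<zeta>))\<^sup>2 / 2 * g (\<eta> - \<zeta>))"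
        by (intro ennreal_leI) (simp add: algebra_simps)
      then show "ennreal (norm (q \<eta>)) * norm (cnj (q \<zeta>) * of_real (g (\<eta> - \<zeta>))) \<le> ennreal ((norm (q \<eta>))\<^sup>2 / 2) * ennreal (g (\<eta> - \<zeta>)) + ennreal ((norm (q \<zeta>))\<^sup>2 / 2) * ennreal (g (\<eta> - \<zeta>))"
        using g0[of "\<eta> - \<zeta>"] by (simp add: norm_mult ennreal_mult[symmetric] ennreal_plus[symmetric] mult.assoc del: ennreal_plus)
    qed
    finally show "ennreal (norm (q \<eta> * (LINT \<zeta>|lborel. cnj (q \<zeta>) * of_real (g (\<eta> - \<zeta>)))))
       \<le> (\<integral>\<^sup>+\<zeta>. ennreal ((norm (q \<eta>))\<^sup>2 / 2) * ennreal (g (\<eta> - \<zeta>)) + ennreal ((norm (q \<zeta>))\<^sup>2 / 2) * ennreal (g (\<eta> - \<zeta>)) \<partial>lborel)" .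
  qed
  also have "\<dots> = (\<integral>\<^sup>+\<eta>. \<integral>\<^sup>+\<zeta>. ennreal ((norm (q \<eta>))\<^sup>2 / 2) * ennreal (g (\<eta> - \<zeta>)) \<partial>lborel \<partial>lborel)
     + (\<integral>\<^sup>+\<eta>. \<integral>\<^sup>+\<zeta>. ennreal ((norm (q \<zeta>))\<^sup>2 / 2) * ennreal (g (\<eta> - \<zeta>)) \<partial>lborel \<partial>lborel)"
    by (subst nn_integral_add[symmetric]) (auto intro!: nn_integral_cong nn_integral_add)
  also have "(\<integral>\<^sup>+\<eta>. \<integral>\<^sup>+\<zeta>. ennreal ((norm (q \<zeta>))\<^sup>2 / 2) * ennreal (g (\<eta> - \<zeta>)) \<partial>lborel \<partial>lborel)
     = (\<integral>\<^sup>+\<zeta>. \<integral>\<^sup>+\<eta>. ennreal ((norm (q \<zeta>))\<^sup>2 / 2) * ennreal (g (\<eta> - \<zeta>)) \<partial>lborel \<partial>lborel)"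
    by (rule lborel_pair.Fubini') measurable
  also have "(\<integral>\<^sup>+\<eta>. \<integral>\<^sup>+\<zeta>. ennreal ((norm (q \<eta>))\<^sup>2 / 2) * ennreal (g (\<eta> - \<zeta>)) \<partial>lborel \<partial>lborel) = (\<integral>\<^sup>+\<eta>. ennreal ((norm (q \<eta>))\<^sup>2 / 2) * ennreal (2 * pi) \<partial>lborel)"
  proof (intro nn_integral_cong)
    fix \<eta>
    have "(\<integral>\<^sup>+\<zeta>. ennreal (g (\<eta> - \<zeta>)) \<partial>lborel) = (\<integral>\<^sup>+\<zeta>. ennreal (g \<zeta>) \<partial>lborel)"
      using nn_integral_real_affine[of "\<lambda>\<zeta>. ennreal (g \<zeta>)" "-1" \<eta>] by simp
    also have "\<dots> = ennreal (2 * pi)" by (subst nn_integral_eq_integral[OF gi]) (auto simp: g0 gI)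
    finally show "(\<integral>\<^sup>+\<zeta>. ennreal ((norm (q \<eta>))\<^sup>2 / 2) * ennreal (g (\<eta> - \<zeta>)) \<partial>lborel) = ennreal ((norm (q \<eta>))\<^sup>2 / 2) * ennreal (2 * pi)"
      by (subst nn_integral_cmult) auto
  qed
  also have "(\<integral>\<^sup>+\<zeta>. \<integral>\<^sup>+\<eta>. ennreal ((norm (q \<zeta>))\<^sup>2 / 2) * ennreal (g (\<eta> - \<zeta>)) \<partial>lborel \<partial>lborel) = (\<integral>\<^sup>+\<eta>. ennreal ((norm (q \<eta>))\<^sup>2 / 2) * ennreal (2 * pi) \<partial>lborel)"
  proof (intro nn_integral_cong)
    fix \<zeta>
    have "(\<integral>\<^sup>+\<eta>. ennreal (g (\<eta> - \<zeta>)) \<partial>lborel) = (\<integral>\<^sup>+\<zeta>. ennreal (g \<zeta>) \<partial>lborel)"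
      using nn_integral_real_affine[of "\<lambda>\<zeta>. ennreal (g \<zeta>)" "1" "- \<zeta>"] by simp
    also have "\<dots> = ennreal (2 * pi)" by (subst nn_integral_eq_integral[OF gi]) (auto simp: g0 gI)
    finally show "(\<integral>\<^sup>+\<eta>. ennreal ((norm (q \<zeta>))\<^sup>2 / 2) * ennreal (g (\<eta> - \<zeta>)) \<partial>lborel) = ennreal ((norm (q \<zeta>))\<^sup>2 / 2) * ennreal (2 * pi)"
      by (subst nn_integral_cmult) auto
  qed
  also have "(\<integral>\<^sup>+\<eta>. ennreal ((norm (q \<eta>))\<^sup>2 / 2) * ennreal (2 * pi) \<partial>lborel) + (\<integral>\<^sup>+\<eta>. ennreal ((norm (q \<eta>))\<^sup>2 / 2) * ennreal (2 * pi) \<partial>lborel)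
      = ennreal (2 * pi * (LINT x|lborel. (norm (q x))\<^sup>2))"
  proof -
    have "(\<integral>\<^sup>+\<eta>. ennreal ((norm (q \<eta>))\<^sup>2 / 2) * ennreal (2 * pi) \<partial>lborel) = ennreal (LINT x|lborel. pi * (norm (q x))\<^sup>2)"
      by (subst nn_integral_eq_integral[symmetric]) (auto simp: q2 ennreal_mult[symmetric] mult_ac intro!: nn_integral_cong)
    then show ?thesis by (simp flip: ennreal_plus)
  qed
  finally show ?thesis unfolding Q_def w_def by (subst (asm) ennreal_le_iff) auto
qed

text \<open>The weights \<open>exp (- (e y)^2 / 2)\<close> increase to \<open>1\<close> as \<open>e\<close> tends to \<open>0\<close>, and Fatou's lemma applies.\<close>

lemma plancherel_le:
  assumes q: "integrable lborel q" and q2: "integrable lborel (\<lambda>x. (norm (q x))\<^sup>2)"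
  shows "(\<integral>\<^sup>+y. ennreal ((norm (ft q y))\<^sup>2) \<partial>lborel) \<le> ennreal (2 * pi * (LINT x|lborel. (norm (q x))\<^sup>2))"
proof -
  have qm [measurable]: "q \<in> borel_measurable borel" using q by auto
  define N where "N = (LINT x|lborel. norm (q x))"
  define B where "B = ennreal (2 * pi * (LINT x|lborel. (norm (q x))\<^sup>2))"
  define u where "u = (\<lambda>(n::nat) y. ennreal ((norm (ft q y))\<^sup>2 * exp (- (inverse (real (Suc n)) * y)\<^sup>2 / 2)))"
  have um [measurable]: "u n \<in> borel_measurable lborel" for n unfolding u_def by measurable
  have ub: "(\<integral>\<^sup>+y. u n y \<partial>lborel) \<le> B" for n
  proof -
    have e: "inverse (real (Suc n)) > 0" by simp
    have "integrable lborel (\<lambda>y. N\<^sup>2 * exp (- (inverse (real (Suc n)) * y)\<^sup>2 / 2))"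
      by (intro integrable_mult_right gaussian_integrable e)
    then have i: "integrable lborel (\<lambda>y. (norm (ft q y))\<^sup>2 * exp (- (inverse (real (Suc n)) * y)\<^sup>2 / 2))"
    proof (rule Bochner_Integration.integrable_bound)
      show "AE y in lborel. norm ((norm (ft q y))\<^sup>2 * exp (- (inverse (real (Suc n)) * y)\<^sup>2 / 2)) \<le> norm (N\<^sup>2 * exp (- (inverse (real (Suc n)) * y)\<^sup>2 / 2))"
        using ft_bound[OF q] by (auto intro!: AE_I2 mult_right_mono power_mono simp: N_def abs_mult)
    qed measurable
    show ?thesis unfolding u_def B_def
      by (subst nn_integral_eq_integral[OF i]) (use plancherel_gaussian[OF q q2 e] in \<open>auto intro!: ennreal_leI\<close>)
  qed
  have lim: "liminf (\<lambda>n. u n y) = ennreal ((norm (ft q y))\<^sup>2)" for y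
  proof (rule lim_imp_Liminf)
    have "(\<lambda>n. (norm (ft q y))\<^sup>2 * exp (- (inverse (real (Suc n)) * y)\<^sup>2 / 2)) \<longlonglongrightarrow> (norm (ft q y))\<^sup>2 * exp (- (0 * y)\<^sup>2 / 2)"
      by (intro tendsto_intros LIMSEQ_inverse_real_of_nat) auto
    then show "(\<lambda>n. u n y) \<longlonglongrightarrow> ennreal ((norm (ft q y))\<^sup>2)"
      unfolding u_def by (intro tendsto_ennrealI) simp
  qed simp
  have "(\<integral>\<^sup>+y. ennreal ((norm (ft q y))\<^sup>2) \<partial>lborel) = (\<integral>\<^sup>+y. liminf (\<lambda>n. u n y) \<partial>lborel)" by (simp add: lim)
  also have "\<dots> \<le> liminf (\<lambda>n. \<integral>\<^sup>+y. u n y \<partial>lborel)" by (rule nn_integral_liminf) measurable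
  also have "\<dots> \<le> liminf (\<lambda>n::nat. B)" by (intro Liminf_mono always_eventually allI ub)
  also have "\<dots> = B" by (simp add: Liminf_const)
  finally show ?thesis by (simp add: B_def)
qed

lemma inv_Fourier_eq_ft: "inv_Fourier m t = of_real (1 / (2 * pi)) * ft m t"
  by (simp add: inv_Fourier_def ft_def)

lemma compact_support_integrable:
  fixes f :: "real \<Rightarrow> complex"
  assumes "continuous_on UNIV f" "\<And>x. \<bar>x\<bar> > B \<Longrightarrow> f x = 0"
  shows "integrable lborel f"
proof -
  have "set_integrable lborel {-B..B} f"
    by (intro borel_integrable_atLeastAtMost' continuous_on_subset[OF assms(1)]) auto
  then have "integrable lborel (\<lambda>x. indicator {-B..B} x *\<^sub>R f x)" by (simp add: set_integrable_def)
  moreover have "(\<lambda>x. indicator {-B..B} x *\<^sub>R f x) = f"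
    using assms(2) by (auto simp: indicator_def fun_eq_iff abs_real_def)
  ultimately show ?thesis by simp
qed

text \<open>The usual proof with a Gaussian factor: after Fubini the integral is an average of \<open>m\<close> over a Gaussian of width \<open>e\<close> around
\<open>\<mu>\<close>, and both sides converge as \<open>e\<close> tends to \<open>0\<close>.\<close>

lemma ft_inversion:
  assumes c: "continuous_on UNIV m" and B: "\<And>x. \<bar>x\<bar> > B \<Longrightarrow> m x = 0"
    and ki: "integrable lborel (ft m)"
  shows "(LINT s|lborel. ft m s * exp (- (\<i> * of_real (s * \<mu>)))) = of_real (2 * pi) * m \<mu>"
proof -
  have mi: "integrable lborel m" by (rule compact_support_integrable[OF c B])
  have mm [measurable]: "m \<in> borel_measurable borel" using mi by auto
  have km [measurable]: "ft m \<in> borel_measurable borel" by measurable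
  define en where "en = (\<lambda>n. inverse (real (Suc n)))"
  have en: "en n > 0" for n by (simp add: en_def)
  have en0: "en \<longlonglongrightarrow> 0" unfolding en_def by (rule LIMSEQ_inverse_real_of_nat)
  have sf: "sigma_finite_measure (lborel :: real measure)" by (rule lborel.sigma_finite_measure_axioms)
  define I where "I = (\<lambda>n. LINT s|lborel. ft m s * exp (- (\<i> * of_real (s * \<mu>))) * of_real (exp (- (en n * s)\<^sup>2 / 2)))"
  have nme: "norm (exp (- (\<i> * of_real x))) = 1" for x using iexp_norm[of "- x"] by simp
  have lim1: "I \<longlonglongrightarrow> (LINT s|lborel. ft m s * exp (- (\<i> * of_real (s * \<mu>))))"
    unfolding I_def
  proof (rule integral_dominated_convergence[where w = "\<lambda>s. norm (ft m s)"])
    show "AE s in lborel. (\<lambda>n. ft m s * exp (- (\<i> * of_real (s * \<mu>))) * of_real (exp (- (en n * s)\<^sup>2 / 2))) \<longlonglongrightarrow> ft m s * exp (- (\<i> * of_real (s * \<mu>)))"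
    proof (rule AE_I2)
      fix s
      have "(\<lambda>n. ft m s * exp (- (\<i> * of_real (s * \<mu>))) * of_real (exp (- (en n * s)\<^sup>2 / 2))) \<longlonglongrightarrow> ft m s * exp (- (\<i> * of_real (s * \<mu>))) * of_real (exp (- (0 * s)\<^sup>2 / 2))"
        by (intro tendsto_intros en0) auto
      then show "(\<lambda>n. ft m s * exp (- (\<i> * of_real (s * \<mu>))) * of_real (exp (- (en n * s)\<^sup>2 / 2))) \<longlonglongrightarrow> ft m s * exp (- (\<i> * of_real (s * \<mu>)))" by simp
    qed
    show "AE s in lborel. norm (ft m s * exp (- (\<i> * of_real (s * \<mu>))) * of_real (exp (- (en n * s)\<^sup>2 / 2))) \<le> norm (ft m s)" for n
    proof (rule AE_I2)
      fix s :: real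
      have "norm (ft m s) * exp (- (en n * s)\<^sup>2 / 2) \<le> norm (ft m s) * 1" by (intro mult_left_mono) auto
      then show "norm (ft m s * exp (- (\<i> * of_real (s * \<mu>))) * of_real (exp (- (en n * s)\<^sup>2 / 2))) \<le> norm (ft m s)"
        using nme[of "s * \<mu>"] by (simp add: norm_mult)
    qed
  qed (use ki in auto)
  \<comment> \<open>Fubini, and the substitution \<open>\<eta> = \<mu> + e \<sigma>\<close>\<close>
  have I2: "I n = (LINT \<sigma>|lborel. of_real (sqrt (2 * pi) * exp (- \<sigma>\<^sup>2 / 2)) * m (\<mu> + en n * \<sigma>))" for n
  proof -
    let ?w = "\<lambda>s. exp (- (en n * s)\<^sup>2 / 2)"
    have "I n = (LINT s|lborel. LINT \<tau>|lborel. exp (- (\<i> * of_real (s * \<mu>))) * of_real (?w s) * (exp (\<i> * of_real (s * \<tau>)) * m \<tau>))"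
      unfolding I_def ft_def by (simp only: integral_mult_right_zero) (simp only: mult_ac)
    also have "\<dots> = (LINT \<tau>|lborel. LINT s|lborel. exp (- (\<i> * of_real (s * \<mu>))) * of_real (?w s) * (exp (\<i> * of_real (s * \<tau>)) * m \<tau>))"
    proof (rule lborel_pair.Fubini_integral[symmetric])
      show "integrable (lborel \<Otimes>\<^sub>M lborel) (\<lambda>(s, \<tau>). exp (- (\<i> * of_real (s * \<mu>))) * of_real (?w s) * (exp (\<i> * of_real (s * \<tau>)) * m \<tau>))"
      proof (rule integrable_pair_product_bound[OF sf sf, where a = ?w and b = "\<lambda>\<tau>. norm (m \<tau>)"])
        fix s \<tau> show "norm (case (s, \<tau>) of (s, \<tau>) \<Rightarrow> exp (- (\<i> * of_real (s * \<mu>))) * of_real (?w s) * (exp (\<i> * of_real (s * \<tau>)) * m \<tau>)) \<le> ?w s * norm (m \<tau>)"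
          using nme[of "s * \<mu>"] iexp_norm[of "s * \<tau>"] by (simp add: norm_mult)
      qed (use mi gaussian_integrable[OF en] in auto)
    qed
    also have "\<dots> = (LINT \<tau>|lborel. m \<tau> * (LINT s|lborel. exp (\<i> * of_real (s * (\<tau> - \<mu>))) * of_real (?w s)))"
    proof -
      have "exp (- (\<i> * of_real (s * \<mu>))) * of_real (?w s) * (exp (\<i> * of_real (s * \<tau>)) * m \<tau>) = m \<tau> * (exp (\<i> * of_real (s * (\<tau> - \<mu>))) * of_real (?w s))" for s \<tau>
        unfolding iexp_diff by (simp only: mult_ac)
      then show ?thesis by (simp only: integral_mult_right_zero)
    qed
    also have "\<dots> = (LINT \<tau>|lborel. m \<tau> * of_real (sqrt (2 * pi) / en n * exp (- ((\<tau> - \<mu>) / en n)\<^sup>2 / 2)))"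
      by (simp only: gaussian_fourier[OF en])
    also have "\<dots> = \<bar>en n\<bar> *\<^sub>R (LINT \<sigma>|lborel. m (\<mu> + en n * \<sigma>) * of_real (sqrt (2 * pi) / en n * exp (- ((\<mu> + en n * \<sigma> - \<mu>) / en n)\<^sup>2 / 2)))"
      using en[of n] by (intro lborel_integral_real_affine) auto
    also have "\<dots> = (LINT \<sigma>|lborel. of_real \<bar>en n\<bar> * (m (\<mu> + en n * \<sigma>) * of_real (sqrt (2 * pi) / en n * exp (- ((\<mu> + en n * \<sigma> - \<mu>) / en n)\<^sup>2 / 2))))"
      by (simp add: scaleR_conv_of_real)
    also have "\<dots> = (LINT \<sigma>|lborel. of_real (sqrt (2 * pi) * exp (- \<sigma>\<^sup>2 / 2)) * m (\<mu> + en n * \<sigma>))"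
      using en[of n] by (intro Bochner_Integration.integral_cong) auto
    finally show ?thesis .
  qed
  obtain M where M: "\<And>x. norm (m x) \<le> M"
  proof -
    have "compact (m ` {-B..B})" by (intro compact_continuous_image continuous_on_subset[OF c]) auto
    then obtain M where "\<forall>z\<in>m ` {-B..B}. norm z \<le> M" using compact_imp_bounded bounded_iff by blast
    then have "norm (m x) \<le> max M 0" for x by (cases "\<bar>x\<bar> > B") (auto simp: B abs_real_def split: if_splits intro: max.coboundedI1)
    then show ?thesis using that by blast
  qed
  have gi: "integrable lborel (\<lambda>\<sigma>::real. exp (- \<sigma>\<^sup>2 / 2))" using gaussian_integrable[of 1] by simp
  have lim2: "I \<longlonglongrightarrow> (LINT \<sigma>|lborel. of_real (sqrt (2 * pi) * exp (- \<sigma>\<^sup>2 / 2)) * m \<mu>)"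
    unfolding I2[abs_def]
  proof (rule integral_dominated_convergence[where w = "\<lambda>\<sigma>. sqrt (2 * pi) * M * exp (- \<sigma>\<^sup>2 / 2)"])
    show "integrable lborel (\<lambda>\<sigma>. sqrt (2 * pi) * M * exp (- \<sigma>\<^sup>2 / 2))" by (intro integrable_mult_right gi)
    show "AE \<sigma> in lborel. (\<lambda>n. of_real (sqrt (2 * pi) * exp (- \<sigma>\<^sup>2 / 2)) * m (\<mu> + en n * \<sigma>)) \<longlonglongrightarrow> of_real (sqrt (2 * pi) * exp (- \<sigma>\<^sup>2 / 2)) * m \<mu>"
    proof (rule AE_I2)
      fix \<sigma>
      have "(\<lambda>n. \<mu> + en n * \<sigma>) \<longlonglongrightarrow> \<mu> + 0 * \<sigma>" by (intro tendsto_intros en0)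
      then have "(\<lambda>n. m (\<mu> + en n * \<sigma>)) \<longlonglongrightarrow> m \<mu>"
        using continuous_on_tendsto_compose[OF c, of "\<lambda>n. \<mu> + en n * \<sigma>" \<mu>] by simp
      then show "(\<lambda>n. of_real (sqrt (2 * pi) * exp (- \<sigma>\<^sup>2 / 2)) * m (\<mu> + en n * \<sigma>)) \<longlonglongrightarrow> of_real (sqrt (2 * pi) * exp (- \<sigma>\<^sup>2 / 2)) * m \<mu>"
        by (intro tendsto_intros)
    qed
    show "AE \<sigma> in lborel. norm (of_real (sqrt (2 * pi) * exp (- \<sigma>\<^sup>2 / 2)) * m (\<mu> + en n * \<sigma>)) \<le> sqrt (2 * pi) * M * exp (- \<sigma>\<^sup>2 / 2)" for n
    proof (rule AE_I2)
      fix \<sigma>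
      have "norm (of_real (sqrt (2 * pi) * exp (- \<sigma>\<^sup>2 / 2)) * m (\<mu> + en n * \<sigma>)) = (sqrt (2 * pi) * exp (- \<sigma>\<^sup>2 / 2)) * norm (m (\<mu> + en n * \<sigma>))"
        by (simp add: norm_mult)
      also have "\<dots> \<le> (sqrt (2 * pi) * exp (- \<sigma>\<^sup>2 / 2)) * M" by (intro mult_left_mono M) auto
      finally show "norm (of_real (sqrt (2 * pi) * exp (- \<sigma>\<^sup>2 / 2)) * m (\<mu> + en n * \<sigma>)) \<le> sqrt (2 * pi) * M * exp (- \<sigma>\<^sup>2 / 2)"
        by (simp add: mult_ac)
    qed
  qed measurable
  have "(LINT \<sigma>|lborel. of_real (sqrt (2 * pi) * exp (- \<sigma>\<^sup>2 / 2)) * m \<mu>) = of_real (LINT \<sigma>|lborel. sqrt (2 * pi) / 1 * exp (- (\<sigma> / 1)\<^sup>2 / 2)) * m \<mu>"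
    by (subst integral_complex_of_real[symmetric]) (simp only: integral_mult_left_zero div_by_1)
  also have "\<dots> = of_real (2 * pi) * m \<mu>" by (subst gaussian_total(2)) auto
  finally show ?thesis using LIMSEQ_unique[OF lim1 lim2] by simp
qed

text \<open>Two integrations by parts give decay like \<open>1 / (1 + t^2)\<close>.\<close>

lemma ft_integrable_C2:
  fixes m m1 m2 :: "real \<Rightarrow> complex"
  assumes d1: "\<And>x. (m has_vector_derivative m1 x) (at x)"
    and d2: "\<And>x. (m1 has_vector_derivative m2 x) (at x)"
    and c2: "continuous_on UNIV m2" and B: "\<And>x. \<bar>x\<bar> > B \<Longrightarrow> m x = 0"
  shows "integrable lborel (ft m)"
proof -
  have c: "continuous_on UNIV m" and c1: "continuous_on UNIV m1"
    using d1 d2 by (auto intro!: continuous_at_imp_continuous_on has_vector_derivative_continuous)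
  have opn: "open {x::real. \<bar>x\<bar> > B}"
    by (intro open_Collect_less continuous_intros)
  have B1: "m1 x = 0" if "\<bar>x\<bar> > B" for x
  proof -
    have "((\<lambda>x. 0) has_vector_derivative m1 x) (at x)"
      using has_vector_derivative_transform_within_open[OF d1 opn, of x "\<lambda>x. 0"] that B by auto
    then show ?thesis using vector_derivative_unique_at[of "\<lambda>x. 0" "m1 x" x 0] by auto
  qed
  have B2: "m2 x = 0" if "\<bar>x\<bar> > B" for x
  proof -
    have "((\<lambda>x. 0) has_vector_derivative m2 x) (at x)"
      using has_vector_derivative_transform_within_open[OF d2 opn, of x "\<lambda>x. 0"] that B1 by auto
    then show ?thesis using vector_derivative_unique_at[of "\<lambda>x. 0" "m2 x" x 0] by auto
  qed
  have mi: "integrable lborel m" by (rule compact_support_integrable[OF c B])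
  have m2i: "integrable lborel m2" by (rule compact_support_integrable[OF c2 B2])
  have mm [measurable]: "m \<in> borel_measurable borel" using mi by auto
  have t2: "of_real (t\<^sup>2) * ft m t = - ft m2 t" for t :: real
  proof -
    let ?G = "\<lambda>\<tau>. exp (\<i> * of_real (t * \<tau>)) * (m1 \<tau> - \<i> * of_real t * m \<tau>)"
    let ?g = "\<lambda>\<tau>. exp (\<i> * of_real (t * \<tau>)) * m2 \<tau> + of_real (t\<^sup>2) * (exp (\<i> * of_real (t * \<tau>)) * m \<tau>)"
    have ed: "((\<lambda>\<tau>. exp (\<i> * of_real (t * \<tau>))) has_vector_derivative exp (\<i> * of_real (t * \<tau>)) * (\<i> * of_real t)) (at \<tau>)" for \<tau>
    proof -
      have "((\<lambda>z. exp (\<i> * (of_real t * z))) has_field_derivative exp (\<i> * (of_real t * of_real \<tau>)) * (\<i> * of_real t)) (at (of_real \<tau>))"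
        by (auto intro!: derivative_eq_intros)
      from has_vector_derivative_real_field[OF this] show ?thesis by simp
    qed
    have Gd: "(?G has_vector_derivative ?g \<tau>) (at \<tau>)" for \<tau>
      by (rule has_vector_derivative_eq_rhs,
          rule has_vector_derivative_mult[OF ed has_vector_derivative_diff[OF d2 has_vector_derivative_mult_right[OF d1]]])
         (simp add: algebra_simps power2_eq_square)
    have gc: "continuous_on UNIV ?g" by (intro continuous_intros c c2)
    define R where "R = \<bar>B\<bar> + 1"
    have out: "\<bar>x\<bar> > B" if "\<not> (-R < x \<and> x < R)" for x using that by (auto simp: R_def)
    have i: "has_bochner_integral lborel (\<lambda>x. indicator {-R..R} x *\<^sub>R ?g x) (?G R - ?G (-R))"
    proof (rule has_bochner_integral_FTC_Icc)
      show "-R \<le> R" by (simp add: R_def)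
      show "(?G has_vector_derivative ?g x) (at x within {-R..R})" for x
        by (rule has_vector_derivative_at_within[OF Gd])
      show "continuous_on {-R..R} ?g" by (rule continuous_on_subset[OF gc]) simp
    qed
    have "(\<lambda>x. indicator {-R..R} x *\<^sub>R ?g x) = ?g"
      using out B B2 by (auto simp: fun_eq_iff indicator_def)
    moreover have "?G R = 0" "?G (-R) = 0" using out[of R] out[of "-R"] B B1 by auto
    ultimately have "(LINT x|lborel. ?g x) = 0" using i by (simp add: has_bochner_integral_integral_eq)
    moreover have "(LINT x|lborel. ?g x) = ft m2 t + of_real (t\<^sup>2) * ft m t"
      unfolding ft_def
      by (subst Bochner_Integration.integral_add[OF ft_integrand_integrable[OF m2i]
            integrable_mult_right[OF ft_integrand_integrable[OF mi]]])
         (simp only: integral_mult_right_zero)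
    ultimately have "of_real (t\<^sup>2) * ft m t + ft m2 t = 0" by (simp only: add.commute)
    then show ?thesis by (simp only: eq_neg_iff_add_eq_0)
  qed
  define K where "K = (LINT \<eta>|lborel. norm (m \<eta>)) + (LINT \<eta>|lborel. norm (m2 \<eta>))"
  have "integrable lborel (\<lambda>x::real. K * inverse (1 + x\<^sup>2))"
    using integrable_inverse_1_plus_square by (simp add: set_integrable_def)
  then show ?thesis
  proof (rule Bochner_Integration.integrable_bound)
    show "AE t in lborel. norm (ft m t) \<le> norm (K * inverse (1 + t\<^sup>2))"
    proof (rule AE_I2)
      fix t :: real
      have "norm (ft m t) * (1 + t\<^sup>2) = norm (ft m t) + norm (of_real (t\<^sup>2) * ft m t)"
        by (simp add: norm_mult algebra_simps del: of_real_power)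
      also have "\<dots> \<le> K" unfolding t2 K_def using ft_bound[OF mi, of t] ft_bound[OF m2i, of t] by simp
      finally have le: "norm (ft m t) * (1 + t\<^sup>2) \<le> K" .
      have p: "1 + t\<^sup>2 > 0" by (simp add: add_pos_nonneg)
      have "norm (ft m t) \<le> K / (1 + t\<^sup>2)" using le p by (simp add: pos_le_divide_eq)
      also have "\<dots> \<le> norm (K * inverse (1 + t\<^sup>2))" by (simp add: divide_inverse)
      finally show "norm (ft m t) \<le> norm (K * inverse (1 + t\<^sup>2))" .
    qed
  qed measurable
qed

section \<open>Square integrable functions on the half plane\<close>

lemma Lr2_eq: "Lr_norm 2 f = ennreal_powr (\<integral>\<^sup>+z. ennreal ((norm (f z))\<^sup>2) \<partial>M\<Omega>) (1 / 2)"
proof -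
  have "enn2real 2 = 2" by (metis enn2real_ennreal ennreal_numeral zero_le_numeral)
  moreover have "ennreal_powr (ennreal (norm (f z))) 2 = ennreal ((norm (f z))\<^sup>2)" for z
    by (simp add: ennreal_powr_def)
  ultimately show ?thesis by (simp add: Lr_norm_def Lp_norm_def)
qed

text \<open>The squared \<open>L\<^sup>2\<close> norm as a real number, meaningful on \<open>L2_Omega\<close>.\<close>

definition n2 :: "(real \<times> real \<Rightarrow> complex) \<Rightarrow> real" where
  "n2 f = (LINT z|M\<Omega>. (norm (f z))\<^sup>2)"

lemma n2_nonneg: "n2 f \<ge> 0" by (simp add: n2_def)

lemma nn2_infinite_or: "Lr_norm 2 f < \<infinity> \<longleftrightarrow> (\<integral>\<^sup>+z. ennreal ((norm (f z))\<^sup>2) \<partial>M\<Omega>) < \<infinity>"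
  by (simp add: Lr2_eq ennreal_powr_def less_top)

lemma L2_Omega_iff: "f \<in> L2_Omega \<longleftrightarrow> f \<in> borel_measurable M\<Omega> \<and> integrable M\<Omega> (\<lambda>z. (norm (f z))\<^sup>2)"
  unfolding L2_Omega_def nn2_infinite_or by (auto simp: integrable_iff_bounded)

lemma L2_integrable: "f \<in> L2_Omega \<Longrightarrow> integrable M\<Omega> (\<lambda>z. (norm (f z))\<^sup>2)"
  and L2_measurable: "f \<in> L2_Omega \<Longrightarrow> f \<in> borel_measurable M\<Omega>"
  by (auto simp: L2_Omega_iff)

lemma Lr2_n2: "f \<in> L2_Omega \<Longrightarrow> Lr_norm 2 f = ennreal (sqrt (n2 f))"
  using nn_integral_eq_integral[OF L2_integrable, of f]
  by (simp add: Lr2_eq ennreal_powr_def n2_def powr_half_sqrt)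

lemma L2_OmegaI_bound:
  assumes "f \<in> borel_measurable M\<Omega>" "(\<integral>\<^sup>+z. ennreal ((norm (f z))\<^sup>2) \<partial>M\<Omega>) \<le> ennreal c"
  shows "f \<in> L2_Omega" "c \<ge> 0 \<Longrightarrow> n2 f \<le> c"
proof -
  show L: "f \<in> L2_Omega" using assms by (auto simp: L2_Omega_iff integrable_iff_bounded le_less_trans)
  show "n2 f \<le> c" if "c \<ge> 0"
    using assms(2) nn_integral_eq_integral[OF L2_integrable[OF L]] that by (simp add: n2_def)
qed

lemma norm_add_sq: "(norm (a + b :: complex))\<^sup>2 \<le> 2 * (norm a)\<^sup>2 + 2 * (norm b)\<^sup>2"
proof -
  have "(norm (a + b))\<^sup>2 \<le> (norm a + norm b)\<^sup>2" by (intro power_mono norm_triangle_ineq) auto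
  also have "\<dots> \<le> 2 * (norm a)\<^sup>2 + 2 * (norm b)\<^sup>2"
    using sum_squares_bound[of "norm a" "norm b"] by (simp add: power2_sum)
  finally show ?thesis .
qed

lemma L2_add:
  assumes "f \<in> L2_Omega" "g \<in> L2_Omega"
  shows "(\<lambda>z. f z + g z) \<in> L2_Omega" "n2 (\<lambda>z. f z + g z) \<le> 2 * n2 f + 2 * n2 g"
proof -
  have [measurable]: "f \<in> borel_measurable M\<Omega>" "g \<in> borel_measurable M\<Omega>" using assms L2_measurable by auto
  have i: "integrable M\<Omega> (\<lambda>z. 2 * (norm (f z))\<^sup>2 + 2 * (norm (g z))\<^sup>2)"
    using assms by (auto simp: L2_integrable)
  have i2: "integrable M\<Omega> (\<lambda>z. (norm (f z + g z))\<^sup>2)"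
    by (rule Bochner_Integration.integrable_bound[OF i]) (auto intro!: AE_I2 norm_add_sq)
  then show "(\<lambda>z. f z + g z) \<in> L2_Omega" by (simp add: L2_Omega_iff)
  have "n2 (\<lambda>z. f z + g z) \<le> (LINT z|M\<Omega>. 2 * (norm (f z))\<^sup>2 + 2 * (norm (g z))\<^sup>2)"
    unfolding n2_def by (intro integral_mono i i2 norm_add_sq)
  also have "\<dots> = 2 * n2 f + 2 * n2 g" using assms by (simp add: n2_def L2_integrable)
  finally show "n2 (\<lambda>z. f z + g z) \<le> 2 * n2 f + 2 * n2 g" .
qed

lemma L2_cmult: "f \<in> L2_Omega \<Longrightarrow> (\<lambda>z. c * f z) \<in> L2_Omega" "n2 (\<lambda>z. c * f z) = (norm c)\<^sup>2 * n2 f"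
  by (auto simp: L2_Omega_iff norm_mult power_mult_distrib n2_def)

lemma L2_minus: "f \<in> L2_Omega \<Longrightarrow> (\<lambda>z. - f z) \<in> L2_Omega"
  using L2_cmult(1)[of f "-1"] by simp

lemma L2_diff: "f \<in> L2_Omega \<Longrightarrow> g \<in> L2_Omega \<Longrightarrow> (\<lambda>z. f z - g z) \<in> L2_Omega"
  using L2_add(1)[of f "\<lambda>z. - g z"] L2_minus[of g] by simp

lemma L2_zero: "(\<lambda>z. 0) \<in> L2_Omega" by (simp add: L2_Omega_iff)

lemma cnj_meas: "g \<in> borel_measurable M \<Longrightarrow> (\<lambda>z. cnj (g z)) \<in> borel_measurable M"
  by (rule measurable_compose[OF _ borel_measurable_continuous_onI]) (auto intro: continuous_intros)

lemma L2_inner_CS: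
  assumes f: "f \<in> L2_Omega" and g: "g \<in> L2_Omega"
  shows "integrable M\<Omega> (\<lambda>z. f z * cnj (g z))" "norm (L2_inner f g) \<le> sqrt (n2 f) * sqrt (n2 g)"
proof -
  have fm [measurable]: "f \<in> borel_measurable M\<Omega>" and gm [measurable]: "g \<in> borel_measurable M\<Omega>"
    using assms L2_measurable by auto
  have cm [measurable]: "(\<lambda>z. cnj (g z)) \<in> borel_measurable M\<Omega>" by (rule cnj_meas) measurable
  have fi: "integrable M\<Omega> (\<lambda>z. (norm (f z))\<^sup>2)" and gi: "integrable M\<Omega> (\<lambda>z. (norm (g z))\<^sup>2)"
    using assms L2_integrable by auto
  have am: "norm (f z) * norm (g z) \<le> (norm (f z))\<^sup>2 + (norm (g z))\<^sup>2" for z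
  proof -
    have "0 \<le> norm (f z) * norm (g z)" by simp
    then show ?thesis using sum_squares_bound[of "norm (f z)" "norm (g z)"] unfolding mult.assoc by linarith
  qed
  have ii: "integrable M\<Omega> (\<lambda>z. norm (f z) * norm (g z))"
  proof (rule Bochner_Integration.integrable_bound[OF Bochner_Integration.integrable_add[OF fi gi]])
    show "AE z in M\<Omega>. norm (norm (f z) * norm (g z)) \<le> norm ((norm (f z))\<^sup>2 + (norm (g z))\<^sup>2)"
      using am by (intro AE_I2) (simp add: abs_mult)
  qed measurable
  show "integrable M\<Omega> (\<lambda>z. f z * cnj (g z))"
    by (rule Bochner_Integration.integrable_bound[OF ii]) (auto simp: norm_mult)
  define I where "I = (LINT z|M\<Omega>. norm (f z) * norm (g z))"
  have le: "norm (L2_inner f g) \<le> I" unfolding L2_inner_def I_def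
    by (rule order_trans[OF integral_norm_bound]) (simp add: norm_mult)
  have I0: "I \<ge> 0" by (simp add: I_def)
  have quad: "0 \<le> n2 f - 2 * t * I + t\<^sup>2 * n2 g" for t
  proof -
    have "0 \<le> (LINT z|M\<Omega>. (norm (f z) - t * norm (g z))\<^sup>2)" by simp
    also have "(\<lambda>z. (norm (f z) - t * norm (g z))\<^sup>2) = (\<lambda>z. (norm (f z))\<^sup>2 - 2 * t * (norm (f z) * norm (g z)) + t\<^sup>2 * (norm (g z))\<^sup>2)"
      by (auto simp: power2_eq_square algebra_simps)
    also have "(LINT z|M\<Omega>. (norm (f z))\<^sup>2 - 2 * t * (norm (f z) * norm (g z)) + t\<^sup>2 * (norm (g z))\<^sup>2) = n2 f - 2 * t * I + t\<^sup>2 * n2 g"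
      using fi gi ii by (simp add: n2_def I_def)
    finally show ?thesis .
  qed
  have "I\<^sup>2 \<le> n2 f * n2 g"
  proof (cases "n2 g = 0")
    case True
    have "I = 0"
    proof (rule ccontr)
      assume "I \<noteq> 0"
      then have Ip: "I > 0" using I0 by simp
      have "0 \<le> n2 f - 2 * ((n2 f + 1) / I) * I" using quad[of "(n2 f + 1) / I"] True by simp
      then show False using Ip n2_nonneg[of f] by simp
    qed
    then show ?thesis using True by simp
  next
    case False
    then have gp: "n2 g > 0" using n2_nonneg[of g] by simp
    have "0 \<le> (n2 f - 2 * (I / n2 g) * I + (I / n2 g)\<^sup>2 * n2 g) * n2 g" using quad[of "I / n2 g"] gp by simp
    also have "\<dots> = n2 f * n2 g - I\<^sup>2" using gp by (simp add: field_simps power2_eq_square)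
    finally show ?thesis by simp
  qed
  then have "I \<le> sqrt (n2 f * n2 g)" using real_le_rsqrt by blast
  then show "norm (L2_inner f g) \<le> sqrt (n2 f) * sqrt (n2 g)" using le by (simp add: real_sqrt_mult)
qed

lemma L2_inner_add_left:
  assumes "f \<in> L2_Omega" "f' \<in> L2_Omega" "g \<in> L2_Omega"
  shows "L2_inner (\<lambda>z. f z + f' z) g = L2_inner f g + L2_inner f' g"
  unfolding L2_inner_def distrib_right
  by (rule Bochner_Integration.integral_add) (intro L2_inner_CS assms)+

lemma L2_inner_cmult_left: "L2_inner (\<lambda>z. c * f z) g = c * L2_inner f g"
  unfolding L2_inner_def mult.assoc by (rule integral_mult_right_zero)

lemma L2_inner_cnj: "cnj (L2_inner f g) = L2_inner g f"
  unfolding L2_inner_def by (subst Bochner_Integration.integral_cnj[symmetric]) (simp add: mult.commute)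

lemma L2_inner_diff_left:
  assumes "f \<in> L2_Omega" "f' \<in> L2_Omega" "g \<in> L2_Omega"
  shows "L2_inner (\<lambda>z. f z - f' z) g = L2_inner f g - L2_inner f' g"
  unfolding L2_inner_def left_diff_distrib
  by (rule Bochner_Integration.integral_diff) (intro L2_inner_CS assms)+

lemma L2_inner_tendsto_left:
  assumes fn: "\<And>n. fn n \<in> L2_Omega" and f: "f \<in> L2_Omega" and g: "g \<in> L2_Omega"
    and lim: "(\<lambda>n. Lr_norm 2 (\<lambda>z. fn n z - f z)) \<longlonglongrightarrow> 0"
  shows "(\<lambda>n. L2_inner (fn n) g) \<longlonglongrightarrow> L2_inner f g"
proof -
  have d: "(\<lambda>z. fn n z - f z) \<in> L2_Omega" for n by (intro L2_diff fn f)
  have "(\<lambda>n. ennreal (sqrt (n2 (\<lambda>z. fn n z - f z)))) \<longlonglongrightarrow> 0" using lim by (simp only: Lr2_n2[OF d])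
  then have "(\<lambda>n. sqrt (n2 (\<lambda>z. fn n z - f z))) \<longlonglongrightarrow> 0" by (subst (asm) ennreal_tendsto_0_iff) (auto simp: n2_nonneg)
  then have "(\<lambda>n. sqrt (n2 (\<lambda>z. fn n z - f z)) * sqrt (n2 g)) \<longlonglongrightarrow> 0" by (rule tendsto_mult_left_zero)
  then have "(\<lambda>n. L2_inner (fn n) g - L2_inner f g) \<longlonglongrightarrow> 0"
    by (rule tendsto_0_le[where K = 1])
       (auto simp: L2_inner_diff_left[OF fn f g, symmetric] n2_nonneg intro!: always_eventually L2_inner_CS(2)[OF d g])
  then show ?thesis by (simp add: LIM_zero_iff)
qed

lemma L2_inner_tendsto_right:
  assumes fn: "\<And>n. fn n \<in> L2_Omega" and f: "f \<in> L2_Omega" and g: "g \<in> L2_Omega"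
    and lim: "(\<lambda>n. Lr_norm 2 (\<lambda>z. fn n z - f z)) \<longlonglongrightarrow> 0"
  shows "(\<lambda>n. L2_inner g (fn n)) \<longlonglongrightarrow> L2_inner g f"
  using tendsto_cnj[OF L2_inner_tendsto_left[OF assms]] by (simp add: L2_inner_cnj)

section \<open>Partial derivatives and integration by parts\<close>

lemma smooth_dx: "smooth f \<Longrightarrow> smooth (dx f)" and smooth_dy: "smooth f \<Longrightarrow> smooth (dy f)"
  unfolding dx_def[abs_def] dy_def[abs_def] by (rule smooth_derivative, assumption)+

lemma smooth_has_partials:
  assumes "smooth f"
  shows "(f has_derivative (\<lambda>v. fst v *\<^sub>R dx f z + snd v *\<^sub>R dy f z)) (at z)"
proof -
  let ?D = "frechet_derivative f (at z)"
  have d: "(f has_derivative ?D) (at z)" by (rule smooth_has_derivative[OF assms])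
  interpret D: linear ?D by (rule has_derivative_linear[OF d])
  have "?D v = fst v *\<^sub>R dx f z + snd v *\<^sub>R dy f z" for v
  proof -
    have "v = fst v *\<^sub>R (1, 0) + snd v *\<^sub>R (0, 1)" by (cases v) simp
    then have "?D v = ?D (fst v *\<^sub>R (1, 0) + snd v *\<^sub>R (0, 1))" by simp
    then show ?thesis by (simp only: D.add D.scaleR dx_def dy_def)
  qed
  then have "?D = (\<lambda>v. fst v *\<^sub>R dx f z + snd v *\<^sub>R dy f z)" by blast
  then show ?thesis using d by simp
qed

lemma partials_unique:
  assumes "(f has_derivative (\<lambda>v. fst v *\<^sub>R a + snd v *\<^sub>R b)) (at z)"
  shows "dx f z = a" "dy f z = b"
proof -
  have "frechet_derivative f (at z) = (\<lambda>v. fst v *\<^sub>R a + snd v *\<^sub>R b)"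
    using frechet_derivative_at[OF assms] by simp
  then show "dx f z = a" "dy f z = b" by (simp_all add: dx_def dy_def)
qed

lemma partials_vector:
  assumes "smooth f"
  shows "((\<lambda>x. f (x, y)) has_vector_derivative dx f (x, y)) (at x)"
    "((\<lambda>y. f (x, y)) has_vector_derivative dy f (x, y)) (at y)"
proof -
  have 1: "((\<lambda>x. (x, y)) has_derivative (\<lambda>t. (t, 0))) (at x)" by (auto intro!: derivative_eq_intros)
  have 2: "((\<lambda>y. (x, y)) has_derivative (\<lambda>t. (0, t))) (at y)" by (auto intro!: derivative_eq_intros)
  show "((\<lambda>x. f (x, y)) has_vector_derivative dx f (x, y)) (at x)"
    using has_derivative_compose[OF 1 smooth_has_partials[OF assms]] by (simp add: has_vector_derivative_def)
  show "((\<lambda>y. f (x, y)) has_vector_derivative dy f (x, y)) (at y)"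
    using has_derivative_compose[OF 2 smooth_has_partials[OF assms]] by (simp add: has_vector_derivative_def)
qed

lemma partials_mult:
  assumes "smooth f" "smooth g"
  shows "dx (\<lambda>z. f z * g z) z = f z * dx g z + dx f z * g z"
    "dy (\<lambda>z. f z * g z) z = f z * dy g z + dy f z * g z"
proof -
  have "((\<lambda>z. f z * g z) has_derivative (\<lambda>v. fst v *\<^sub>R (f z * dx g z + dx f z * g z) + snd v *\<^sub>R (f z * dy g z + dy f z * g z))) (at z)"
    by (rule has_derivative_eq_rhs, rule has_derivative_mult[OF smooth_has_partials[OF assms(1)] smooth_has_partials[OF assms(2)]])
       (auto simp: algebra_simps)
  then show "dx (\<lambda>z. f z * g z) z = f z * dx g z + dx f z * g z"
    "dy (\<lambda>z. f z * g z) z = f z * dy g z + dy f z * g z" using partials_unique by blast+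
qed

lemma partials_cnj:
  assumes "smooth f"
  shows "dx (\<lambda>z. cnj (f z)) z = cnj (dx f z)" "dy (\<lambda>z. cnj (f z)) z = cnj (dy f z)"
proof -
  have "((\<lambda>z. cnj (f z)) has_derivative (\<lambda>v. fst v *\<^sub>R cnj (dx f z) + snd v *\<^sub>R cnj (dy f z))) (at z)"
    by (rule has_derivative_eq_rhs, rule bounded_linear.has_derivative[OF bounded_linear_cnj smooth_has_partials[OF assms]])
       (auto simp: scaleR_conv_of_real)
  then show "dx (\<lambda>z. cnj (f z)) z = cnj (dx f z)" "dy (\<lambda>z. cnj (f z)) z = cnj (dy f z)" using partials_unique by blast+
qed

lemma smooth_cnj: "smooth f \<Longrightarrow> smooth (\<lambda>z. cnj (f z))"
  by (rule smooth_bounded_linear[OF bounded_linear_cnj])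

lemma smooth_fst: "smooth (\<lambda>z::real \<times> real. complex_of_real (1 + fst z))"
  by (rule smooth_bounded_linear[OF bounded_linear_of_real smooth_add[OF smooth_const smooth_linear[OF bounded_linear_fst]]])

lemma partials_fst: "dx (\<lambda>z::real \<times> real. complex_of_real (1 + fst z)) z = 1" "dy (\<lambda>z::real \<times> real. complex_of_real (1 + fst z)) z = 0"
proof -
  have "((\<lambda>z::real \<times> real. complex_of_real (1 + fst z)) has_derivative (\<lambda>v. fst v *\<^sub>R 1 + snd v *\<^sub>R 0)) (at z)"
    by (auto intro!: derivative_eq_intros simp: scaleR_conv_of_real)
  then show "dx (\<lambda>z::real \<times> real. complex_of_real (1 + fst z)) z = 1" "dy (\<lambda>z::real \<times> real. complex_of_real (1 + fst z)) z = 0"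
    using partials_unique by blast+
qed

lemma partials_zero_off:
  assumes "\<And>z. z \<notin> K \<Longrightarrow> f z = 0" "closed K" "z \<notin> K"
  shows "dx f z = 0" "dy f z = 0"
proof -
  have "(f has_derivative (\<lambda>v. fst v *\<^sub>R 0 + snd v *\<^sub>R 0)) (at z)"
    by (rule has_derivative_transform_within_open[of "\<lambda>_. 0" _ z UNIV "- K"]) (use assms in auto)
  then show "dx f z = 0" "dy f z = 0" using partials_unique by blast+
qed

lemma Omega2_open: "open Omega2"
proof -
  have "Omega2 = {z. 0 < fst z}" by (auto simp: Omega2_def)
  moreover have "open {z::real \<times> real. 0 < fst z}" by (intro open_Collect_less continuous_intros)
  ultimately show ?thesis by simp
qed

lemma Omega2_sets [measurable]: "Omega2 \<in> sets borel" using Omega2_open by simp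

lemma space_M\<Omega>: "space M\<Omega> = Omega2" by (simp add: M\<Omega>_def space_restrict_space)

lemma measurable_M\<Omega>: "f \<in> borel_measurable borel \<Longrightarrow> f \<in> borel_measurable M\<Omega>"
  unfolding M\<Omega>_def by (rule measurable_restrict_space1) simp

lemma continuous_M\<Omega>: "continuous_on UNIV f \<Longrightarrow> f \<in> borel_measurable M\<Omega>"
  by (intro measurable_M\<Omega> borel_measurable_continuous_onI)

lemma compact_support_integrable2:
  fixes G :: "real \<times> real \<Rightarrow> 'b::{banach, second_countable_topology}"
  assumes "continuous_on UNIV G" "compact K" "\<And>z. z \<notin> K \<Longrightarrow> G z = 0"
  shows "integrable lborel G"
proof -
  have "integrable lborel (\<lambda>x. indicator K x *\<^sub>R G x)"
    by (intro borel_integrable_compact assms continuous_on_subset[OF assms(1)]) auto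
  moreover have "(\<lambda>x. indicator K x *\<^sub>R G x) = G" using assms(3) by (auto simp: indicator_def)
  ultimately show ?thesis by simp
qed

lemma compact_support_M\<Omega>:
  fixes G :: "real \<times> real \<Rightarrow> 'b::{banach, second_countable_topology}"
  assumes "continuous_on UNIV G" "compact K" "\<And>z. z \<notin> K \<Longrightarrow> G z = 0"
  shows "integrable M\<Omega> G"
  unfolding M\<Omega>_def
proof (subst integrable_restrict_space)
  show "Omega2 \<inter> space lborel \<in> sets lborel" by simp
  have i: "integrable lborel G" by (rule compact_support_integrable2[OF assms])
  show "integrable lborel (\<lambda>x. indicator Omega2 x *\<^sub>R G x)"
    by (rule Bochner_Integration.integrable_bound[OF i]) (use i in \<open>auto intro!: AE_I2 simp: indicator_def\<close>)
qed

lemma M\<Omega>_integral_eq: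
  fixes G :: "real \<times> real \<Rightarrow> complex"
  assumes "\<And>z. z \<notin> Omega2 \<Longrightarrow> G z = 0"
  shows "(LINT z|M\<Omega>. G z) = (LINT z|lborel. G z)"
proof -
  have "(\<lambda>x. indicator Omega2 x *\<^sub>R G x) = G" using assms by (auto simp: indicator_def)
  then show ?thesis unfolding M\<Omega>_def by (subst integral_restrict_space) auto
qed

text \<open>Integrate first in the direction of the derivative and use the fundamental theorem of calculus.\<close>

lemma integral_partials_zero:
  assumes F: "smooth F" and K: "compact K" "\<And>z. z \<notin> K \<Longrightarrow> F z = 0"
  shows "(LINT z|lborel. dx F z) = 0" "(LINT z|lborel. dy F z) = 0"
proof -
  have off: "dx F z = 0" "dy F z = 0" if "z \<notin> K" for z
    using partials_zero_off[OF K(2) compact_imp_closed[OF K(1)] that] by auto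
  have ix: "integrable lborel (dx F)" and iy: "integrable lborel (dy F)"
    by (rule compact_support_integrable2[OF smooth_continuous K(1)], use F off smooth_dx smooth_dy in auto)+
  obtain R0 where R0: "\<And>z. z \<in> K \<Longrightarrow> norm z \<le> R0" using compact_imp_bounded[OF K(1)] bounded_iff by blast
  define R where "R = \<bar>R0\<bar> + 1"
  have out: "(x, y) \<notin> K" if "\<bar>x\<bar> \<ge> R \<or> \<bar>y\<bar> \<ge> R" for x y
    using R0[of "(x, y)"] norm_fst_le[of x y] norm_snd_le[of y x] that by (auto simp: R_def)
  have zx: "(LINT x|lborel. dx F (x, y)) = 0" for y
  proof -
    have "has_bochner_integral lborel (\<lambda>x. indicator {-R..R} x *\<^sub>R dx F (x, y)) (F (R, y) - F (-R, y))"
    proof (rule has_bochner_integral_FTC_Icc)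
      show "continuous_on {-R..R} (\<lambda>x. dx F (x, y))"
        by (rule continuous_on_compose2[OF smooth_continuous[OF smooth_dx[OF F], of UNIV]]) (auto intro: continuous_intros)
    qed (auto simp: R_def intro!: has_vector_derivative_at_within partials_vector F)
    moreover have "(\<lambda>x. indicator {-R..R} x *\<^sub>R dx F (x, y)) = (\<lambda>x. dx F (x, y))"
    proof
      fix x show "indicator {-R..R} x *\<^sub>R dx F (x, y) = dx F (x, y)"
        using off(1)[OF out[of x y]] by (cases "x \<in> {-R..R}") (auto simp: abs_real_def split: if_splits)
    qed
    ultimately show ?thesis using K(2)[OF out[of R y]] K(2)[OF out[of "-R" y]]
      by (simp add: has_bochner_integral_integral_eq R_def)
  qed
  have zy: "(LINT y|lborel. dy F (x, y)) = 0" for x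
  proof -
    have "has_bochner_integral lborel (\<lambda>y. indicator {-R..R} y *\<^sub>R dy F (x, y)) (F (x, R) - F (x, -R))"
    proof (rule has_bochner_integral_FTC_Icc)
      show "continuous_on {-R..R} (\<lambda>y. dy F (x, y))"
        by (rule continuous_on_compose2[OF smooth_continuous[OF smooth_dy[OF F], of UNIV]]) (auto intro: continuous_intros)
    qed (auto simp: R_def intro!: has_vector_derivative_at_within partials_vector F)
    moreover have "(\<lambda>y. indicator {-R..R} y *\<^sub>R dy F (x, y)) = (\<lambda>y. dy F (x, y))"
    proof
      fix y show "indicator {-R..R} y *\<^sub>R dy F (x, y) = dy F (x, y)"
        using off(2)[OF out[of x y]] by (cases "y \<in> {-R..R}") (auto simp: abs_real_def split: if_splits)
    qed
    ultimately show ?thesis using K(2)[OF out[of x R]] K(2)[OF out[of x "-R"]]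
      by (simp add: has_bochner_integral_integral_eq R_def)
  qed
  have "(LINT z|lborel. dx F z) = (LINT z|(lborel \<Otimes>\<^sub>M lborel). dx F z)" by (simp add: lborel_prod)
  also have "\<dots> = (LINT y|lborel. LINT x|lborel. dx F (x, y))"
    using lborel_pair.integral_snd[of "\<lambda>x y. dx F (x, y)"] ix by (simp add: lborel_prod)
  finally show "(LINT z|lborel. dx F z) = 0" by (simp add: zx)
  have "(LINT z|lborel. dy F z) = (LINT z|(lborel \<Otimes>\<^sub>M lborel). dy F z)" by (simp add: lborel_prod)
  also have "\<dots> = (LINT x|lborel. LINT y|lborel. dy F (x, y))"
    using lborel_pair.integral_fst[of "\<lambda>x y. dy F (x, y)"] iy by (simp add: lborel_prod)
  finally show "(LINT z|lborel. dy F z) = 0" by (simp add: zy)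
qed

lemma test_function_support:
  assumes "\<phi> \<in> Cc_infinity Omega2"
  obtains K where "compact K" "K \<subseteq> Omega2" "\<And>z. z \<notin> K \<Longrightarrow> \<phi> z = 0" "\<And>z. z \<notin> K \<Longrightarrow> dx \<phi> z = 0"
    "\<And>z. z \<notin> K \<Longrightarrow> dy \<phi> z = 0" "smooth \<phi>"
proof -
  let ?K = "closure {z. \<phi> z \<noteq> 0}"
  have s: "smooth \<phi>" "compact ?K" "?K \<subseteq> Omega2" using assms by (auto simp: Cc_infinity_def)
  have z: "\<phi> z = 0" if "z \<notin> ?K" for z using closure_subset[of "{z. \<phi> z \<noteq> 0}"] that by auto
  show ?thesis
  proof (rule that[OF s(2,3)])
    show "\<phi> z = 0" "dx \<phi> z = 0" "dy \<phi> z = 0" if "z \<notin> ?K" for z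
      using z partials_zero_off[of ?K \<phi> z] compact_imp_closed[OF s(2)] that by blast+
  qed (rule s(1))
qed

lemma compact_support_L2:
  assumes "continuous_on UNIV G" "compact K" "\<And>z. z \<notin> K \<Longrightarrow> G z = 0"
  shows "G \<in> L2_Omega"
  unfolding L2_Omega_iff
  by (intro conjI continuous_M\<Omega> assms(1) compact_support_M\<Omega>[OF _ assms(2)])
     (use assms(3) in \<open>auto intro!: continuous_intros assms(1)\<close>)

text \<open>The second component of the form associated with \<open>- Friedlander\<close>.\<close>

abbreviation wdy :: "(real \<times> real \<Rightarrow> complex) \<Rightarrow> real \<times> real \<Rightarrow> complex" where
  "wdy f \<equiv> (\<lambda>z. of_real (sqrt (1 + fst z)) * dy f z)"

lemma continuous_wdy: "smooth f \<Longrightarrow> continuous_on UNIV (wdy f)"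
  using smooth_continuous[OF smooth_dy, of f UNIV] by (intro continuous_intros) auto

lemma continuous_Friedlander: "smooth f \<Longrightarrow> continuous_on UNIV (Friedlander f)"
  unfolding Friedlander_def[abs_def]
  using smooth_continuous[OF smooth_dy[OF smooth_dy], of f UNIV] smooth_continuous[OF smooth_dx[OF smooth_dx], of f UNIV]
  by (intro continuous_intros) auto

lemma test_function_L2:
  assumes "\<phi> \<in> Cc_infinity Omega2"
  shows "\<phi> \<in> L2_Omega" "dx \<phi> \<in> L2_Omega" "wdy \<phi> \<in> L2_Omega" "Friedlander \<phi> \<in> L2_Omega"
proof -
  obtain K where K: "compact K" "K \<subseteq> Omega2" "\<And>z. z \<notin> K \<Longrightarrow> \<phi> z = 0" "\<And>z. z \<notin> K \<Longrightarrow> dx \<phi> z = 0"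
    "\<And>z. z \<notin> K \<Longrightarrow> dy \<phi> z = 0" and s: "smooth \<phi>" using test_function_support[OF assms] by metis
  have d: "dx (dx \<phi>) z = 0" "dy (dy \<phi>) z = 0" if "z \<notin> K" for z
    using partials_zero_off[OF K(4) compact_imp_closed[OF K(1)] that] partials_zero_off[OF K(5) compact_imp_closed[OF K(1)] that] by auto
  show "\<phi> \<in> L2_Omega" by (rule compact_support_L2[OF smooth_continuous[OF s] K(1,3)])
  show "dx \<phi> \<in> L2_Omega" by (rule compact_support_L2[OF smooth_continuous[OF smooth_dx[OF s]] K(1,4)])
  show "wdy \<phi> \<in> L2_Omega" by (rule compact_support_L2[OF continuous_wdy[OF s] K(1)]) (simp add: K)
  show "Friedlander \<phi> \<in> L2_Omega" by (rule compact_support_L2[OF continuous_Friedlander[OF s] K(1)]) (simp add: Friedlander_def d)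
qed

text \<open>The test function keeps all integrands compactly supported inside the half plane, so each side of the identity differs from the
other by the integral of a total derivative.\<close>

lemma integration_by_parts:
  assumes f: "smooth f" and phi: "\<phi> \<in> Cc_infinity Omega2"
  shows "L2_inner (\<lambda>z. - Friedlander f z) \<phi> = L2_inner (dx f) (dx \<phi>) + L2_inner (wdy f) (wdy \<phi>)"
proof -
  obtain K where K: "compact K" "K \<subseteq> Omega2" "\<And>z. z \<notin> K \<Longrightarrow> \<phi> z = 0" "\<And>z. z \<notin> K \<Longrightarrow> dx \<phi> z = 0"
    "\<And>z. z \<notin> K \<Longrightarrow> dy \<phi> z = 0" and s: "smooth \<phi>" using test_function_support[OF phi] by metis
  note sm = smooth_dx[OF f] smooth_dy[OF f] smooth_cnj[OF s] smooth_fst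
  define P where "P = (\<lambda>z. dx f z * cnj (\<phi> z))"
  define Q where "Q = (\<lambda>z. of_real (1 + fst z) * (dy f z * cnj (\<phi> z)))"
  have sP: "smooth P" and sQ: "smooth Q" unfolding P_def Q_def by (intro smooth_mult sm)+
  have PK: "P z = 0" "Q z = 0" if "z \<notin> K" for z using K(3)[OF that] by (auto simp: P_def Q_def)
  have dP: "dx P z = dx f z * cnj (dx \<phi> z) + dx (dx f) z * cnj (\<phi> z)" for z
    unfolding P_def by (simp add: partials_mult[OF sm(1,3)] partials_cnj[OF s])
  have dQ: "dy Q z = of_real (1 + fst z) * (dy f z * cnj (dy \<phi> z) + dy (dy f) z * cnj (\<phi> z))" for z
    unfolding Q_def by (simp only: partials_mult[OF sm(4) smooth_mult[OF sm(2,3)]] partials_mult[OF sm(2,3)] partials_cnj[OF s] partials_fst) simp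
  note off = partials_zero_off[OF _ compact_imp_closed[OF K(1)]]
  have iP: "(LINT z|M\<Omega>. dx P z) = 0"
  proof (subst M\<Omega>_integral_eq)
    show "dx P z = 0" if "z \<notin> Omega2" for z using off(1)[of P z] PK(1) K(2) that by blast
    show "(LINT z|lborel. dx P z) = 0" using integral_partials_zero(1)[OF sP K(1)] PK(1) by blast
  qed
  have iQ: "(LINT z|M\<Omega>. dy Q z) = 0"
  proof (subst M\<Omega>_integral_eq)
    show "dy Q z = 0" if "z \<notin> Omega2" for z using off(2)[of Q z] PK(2) K(2) that by blast
    show "(LINT z|lborel. dy Q z) = 0" using integral_partials_zero(2)[OF sQ K(1)] PK(2) by blast
  qed
  have a: "integrable M\<Omega> (\<lambda>z. dx f z * cnj (dx \<phi> z))"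
    using smooth_continuous[OF smooth_dx[OF f], of UNIV] smooth_continuous[OF smooth_dx[OF s], of UNIV]
    by (intro compact_support_M\<Omega>[OF _ K(1)] continuous_intros) (auto simp: K)
  have b: "integrable M\<Omega> (\<lambda>z. wdy f z * cnj (wdy \<phi> z))"
    using smooth_continuous[OF smooth_dy[OF f], of UNIV] smooth_continuous[OF smooth_dy[OF s], of UNIV]
    by (intro compact_support_M\<Omega>[OF _ K(1)] continuous_intros) (auto simp: K)
  have c: "integrable M\<Omega> (dx P)" "integrable M\<Omega> (dy Q)"
  proof -
    show "integrable M\<Omega> (dx P)"
      by (rule compact_support_M\<Omega>[OF smooth_continuous[OF smooth_dx[OF sP]] K(1)]) (use off(1)[of P] PK(1) in blast)
    show "integrable M\<Omega> (dy Q)"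
      by (rule compact_support_M\<Omega>[OF smooth_continuous[OF smooth_dy[OF sQ]] K(1)]) (use off(2)[of Q] PK(2) in blast)
  qed
  have "L2_inner (\<lambda>z. - Friedlander f z) \<phi> = (LINT z|M\<Omega>. dx f z * cnj (dx \<phi> z) + wdy f z * cnj (wdy \<phi> z) - dx P z - dy Q z)"
    unfolding L2_inner_def
  proof (rule Bochner_Integration.integral_cong[OF refl])
    fix z assume "z \<in> space M\<Omega>"
    then have "fst z > 0" by (auto simp: space_M\<Omega> Omega2_def)
    then have "complex_of_real (sqrt (1 + fst z)) * of_real (sqrt (1 + fst z)) = of_real (1 + fst z)"
      by (simp flip: of_real_mult)
    then have "wdy f z * cnj (wdy \<phi> z) = of_real (1 + fst z) * (dy f z * cnj (dy \<phi> z))"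
      by (simp add: mult_ac)
    then show "- Friedlander f z * cnj (\<phi> z) = dx f z * cnj (dx \<phi> z) + wdy f z * cnj (wdy \<phi> z) - dx P z - dy Q z"
      by (simp only: dP dQ Friedlander_def) (simp add: algebra_simps)
  qed
  also have "\<dots> = L2_inner (dx f) (dx \<phi>) + L2_inner (wdy f) (wdy \<phi>)"
    using a b c iP iQ by (simp add: L2_inner_def)
  finally show ?thesis .
qed

section \<open>Green identity against the operator domain\<close>

lemma Lr2_tendsto_0:
  assumes "\<And>n. g n \<in> L2_Omega" "(\<lambda>n. n2 (g n)) \<longlonglongrightarrow> 0"
  shows "(\<lambda>n. Lr_norm 2 (g n)) \<longlonglongrightarrow> 0"
proof -
  have "(\<lambda>n. sqrt (n2 (g n))) \<longlonglongrightarrow> 0" using tendsto_real_sqrt[OF assms(2)] by simp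
  then have "(\<lambda>n. ennreal (sqrt (n2 (g n)))) \<longlonglongrightarrow> ennreal 0" by (rule tendsto_ennrealI)
  then show ?thesis by (simp add: Lr2_n2[OF assms(1)])
qed

lemma n2_mono:
  assumes "f \<in> borel_measurable M\<Omega>" "g \<in> L2_Omega" "\<And>z. z \<in> Omega2 \<Longrightarrow> norm (f z) \<le> norm (g z)"
  shows "f \<in> L2_Omega" "n2 f \<le> n2 g"
proof -
  have [measurable]: "f \<in> borel_measurable M\<Omega>" by fact
  have le: "(norm (f z))\<^sup>2 \<le> (norm (g z))\<^sup>2" if "z \<in> space M\<Omega>" for z
    using assms(3)[of z] that by (intro power_mono) (auto simp: space_M\<Omega>)
  have i: "integrable M\<Omega> (\<lambda>z. (norm (f z))\<^sup>2)"
    by (rule Bochner_Integration.integrable_bound[OF L2_integrable[OF assms(2)]]) (use le in \<open>auto intro!: AE_I2\<close>)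
  then show "f \<in> L2_Omega" by (simp add: L2_Omega_iff assms(1))
  show "n2 f \<le> n2 g" unfolding n2_def by (rule integral_mono[OF i L2_integrable[OF assms(2)] le])
qed

lemma multiplier_L2:
  assumes k: "continuous_on UNIV k" and b: "\<And>z. \<bar>k z\<bar> \<le> c" and g: "g \<in> L2_Omega"
  shows "(\<lambda>z. complex_of_real (k z) * g z) \<in> L2_Omega" "n2 (\<lambda>z. complex_of_real (k z) * g z) \<le> c\<^sup>2 * n2 g"
proof -
  have m: "(\<lambda>z. complex_of_real (k z) * g z) \<in> borel_measurable M\<Omega>"
    by (intro borel_measurable_times L2_measurable g continuous_M\<Omega> continuous_intros k)
  have cg: "(\<lambda>z. complex_of_real c * g z) \<in> L2_Omega" by (rule L2_cmult(1)[OF g])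
  have bb: "norm (complex_of_real (k z) * g z) \<le> norm (complex_of_real c * g z)" for z
    using b[of z] by (auto simp: norm_mult intro!: mult_right_mono)
  show "(\<lambda>z. complex_of_real (k z) * g z) \<in> L2_Omega" by (rule n2_mono(1)[OF m cg bb])
  show "n2 (\<lambda>z. complex_of_real (k z) * g z) \<le> c\<^sup>2 * n2 g"
    using n2_mono(2)[OF m cg bb] by (simp add: L2_cmult(2))
qed

text \<open>Dominated convergence.\<close>

lemma cutoff_L2_tendsto:
  assumes k: "\<And>n. continuous_on UNIV (k n)" and b: "\<And>n z. \<bar>k n z\<bar> \<le> c"
    and lim: "\<And>z. z \<in> Omega2 \<Longrightarrow> (\<lambda>n. k n z) \<longlonglongrightarrow> 1" and g: "g \<in> L2_Omega"
  shows "(\<lambda>n. n2 (\<lambda>z. complex_of_real (k n z - 1) * g z)) \<longlonglongrightarrow> 0"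
proof -
  have [measurable]: "g \<in> borel_measurable M\<Omega>" by (rule L2_measurable[OF g])
  have [measurable]: "(\<lambda>z. complex_of_real (k n z - 1)) \<in> borel_measurable M\<Omega>" for n
    by (intro continuous_M\<Omega> continuous_intros k)
  have "(\<lambda>n. LINT z|M\<Omega>. (norm (complex_of_real (k n z - 1) * g z))\<^sup>2) \<longlonglongrightarrow> (LINT z|M\<Omega>. 0)"
  proof (rule integral_dominated_convergence[where w = "\<lambda>z. (c + 1)\<^sup>2 * (norm (g z))\<^sup>2"])
    show "integrable M\<Omega> (\<lambda>z. (c + 1)\<^sup>2 * (norm (g z))\<^sup>2)" by (intro integrable_mult_right L2_integrable g)
    show "AE z in M\<Omega>. (\<lambda>n. (norm (complex_of_real (k n z - 1) * g z))\<^sup>2) \<longlonglongrightarrow> 0"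
    proof (rule AE_I2)
      fix z assume "z \<in> space M\<Omega>"
      then have "(\<lambda>n. k n z) \<longlonglongrightarrow> 1" by (intro lim) (simp add: space_M\<Omega>)
      then have "(\<lambda>n. (norm (complex_of_real (k n z - 1) * g z))\<^sup>2) \<longlonglongrightarrow> (norm (complex_of_real (1 - 1) * g z))\<^sup>2"
        by (intro tendsto_intros)
      then show "(\<lambda>n. (norm (complex_of_real (k n z - 1) * g z))\<^sup>2) \<longlonglongrightarrow> 0" by simp
    qed
    show "AE z in M\<Omega>. norm ((norm (complex_of_real (k n z - 1) * g z))\<^sup>2) \<le> (c + 1)\<^sup>2 * (norm (g z))\<^sup>2" for n
    proof (rule AE_I2)
      fix z
      have "\<bar>k n z - 1\<bar> \<le> c + 1" using b[of n z] by linarith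
      then have "(norm (complex_of_real (k n z - 1)))\<^sup>2 \<le> (c + 1)\<^sup>2"
        by (simp only: norm_of_real) (intro power_mono; simp)
      then have "(norm (complex_of_real (k n z - 1)))\<^sup>2 * (norm (g z))\<^sup>2 \<le> (c + 1)\<^sup>2 * (norm (g z))\<^sup>2"
        by (intro mult_right_mono) auto
      then show "norm ((norm (complex_of_real (k n z - 1) * g z))\<^sup>2) \<le> (c + 1)\<^sup>2 * (norm (g z))\<^sup>2"
        by (simp only: norm_mult power_mult_distrib) simp
    qed
  qed measurable
  then show ?thesis by (simp add: n2_def)
qed

text \<open>Equal to \<open>1\<close> on \<open>1/N \<le> x \<le> N\<close>, \<open>\<bar>y\<bar> \<le> N\<close> and vanishing outside \<open>1/(2N) \<le> x \<le> 2N\<close>, \<open>\<bar>y\<bar> \<le> 2N\<close>, for a step function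
\<open>s\<close> that rises from \<open>0\<close> to \<open>1\<close> between \<open>1/2\<close> and \<open>1\<close>. The summand \<open>+ 0\<close> gives all four factors the same affine form.\<close>

definition cutoff :: "(real \<Rightarrow> real) \<Rightarrow> real \<Rightarrow> real \<times> real \<Rightarrow> real" where
  "cutoff s N z = (s (N * fst z + 0) * s (- 1 / N * fst z + 2)) * (s (- 1 / N * snd z + 2) * s (1 / N * snd z + 2))"

lemma has_derivative_step:
  assumes "smooth (s :: real \<Rightarrow> real)"
  shows "((\<lambda>z::real \<times> real. s (a * fst z + c)) has_derivative (\<lambda>v. fst v *\<^sub>R (a * frechet_derivative s (at (a * fst z + c)) 1) + snd v *\<^sub>R 0)) (at z)"
    "((\<lambda>z::real \<times> real. s (a * snd z + c)) has_derivative (\<lambda>v. fst v *\<^sub>R 0 + snd v *\<^sub>R (a * frechet_derivative s (at (a * snd z + c)) 1))) (at z)"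
proof -
  have 1: "((\<lambda>z::real \<times> real. a * fst z + c) has_derivative (\<lambda>v. a * fst v)) (at z)"
    by (auto intro!: derivative_eq_intros)
  have 2: "((\<lambda>z::real \<times> real. a * snd z + c) has_derivative (\<lambda>v. a * snd v)) (at z)"
    by (auto intro!: derivative_eq_intros)
  note d = smooth_has_derivative[OF assms]
  show "((\<lambda>z::real \<times> real. s (a * fst z + c)) has_derivative (\<lambda>v. fst v *\<^sub>R (a * frechet_derivative s (at (a * fst z + c)) 1) + snd v *\<^sub>R 0)) (at z)"
    by (rule has_derivative_eq_rhs, rule has_derivative_compose[OF 1 d], rule ext,
        subst has_derivative_real_scale[OF d]) simp
  show "((\<lambda>z::real \<times> real. s (a * snd z + c)) has_derivative (\<lambda>v. fst v *\<^sub>R 0 + snd v *\<^sub>R (a * frechet_derivative s (at (a * snd z + c)) 1))) (at z)"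
    by (rule has_derivative_eq_rhs, rule has_derivative_compose[OF 2 d], rule ext,
        subst has_derivative_real_scale[OF d]) simp
qed

text \<open>The derivatives are of size \<open>1/N\<close> except in the strip \<open>x \<le> 1/N\<close> along the boundary, where the \<open>x\<close>-derivative is of size
\<open>N\<close>.\<close>

lemma cutoff_properties:
  assumes s: "smooth (s :: real \<Rightarrow> real)" and s0: "\<And>x. x \<le> 1/2 \<Longrightarrow> s x = 0" and s1: "\<And>x. x \<ge> 1 \<Longrightarrow> s x = 1"
  shows "\<exists>c k1 k2. c \<ge> 0 \<and> (\<forall>N\<ge>1. smooth (\<lambda>z. complex_of_real (cutoff s N z)) \<and> (\<forall>z. \<bar>cutoff s N z\<bar> \<le> c)
     \<and> continuous_on UNIV (k1 N) \<and> continuous_on UNIV (k2 N)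
     \<and> (\<forall>z. dx (\<lambda>z. complex_of_real (cutoff s N z)) z = of_real (k1 N z))
     \<and> (\<forall>z. dy (\<lambda>z. complex_of_real (cutoff s N z)) z = of_real (k2 N z))
     \<and> (\<forall>z. \<bar>k1 N z\<bar> \<le> c * N * indicator {z. fst z \<le> 1 / N} z + c / N) \<and> (\<forall>z. \<bar>k2 N z\<bar> \<le> c / N))"
proof -
  define s' where "s' = (\<lambda>x. frechet_derivative s (at x) (1::real))"
  have s's: "smooth s'" unfolding s'_def by (rule smooth_derivative[OF s])
  have sc: "continuous_on UNIV s" and s'c: "continuous_on UNIV s'" by (rule smooth_continuous, fact)+
  have s'0: "s' x = 0" if "x < 1/2 \<or> x > 1" for x
  proof -
    have "(s has_derivative (\<lambda>_. 0)) (at x)"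
      using that
    proof
      assume "x < 1/2"
      show ?thesis
        by (rule has_derivative_transform_within_open[of "\<lambda>_. 0" _ x UNIV "{..<1/2}"])
           (use \<open>x < 1/2\<close> in \<open>auto simp: s0\<close>)
    next
      assume "x > 1"
      show ?thesis
        by (rule has_derivative_transform_within_open[of "\<lambda>_. 1" _ x UNIV "{1<..}"])
           (use \<open>x > 1\<close> in \<open>auto simp: s1\<close>)
    qed
    then show ?thesis unfolding s'_def using frechet_derivative_at[of s "\<lambda>_. 0" x] by metis
  qed
  obtain K where K: "K \<ge> 1" "\<And>x. \<bar>s x\<bar> \<le> K" "\<And>x. \<bar>s' x\<bar> \<le> K"
  proof -
    have "compact (s ` {1/2..1})" "compact (s' ` {1/2..1})"
      by (intro compact_continuous_image continuous_on_subset[OF sc] continuous_on_subset[OF s'c]; simp)+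
    then obtain A B where A: "\<forall>y\<in>s ` {1/2..1}. norm y \<le> A" and B: "\<forall>y\<in>s' ` {1/2..1}. norm y \<le> B"
      by (meson compact_imp_bounded bounded_iff)
    define K where "K = max 1 (max A B)"
    have "\<bar>s x\<bar> \<le> K" for x
    proof -
      consider "x \<le> 1/2" | "x \<ge> 1" | "x \<in> {1/2..1}" by fastforce
      then show ?thesis
      proof cases
        case 3 then show ?thesis using A by (force simp: K_def)
      qed (auto simp: s0 s1 K_def)
    qed
    moreover have "\<bar>s' x\<bar> \<le> K" for x
    proof (cases "x \<in> {1/2..1}")
      case True then show ?thesis using B by (force simp: K_def)
    next
      case False then show ?thesis using s'0[of x] by (auto simp: K_def)
    qed
    ultimately show ?thesis using that[of K] by (simp add: K_def)
  qed
  define k1 where "k1 = (\<lambda>N z. (N * s' (N * fst z + 0) * s (- 1 / N * fst z + 2) + s (N * fst z + 0) * (- 1 / N * s' (- 1 / N * fst z + 2))) * (s (- 1 / N * snd z + 2) * s (1 / N * snd z + 2)))"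
  define k2 where "k2 = (\<lambda>N z. (s (N * fst z + 0) * s (- 1 / N * fst z + 2)) * (- 1 / N * s' (- 1 / N * snd z + 2) * s (1 / N * snd z + 2) + s (- 1 / N * snd z + 2) * (1 / N * s' (1 / N * snd z + 2))))"
  define c where "c = 2 * K ^ 4"
  have prod: "\<bar>a * b\<bar> \<le> A * B" if "\<bar>a\<bar> \<le> A" "\<bar>b\<bar> \<le> B" for a b A B :: real
    unfolding abs_mult using that by (intro mult_mono) auto
  have K4: "\<bar>(a1 * a2) * (a3 * a4)\<bar> \<le> K ^ 4" if "\<bar>a1\<bar> \<le> K" "\<bar>a2\<bar> \<le> K" "\<bar>a3\<bar> \<le> K" "\<bar>a4\<bar> \<le> K" for a1 a2 a3 a4
    using prod[OF prod[OF that(1,2)] prod[OF that(3,4)]] by (simp add: power4_eq_xxxx mult.assoc)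
  have K40: "K ^ 4 \<ge> 0" by simp
  have ks: "continuous_on UNIV (\<lambda>z::real \<times> real. s (a * fst z + b))" "continuous_on UNIV (\<lambda>z::real \<times> real. s' (a * fst z + b))"
    "continuous_on UNIV (\<lambda>z::real \<times> real. s (a * snd z + b))" "continuous_on UNIV (\<lambda>z::real \<times> real. s' (a * snd z + b))" for a b
    by (rule continuous_on_compose2[OF sc] continuous_on_compose2[OF s'c]; force intro: continuous_intros)+
  have main: "smooth (\<lambda>z. complex_of_real (cutoff s N z)) \<and> (\<forall>z. \<bar>cutoff s N z\<bar> \<le> c)
     \<and> continuous_on UNIV (k1 N) \<and> continuous_on UNIV (k2 N)
     \<and> (\<forall>z. dx (\<lambda>z. complex_of_real (cutoff s N z)) z = of_real (k1 N z))
     \<and> (\<forall>z. dy (\<lambda>z. complex_of_real (cutoff s N z)) z = of_real (k2 N z))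
     \<and> (\<forall>z. \<bar>k1 N z\<bar> \<le> c * N * indicator {z. fst z \<le> 1 / N} z + c / N) \<and> (\<forall>z. \<bar>k2 N z\<bar> \<le> c / N)" if N: "N \<ge> 1" for N
  proof (intro conjI allI)
    have l1: "bounded_linear (\<lambda>z::real \<times> real. a * fst z)" and l2: "bounded_linear (\<lambda>z::real \<times> real. a * snd z)" for a
      by (intro bounded_linear_mult_right[THEN bounded_linear_compose] bounded_linear_fst bounded_linear_snd)+
    have "smooth (cutoff s N)" unfolding cutoff_def[abs_def]
      by (intro smooth_mult smooth_compose_affine[OF l1 s] smooth_compose_affine[OF l2 s])
    then show "smooth (\<lambda>z. complex_of_real (cutoff s N z))" by (rule smooth_bounded_linear[OF bounded_linear_of_real])
    show "continuous_on UNIV (k1 N)" "continuous_on UNIV (k2 N)" unfolding k1_def k2_def by (intro continuous_intros ks)+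
    fix z :: "real \<times> real"
    show "\<bar>cutoff s N z\<bar> \<le> c" using order_trans[OF K4[OF K(2) K(2) K(2) K(2)], of c] K40 unfolding cutoff_def c_def by simp
    have "(cutoff s N has_derivative (\<lambda>v. fst v *\<^sub>R k1 N z + snd v *\<^sub>R k2 N z)) (at z)"
      unfolding cutoff_def[abs_def]
      by (rule has_derivative_eq_rhs, rule has_derivative_mult[OF has_derivative_mult[OF has_derivative_step(1)[OF s] has_derivative_step(1)[OF s]] has_derivative_mult[OF has_derivative_step(2)[OF s] has_derivative_step(2)[OF s]]])
         (simp add: k1_def k2_def s'_def algebra_simps)
    from bounded_linear.has_derivative[OF bounded_linear_of_real this]
    have "((\<lambda>z. complex_of_real (cutoff s N z)) has_derivative (\<lambda>v. fst v *\<^sub>R of_real (k1 N z) + snd v *\<^sub>R of_real (k2 N z))) (at z)"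
      by (simp add: scaleR_conv_of_real)
    then show "dx (\<lambda>z. complex_of_real (cutoff s N z)) z = of_real (k1 N z)" "dy (\<lambda>z. complex_of_real (cutoff s N z)) z = of_real (k2 N z)"
      using partials_unique by blast+
    have N0: "N > 0" using N by simp
    show "\<bar>k2 N z\<bar> \<le> c / N"
    proof -
      let ?a = "s (N * fst z + 0)" and ?b = "s (- 1 / N * fst z + 2)"
      have e: "k2 N z = (1 / N) * ((?a * ?b) * (s (- 1 / N * snd z + 2) * s' (1 / N * snd z + 2)) - (?a * ?b) * (s' (- 1 / N * snd z + 2) * s (1 / N * snd z + 2)))"
        by (simp add: k2_def algebra_simps)
      have "\<bar>(?a * ?b) * (s (- 1 / N * snd z + 2) * s' (1 / N * snd z + 2)) - (?a * ?b) * (s' (- 1 / N * snd z + 2) * s (1 / N * snd z + 2))\<bar> \<le> c"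
        using K4[OF K(2) K(2) K(2) K(3), of "N * fst z + 0" "- 1 / N * fst z + 2" "- 1 / N * snd z + 2" "1 / N * snd z + 2"]
          K4[OF K(2) K(2) K(3) K(2), of "N * fst z + 0" "- 1 / N * fst z + 2" "- 1 / N * snd z + 2" "1 / N * snd z + 2"]
        unfolding c_def by linarith
      then show ?thesis unfolding e using N0 by (simp add: abs_mult divide_right_mono)
    qed
    show "\<bar>k1 N z\<bar> \<le> c * N * indicator {z. fst z \<le> 1 / N} z + c / N"
    proof -
      let ?p = "(s' (N * fst z + 0) * s (- 1 / N * fst z + 2)) * (s (- 1 / N * snd z + 2) * s (1 / N * snd z + 2))"
      let ?q = "(s (N * fst z + 0) * s' (- 1 / N * fst z + 2)) * (s (- 1 / N * snd z + 2) * s (1 / N * snd z + 2))"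
      have e: "k1 N z = N * ?p - (1 / N) * ?q" by (simp add: k1_def algebra_simps)
      have p: "\<bar>?p\<bar> \<le> c * indicator {z. fst z \<le> 1 / N} z"
      proof (cases "fst z \<le> 1 / N")
        case True
        have "\<bar>?p\<bar> \<le> c" using order_trans[OF K4[OF K(3) K(2) K(2) K(2)], of c] K40 unfolding c_def by simp
        moreover have "indicator {z. fst z \<le> 1 / N} z = (1::real)" using True by simp
        ultimately show ?thesis by (simp only: mult_1_right)
      next
        case False
        then have "N * fst z > 1" using N0 by (simp add: field_simps)
        then show ?thesis using s'0[of "N * fst z + 0"] False by simp
      qed
      have q: "\<bar>?q\<bar> \<le> c" using order_trans[OF K4[OF K(2) K(3) K(2) K(2)], of c] K40 unfolding c_def by simp
      have "\<bar>k1 N z\<bar> \<le> N * \<bar>?p\<bar> + (1 / N) * \<bar>?q\<bar>" unfolding e using N0 by (simp add: abs_mult order_trans[OF abs_triangle_ineq4])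
      also have "\<dots> \<le> N * (c * indicator {z. fst z \<le> 1 / N} z) + (1 / N) * c"
        using p q N0 by (intro add_mono mult_left_mono) auto
      finally show ?thesis by (simp add: mult_ac)
    qed
  qed
  have "c \<ge> 0" using K40 by (simp add: c_def)
  then show ?thesis using main by blast
qed

lemma limit_by_squeeze_two:
  assumes "a \<longlonglongrightarrow> 0" "b \<longlonglongrightarrow> 0" "\<And>n. (0::real) \<le> x n" "\<And>n. x n \<le> 2 * a n + 2 * b n"
  shows "x \<longlonglongrightarrow> 0"
proof (rule tendsto_sandwich[OF _ _ tendsto_const])
  show "(\<lambda>n. 2 * a n + 2 * b n) \<longlonglongrightarrow> 0" using tendsto_add[OF tendsto_mult_left[OF assms(1), of 2] tendsto_mult_left[OF assms(2), of 2]] by simp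
qed (use assms(3,4) in auto)

definition near_boundary :: "nat \<Rightarrow> (real \<times> real) set" where
  "near_boundary n = {z. fst z \<le> 1 / real (Suc n)}"

lemma near_boundary_sets [measurable]: "near_boundary n \<in> sets borel"
  unfolding near_boundary_def by (intro borel_closed closed_Collect_le continuous_intros)

text \<open>The domain of the operator is defined by testing against functions supported away from the boundary, so \<open>f\<close> is
multiplied by cutoffs and the cutoffs are removed. The commutator with \<open>\<partial>\<^sub>x\<close> has size \<open>N\<close> in a strip of width \<open>1/N\<close>, and the assumption
\<open>strip\<close> says that \<open>f\<close> is small enough there. On the other side, \<open>v\<close> is approximated by test functions, which is where its
Dirichlet condition enters.\<close>

theorem green_identity:
  fixes s :: "real \<Rightarrow> real"
  assumes v: "neg_Friedlander_D v Av"
    and step: "smooth s" "\<And>x. x \<le> 1/2 \<Longrightarrow> s x = 0" "\<And>x. x \<ge> 1 \<Longrightarrow> s x = 1"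
    and f: "smooth f" "f \<in> L2_Omega" "dx f \<in> L2_Omega" "wdy f \<in> L2_Omega" "Friedlander f \<in> L2_Omega"
    and wf: "(\<lambda>z. of_real (sqrt (1 + fst z)) * f z) \<in> L2_Omega"
    and strip: "(\<lambda>n. (real (Suc n))\<^sup>2 * n2 (\<lambda>z. indicator (near_boundary n) z * f z)) \<longlonglongrightarrow> 0"
  shows "L2_inner (\<lambda>z. - Friedlander f z) v = L2_inner f Av"
proof -
  have vH: "v \<in> H10" and AvL: "Av \<in> L2_Omega"
    and weak: "\<And>\<psi>. \<psi> \<in> Cc_infinity Omega2 \<Longrightarrow> L2_inner v (\<lambda>z. - Friedlander \<psi> z) = L2_inner Av \<psi>"
    using v by (auto simp: neg_Friedlander_D_def)
  have vL: "v \<in> L2_Omega" using vH by (simp add: H10_def)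
  obtain v1 v2 \<phi> where v1: "v1 \<in> L2_Omega" and v2: "v2 \<in> L2_Omega" and \<phi>: "\<And>n. \<phi> n \<in> Cc_infinity Omega2"
    and lim0: "(\<lambda>n. Lr_norm 2 (\<lambda>z. \<phi> n z - v z)) \<longlonglongrightarrow> 0"
    and lim1: "(\<lambda>n. Lr_norm 2 (\<lambda>z. dx (\<phi> n) z - v1 z)) \<longlonglongrightarrow> 0"
    and lim2: "(\<lambda>n. Lr_norm 2 (\<lambda>z. wdy (\<phi> n) z - v2 z)) \<longlonglongrightarrow> 0"
    using vH unfolding H10_def by blast
  \<comment> \<open>integration by parts against the test functions that approximate \<open>v\<close>\<close>
  have form: "L2_inner (\<lambda>z. - Friedlander g z) v = L2_inner (dx g) v1 + L2_inner (wdy g) v2"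
    if g: "smooth g" "dx g \<in> L2_Omega" "wdy g \<in> L2_Omega" "Friedlander g \<in> L2_Omega" for g
  proof -
    have "(\<lambda>n. L2_inner (\<lambda>z. - Friedlander g z) (\<phi> n)) \<longlonglongrightarrow> L2_inner (\<lambda>z. - Friedlander g z) v"
      by (rule L2_inner_tendsto_right[OF test_function_L2(1)[OF \<phi>] vL L2_minus[OF g(4)] lim0])
    moreover have "(\<lambda>n. L2_inner (dx g) (dx (\<phi> n)) + L2_inner (wdy g) (wdy (\<phi> n))) \<longlonglongrightarrow> L2_inner (dx g) v1 + L2_inner (wdy g) v2"
      by (rule tendsto_add[OF L2_inner_tendsto_right[OF test_function_L2(2)[OF \<phi>] v1 g(2) lim1]
            L2_inner_tendsto_right[OF test_function_L2(3)[OF \<phi>] v2 g(3) lim2]])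
    ultimately show ?thesis unfolding integration_by_parts[OF g(1) \<phi>] by (rule LIMSEQ_unique)
  qed
  obtain c k1 k2 where c: "c \<ge> 0" and cut: "\<And>N. N \<ge> 1 \<Longrightarrow> smooth (\<lambda>z. complex_of_real (cutoff s N z)) \<and> (\<forall>z. \<bar>cutoff s N z\<bar> \<le> c)
     \<and> continuous_on UNIV (k1 N) \<and> continuous_on UNIV (k2 N)
     \<and> (\<forall>z. dx (\<lambda>z. complex_of_real (cutoff s N z)) z = of_real (k1 N z))
     \<and> (\<forall>z. dy (\<lambda>z. complex_of_real (cutoff s N z)) z = of_real (k2 N z))
     \<and> (\<forall>z. \<bar>k1 N z\<bar> \<le> c * N * indicator {z. fst z \<le> 1 / N} z + c / N) \<and> (\<forall>z. \<bar>k2 N z\<bar> \<le> c / N)"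
    using cutoff_properties[OF step] by blast
  define N where "N = (\<lambda>n. real (Suc n))"
  have N1: "N n \<ge> 1" for n by (simp add: N_def)
  define kap where "kap = (\<lambda>n. cutoff s (N n))"
  have ks: "smooth (\<lambda>z. complex_of_real (kap n z))" and kb: "\<bar>kap n z\<bar> \<le> c"
    and k1c: "continuous_on UNIV (k1 (N n))" and k2c: "continuous_on UNIV (k2 (N n))"
    and kdx: "dx (\<lambda>z. complex_of_real (kap n z)) z = of_real (k1 (N n) z)"
    and kdy: "dy (\<lambda>z. complex_of_real (kap n z)) z = of_real (k2 (N n) z)"
    and k1b: "\<bar>k1 (N n) z\<bar> \<le> c * N n * indicator (near_boundary n) z + c / N n"
    and k2b: "\<bar>k2 (N n) z\<bar> \<le> c / N n" for n z
    using cut[OF N1[of n]] unfolding kap_def near_boundary_def N_def by blast+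
  have kc: "continuous_on UNIV (kap n)" for n
  proof -
    have "continuous_on UNIV (\<lambda>z. Re (complex_of_real (kap n z)))"
      by (intro continuous_intros smooth_continuous ks)
    then show ?thesis by simp
  qed
  have klim: "(\<lambda>n. kap n z) \<longlonglongrightarrow> 1" if "z \<in> Omega2" for z
  proof (rule tendsto_eventually)
    have x: "fst z > 0" using that by (auto simp: Omega2_def)
    obtain M :: nat where M: "1 / fst z + fst z + \<bar>snd z\<bar> \<le> real M" using real_arch_simple by blast
    show "\<forall>\<^sub>F n in sequentially. kap n z = 1"
    proof (rule eventually_sequentiallyI[of M])
      fix n assume "n \<ge> M"
      then have sum: "1 / fst z + fst z + \<bar>snd z\<bar> \<le> N n" using M by (simp add: N_def)
      have b: "1 / fst z \<le> N n" "fst z \<le> N n" "snd z \<le> N n" "- snd z \<le> N n"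
      proof -
        have "1 / fst z > 0" "snd z \<le> \<bar>snd z\<bar>" "- snd z \<le> \<bar>snd z\<bar>" "0 \<le> \<bar>snd z\<bar>" using x by simp_all
        then show "1 / fst z \<le> N n" "fst z \<le> N n" "snd z \<le> N n" "- snd z \<le> N n"
          using sum x by linarith+
      qed
      have "N n * fst z \<ge> 1" using b(1) x by (simp add: field_simps)
      moreover have "fst z / N n \<le> 1" "snd z / N n \<le> 1" "- snd z / N n \<le> 1"
      proof -
        have p: "N n > 0" using N1[of n] by linarith
        show "fst z / N n \<le> 1" "snd z / N n \<le> 1" "- snd z / N n \<le> 1"
          using b by (simp_all only: pos_divide_le_eq[OF p] mult_1)
      qed
      ultimately show "kap n z = 1" unfolding kap_def cutoff_def by (simp add: step(3))
    qed
  qed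
  \<comment> \<open>\<open>f\<close> cut off near the boundary and near infinity\<close>
  define chi where "chi = (\<lambda>n z. complex_of_real (kap n z) * f z)"
  have cs: "smooth (chi n)" for n unfolding chi_def by (intro smooth_mult ks f(1))
  have cC: "chi n \<in> Cc_infinity Omega2" for n
  proof -
    define B where "B = {1 / (2 * N n)..2 * N n} \<times> {- (2 * N n)..2 * N n}"
    have Bc: "compact B" unfolding B_def by (intro compact_Times compact_Icc)
    have BO: "B \<subseteq> Omega2" using N1[of n] by (auto simp: B_def Omega2_def) (smt (verit) divide_pos_pos)
    have "kap n z = 0" if "z \<notin> B" for z
    proof -
      have p: "N n > 0" using N1[of n] by linarith
      have "\<not> (1 / (2 * N n) \<le> fst z \<and> fst z \<le> 2 * N n \<and> - (2 * N n) \<le> snd z \<and> snd z \<le> 2 * N n)"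
        using that by (auto simp: B_def mem_Times_iff)
      then consider "fst z < 1 / (2 * N n)" | "fst z > 2 * N n" | "snd z > 2 * N n" | "snd z < - (2 * N n)"
        by linarith
      then show ?thesis
      proof cases
        case 1
        then have "N n * fst z \<le> 1 / 2" using p by (simp add: field_simps)
        then show ?thesis by (simp add: kap_def cutoff_def step(2))
      next
        case 2
        then have "- 1 / N n * fst z + 2 \<le> 1 / 2" using p by (simp add: field_simps)
        then have "s (- 1 / N n * fst z + 2) = 0" by (rule step(2))
        then show ?thesis by (simp only: kap_def cutoff_def mult_zero_left mult_zero_right)
      next
        case 3
        then have "- 1 / N n * snd z + 2 \<le> 1 / 2" using p by (simp add: field_simps)
        then have "s (- 1 / N n * snd z + 2) = 0" by (rule step(2))
        then show ?thesis by (simp only: kap_def cutoff_def mult_zero_left mult_zero_right)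
      next
        case 4
        then have "1 / N n * snd z + 2 \<le> 1 / 2" using p by (simp add: field_simps)
        then have "s (1 / N n * snd z + 2) = 0" by (rule step(2))
        then show ?thesis by (simp only: kap_def cutoff_def mult_zero_left mult_zero_right)
      qed
    qed
    then have "{z. chi n z \<noteq> 0} \<subseteq> B" by (auto simp: chi_def)
    then have cl: "closure {z. chi n z \<noteq> 0} \<subseteq> B" by (intro closure_minimal compact_imp_closed Bc)
    then have "compact (closure {z. chi n z \<noteq> 0})"
      using Bc by (metis closed_closure compact_Int_closed inf.absorb_iff2)
    then show ?thesis using cl BO cs by (auto simp: Cc_infinity_def)
  qed
  note cL = test_function_L2[OF cC]
  have dchi: "dx (chi n) z = of_real (kap n z) * dx f z + of_real (k1 (N n) z) * f z"
    "dy (chi n) z = of_real (kap n z) * dy f z + of_real (k2 (N n) z) * f z" for n z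
    unfolding chi_def partials_mult[OF ks f(1)] kdx kdy by simp_all
  have Ninv: "(\<lambda>n. K / (N n)\<^sup>2) \<longlonglongrightarrow> 0" for K
  proof -
    have "(\<lambda>n. K * (inverse (real (Suc n)))\<^sup>2) \<longlonglongrightarrow> K * 0\<^sup>2" by (intro tendsto_intros LIMSEQ_inverse_real_of_nat)
    then show ?thesis by (simp add: N_def field_simps)
  qed
  have L0: "(\<lambda>n. Lr_norm 2 (\<lambda>z. chi n z - f z)) \<longlonglongrightarrow> 0"
  proof (rule Lr2_tendsto_0[OF L2_diff[OF cL(1) f(2)]])
    show "(\<lambda>n. n2 (\<lambda>z. chi n z - f z)) \<longlonglongrightarrow> 0"
      using cutoff_L2_tendsto[OF kc kb klim f(2)] by (simp add: chi_def algebra_simps)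
  qed
  have L1: "(\<lambda>n. Lr_norm 2 (\<lambda>z. dx (chi n) z - dx f z)) \<longlonglongrightarrow> 0"
  proof (rule Lr2_tendsto_0[OF L2_diff[OF cL(2) f(3)]])
    let ?a = "\<lambda>n z. complex_of_real (kap n z - 1) * dx f z" and ?b = "\<lambda>n z. complex_of_real (k1 (N n) z) * f z"
    let ?i = "\<lambda>n z. indicator (near_boundary n) z * f z"
    have bB: "norm (?b n z) \<le> norm (complex_of_real (c * N n * indicator (near_boundary n) z + c / N n) * f z)" for n z
      unfolding norm_mult norm_of_real by (rule mult_right_mono[OF order_trans[OF k1b abs_ge_self]]) simp
    have iL: "?i n \<in> L2_Omega" for n
    proof (rule n2_mono(1)[OF _ f(2)])
      have "(\<lambda>z. indicator (near_boundary n) z :: complex) \<in> borel_measurable M\<Omega>" by (intro measurable_M\<Omega>) measurable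
      then show "?i n \<in> borel_measurable M\<Omega>" using L2_measurable[OF f(2)] by (rule borel_measurable_times)
    qed (auto simp: indicator_def)
    have e: "(\<lambda>z. complex_of_real (c * N n * indicator (near_boundary n) z + c / N n) * f z) = (\<lambda>z. of_real (c * N n) * ?i n z + of_real (c / N n) * f z)" for n
      by (rule ext) (simp add: algebra_simps split: split_indicator)
    have bB': "norm (?b n z) \<le> norm (of_real (c * N n) * ?i n z + of_real (c / N n) * f z)" for n z
      using bB[of n z] unfolding fun_cong[OF e[of n], of z] .
    have sL: "(\<lambda>z. of_real (c * N n) * ?i n z + of_real (c / N n) * f z) \<in> L2_Omega" for n
      by (intro L2_add L2_cmult iL f(2))
    have bm: "?b n \<in> borel_measurable M\<Omega>" for n
      by (intro borel_measurable_times L2_measurable[OF f(2)] continuous_M\<Omega> continuous_intros k1c)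
    have bL: "?b n \<in> L2_Omega" for n
      by (rule n2_mono(1)[OF bm sL bB'])
    have aL: "?a n \<in> L2_Omega" for n
    proof (rule multiplier_L2(1)[where c = "c + 1", OF _ _ f(3)])
      show "continuous_on UNIV (\<lambda>z. kap n z - 1)" by (intro continuous_intros kc)
      show "\<bar>kap n z - 1\<bar> \<le> c + 1" for z using kb[of n z] by linarith
    qed
    \<comment> \<open>the two terms are the commutators in the boundary strip and near infinity\<close>
    have b2: "n2 (?b n) \<le> 2 * (c\<^sup>2 * ((N n)\<^sup>2 * n2 (?i n))) + 2 * (c\<^sup>2 * n2 f / (N n)\<^sup>2)" for n
    proof -
      have "n2 (?b n) \<le> n2 (\<lambda>z. of_real (c * N n) * ?i n z + of_real (c / N n) * f z)"
        by (rule n2_mono(2)[OF bm sL bB'])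
      also have "\<dots> \<le> 2 * n2 (\<lambda>z. of_real (c * N n) * ?i n z) + 2 * n2 (\<lambda>z. of_real (c / N n) * f z)"
        by (intro L2_add L2_cmult iL f(2))
      also have "\<dots> = 2 * (c\<^sup>2 * ((N n)\<^sup>2 * n2 (?i n))) + 2 * (c\<^sup>2 * n2 f / (N n)\<^sup>2)"
        unfolding L2_cmult(2) norm_of_real by (simp add: power_mult_distrib power_divide mult_ac)
      finally show ?thesis .
    qed
    have lb: "(\<lambda>n. n2 (?b n)) \<longlonglongrightarrow> 0"
      by (rule limit_by_squeeze_two[OF _ Ninv n2_nonneg b2])
         (use tendsto_mult_left[OF strip, of "c\<^sup>2"] in \<open>simp add: N_def\<close>)
    have la: "(\<lambda>n. n2 (?a n)) \<longlonglongrightarrow> 0" by (rule cutoff_L2_tendsto[OF kc kb klim f(3)])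
    have "n2 (\<lambda>z. dx (chi n) z - dx f z) \<le> 2 * n2 (?a n) + 2 * n2 (?b n)" for n
    proof -
      have "(\<lambda>z. dx (chi n) z - dx f z) = (\<lambda>z. ?a n z + ?b n z)" by (auto simp: dchi algebra_simps)
      then show ?thesis using L2_add(2)[OF aL bL] by simp
    qed
    then show "(\<lambda>n. n2 (\<lambda>z. dx (chi n) z - dx f z)) \<longlonglongrightarrow> 0"
      by (rule limit_by_squeeze_two[OF la lb n2_nonneg])
  qed
  have L2: "(\<lambda>n. Lr_norm 2 (\<lambda>z. wdy (chi n) z - wdy f z)) \<longlonglongrightarrow> 0"
  proof (rule Lr2_tendsto_0[OF L2_diff[OF cL(3) f(4)]])
    let ?a = "\<lambda>n z. complex_of_real (kap n z - 1) * wdy f z"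
    let ?w = "\<lambda>z. complex_of_real (sqrt (1 + fst z)) * f z"
    let ?b = "\<lambda>n z. complex_of_real (k2 (N n) z) * ?w z"
    have bL: "?b n \<in> L2_Omega" "n2 (?b n) \<le> (c / N n)\<^sup>2 * n2 ?w" for n
      by (rule multiplier_L2[OF k2c k2b wf])+
    have aL: "?a n \<in> L2_Omega" for n
    proof (rule multiplier_L2(1)[where c = "c + 1", OF _ _ f(4)])
      show "continuous_on UNIV (\<lambda>z. kap n z - 1)" by (intro continuous_intros kc)
      show "\<bar>kap n z - 1\<bar> \<le> c + 1" for z using kb[of n z] by linarith
    qed
    have la: "(\<lambda>n. n2 (?a n)) \<longlonglongrightarrow> 0" by (rule cutoff_L2_tendsto[OF kc kb klim f(4)])
    have "n2 (\<lambda>z. wdy (chi n) z - wdy f z) \<le> 2 * n2 (?a n) + 2 * (c\<^sup>2 * n2 ?w / (N n)\<^sup>2)" for n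
    proof -
      have "(\<lambda>z. wdy (chi n) z - wdy f z) = (\<lambda>z. ?a n z + ?b n z)" by (auto simp: dchi algebra_simps)
      then show ?thesis using L2_add(2)[OF aL bL(1), of n n] bL(2)[of n] by (simp add: power_divide)
    qed
    then show "(\<lambda>n. n2 (\<lambda>z. wdy (chi n) z - wdy f z)) \<longlonglongrightarrow> 0"
      by (rule limit_by_squeeze_two[OF la Ninv n2_nonneg])
  qed
  \<comment> \<open>the defining property of the domain, applied to the cut off \<open>f\<close>\<close>
  have eq: "L2_inner (chi n) Av = L2_inner (dx (chi n)) v1 + L2_inner (wdy (chi n)) v2" for n
  proof -
    have "L2_inner (chi n) Av = L2_inner (\<lambda>z. - Friedlander (chi n) z) v"
      using arg_cong[OF weak[OF cC[of n]], of cnj] by (simp only: L2_inner_cnj)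
    then show ?thesis using form[OF cs cL(2,3,4)] by simp
  qed
  have "(\<lambda>n. L2_inner (dx (chi n)) v1 + L2_inner (wdy (chi n)) v2) \<longlonglongrightarrow> L2_inner (dx f) v1 + L2_inner (wdy f) v2"
    by (rule tendsto_add[OF L2_inner_tendsto_left[OF cL(2) f(3) v1 L1] L2_inner_tendsto_left[OF cL(3) f(4) v2 L2]])
  then have "(\<lambda>n. L2_inner (chi n) Av) \<longlonglongrightarrow> L2_inner (dx f) v1 + L2_inner (wdy f) v2" unfolding eq .
  moreover have "(\<lambda>n. L2_inner (chi n) Av) \<longlonglongrightarrow> L2_inner f Av"
    by (rule L2_inner_tendsto_left[OF cL(1) f(2) AvL L0])
  ultimately have "L2_inner f Av = L2_inner (dx f) v1 + L2_inner (wdy f) v2" by (rule LIMSEQ_unique[symmetric])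
  then show ?thesis using form[OF f(1,3,4,5)] by simp
qed

section \<open>Superpositions of Airy modes\<close>

text \<open>A superposition over \<open>\<eta>\<close> with amplitude \<open>p\<close>. The profile \<open>a\<close> is \<open>airy\<close> for the modes themselves; their \<open>x\<close>-derivatives
lead to \<open>airy'\<close>, which is why \<open>a\<close> is a parameter.\<close>

definition mode_int :: "(real \<Rightarrow> real) \<Rightarrow> real \<Rightarrow> real \<Rightarrow> real \<Rightarrow> (real \<Rightarrow> complex) \<Rightarrow> real \<times> real \<Rightarrow> complex" where
  "mode_int a \<omega> lo hi p z = integral {lo..hi}
     (\<lambda>\<eta>. p \<eta> * exp (\<i> * of_real (snd z * \<eta>)) * of_real (a (\<eta> powr (2/3) * fst z - \<omega>)))"

lemma mode_integrand_continuous: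
  assumes "0 < lo" "continuous_on UNIV a" "continuous_on {lo..hi} p"
  shows "continuous_on (UNIV \<times> {lo..hi}) (\<lambda>(z, \<eta>). p \<eta> * exp (\<i> * of_real (snd z * \<eta>)) * of_real (a (\<eta> powr (2/3) * fst z - \<omega>)))"
proof -
  have p: "continuous_on (UNIV \<times> {lo..hi}) (\<lambda>w::(real \<times> real) \<times> real. p (snd w))"
    by (rule continuous_on_compose2[OF assms(3)]) (auto intro: continuous_intros)
  have a: "continuous_on (UNIV \<times> {lo..hi}) (\<lambda>w::(real \<times> real) \<times> real. a (snd w powr (2/3) * fst (fst w) - \<omega>))"
    by (rule continuous_on_compose2[OF assms(2)]) (use assms(1) in \<open>auto intro!: continuous_intros\<close>)
  show ?thesis unfolding split_beta by (intro continuous_intros p a)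
qed

lemma mode_integrand_continuous':
  assumes "0 < lo" "continuous_on UNIV a" "continuous_on {lo..hi} p"
  shows "continuous_on {lo..hi} (\<lambda>\<eta>. p \<eta> * exp (\<i> * of_real (snd z * \<eta>)) * of_real (a (\<eta> powr (2/3) * fst z - \<omega>)))"
proof -
  have a: "continuous_on {lo..hi} (\<lambda>\<eta>. a (\<eta> powr (2/3) * fst z - \<omega>))"
    by (rule continuous_on_compose2[OF assms(2)]) (use assms(1) in \<open>auto intro!: continuous_intros\<close>)
  show ?thesis by (intro continuous_intros assms(3) a)
qed

lemma mode_int_integrable:
  assumes "0 < lo" "continuous_on UNIV a" "continuous_on {lo..hi} p"
  shows "(\<lambda>\<eta>. p \<eta> * exp (\<i> * of_real (snd z * \<eta>)) * of_real (a (\<eta> powr (2/3) * fst z - \<omega>))) integrable_on {lo..hi}"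
  by (rule integrable_continuous_interval[OF mode_integrand_continuous'[OF assms]])

lemma mode_int_continuous:
  assumes "0 < lo" "continuous_on UNIV a" "continuous_on {lo..hi} p"
  shows "continuous_on UNIV (mode_int a \<omega> lo hi p)"
  using integral_continuous_on_param[OF mode_integrand_continuous[OF assms, unfolded cbox_interval[symmetric]]]
  unfolding mode_int_def[abs_def] cbox_interval .

lemma mode_int_add:
  assumes "0 < lo" "continuous_on UNIV a" "continuous_on {lo..hi} p" "continuous_on {lo..hi} q"
  shows "mode_int a \<omega> lo hi (\<lambda>\<eta>. p \<eta> + q \<eta>) z = mode_int a \<omega> lo hi p z + mode_int a \<omega> lo hi q z"
  unfolding mode_int_def
  unfolding distrib_right
  by (rule integral_add[OF mode_int_integrable[OF assms(1,2,3)] mode_int_integrable[OF assms(1,2,4)]])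

lemma mode_int_cmult: "mode_int a \<omega> lo hi (\<lambda>\<eta>. c * p \<eta>) z = c * mode_int a \<omega> lo hi p z"
  unfolding mode_int_def by (simp add: mult.assoc)

lemma mode_int_cong:
  "(\<And>\<eta>. lo \<le> \<eta> \<Longrightarrow> \<eta> \<le> hi \<Longrightarrow> p \<eta> = q \<eta>) \<Longrightarrow> mode_int a \<omega> lo hi p z = mode_int a \<omega> lo hi q z"
  unfolding mode_int_def by (intro integral_cong) auto

lemma powr_continuous: "0 < lo \<Longrightarrow> continuous_on {lo..hi} (\<lambda>\<eta>::real. complex_of_real (\<eta> powr c))"
  by (intro continuous_intros) auto

lemma mode_int_derivative:
  assumes lo: "0 < lo" and a: "\<And>s. (a has_real_derivative a' s) (at s)" and a'c: "continuous_on UNIV a'"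
    and p: "continuous_on {lo..hi} p"
  shows "(mode_int a \<omega> lo hi p has_derivative
     (\<lambda>v. fst v *\<^sub>R mode_int a' \<omega> lo hi (\<lambda>\<eta>. of_real (\<eta> powr (2/3)) * p \<eta>) z
        + snd v *\<^sub>R mode_int a \<omega> lo hi (\<lambda>\<eta>. \<i> * of_real \<eta> * p \<eta>) z)) (at z)"
proof -
  have ac: "continuous_on UNIV a" using a by (auto intro!: continuous_at_imp_continuous_on DERIV_isCont)
  define f where "f = (\<lambda>(z::real \<times> real) \<eta>. p \<eta> * exp (\<i> * of_real (snd z * \<eta>)) * of_real (a (\<eta> powr (2/3) * fst z - \<omega>)))"
  define A where "A = (\<lambda>(z::real \<times> real) \<eta>. (of_real (\<eta> powr (2/3)) * p \<eta>) * exp (\<i> * of_real (snd z * \<eta>)) * of_real (a' (\<eta> powr (2/3) * fst z - \<omega>)))"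
  define B where "B = (\<lambda>(z::real \<times> real) \<eta>. (\<i> * of_real \<eta> * p \<eta>) * exp (\<i> * of_real (snd z * \<eta>)) * of_real (a (\<eta> powr (2/3) * fst z - \<omega>)))"
  have pA: "continuous_on {lo..hi} (\<lambda>\<eta>. of_real (\<eta> powr (2/3)) * p \<eta>)"
    by (intro continuous_on_mult powr_continuous lo p)
  have pB: "continuous_on {lo..hi} (\<lambda>\<eta>. \<i> * of_real \<eta> * p \<eta>)" by (intro continuous_intros p)
  define fx where "fx = (\<lambda>z \<eta>. (blinfun_scaleR_left (A z \<eta>) o\<^sub>L fst_blinfun) + (blinfun_scaleR_left (B z \<eta>) o\<^sub>L snd_blinfun))"
  have fxa: "blinfun_apply (fx z \<eta>) v = fst v *\<^sub>R A z \<eta> + snd v *\<^sub>R B z \<eta>" for z \<eta> v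
    by (simp add: fx_def blinfun.bilinear_simps)
  have d: "((\<lambda>z. f z \<eta>) has_derivative blinfun_apply (fx z \<eta>)) (at z)" for z \<eta>
  proof -
    have e: "((\<lambda>z::real \<times> real. exp (\<i> * of_real (snd z * \<eta>))) has_derivative
       (\<lambda>v. snd v *\<^sub>R (\<i> * of_real \<eta> * exp (\<i> * of_real (snd z * \<eta>))))) (at z)"
    proof -
      have "((\<lambda>z::real \<times> real. \<i> * complex_of_real (snd z * \<eta>)) has_derivative (\<lambda>v. \<i> * of_real (snd v * \<eta>))) (at z)"
        by (auto intro!: derivative_eq_intros)
      from has_derivative_compose[OF this DERIV_exp[unfolded has_field_derivative_def]]
      show ?thesis by (rule has_derivative_eq_rhs) (auto simp: scaleR_conv_of_real mult_ac)
    qed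
    have "((\<lambda>z::real \<times> real. \<eta> powr (2/3) * fst z - \<omega>) has_derivative (\<lambda>v. \<eta> powr (2/3) * fst v)) (at z)"
      by (auto intro!: derivative_eq_intros)
    from has_derivative_compose[OF this a[unfolded has_field_derivative_def]]
    have "((\<lambda>z::real \<times> real. a (\<eta> powr (2/3) * fst z - \<omega>)) has_derivative (\<lambda>v. a' (\<eta> powr (2/3) * fst z - \<omega>) * (\<eta> powr (2/3) * fst v))) (at z)" .
    from bounded_linear.has_derivative[OF bounded_linear_of_real this]
    have a2: "((\<lambda>z::real \<times> real. complex_of_real (a (\<eta> powr (2/3) * fst z - \<omega>))) has_derivative (\<lambda>v. of_real (a' (\<eta> powr (2/3) * fst z - \<omega>) * (\<eta> powr (2/3) * fst v)))) (at z)" .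
    show ?thesis unfolding f_def
      by (rule has_derivative_eq_rhs, rule has_derivative_mult[OF has_derivative_mult[OF has_derivative_const e] a2])
         (auto simp: fxa A_def B_def scaleR_conv_of_real algebra_simps)
  qed
  have cA: "continuous_on (UNIV \<times> {lo..hi}) (\<lambda>w. A (fst w) (snd w))"
    using mode_integrand_continuous[OF lo a'c pA] unfolding A_def split_beta .
  have cB: "continuous_on (UNIV \<times> {lo..hi}) (\<lambda>w. B (fst w) (snd w))"
    using mode_integrand_continuous[OF lo ac pB] unfolding B_def split_beta .
  have cfx: "continuous_on (UNIV \<times> cbox lo hi) (\<lambda>(z, \<eta>). fx z \<eta>)"
    unfolding fx_def split_beta cbox_interval
    by (intro continuous_intros bounded_linear.continuous_on[OF bounded_linear_blinfun_scaleR_left] cA cB)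
  have fi: "f z integrable_on cbox lo hi" for z
    unfolding f_def cbox_interval by (rule mode_int_integrable[OF lo ac p])
  have L: "((\<lambda>z. integral (cbox lo hi) (f z)) has_derivative blinfun_apply (integral (cbox lo hi) (fx z))) (at z within UNIV)"
    by (rule leibniz_rule[OF has_derivative_at_withinI[OF d] fi cfx]) auto
  have ci: "continuous_on (cbox lo hi) (fx z)"
  proof -
    have "continuous_on (cbox lo hi) (\<lambda>\<eta>. (z, \<eta>))" by (intro continuous_intros)
    moreover have "(\<lambda>\<eta>. (z, \<eta>)) ` cbox lo hi \<subseteq> UNIV \<times> cbox lo hi" by auto
    ultimately show ?thesis using continuous_on_compose2[OF cfx, of "cbox lo hi" "\<lambda>\<eta>. (z, \<eta>)"] by simp
  qed
  have "blinfun_apply (integral (cbox lo hi) (fx z)) v = fst v *\<^sub>R integral {lo..hi} (A z) + snd v *\<^sub>R integral {lo..hi} (B z)" for v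
  proof -
    have Ai: "A z integrable_on {lo..hi}" unfolding A_def by (rule mode_int_integrable[OF lo a'c pA])
    have Bi: "B z integrable_on {lo..hi}" unfolding B_def by (rule mode_int_integrable[OF lo ac pB])
    have "blinfun_apply (integral (cbox lo hi) (fx z)) v = integral (cbox lo hi) (\<lambda>\<eta>. blinfun_apply (fx z \<eta>) v)"
      by (rule blinfun_apply_integral[symmetric, OF integrable_continuous[OF ci]] blinfun_apply_integral[OF integrable_continuous[OF ci]])
    also have "\<dots> = fst v *\<^sub>R integral {lo..hi} (A z) + snd v *\<^sub>R integral {lo..hi} (B z)"
      unfolding fxa cbox_interval using Ai Bi by (simp add: integral_add integrable_cmul)
    finally show ?thesis .
  qed
  then have "blinfun_apply (integral (cbox lo hi) (fx z)) = (\<lambda>v. fst v *\<^sub>R integral {lo..hi} (A z) + snd v *\<^sub>R integral {lo..hi} (B z))" by (rule ext)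
  with L show ?thesis unfolding mode_int_def[abs_def] f_def A_def B_def cbox_interval by simp
qed

lemma airy_continuous: "continuous_on UNIV airy" and airy'_continuous: "continuous_on UNIV airy'"
  by (auto intro!: continuous_at_imp_continuous_on DERIV_isCont airy_deriv airy'_deriv)

lemma airy''_continuous: "continuous_on UNIV (\<lambda>s. s * airy s)"
  by (intro continuous_intros airy_continuous)

text \<open>The Airy equation expresses a second derivative through modes again, at the price of a factor \<open>x\<close>.\<close>

lemma mode_int_airy'':
  assumes lo: "0 < lo" and p: "continuous_on {lo..hi} p"
  shows "mode_int (\<lambda>s. s * airy s) \<omega> lo hi p z
     = of_real (fst z) * mode_int airy \<omega> lo hi (\<lambda>\<eta>. of_real (\<eta> powr (2/3)) * p \<eta>) z - of_real \<omega> * mode_int airy \<omega> lo hi p z"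
proof -
  let ?p = "\<lambda>\<eta>. complex_of_real (\<eta> powr (2/3)) * p \<eta>"
  have pA: "continuous_on {lo..hi} ?p" by (intro continuous_on_mult powr_continuous lo p)
  have "of_real (fst z) * mode_int airy \<omega> lo hi ?p z - of_real \<omega> * mode_int airy \<omega> lo hi p z
     = mode_int airy \<omega> lo hi (\<lambda>\<eta>. of_real (fst z) * ?p \<eta>) z + mode_int airy \<omega> lo hi (\<lambda>\<eta>. - of_real \<omega> * p \<eta>) z"
    by (simp only: mode_int_cmult) simp
  also have "\<dots> = mode_int airy \<omega> lo hi (\<lambda>\<eta>. of_real (fst z) * ?p \<eta> + - of_real \<omega> * p \<eta>) z"
    by (rule mode_int_add[symmetric, OF lo airy_continuous]) (intro continuous_on_mult continuous_on_const pA p)+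
  also have "\<dots> = mode_int (\<lambda>s. s * airy s) \<omega> lo hi p z"
    unfolding mode_int_def by (intro integral_cong) (simp add: algebra_simps)
  finally show ?thesis by simp
qed

text \<open>The two profiles have to be treated together: an \<open>x\<close>-derivative exchanges \<open>airy\<close> and \<open>airy'\<close> up to powers of \<open>\<eta>\<close>
and a factor \<open>x\<close>, and a \<open>y\<close>-derivative only changes the amplitude.\<close>

lemma mode_int_Ck:
  assumes lo: "0 < lo"
  shows "continuous_on {lo..hi} p \<Longrightarrow> Ck n (mode_int airy \<omega> lo hi p) \<and> Ck n (mode_int airy' \<omega> lo hi p)"
proof (induction n arbitrary: p)
  case (Suc n)
  note p = Suc.prems
  have pA: "continuous_on {lo..hi} (\<lambda>\<eta>. of_real (\<eta> powr (2/3)) * q \<eta>)" if "continuous_on {lo..hi} q" for q :: "real \<Rightarrow> complex"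
    by (intro continuous_on_mult powr_continuous lo that)
  have pB: "continuous_on {lo..hi} (\<lambda>\<eta>. \<i> * of_real \<eta> * p \<eta>)" by (intro continuous_intros p)
  have fstC: "Ck n (\<lambda>z::real \<times> real. complex_of_real (fst z))"
    by (rule Ck_bounded_linear[OF bounded_linear_of_real Ck_linear[OF bounded_linear_fst]])
  have "Ck n (mode_int (\<lambda>s. s * airy s) \<omega> lo hi (\<lambda>\<eta>. of_real (\<eta> powr (2/3)) * p \<eta>))"
  proof -
    have "Ck n (\<lambda>z. of_real (fst z) * mode_int airy \<omega> lo hi (\<lambda>\<eta>. of_real (\<eta> powr (2/3)) * (of_real (\<eta> powr (2/3)) * p \<eta>)) z
       + (- of_real \<omega>) * mode_int airy \<omega> lo hi (\<lambda>\<eta>. of_real (\<eta> powr (2/3)) * p \<eta>) z)"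
      using Suc.IH[OF pA[OF pA[OF p]]] Suc.IH[OF pA[OF p]] by (intro Ck_add Ck_mult fstC Ck_const) auto
    then show ?thesis unfolding mode_int_airy''[OF lo pA[OF p], abs_def] by simp
  qed
  then show ?case
    using Suc.IH[OF pA[OF p]] Suc.IH[OF pB]
    by (intro conjI Ck_SucI[OF mode_int_derivative[OF lo airy_deriv airy'_continuous p]]
              Ck_SucI[OF mode_int_derivative[OF lo airy'_deriv airy''_continuous p]]
              Ck_add Ck_bounded_linear[OF bounded_linear_scaleR_right]) auto
qed simp

lemma mode_int_smooth: "0 < lo \<Longrightarrow> continuous_on {lo..hi} p \<Longrightarrow> smooth (mode_int airy \<omega> lo hi p)"
  using mode_int_Ck by (intro Ck_imp_smooth) blast

lemma mode_int_partials:
  assumes lo: "0 < lo" and p: "continuous_on {lo..hi} p"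
  shows "dx (mode_int airy \<omega> lo hi p) = mode_int airy' \<omega> lo hi (\<lambda>\<eta>. of_real (\<eta> powr (2/3)) * p \<eta>)"
    "dy (mode_int airy \<omega> lo hi p) = mode_int airy \<omega> lo hi (\<lambda>\<eta>. \<i> * of_real \<eta> * p \<eta>)"
    "dx (mode_int airy' \<omega> lo hi p) = mode_int (\<lambda>s. s * airy s) \<omega> lo hi (\<lambda>\<eta>. of_real (\<eta> powr (2/3)) * p \<eta>)"
  using partials_unique[OF mode_int_derivative[OF lo airy_deriv airy'_continuous p]]
    partials_unique[OF mode_int_derivative[OF lo airy'_deriv airy''_continuous p]] by blast+

text \<open>The square root of the eigenvalue \<open>\<eta>^2 + \<omega> \<eta>^(4/3)\<close> of \<open>- Friedlander\<close>, that is, the time frequency of the mode.\<close>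

definition freq :: "real \<Rightarrow> real \<Rightarrow> real" where
  "freq \<omega> \<eta> = sqrt (\<eta>\<^sup>2 + \<omega> * \<eta> powr (4/3))"

lemma freq_sq: "\<omega> \<ge> 0 \<Longrightarrow> (freq \<omega> \<eta>)\<^sup>2 = \<eta>\<^sup>2 + \<omega> * \<eta> powr (4/3)"
  by (simp add: freq_def)

text \<open>With \<open>s = \<eta>^(2/3) x - \<omega>\<close> the second \<open>x\<close>-derivative contributes \<open>\<eta>^(4/3) s = \<eta>^2 x - \<omega> \<eta>^(4/3)\<close>, and the term
\<open>\<eta>^2 x\<close> cancels against \<open>(1 + x) \<partial>\<^sub>y\<^sup>2\<close>.\<close>

lemma Friedlander_mode:
  assumes lo: "0 < lo" and om: "\<omega> \<ge> 0" and p: "continuous_on {lo..hi} p"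
  shows "Friedlander (mode_int airy \<omega> lo hi p) z = - mode_int airy \<omega> lo hi (\<lambda>\<eta>. of_real ((freq \<omega> \<eta>)\<^sup>2) * p \<eta>) z"
proof -
  let ?q = "\<lambda>\<eta>. complex_of_real (\<eta> powr (2/3))"
  have pA: "continuous_on {lo..hi} (\<lambda>\<eta>. ?q \<eta> * q \<eta>)" if "continuous_on {lo..hi} q" for q :: "real \<Rightarrow> complex"
    by (intro continuous_on_mult powr_continuous lo that)
  have pB: "continuous_on {lo..hi} (\<lambda>\<eta>. \<i> * of_real \<eta> * p \<eta>)" by (intro continuous_intros p)
  have pB2: "continuous_on {lo..hi} (\<lambda>\<eta>. \<i> * of_real \<eta> * (\<i> * of_real \<eta> * p \<eta>))" by (intro continuous_intros p)
  have "Friedlander (mode_int airy \<omega> lo hi p) z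
     = mode_int (\<lambda>s. s * airy s) \<omega> lo hi (\<lambda>\<eta>. ?q \<eta> * (?q \<eta> * p \<eta>)) z
       + mode_int airy \<omega> lo hi (\<lambda>\<eta>. of_real (1 + fst z) * (\<i> * of_real \<eta> * (\<i> * of_real \<eta> * p \<eta>))) z"
    by (simp only: Friedlander_def mode_int_partials[OF lo p] mode_int_partials(3)[OF lo pA[OF p]] mode_int_partials(2)[OF lo pB] mode_int_cmult)
  also have "\<dots> = mode_int airy \<omega> lo hi (\<lambda>\<eta>. - 1 * (of_real ((freq \<omega> \<eta>)\<^sup>2) * p \<eta>)) z"
  proof -
    have i1: "(\<lambda>\<eta>. ?q \<eta> * (?q \<eta> * p \<eta>) * exp (\<i> * of_real (snd z * \<eta>)) * of_real ((\<eta> powr (2/3) * fst z - \<omega>) * airy (\<eta> powr (2/3) * fst z - \<omega>))) integrable_on {lo..hi}"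
      by (rule mode_int_integrable[OF lo airy''_continuous pA[OF pA[OF p]]])
    have i2: "(\<lambda>\<eta>. of_real (1 + fst z) * (\<i> * of_real \<eta> * (\<i> * of_real \<eta> * p \<eta>)) * exp (\<i> * of_real (snd z * \<eta>)) * of_real (airy (\<eta> powr (2/3) * fst z - \<omega>))) integrable_on {lo..hi}"
      by (rule mode_int_integrable[OF lo airy_continuous]) (intro continuous_on_mult continuous_on_const pB2)
    show ?thesis unfolding mode_int_def integral_add[OF i1 i2, symmetric]
    proof (rule integral_cong)
      fix \<eta> assume "\<eta> \<in> {lo..hi}"
      then have e: "\<eta> > 0" using lo by auto
      have e2: "\<eta> powr (2/3) * \<eta> powr (2/3) = \<eta> powr (4/3)" by (simp flip: powr_add)
      have e3: "\<eta> powr (4/3) * \<eta> powr (2/3) = \<eta>\<^sup>2"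
      proof -
        have "\<eta> powr (4/3) * \<eta> powr (2/3) = \<eta> powr 2" by (simp flip: powr_add)
        also have "\<dots> = \<eta>\<^sup>2" using e powr_realpow[of \<eta> 2] by simp
        finally show ?thesis .
      qed
      let ?E = "p \<eta> * exp (\<i> * of_real (snd z * \<eta>)) * of_real (airy (\<eta> powr (2/3) * fst z - \<omega>))"
      have "?q \<eta> * (?q \<eta> * p \<eta>) * exp (\<i> * of_real (snd z * \<eta>)) * of_real ((\<eta> powr (2/3) * fst z - \<omega>) * airy (\<eta> powr (2/3) * fst z - \<omega>))
         = of_real (\<eta> powr (2/3) * \<eta> powr (2/3) * (\<eta> powr (2/3) * fst z - \<omega>)) * ?E"
        by (simp only: of_real_mult) (simp only: mult_ac)
      also have "\<eta> powr (2/3) * \<eta> powr (2/3) * (\<eta> powr (2/3) * fst z - \<omega>) = \<eta>\<^sup>2 * fst z - \<omega> * \<eta> powr (4/3)"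
        unfolding e2 right_diff_distrib mult.assoc[symmetric] e3 by simp
      finally have 1: "?q \<eta> * (?q \<eta> * p \<eta>) * exp (\<i> * of_real (snd z * \<eta>)) * of_real ((\<eta> powr (2/3) * fst z - \<omega>) * airy (\<eta> powr (2/3) * fst z - \<omega>))
         = of_real (\<eta>\<^sup>2 * fst z - \<omega> * \<eta> powr (4/3)) * ?E" .
      have "of_real (1 + fst z) * (\<i> * of_real \<eta> * (\<i> * of_real \<eta> * p \<eta>)) * exp (\<i> * of_real (snd z * \<eta>)) * of_real (airy (\<eta> powr (2/3) * fst z - \<omega>))
        = (\<i> * \<i>) * (of_real ((1 + fst z) * \<eta> * \<eta>) * ?E)"
        by (simp only: of_real_mult) (simp only: mult_ac)
      also have "\<dots> = of_real (- ((1 + fst z) * \<eta>\<^sup>2)) * ?E" by (simp add: power2_eq_square mult_ac)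
      finally have 2: "of_real (1 + fst z) * (\<i> * of_real \<eta> * (\<i> * of_real \<eta> * p \<eta>)) * exp (\<i> * of_real (snd z * \<eta>)) * of_real (airy (\<eta> powr (2/3) * fst z - \<omega>))
        = of_real (- ((1 + fst z) * \<eta>\<^sup>2)) * ?E" .
      have "of_real (\<eta>\<^sup>2 * fst z - \<omega> * \<eta> powr (4/3)) * ?E + of_real (- ((1 + fst z) * \<eta>\<^sup>2)) * ?E
         = of_real ((\<eta>\<^sup>2 * fst z - \<omega> * \<eta> powr (4/3)) + - ((1 + fst z) * \<eta>\<^sup>2)) * ?E"
        by (simp only: of_real_add distrib_right)
      also have "(\<eta>\<^sup>2 * fst z - \<omega> * \<eta> powr (4/3)) + - ((1 + fst z) * \<eta>\<^sup>2) = - (freq \<omega> \<eta>)\<^sup>2"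
        by (simp add: freq_sq[OF om] algebra_simps)
      finally show "?q \<eta> * (?q \<eta> * p \<eta>) * exp (\<i> * of_real (snd z * \<eta>)) * of_real ((\<eta> powr (2/3) * fst z - \<omega>) * airy (\<eta> powr (2/3) * fst z - \<omega>))
         + of_real (1 + fst z) * (\<i> * of_real \<eta> * (\<i> * of_real \<eta> * p \<eta>)) * exp (\<i> * of_real (snd z * \<eta>)) * of_real (airy (\<eta> powr (2/3) * fst z - \<omega>))
         = - 1 * (of_real ((freq \<omega> \<eta>)\<^sup>2) * p \<eta>) * exp (\<i> * of_real (snd z * \<eta>)) * of_real (airy (\<eta> powr (2/3) * fst z - \<omega>))"
        unfolding 1 2 by (simp add: mult_ac)
    qed
  qed
  finally show ?thesis by (simp only: mode_int_cmult) simp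
qed

section \<open>Square integrability of the modes\<close>

lemma nn_integral_M\<Omega>:
  assumes [measurable]: "f \<in> borel_measurable borel"
  shows "(\<integral>\<^sup>+z. f z \<partial>M\<Omega>) = (\<integral>\<^sup>+x. (\<integral>\<^sup>+y. f (x, y) \<partial>lborel) * indicator {0<..} x \<partial>lborel)"
proof -
  have ind: "indicator Omega2 (x, y) = (indicator {0<..} x :: ennreal)" for x y
    by (auto simp: Omega2_def indicator_def)
  have "(\<integral>\<^sup>+z. f z \<partial>M\<Omega>) = (\<integral>\<^sup>+z. f z * indicator Omega2 z \<partial>lborel)"
    unfolding M\<Omega>_def by (rule nn_integral_restrict_space) simp
  also have "\<dots> = (\<integral>\<^sup>+z. f z * indicator Omega2 z \<partial>(lborel \<Otimes>\<^sub>M lborel))" by (simp add: lborel_prod)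
  also have "\<dots> = (\<integral>\<^sup>+x. \<integral>\<^sup>+y. f (x, y) * indicator Omega2 (x, y) \<partial>lborel \<partial>lborel)"
    by (rule lborel.nn_integral_fst[symmetric]) (simp add: lborel_prod)
  also have "\<dots> = (\<integral>\<^sup>+x. (\<integral>\<^sup>+y. f (x, y) \<partial>lborel) * indicator {0<..} x \<partial>lborel)"
    unfolding ind by (intro nn_integral_cong nn_integral_multc) measurable
  finally show ?thesis .
qed

text \<open>Plancherel in \<open>y\<close> on each line \<open>x = const\<close>.\<close>

lemma plancherel_Omega:
  fixes q :: "real \<Rightarrow> real \<Rightarrow> complex" and w :: "real \<Rightarrow> real"
  assumes qm: "(\<lambda>(x, \<eta>). q x \<eta>) \<in> borel_measurable borel"
    and qi: "\<And>x. x > 0 \<Longrightarrow> integrable lborel (q x)" "\<And>x. x > 0 \<Longrightarrow> integrable lborel (\<lambda>\<eta>. (norm (q x \<eta>))\<^sup>2)"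
    and F: "F \<in> borel_measurable borel" "\<And>x y. x > 0 \<Longrightarrow> F (x, y) = ft (q x) y"
  shows "(\<integral>\<^sup>+z. ennreal ((norm (F z))\<^sup>2) \<partial>M\<Omega>)
    \<le> ennreal (2 * pi) * (\<integral>\<^sup>+x. (\<integral>\<^sup>+\<eta>. ennreal ((norm (q x \<eta>))\<^sup>2) \<partial>lborel) * indicator {0<..} x \<partial>lborel)"
proof -
  have "(\<lambda>p. ennreal ((norm (case_prod q p))\<^sup>2)) \<in> borel_measurable borel"
    by (rule measurable_compose[OF qm]) measurable
  then have qm2: "(\<lambda>(x, \<eta>). ennreal ((norm (q x \<eta>))\<^sup>2)) \<in> borel_measurable (lborel \<Otimes>\<^sub>M lborel)"
    by (simp add: lborel_prod split_beta)
  have qm3: "(\<lambda>x. \<integral>\<^sup>+\<eta>. ennreal ((norm (q x \<eta>))\<^sup>2) \<partial>lborel) \<in> borel_measurable lborel"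
    by (rule lborel.borel_measurable_nn_integral[OF qm2])
  have Fm: "(\<lambda>z. ennreal ((norm (F z))\<^sup>2)) \<in> borel_measurable borel"
    by (rule measurable_compose[OF F(1)]) measurable
  have "(\<integral>\<^sup>+z. ennreal ((norm (F z))\<^sup>2) \<partial>M\<Omega>) = (\<integral>\<^sup>+x. (\<integral>\<^sup>+y. ennreal ((norm (F (x, y)))\<^sup>2) \<partial>lborel) * indicator {0<..} x \<partial>lborel)"
    by (rule nn_integral_M\<Omega>[OF Fm])
  also have "\<dots> \<le> (\<integral>\<^sup>+x. ennreal (2 * pi) * ((\<integral>\<^sup>+\<eta>. ennreal ((norm (q x \<eta>))\<^sup>2) \<partial>lborel) * indicator {0<..} x) \<partial>lborel)"
  proof (rule nn_integral_mono)
    fix x :: real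
    show "(\<integral>\<^sup>+y. ennreal ((norm (F (x, y)))\<^sup>2) \<partial>lborel) * indicator {0<..} x
      \<le> ennreal (2 * pi) * ((\<integral>\<^sup>+\<eta>. ennreal ((norm (q x \<eta>))\<^sup>2) \<partial>lborel) * indicator {0<..} x)"
    proof (cases "x > 0")
      case True
      have "(\<integral>\<^sup>+y. ennreal ((norm (F (x, y)))\<^sup>2) \<partial>lborel) \<le> ennreal (2 * pi * (LINT \<eta>|lborel. (norm (q x \<eta>))\<^sup>2))"
        using plancherel_le[OF qi[OF True]] by (simp add: F(2)[OF True])
      also have "\<dots> = ennreal (2 * pi) * (\<integral>\<^sup>+\<eta>. ennreal ((norm (q x \<eta>))\<^sup>2) \<partial>lborel)"
        by (subst nn_integral_eq_integral[OF qi(2)[OF True]]) (auto simp: ennreal_mult)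
      finally show ?thesis using True by simp
    qed simp
  qed
  also have "\<dots> = ennreal (2 * pi) * (\<integral>\<^sup>+x. (\<integral>\<^sup>+\<eta>. ennreal ((norm (q x \<eta>))\<^sup>2) \<partial>lborel) * indicator {0<..} x \<partial>lborel)"
    by (rule nn_integral_cmult) (use qm3 in measurable)
  finally show ?thesis .
qed

lemma mode_int_ft:
  assumes "0 < lo" "continuous_on UNIV a" "continuous_on {lo..hi} p"
  shows "mode_int a \<omega> lo hi p (x, y) = ft (\<lambda>\<eta>. indicator {lo..hi} \<eta> *\<^sub>R (p \<eta> * of_real (a (\<eta> powr (2/3) * x - \<omega>)))) y"
proof -
  let ?f = "\<lambda>\<eta>. p \<eta> * exp (\<i> * of_real (y * \<eta>)) * of_real (a (\<eta> powr (2/3) * x - \<omega>))"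
  have "set_integrable lborel {lo..hi} ?f"
    using mode_integrand_continuous'[OF assms, of "(x, y)"] by (intro borel_integrable_atLeastAtMost') simp
  from set_borel_integral_eq_integral(2)[OF this]
  have "mode_int a \<omega> lo hi p (x, y) = (LINT \<eta>:{lo..hi}|lborel. ?f \<eta>)" by (simp add: mode_int_def)
  also have "\<dots> = ft (\<lambda>\<eta>. indicator {lo..hi} \<eta> *\<^sub>R (p \<eta> * of_real (a (\<eta> powr (2/3) * x - \<omega>)))) y"
    unfolding set_lebesgue_integral_def ft_def by (intro Bochner_Integration.integral_cong) (auto simp: mult_ac)
  finally show ?thesis .
qed

lemma indicator_continuous_measurable:
  fixes p :: "real \<Rightarrow> complex"
  assumes "continuous_on {lo..hi} p"
  shows "(\<lambda>\<eta>. indicator {lo..hi} \<eta> *\<^sub>R p \<eta>) \<in> borel_measurable borel"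
  using borel_measurable_continuous_on_indicator[OF _ assms] by simp

text \<open>Plancherel in \<open>y\<close>, then a pointwise bound of the profile that is uniform in \<open>\<eta>\<close>.\<close>

lemma mode_int_weighted_bound:
  assumes lo: "0 < lo" "lo \<le> hi" and ac: "continuous_on UNIV a" and p: "continuous_on {lo..hi} p"
    and wm [measurable]: "w \<in> borel_measurable borel" and bm [measurable]: "b \<in> borel_measurable borel"
    and P: "\<And>\<eta>. \<eta> \<in> {lo..hi} \<Longrightarrow> norm (p \<eta>) \<le> P"
    and wb: "\<And>x \<eta>. x > 0 \<Longrightarrow> \<eta> \<in> {lo..hi} \<Longrightarrow> \<bar>w x * a (\<eta> powr (2/3) * x - \<omega>)\<bar> \<le> b x"
    and bI: "(\<integral>\<^sup>+x. ennreal ((b x)\<^sup>2) * indicator {0<..} x \<partial>lborel) \<le> ennreal B" "B \<ge> 0"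
  shows "(\<integral>\<^sup>+z. ennreal ((norm (of_real (w (fst z)) * mode_int a \<omega> lo hi p z))\<^sup>2) \<partial>M\<Omega>) \<le> ennreal (2 * pi * (hi - lo) * P\<^sup>2 * B)"
proof -
  have P0: "P \<ge> 0" using order_trans[OF norm_ge_zero P[of lo]] lo by simp
  define q where "q = (\<lambda>x \<eta>. of_real (w x) * (indicator {lo..hi} \<eta> *\<^sub>R (p \<eta> * of_real (a (\<eta> powr (2/3) * x - \<omega>)))))"
  have am [measurable]: "a \<in> borel_measurable borel" by (rule borel_measurable_continuous_onI[OF ac])
  have q_eq: "q x \<eta> = of_real (w x) * ((indicator {lo..hi} \<eta> *\<^sub>R p \<eta>) * of_real (a (\<eta> powr (2/3) * x - \<omega>)))" for x \<eta>
    by (simp add: q_def)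
  have pm [measurable]: "(\<lambda>\<eta>. indicator {lo..hi} \<eta> *\<^sub>R p \<eta>) \<in> borel_measurable borel"
    by (rule indicator_continuous_measurable[OF p])
  have qm: "(\<lambda>(x, \<eta>). q x \<eta>) \<in> borel_measurable borel"
    unfolding q_eq borel_prod[symmetric] by measurable
  have qx [measurable]: "q x \<in> borel_measurable borel" for x unfolding q_eq by measurable
  have qb: "norm (q x \<eta>) \<le> P * b x * indicator {lo..hi} \<eta>" if "x > 0" for x \<eta>
  proof (cases "\<eta> \<in> {lo..hi}")
    case True
    have "norm (q x \<eta>) = norm (p \<eta>) * \<bar>w x * a (\<eta> powr (2/3) * x - \<omega>)\<bar>"
      using True by (simp add: q_def norm_mult abs_mult)
    also have "\<dots> \<le> P * b x" by (intro mult_mono P wb True that P0) auto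
    finally show ?thesis using True by simp
  qed (simp add: q_def)
  have b0: "b x \<ge> 0" if "x > 0" for x using wb[OF that, of lo] lo by force
  have indi: "integrable lborel (indicator {lo..hi} :: real \<Rightarrow> real)"
    by (rule integrable_real_indicator) (auto simp: emeasure_lborel_Icc_eq)
  have qi: "integrable lborel (q x)" if "x > 0" for x
  proof (rule Bochner_Integration.integrable_bound)
    show "integrable lborel (\<lambda>\<eta>. P * b x * indicator {lo..hi} \<eta> :: real)" by (intro integrable_mult_right indi)
    show "AE \<eta> in lborel. norm (q x \<eta>) \<le> norm (P * b x * indicator {lo..hi} \<eta> :: real)"
      unfolding real_norm_def by (intro AE_I2 order_trans[OF qb[OF that] abs_ge_self])
  qed measurable
  have qb2: "(norm (q x \<eta>))\<^sup>2 \<le> (P * b x)\<^sup>2 * indicator {lo..hi} \<eta>" if "x > 0" for x \<eta>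
    using power_mono[OF qb[OF that, of \<eta>] norm_ge_zero, of 2] by (auto simp: indicator_def)
  have qi2: "integrable lborel (\<lambda>\<eta>. (norm (q x \<eta>))\<^sup>2)" if "x > 0" for x
  proof (rule Bochner_Integration.integrable_bound)
    show "integrable lborel (\<lambda>\<eta>. (P * b x)\<^sup>2 * indicator {lo..hi} \<eta> :: real)" by (intro integrable_mult_right indi)
    show "AE \<eta> in lborel. norm ((norm (q x \<eta>))\<^sup>2) \<le> norm ((P * b x)\<^sup>2 * indicator {lo..hi} \<eta> :: real)"
      unfolding real_norm_def abs_power2 by (intro AE_I2 order_trans[OF qb2[OF that] abs_ge_self])
  qed measurable
  let ?F = "\<lambda>z. of_real (w (fst z)) * mode_int a \<omega> lo hi p z"
  have mc [measurable]: "mode_int a \<omega> lo hi p \<in> borel_measurable borel"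
    by (rule borel_measurable_continuous_onI[OF mode_int_continuous[OF lo(1) ac p]])
  have Fm: "?F \<in> borel_measurable borel" unfolding borel_prod[symmetric]
    by (intro borel_measurable_times mc[unfolded borel_prod[symmetric]]) measurable
  have "(\<integral>\<^sup>+z. ennreal ((norm (?F z))\<^sup>2) \<partial>M\<Omega>)
    \<le> ennreal (2 * pi) * (\<integral>\<^sup>+x. (\<integral>\<^sup>+\<eta>. ennreal ((norm (q x \<eta>))\<^sup>2) \<partial>lborel) * indicator {0<..} x \<partial>lborel)"
  proof (rule plancherel_Omega[OF qm qi qi2 Fm])
    show "?F (x, y) = ft (q x) y" for x y
      unfolding mode_int_ft[OF lo(1) ac p] q_def ft_def
      by (simp only: fst_conv integral_mult_right_zero[symmetric]) (simp only: mult_ac)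
  qed
  also have "\<dots> \<le> ennreal (2 * pi) * (\<integral>\<^sup>+x. ennreal (P\<^sup>2 * (hi - lo)) * (ennreal ((b x)\<^sup>2) * indicator {0<..} x) \<partial>lborel)"
  proof (intro mult_left_mono nn_integral_mono)
    fix x :: real
    show "(\<integral>\<^sup>+\<eta>. ennreal ((norm (q x \<eta>))\<^sup>2) \<partial>lborel) * indicator {0<..} x \<le> ennreal (P\<^sup>2 * (hi - lo)) * (ennreal ((b x)\<^sup>2) * indicator {0<..} x)"
    proof (cases "x > 0")
      case True
      have "(\<integral>\<^sup>+\<eta>. ennreal ((norm (q x \<eta>))\<^sup>2) \<partial>lborel) \<le> (\<integral>\<^sup>+\<eta>. ennreal ((P * b x)\<^sup>2) * indicator {lo..hi} \<eta> \<partial>lborel)"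
      proof (rule nn_integral_mono)
        fix \<eta> show "ennreal ((norm (q x \<eta>))\<^sup>2) \<le> ennreal ((P * b x)\<^sup>2) * indicator {lo..hi} \<eta>"
          using qb2[OF True, of \<eta>] by (cases "\<eta> \<in> {lo..hi}") (auto intro: ennreal_leI)
      qed
      also have "\<dots> = ennreal ((P * b x)\<^sup>2) * ennreal (hi - lo)"
        by (subst nn_integral_cmult_indicator) (use lo in auto)
      also have "\<dots> = ennreal (P\<^sup>2 * (hi - lo)) * ennreal ((b x)\<^sup>2)"
        using lo by (simp add: ennreal_mult[symmetric] power_mult_distrib mult_ac)
      finally show ?thesis using True by simp
    qed simp
  qed simp
  also have "\<dots> = ennreal (2 * pi) * (ennreal (P\<^sup>2 * (hi - lo)) * (\<integral>\<^sup>+x. ennreal ((b x)\<^sup>2) * indicator {0<..} x \<partial>lborel))"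
    by (subst nn_integral_cmult) auto
  also have "\<dots> \<le> ennreal (2 * pi) * (ennreal (P\<^sup>2 * (hi - lo)) * ennreal B)"
    by (intro mult_left_mono bI) auto
  also have "\<dots> = ennreal (2 * pi * (hi - lo) * P\<^sup>2 * B)"
    using lo bI(2) by (simp add: ennreal_mult[symmetric] mult_ac)
  finally show ?thesis .
qed

lemma airy_decay_from:
  assumes "\<omega> \<ge> 0"
  shows "\<exists>C\<ge>0. \<forall>s\<ge>-\<omega>. \<bar>airy s\<bar> \<le> C * exp (- s) \<and> \<bar>airy' s\<bar> \<le> C * exp (- s)"
proof -
  obtain C where C: "C > 0" "\<And>s. s \<ge> 0 \<Longrightarrow> \<bar>airy s\<bar> \<le> C * exp (- s) \<and> \<bar>airy' s\<bar> \<le> C * exp (- s)"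
    using airy_decay by blast
  have "compact (airy ` {-\<omega>..0})" "compact (airy' ` {-\<omega>..0})"
    by (intro compact_continuous_image continuous_on_subset[OF airy_continuous] continuous_on_subset[OF airy'_continuous]; simp)+
  then obtain K1 K2 where K: "\<forall>y\<in>airy ` {-\<omega>..0}. norm y \<le> K1" "\<forall>y\<in>airy' ` {-\<omega>..0}. norm y \<le> K2"
    by (meson compact_imp_bounded bounded_iff)
  define D where "D = C + \<bar>K1\<bar> + \<bar>K2\<bar>"
  have "\<bar>airy s\<bar> \<le> D * exp (- s) \<and> \<bar>airy' s\<bar> \<le> D * exp (- s)" if s: "s \<ge> - \<omega>" for s
  proof (cases "s \<ge> 0")
    case True
    have "C * exp (- s) \<le> D * exp (- s)" by (intro mult_right_mono) (auto simp: D_def)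
    then show ?thesis using C(2)[OF True] by linarith
  next
    case False
    then have "norm (airy s) \<le> K1" "norm (airy' s) \<le> K2" using K s by auto
    then have "\<bar>airy s\<bar> \<le> D * 1" "\<bar>airy' s\<bar> \<le> D * 1" using C(1) by (auto simp: D_def)
    moreover have "D * 1 \<le> D * exp (- s)" using False C(1) by (intro mult_left_mono) (auto simp: D_def)
    ultimately show ?thesis by linarith
  qed
  moreover have "D \<ge> 0" using C(1) by (simp add: D_def)
  ultimately show ?thesis by blast
qed

lemma exp_square_integral:
  assumes "k > 0"
  shows "(\<integral>\<^sup>+x. ennreal ((K * exp (- (k * x)))\<^sup>2) * indicator {0<..} x \<partial>lborel) \<le> ennreal (K\<^sup>2 / (2 * k))"
proof -
  have "(\<integral>\<^sup>+x. ennreal ((K * exp (- (k * x)))\<^sup>2) * indicator {0<..} x \<partial>lborel)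
     \<le> (\<integral>\<^sup>+x. ennreal (K\<^sup>2 * exp (- (2 * k * x))) * indicator {0..} x \<partial>lborel)"
    by (intro nn_integral_mono) (auto simp: indicator_def power_mult_distrib exp_double[symmetric] mult.assoc)
  also have "\<dots> = ennreal (0 - (- (K\<^sup>2 / (2 * k)) * exp (- (2 * k * 0))))"
  proof (rule nn_integral_FTC_atLeast)
    show "((\<lambda>x. - (K\<^sup>2 / (2 * k)) * exp (- (2 * k * x))) has_real_derivative K\<^sup>2 * exp (- (2 * k * x))) (at x)" for x
      using assms by (auto intro!: derivative_eq_intros)
    have "LIM x at_top. 2 * k * x :> at_top"
      using assms by (intro filterlim_tendsto_pos_mult_at_top[OF tendsto_const]) (auto simp: filterlim_ident)
    then have "((\<lambda>x. exp (- (2 * k * x))) \<longlongrightarrow> 0) at_top"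
      by (intro filterlim_compose[OF exp_at_bot] filterlim_compose[OF filterlim_uminus_at_bot_at_top])
    then show "((\<lambda>x. - (K\<^sup>2 / (2 * k)) * exp (- (2 * k * x))) \<longlongrightarrow> 0) at_top"
      by (rule tendsto_mult_right_zero)
  qed auto
  finally show ?thesis by simp
qed

lemma mode_L2_weighted:
  assumes lo: "0 < lo" "lo \<le> hi" and om: "\<omega> \<ge> 0" and a: "a = airy \<or> a = airy'"
    and wm: "w \<in> borel_measurable borel" and w: "\<And>x. x > 0 \<Longrightarrow> \<bar>w x\<bar> \<le> 1 + x"
  shows "\<exists>K\<ge>0. \<forall>p P. continuous_on {lo..hi} p \<longrightarrow> (\<forall>\<eta>\<in>{lo..hi}. norm (p \<eta>) \<le> P) \<longrightarrow>
     (\<lambda>z. of_real (w (fst z)) * mode_int a \<omega> lo hi p z) \<in> L2_Omega \<and>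
     n2 (\<lambda>z. of_real (w (fst z)) * mode_int a \<omega> lo hi p z) \<le> K * P\<^sup>2"
proof -
  have ac: "continuous_on UNIV a" using a airy_continuous airy'_continuous by auto
  obtain C where C: "C \<ge> 0" "\<And>s. s \<ge> -\<omega> \<Longrightarrow> \<bar>a s\<bar> \<le> C * exp (- s)"
    using airy_decay_from[OF om] a by blast
  define k where "k = lo powr (2/3)"
  have k: "k > 0" using lo by (simp add: k_def)
  define K where "K = C * exp \<omega> * (1 + 2 / k)"
  have wb: "\<bar>w x * a (\<eta> powr (2/3) * x - \<omega>)\<bar> \<le> K * exp (- (k / 2 * x))" if x: "x > 0" and e: "\<eta> \<in> {lo..hi}" for x \<eta>
  proof -
    have "k \<le> \<eta> powr (2/3)" unfolding k_def using e lo by (intro powr_mono2) auto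
    then have kx: "k * x \<le> \<eta> powr (2/3) * x" using x by (intro mult_right_mono) auto
    have "\<eta> powr (2/3) * x - \<omega> \<ge> - \<omega>" using x by simp
    then have "\<bar>a (\<eta> powr (2/3) * x - \<omega>)\<bar> \<le> C * exp (- (\<eta> powr (2/3) * x - \<omega>))" by (rule C(2))
    also have "\<dots> \<le> C * exp (\<omega> - k * x)" using kx C(1) by (intro mult_left_mono) auto
    finally have A: "\<bar>a (\<eta> powr (2/3) * x - \<omega>)\<bar> \<le> C * exp (\<omega> - k * x)" .
    have "1 + x \<le> (1 + 2 / k) * (1 + k / 2 * x)" using k x by (simp add: field_simps)
    also have "\<dots> \<le> (1 + 2 / k) * exp (k / 2 * x)" using k by (intro mult_left_mono exp_ge_add_one_self) auto
    finally have W: "\<bar>w x\<bar> \<le> (1 + 2 / k) * exp (k / 2 * x)" using w[OF x] by linarith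
    have "\<bar>w x * a (\<eta> powr (2/3) * x - \<omega>)\<bar> \<le> ((1 + 2 / k) * exp (k / 2 * x)) * (C * exp (\<omega> - k * x))"
      unfolding abs_mult using A W k C(1) by (intro mult_mono) auto
    also have "\<dots> = C * (1 + 2 / k) * (exp (k / 2 * x) * exp (\<omega> - k * x))" by (simp only: mult_ac)
    also have "exp (k / 2 * x) * exp (\<omega> - k * x) = exp \<omega> * exp (- (k / 2 * x))"
      by (simp add: mult_exp_exp field_simps)
    finally show ?thesis by (simp add: K_def mult_ac)
  qed
  define B where "B = K\<^sup>2 / (2 * (k / 2))"
  have B: "(\<integral>\<^sup>+x. ennreal ((K * exp (- (k / 2 * x)))\<^sup>2) * indicator {0<..} x \<partial>lborel) \<le> ennreal B" "B \<ge> 0"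
    unfolding B_def using exp_square_integral[of "k / 2" K] k by auto
  have main: "(\<lambda>z. of_real (w (fst z)) * mode_int a \<omega> lo hi p z) \<in> L2_Omega \<and>
     n2 (\<lambda>z. of_real (w (fst z)) * mode_int a \<omega> lo hi p z) \<le> (2 * pi * (hi - lo) * B) * P\<^sup>2"
    if p: "continuous_on {lo..hi} p" and P: "\<forall>\<eta>\<in>{lo..hi}. norm (p \<eta>) \<le> P" for p P
  proof -
    have i: "(\<integral>\<^sup>+z. ennreal ((norm (of_real (w (fst z)) * mode_int a \<omega> lo hi p z))\<^sup>2) \<partial>M\<Omega>) \<le> ennreal (2 * pi * (hi - lo) * P\<^sup>2 * B)"
      by (rule mode_int_weighted_bound[OF lo ac p wm _ _ wb B]) (use P in auto)
    have c: "2 * pi * (hi - lo) * P\<^sup>2 * B \<ge> 0" using lo B(2) by simp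
    have m: "(\<lambda>z. of_real (w (fst z)) * mode_int a \<omega> lo hi p z) \<in> borel_measurable M\<Omega>"
    proof (rule measurable_M\<Omega>)
      have "(\<lambda>z::real\<times>real. w (fst z)) \<in> borel_measurable borel"
        by (rule measurable_compose[OF _ wm]) (intro borel_measurable_continuous_onI continuous_intros)
      then have "(\<lambda>z::real\<times>real. complex_of_real (w (fst z))) \<in> borel_measurable borel"
        by (rule measurable_compose) (intro borel_measurable_continuous_onI continuous_intros)
      then show "(\<lambda>z. of_real (w (fst z)) * mode_int a \<omega> lo hi p z) \<in> borel_measurable borel"
        by (intro borel_measurable_times borel_measurable_continuous_onI[OF mode_int_continuous[OF lo(1) ac p]])
    qed
    show ?thesis using L2_OmegaI_bound(1)[OF m i] L2_OmegaI_bound(2)[OF m i c] by (simp add: mult_ac)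
  qed
  have "2 * pi * (hi - lo) * B \<ge> 0" using lo B(2) by simp
  then show ?thesis using main by blast
qed

lemma mode_L2:
  assumes lo: "0 < lo" "lo \<le> hi" and om: "\<omega> \<ge> 0" and a: "a = airy \<or> a = airy'"
  shows "\<exists>K\<ge>0. \<forall>p P. continuous_on {lo..hi} p \<longrightarrow> (\<forall>\<eta>\<in>{lo..hi}. norm (p \<eta>) \<le> P) \<longrightarrow>
     mode_int a \<omega> lo hi p \<in> L2_Omega \<and> n2 (mode_int a \<omega> lo hi p) \<le> K * P\<^sup>2"
  using mode_L2_weighted[OF lo om a, of "\<lambda>_. 1"] by simp

lemma continuous_Icc_bounded:
  fixes p :: "real \<Rightarrow> complex"
  assumes "continuous_on {lo..hi} p"
  obtains P where "P \<ge> 0" "\<forall>\<eta>\<in>{lo..hi}. norm (p \<eta>) \<le> P"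
proof -
  have "compact (p ` {lo..hi})" by (intro compact_continuous_image assms) simp
  then obtain P where P: "\<forall>y\<in>p ` {lo..hi}. norm y \<le> P" using compact_imp_bounded bounded_iff by blast
  have "\<forall>\<eta>\<in>{lo..hi}. norm (p \<eta>) \<le> max P 0" using P by (auto intro: max.coboundedI1)
  then show ?thesis by (rule that[of "max P 0", rotated]) simp
qed

lemma mode_in_L2:
  assumes lo: "0 < lo" "lo \<le> hi" and om: "\<omega> \<ge> 0" and p: "continuous_on {lo..hi} p"
  shows "mode_int airy \<omega> lo hi p \<in> L2_Omega" "mode_int airy' \<omega> lo hi p \<in> L2_Omega"
    "(\<lambda>z. of_real (sqrt (1 + fst z)) * mode_int airy \<omega> lo hi p z) \<in> L2_Omega"
proof -
  obtain P where P: "\<forall>\<eta>\<in>{lo..hi}. norm (p \<eta>) \<le> P" using continuous_Icc_bounded[OF p] by blast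
  show "mode_int airy \<omega> lo hi p \<in> L2_Omega" "mode_int airy' \<omega> lo hi p \<in> L2_Omega"
    using mode_L2[OF lo om, of airy] mode_L2[OF lo om, of airy'] p P by blast+
  have s: "\<bar>sqrt (1 + x)\<bar> \<le> 1 + x" if "x > 0" for x
  proof -
    have "sqrt (1 + x) * 1 \<le> sqrt (1 + x) * sqrt (1 + x)" using that by (intro mult_left_mono) auto
    then show ?thesis using that by simp
  qed
  have "(\<lambda>x. sqrt (1 + x)) \<in> borel_measurable borel" by measurable
  from mode_L2_weighted[OF lo om _ this s, of airy] p P
  show "(\<lambda>z. of_real (sqrt (1 + fst z)) * mode_int airy \<omega> lo hi p z) \<in> L2_Omega" by blast
qed

text \<open>Because the profile vanishes at \<open>- \<omega>\<close>, the mode is \<open>O(x)\<close> near the boundary. The integral of \<open>x^2\<close> over a strip of width \<open>1/N\<close>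
is \<open>O(N^(-3))\<close>, which beats the factor \<open>N^2\<close>.\<close>

lemma mode_near_boundary:
  assumes lo: "0 < lo" "lo \<le> hi" and om: "\<omega> \<ge> 0" and z: "airy (- \<omega>) = 0" and p: "continuous_on {lo..hi} p"
  shows "(\<lambda>n. (real (Suc n))\<^sup>2 * n2 (\<lambda>z. indicator (near_boundary n) z * mode_int airy \<omega> lo hi p z)) \<longlonglongrightarrow> 0"
proof -
  obtain P where P: "\<forall>\<eta>\<in>{lo..hi}. norm (p \<eta>) \<le> P" using continuous_Icc_bounded[OF p] by blast
  define S where "S = hi powr (2/3)"
  have "compact (airy' ` {-\<omega>..S - \<omega>})" by (intro compact_continuous_image continuous_on_subset[OF airy'_continuous]) auto
  then obtain M where M: "\<forall>y\<in>airy' ` {-\<omega>..S - \<omega>}. norm y \<le> M" using compact_imp_bounded bounded_iff by blast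
  have S: "S \<ge> 0" by (simp add: S_def)
  have M0: "M \<ge> 0" using M S by (auto intro: order_trans[OF norm_ge_zero[of "airy' (- \<omega>)"]])
  \<comment> \<open>the mean value theorem, starting from the zero \<open>- \<omega>\<close>\<close>
  have lip: "\<bar>airy (\<eta> powr (2/3) * x - \<omega>)\<bar> \<le> M * S * x" if x: "0 < x" "x \<le> 1" and e: "\<eta> \<in> {lo..hi}" for x \<eta>
  proof -
    let ?t = "\<eta> powr (2/3) * x"
    have eS: "\<eta> powr (2/3) \<le> S" unfolding S_def using e lo by (intro powr_mono2) auto
    have tS: "?t \<le> S * x" using eS x by (intro mult_right_mono) auto
    have "S * x \<le> S * 1" using x S by (intro mult_left_mono) auto
    then have tS1: "?t \<le> S" using tS by linarith
    have t0: "?t > 0" using x e lo by simp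
    then have lt: "- \<omega> < ?t - \<omega>" by simp
    obtain \<xi> where xi: "- \<omega> < \<xi>" "\<xi> < ?t - \<omega>" "airy (?t - \<omega>) - airy (- \<omega>) = (?t - \<omega> - (- \<omega>)) * airy' \<xi>"
      using MVT2[OF lt, of airy airy'] airy_deriv by blast
    have "\<bar>airy' \<xi>\<bar> \<le> M" using M xi tS1 by auto
    then have "?t * \<bar>airy' \<xi>\<bar> \<le> (S * x) * M" using tS t0 M0 S x by (intro mult_mono) auto
    then show ?thesis using xi z t0 x by (simp add: abs_mult mult_ac)
  qed
  define C where "C = 2 * pi * (hi - lo) * P\<^sup>2 * (M * S)\<^sup>2"
  have C0: "C \<ge> 0" using lo by (simp add: C_def)
  have bd: "n2 (\<lambda>z. indicator (near_boundary n) z * mode_int airy \<omega> lo hi p z) \<le> C * (1 / real (Suc n)) ^ 3" for n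
  proof -
    define d where "d = 1 / real (Suc n)"
    have d: "0 < d" "d \<le> 1" by (auto simp: d_def)
    define w where "w = (\<lambda>x. indicator {..d} x :: real)"
    define b where "b = (\<lambda>x. M * S * d * indicator {0..d} x :: real)"
    have wm: "w \<in> borel_measurable borel" and bm: "b \<in> borel_measurable borel" by (simp_all add: w_def b_def)
    have wb: "\<bar>w x * airy (\<eta> powr (2/3) * x - \<omega>)\<bar> \<le> b x" if x: "x > 0" and e: "\<eta> \<in> {lo..hi}" for x \<eta>
    proof (cases "x \<le> d")
      case True
      have "M * S * x \<le> M * S * d" using True M0 S by (intro mult_left_mono) auto
      then show ?thesis using lip[OF x _ e] True d x by (simp add: w_def b_def)
    qed (simp add: w_def b_def)
    have bI: "(\<integral>\<^sup>+x. ennreal ((b x)\<^sup>2) * indicator {0<..} x \<partial>lborel) \<le> ennreal ((M * S)\<^sup>2 * d ^ 3)"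
    proof -
      have "(\<integral>\<^sup>+x. ennreal ((b x)\<^sup>2) * indicator {0<..} x \<partial>lborel) \<le> (\<integral>\<^sup>+x. ennreal ((M * S * d)\<^sup>2) * indicator {0..d} x \<partial>lborel)"
        by (intro nn_integral_mono) (auto simp: b_def indicator_def)
      also have "\<dots> = ennreal ((M * S * d)\<^sup>2) * ennreal d" using d by (subst nn_integral_cmult_indicator) auto
      also have "\<dots> = ennreal ((M * S * d)\<^sup>2 * d)" using d by (intro ennreal_mult[symmetric]) auto
      also have "(M * S * d)\<^sup>2 * d = (M * S)\<^sup>2 * d ^ 3"
        by (simp add: power_mult_distrib power3_eq_cube power2_eq_square mult_ac)
      finally show ?thesis .
    qed
    have B0: "(M * S)\<^sup>2 * d ^ 3 \<ge> 0" using d by simp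
    have e: "(\<lambda>z. indicator (near_boundary n) z * mode_int airy \<omega> lo hi p z) = (\<lambda>z. of_real (w (fst z)) * mode_int airy \<omega> lo hi p z)"
      by (auto simp: near_boundary_def w_def d_def indicator_def)
    have "(\<integral>\<^sup>+z. ennreal ((norm (of_real (w (fst z)) * mode_int airy \<omega> lo hi p z))\<^sup>2) \<partial>M\<Omega>) \<le> ennreal (2 * pi * (hi - lo) * P\<^sup>2 * ((M * S)\<^sup>2 * d ^ 3))"
      by (rule mode_int_weighted_bound[OF lo airy_continuous p wm bm _ wb bI B0]) (use P in auto)
    moreover have "(\<lambda>z. of_real (w (fst z)) * mode_int airy \<omega> lo hi p z) \<in> borel_measurable M\<Omega>"
      unfolding e[symmetric]
      by (intro borel_measurable_times L2_measurable[OF mode_in_L2(1)[OF lo om p]] measurable_M\<Omega>) measurable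
    moreover have "2 * pi * (hi - lo) * P\<^sup>2 * ((M * S)\<^sup>2 * d ^ 3) \<ge> 0" using lo d by simp
    ultimately have "n2 (\<lambda>z. of_real (w (fst z)) * mode_int airy \<omega> lo hi p z) \<le> 2 * pi * (hi - lo) * P\<^sup>2 * ((M * S)\<^sup>2 * d ^ 3)"
      by (intro L2_OmegaI_bound(2))
    then show ?thesis unfolding e C_def d_def by (simp only: mult.assoc)
  qed
  have "(\<lambda>n. C * inverse (real (Suc n))) \<longlonglongrightarrow> C * 0" by (intro tendsto_intros LIMSEQ_inverse_real_of_nat)
  then have lim: "(\<lambda>n. C * inverse (real (Suc n))) \<longlonglongrightarrow> 0" by simp
  show ?thesis
  proof (rule tendsto_sandwich[OF _ _ tendsto_const lim])
    show "\<forall>\<^sub>F n in sequentially. 0 \<le> (real (Suc n))\<^sup>2 * n2 (\<lambda>z. indicator (near_boundary n) z * mode_int airy \<omega> lo hi p z)"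
      by (intro always_eventually allI mult_nonneg_nonneg n2_nonneg) simp
    show "\<forall>\<^sub>F n in sequentially. (real (Suc n))\<^sup>2 * n2 (\<lambda>z. indicator (near_boundary n) z * mode_int airy \<omega> lo hi p z) \<le> C * inverse (real (Suc n))"
    proof (intro always_eventually allI)
      fix n
      have "(real (Suc n))\<^sup>2 * n2 (\<lambda>z. indicator (near_boundary n) z * mode_int airy \<omega> lo hi p z) \<le> (real (Suc n))\<^sup>2 * (C * (1 / real (Suc n)) ^ 3)"
        by (intro mult_left_mono bd) simp
      also have "\<dots> = C * inverse (real (Suc n))"
      proof -
        have "x\<^sup>2 * (C * (1 / x) ^ 3) = C * inverse x" if "x \<noteq> 0" for x :: real
          using that by (simp add: power3_eq_cube power2_eq_square field_simps)
        then show ?thesis by (metis of_nat_neq_0)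
      qed
      finally show "(real (Suc n))\<^sup>2 * n2 (\<lambda>z. indicator (near_boundary n) z * mode_int airy \<omega> lo hi p z) \<le> C * inverse (real (Suc n))" .
    qed
  qed
qed

lemma freq_continuous: "0 < lo \<Longrightarrow> continuous_on {lo..hi} (freq \<omega>)"
  unfolding freq_def[abs_def] by (intro continuous_intros) auto

text \<open>The operator acts on modes by multiplying the amplitude with the square of the frequency.\<close>

lemma mode_green:
  fixes s :: "real \<Rightarrow> real"
  assumes v: "neg_Friedlander_D v Av"
    and step: "smooth s" "\<And>x. x \<le> 1/2 \<Longrightarrow> s x = 0" "\<And>x. x \<ge> 1 \<Longrightarrow> s x = 1"
    and lo: "0 < lo" "lo \<le> hi" and om: "\<omega> \<ge> 0" and z: "airy (- \<omega>) = 0" and p: "continuous_on {lo..hi} p"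
  shows "L2_inner (mode_int airy \<omega> lo hi (\<lambda>\<eta>. of_real ((freq \<omega> \<eta>)\<^sup>2) * p \<eta>)) v = L2_inner (mode_int airy \<omega> lo hi p) Av"
proof -
  let ?f = "mode_int airy \<omega> lo hi p"
  have pA: "continuous_on {lo..hi} (\<lambda>\<eta>. of_real (\<eta> powr (2/3)) * p \<eta>)"
    by (intro continuous_on_mult powr_continuous lo p)
  have pB: "continuous_on {lo..hi} (\<lambda>\<eta>. \<i> * of_real \<eta> * p \<eta>)" by (intro continuous_intros p)
  have pF: "continuous_on {lo..hi} (\<lambda>\<eta>. of_real ((freq \<omega> \<eta>)\<^sup>2) * p \<eta>)"
    by (intro continuous_intros p freq_continuous lo)
  have F: "Friedlander ?f = (\<lambda>z. - mode_int airy \<omega> lo hi (\<lambda>\<eta>. of_real ((freq \<omega> \<eta>)\<^sup>2) * p \<eta>) z)"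
    by (rule ext, rule Friedlander_mode[OF lo(1) om p])
  have "L2_inner (\<lambda>z. - Friedlander ?f z) v = L2_inner ?f Av"
  proof (rule green_identity[OF v step mode_int_smooth[OF lo(1) p] mode_in_L2(1)[OF lo om p]])
    show "dx ?f \<in> L2_Omega" unfolding mode_int_partials[OF lo(1) p] by (rule mode_in_L2(2)[OF lo om pA])
    show "wdy ?f \<in> L2_Omega" unfolding mode_int_partials[OF lo(1) p] by (rule mode_in_L2(3)[OF lo om pB])
    show "Friedlander ?f \<in> L2_Omega" unfolding F by (rule L2_minus[OF mode_in_L2(1)[OF lo om pF]])
    show "(\<lambda>z. of_real (sqrt (1 + fst z)) * ?f z) \<in> L2_Omega" by (rule mode_in_L2(3)[OF lo om p])
  qed (use mode_near_boundary[OF lo om z p] in auto)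
  then show ?thesis unfolding F by simp
qed

section \<open>Gallery modes as solutions of the wave equation\<close>

lemma Lr2_tendsto_0_iff:
  assumes "\<And>s. g s \<in> L2_Omega"
  shows "((\<lambda>s. Lr_norm 2 (g s)) \<longlongrightarrow> 0) F \<longleftrightarrow> ((\<lambda>s. n2 (g s)) \<longlongrightarrow> 0) F"
proof -
  have "((\<lambda>s. ennreal (sqrt (n2 (g s)))) \<longlongrightarrow> 0) F \<longleftrightarrow> ((\<lambda>s. sqrt (n2 (g s))) \<longlongrightarrow> 0) F"
    using tendsto_ennreal_iff[of "\<lambda>s. sqrt (n2 (g s))" F 0] by (simp add: n2_nonneg)
  also have "\<dots> \<longleftrightarrow> ((\<lambda>s. n2 (g s)) \<longlongrightarrow> 0) F"
  proof
    assume "((\<lambda>s. sqrt (n2 (g s))) \<longlongrightarrow> 0) F"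
    from tendsto_power[OF this, of 2] show "((\<lambda>s. n2 (g s)) \<longlongrightarrow> 0) F" by (simp add: n2_nonneg)
  next
    assume "((\<lambda>s. n2 (g s)) \<longlongrightarrow> 0) F"
    from tendsto_real_sqrt[OF this] show "((\<lambda>s. sqrt (n2 (g s))) \<longlongrightarrow> 0) F" by simp
  qed
  finally show ?thesis by (simp add: Lr2_n2[OF assms])
qed

text \<open>Quadratic Taylor remainders give derivatives of \<open>L\<^sup>2\<close>-valued functions tested against a fixed element without differentiating under
the integral.\<close>

lemma quadratic_remainder_derivative:
  fixes F :: "real \<Rightarrow> complex"
  assumes "\<And>s. norm (F s - F t - of_real (s - t) * F') \<le> B * (s - t)\<^sup>2"
  shows "(F has_vector_derivative F') (at t)"
  unfolding has_vector_derivative_def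
proof (rule has_derivativeI_sandwich[of 1])
  show "bounded_linear (\<lambda>x. x *\<^sub>R F')" by (rule bounded_linear_scaleR_left)
  fix s assume s: "s \<noteq> t"
  have "norm (F s - F t - (s - t) *\<^sub>R F') \<le> B * (s - t)\<^sup>2" using assms[of s] by (simp add: scaleR_conv_of_real)
  then have "norm (F s - F t - (s - t) *\<^sub>R F') / norm (s - t) \<le> B * (s - t)\<^sup>2 / norm (s - t)"
    by (intro divide_right_mono) auto
  also have "(s - t)\<^sup>2 = \<bar>s - t\<bar> * \<bar>s - t\<bar>" by (simp add: power2_eq_square)
  also have "B * (\<bar>s - t\<bar> * \<bar>s - t\<bar>) / norm (s - t) = B * \<bar>s - t\<bar>"
  proof -
    have "B * (a * a) / a = B * a" if "a \<noteq> 0" for a :: real using that by simp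
    then show ?thesis unfolding real_norm_def using s by (metis abs_eq_0_iff eq_iff_diff_eq_0)
  qed
  finally show "norm (F s - F t - (s - t) *\<^sub>R F') / norm (s - t) \<le> B * \<bar>s - t\<bar>" .
next
  have "((\<lambda>s. B * \<bar>s - t\<bar>) \<longlongrightarrow> B * \<bar>t - t\<bar>) (at t)" by (intro tendsto_intros)
  then show "((\<lambda>s. B * \<bar>s - t\<bar>) \<longlongrightarrow> 0) (at t)" by simp
qed simp

lemma iexp_remainders:
  "norm (exp (\<i> * of_real (s * m)) - exp (\<i> * of_real (t * m))) \<le> \<bar>s - t\<bar> * \<bar>m\<bar>"
  "norm (exp (\<i> * of_real (s * m)) - exp (\<i> * of_real (t * m)) - of_real (s - t) * (\<i> * of_real m * exp (\<i> * of_real (t * m)))) \<le> (s - t)\<^sup>2 * m\<^sup>2"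
proof -
  define x where "x = (s - t) * m"
  have e: "exp (\<i> * of_real (s * m)) = exp (\<i> * of_real (t * m)) * exp (\<i> * of_real x)"
    by (simp add: mult_exp_exp x_def algebra_simps)
  have "norm (exp (\<i> * of_real (s * m)) - exp (\<i> * of_real (t * m))) = norm (exp (\<i> * of_real (t * m)) * (exp (\<i> * of_real x) - 1))"
    unfolding e by (simp add: algebra_simps)
  also have "\<dots> = norm (exp (\<i> * of_real x) - 1)" by (simp only: norm_mult iexp_norm mult_1)
  also have "\<dots> \<le> \<bar>x\<bar>" using iexp_approx1[of x 0] by simp
  finally show "norm (exp (\<i> * of_real (s * m)) - exp (\<i> * of_real (t * m))) \<le> \<bar>s - t\<bar> * \<bar>m\<bar>" by (simp add: x_def abs_mult)
  have "norm (exp (\<i> * of_real (s * m)) - exp (\<i> * of_real (t * m)) - of_real (s - t) * (\<i> * of_real m * exp (\<i> * of_real (t * m))))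
     = norm (exp (\<i> * of_real (t * m)) * (exp (\<i> * of_real x) - (1 + \<i> * of_real x)))"
    unfolding e by (simp add: x_def algebra_simps)
  also have "\<dots> = norm (exp (\<i> * of_real x) - (1 + \<i> * of_real x))" by (simp only: norm_mult iexp_norm mult_1)
  also have "\<dots> \<le> \<bar>x\<bar> ^ 2 / 2" using iexp_approx1[of x 1] by (simp add: numeral_2_eq_2)
  also have "\<dots> \<le> x\<^sup>2" by simp
  finally show "norm (exp (\<i> * of_real (s * m)) - exp (\<i> * of_real (t * m)) - of_real (s - t) * (\<i> * of_real m * exp (\<i> * of_real (t * m)))) \<le> (s - t)\<^sup>2 * m\<^sup>2"
    by (simp add: x_def power_mult_distrib)
qed

text \<open>The amplitude \<open>c\<close> is \<open>1\<close> for the wave itself and \<open>\<i>\<close> times the frequency for its time derivative.\<close>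

definition mode_wave :: "real \<Rightarrow> real \<Rightarrow> real \<Rightarrow> (real \<Rightarrow> complex) \<Rightarrow> real \<Rightarrow> real \<times> real \<Rightarrow> complex" where
  "mode_wave \<omega> lo hi c t = mode_int airy \<omega> lo hi (\<lambda>\<eta>. c \<eta> * exp (\<i> * of_real (t * freq \<omega> \<eta>)))"

lemma mode_wave_profile_continuous:
  assumes "0 < lo" "continuous_on {lo..hi} c"
  shows "continuous_on {lo..hi} (\<lambda>\<eta>. c \<eta> * exp (\<i> * of_real (t * freq \<omega> \<eta>)))"
  by (intro continuous_intros assms freq_continuous)

lemma mode_wave_time_derivative:
  assumes lo: "0 < lo" "lo \<le> hi" and om: "\<omega> \<ge> 0" and c: "continuous_on {lo..hi} c" and v: "v \<in> L2_Omega"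
  shows "((\<lambda>s. L2_inner (mode_wave \<omega> lo hi c s) v) has_vector_derivative
     L2_inner (mode_wave \<omega> lo hi (\<lambda>\<eta>. \<i> * of_real (freq \<omega> \<eta>) * c \<eta>) t) v) (at t)"
proof -
  obtain K where K: "K \<ge> 0" "\<And>p P. continuous_on {lo..hi} p \<Longrightarrow> (\<forall>\<eta>\<in>{lo..hi}. norm (p \<eta>) \<le> P) \<Longrightarrow>
     mode_int airy \<omega> lo hi p \<in> L2_Omega \<and> n2 (mode_int airy \<omega> lo hi p) \<le> K * P\<^sup>2"
    using mode_L2[OF lo om, of airy] by blast
  let ?c' = "\<lambda>\<eta>. \<i> * of_real (freq \<omega> \<eta>) * c \<eta>"
  have fc: "continuous_on {lo..hi} (\<lambda>\<eta>. c \<eta> * of_real ((freq \<omega> \<eta>)\<^sup>2))" by (intro continuous_intros c freq_continuous lo)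
  have c': "continuous_on {lo..hi} ?c'" by (intro continuous_intros c freq_continuous lo)
  obtain P where P: "P \<ge> 0" "\<forall>\<eta>\<in>{lo..hi}. norm (c \<eta> * of_real ((freq \<omega> \<eta>)\<^sup>2)) \<le> P" using continuous_Icc_bounded[OF fc] by blast
  let ?E = "\<lambda>s \<eta>. c \<eta> * exp (\<i> * of_real (s * freq \<omega> \<eta>))"
  let ?E' = "\<lambda>\<eta>. ?c' \<eta> * exp (\<i> * of_real (t * freq \<omega> \<eta>))"
  have Ec: "continuous_on {lo..hi} (?E s)" for s by (rule mode_wave_profile_continuous[OF lo(1) c])
  have E'c: "continuous_on {lo..hi} ?E'" by (rule mode_wave_profile_continuous[OF lo(1) c'])
  have EL: "mode_int airy \<omega> lo hi (?E s) \<in> L2_Omega" for s by (rule mode_in_L2(1)[OF lo om Ec])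
  have E'L: "mode_int airy \<omega> lo hi ?E' \<in> L2_Omega" by (rule mode_in_L2(1)[OF lo om E'c])
  show ?thesis
  proof (rule quadratic_remainder_derivative)
    fix s
    define r where "r = (\<lambda>\<eta>. ?E s \<eta> + (- 1) * ?E t \<eta> + (- of_real (s - t)) * ?E' \<eta>)"
    have rc1: "continuous_on {lo..hi} (\<lambda>\<eta>. ?E s \<eta> + (- 1) * ?E t \<eta>)" "continuous_on {lo..hi} (\<lambda>\<eta>. (- 1) * ?E t \<eta>)"
      "continuous_on {lo..hi} (\<lambda>\<eta>. (- of_real (s - t)) * ?E' \<eta>)"
      by (intro continuous_on_add continuous_on_mult continuous_on_const Ec E'c)+
    have rc: "continuous_on {lo..hi} r" unfolding r_def by (rule continuous_on_add[OF rc1(1,3)])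
    have rb: "\<forall>\<eta>\<in>{lo..hi}. norm (r \<eta>) \<le> P * (s - t)\<^sup>2"
    proof
      fix \<eta> assume e: "\<eta> \<in> {lo..hi}"
      let ?m = "freq \<omega> \<eta>"
      have "r \<eta> = c \<eta> * (exp (\<i> * of_real (s * ?m)) - exp (\<i> * of_real (t * ?m)) - of_real (s - t) * (\<i> * of_real ?m * exp (\<i> * of_real (t * ?m))))"
        by (simp add: r_def algebra_simps)
      then have "norm (r \<eta>) \<le> norm (c \<eta>) * ((s - t)\<^sup>2 * ?m\<^sup>2)"
        using iexp_remainders(2)[of s ?m t] by (simp only: norm_mult) (intro mult_left_mono; simp)
      also have "\<dots> = norm (c \<eta> * of_real (?m\<^sup>2)) * (s - t)\<^sup>2" by (simp add: norm_mult del: of_real_power)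
      also have "\<dots> \<le> P * (s - t)\<^sup>2" using P(2) e by (intro mult_right_mono) auto
      finally show "norm (r \<eta>) \<le> P * (s - t)\<^sup>2" .
    qed
    have n: "n2 (mode_int airy \<omega> lo hi r) \<le> K * (P * (s - t)\<^sup>2)\<^sup>2" and rL: "mode_int airy \<omega> lo hi r \<in> L2_Omega"
      using K(2)[OF rc rb] by auto
    have split: "mode_int airy \<omega> lo hi r = (\<lambda>z. mode_int airy \<omega> lo hi (?E s) z - mode_int airy \<omega> lo hi (?E t) z - of_real (s - t) * mode_int airy \<omega> lo hi ?E' z)"
      unfolding r_def
      by (rule ext) (simp only: mode_int_add[OF lo(1) airy_continuous rc1(1,3)] mode_int_add[OF lo(1) airy_continuous Ec rc1(2)] mode_int_cmult, simp add: algebra_simps)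
    have "L2_inner (mode_int airy \<omega> lo hi r) v = L2_inner (mode_wave \<omega> lo hi c s) v - L2_inner (mode_wave \<omega> lo hi c t) v
        - of_real (s - t) * L2_inner (mode_wave \<omega> lo hi ?c' t) v"
      unfolding split mode_wave_def
      by (subst L2_inner_diff_left[OF L2_diff[OF EL EL] L2_cmult(1)[OF E'L] v], subst L2_inner_diff_left[OF EL EL v], subst L2_inner_cmult_left) simp
    then have "norm (L2_inner (mode_wave \<omega> lo hi c s) v - L2_inner (mode_wave \<omega> lo hi c t) v - of_real (s - t) * L2_inner (mode_wave \<omega> lo hi ?c' t) v)
       \<le> sqrt (n2 (mode_int airy \<omega> lo hi r)) * sqrt (n2 v)" using L2_inner_CS(2)[OF rL v] by simp
    also have "\<dots> \<le> (sqrt K * (P * (s - t)\<^sup>2)) * sqrt (n2 v)"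
    proof (rule mult_right_mono)
      have "sqrt (n2 (mode_int airy \<omega> lo hi r)) \<le> sqrt (K * (P * (s - t)\<^sup>2)\<^sup>2)" using n by simp
      also have "\<dots> = sqrt K * (P * (s - t)\<^sup>2)" using P(1) by (simp add: real_sqrt_mult)
      finally show "sqrt (n2 (mode_int airy \<omega> lo hi r)) \<le> sqrt K * (P * (s - t)\<^sup>2)" .
    qed (simp add: n2_nonneg)
    finally show "norm (L2_inner (mode_wave \<omega> lo hi c s) v - L2_inner (mode_wave \<omega> lo hi c t) v - of_real (s - t) * L2_inner (mode_wave \<omega> lo hi ?c' t) v)
       \<le> (sqrt K * P * sqrt (n2 v)) * (s - t)\<^sup>2" by (simp only: mult_ac)
  qed
qed

lemma id_M\<Omega>: "(\<lambda>z. z) \<in> measurable M\<Omega> borel"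
  by (rule measurable_M\<Omega>) simp

lemma pair_id_measurable: "(\<lambda>p::real \<times> (real \<times> real). p) \<in> measurable (lborel \<Otimes>\<^sub>M M\<Omega>) borel"
proof -
  have "(\<lambda>p. (fst p, snd p)) \<in> measurable (lborel \<Otimes>\<^sub>M M\<Omega>) (borel \<Otimes>\<^sub>M borel)"
  proof (rule measurable_Pair)
    show "fst \<in> measurable (lborel \<Otimes>\<^sub>M M\<Omega>) borel" using measurable_fst[of lborel M\<Omega>] by simp
    show "snd \<in> measurable (lborel \<Otimes>\<^sub>M M\<Omega>) borel" by (rule measurable_compose[OF measurable_snd id_M\<Omega>])
  qed
  then show ?thesis by (simp add: borel_prod)
qed

lemma mode_wave_jointly_continuous:
  assumes lo: "0 < lo" and c: "continuous_on {lo..hi} c"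
  shows "continuous_on UNIV (\<lambda>p. mode_wave \<omega> lo hi c (fst p) (snd p))"
proof -
  let ?f = "\<lambda>(p::real \<times> (real \<times> real)) \<eta>. c \<eta> * exp (\<i> * of_real (fst p * freq \<omega> \<eta>)) * exp (\<i> * of_real (snd (snd p) * \<eta>)) * of_real (airy (\<eta> powr (2/3) * fst (snd p) - \<omega>))"
  have 1: "continuous_on (UNIV \<times> {lo..hi}) (\<lambda>w::(real \<times> (real \<times> real)) \<times> real. c (snd w))"
    by (rule continuous_on_compose2[OF c]) (auto intro: continuous_intros)
  have 2: "continuous_on (UNIV \<times> {lo..hi}) (\<lambda>w::(real \<times> (real \<times> real)) \<times> real. freq \<omega> (snd w))"
    by (rule continuous_on_compose2[OF freq_continuous[OF lo]]) (auto intro: continuous_intros)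
  have 3: "continuous_on (UNIV \<times> {lo..hi}) (\<lambda>w::(real \<times> (real \<times> real)) \<times> real. airy (snd w powr (2/3) * fst (snd (fst w)) - \<omega>))"
    by (rule continuous_on_compose2[OF airy_continuous]) (use lo in \<open>auto intro!: continuous_intros\<close>)
  have "continuous_on (UNIV \<times> cbox lo hi) (\<lambda>(p, \<eta>). ?f p \<eta>)"
    unfolding split_beta cbox_interval by (intro continuous_intros 1 2 3)
  from integral_continuous_on_param[OF this] show ?thesis
    unfolding mode_wave_def mode_int_def cbox_interval .
qed

text \<open>Each time derivative multiplies the amplitude by \<open>\<i>\<close> times the frequency; after two of them Green's identity moves the
resulting factor to the other argument.\<close>

lemma mode_wave_solution:
  fixes s :: "real \<Rightarrow> real"
  assumes step: "smooth s" "\<And>x. x \<le> 1/2 \<Longrightarrow> s x = 0" "\<And>x. x \<ge> 1 \<Longrightarrow> s x = 1"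
    and lo: "0 < lo" "lo \<le> hi" and om: "\<omega> \<ge> 0" and z: "airy (- \<omega>) = 0"
  shows "wave_solution (mode_wave \<omega> lo hi (\<lambda>\<eta>. 1)) (mode_wave \<omega> lo hi (\<lambda>\<eta>. \<i> * of_real (freq \<omega> \<eta>)) 0)"
proof -
  let ?u = "mode_wave \<omega> lo hi (\<lambda>\<eta>. 1)"
  let ?c1 = "\<lambda>\<eta>. \<i> * complex_of_real (freq \<omega> \<eta>)"
  have one: "continuous_on {lo..hi} (\<lambda>\<eta>. 1 :: complex)" by (rule continuous_on_const)
  have c1: "continuous_on {lo..hi} ?c1" by (intro continuous_intros freq_continuous lo)
  have uL: "?u t \<in> L2_Omega" for t unfolding mode_wave_def
    by (rule mode_in_L2(1)[OF lo om mode_wave_profile_continuous[OF lo(1) one]])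
  have u1L: "mode_wave \<omega> lo hi ?c1 t \<in> L2_Omega" for t unfolding mode_wave_def
    by (rule mode_in_L2(1)[OF lo om mode_wave_profile_continuous[OF lo(1) c1]])
  have meas: "(\<lambda>(t, z). ?u t z) \<in> borel_measurable (lborel \<Otimes>\<^sub>M M\<Omega>)"
  proof -
    have "(\<lambda>p. ?u (fst p) (snd p)) \<in> borel_measurable borel"
      by (rule borel_measurable_continuous_onI[OF mode_wave_jointly_continuous[OF lo(1) one]])
    from measurable_compose[OF pair_id_measurable this] show ?thesis by (simp add: split_beta)
  qed
  have cont: "((\<lambda>s. Lr_norm 2 (\<lambda>z. ?u s z - ?u t z)) \<longlongrightarrow> 0) (at t)" for t
  proof (subst Lr2_tendsto_0_iff[OF L2_diff[OF uL uL]])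
    obtain K where K: "K \<ge> 0" "\<And>p P. continuous_on {lo..hi} p \<Longrightarrow> (\<forall>\<eta>\<in>{lo..hi}. norm (p \<eta>) \<le> P) \<Longrightarrow>
       mode_int airy \<omega> lo hi p \<in> L2_Omega \<and> n2 (mode_int airy \<omega> lo hi p) \<le> K * P\<^sup>2"
      using mode_L2[OF lo om, of airy] by blast
    obtain P where P: "P \<ge> 0" "\<forall>\<eta>\<in>{lo..hi}. norm (?c1 \<eta>) \<le> P" using continuous_Icc_bounded[OF c1] by blast
    have b: "n2 (\<lambda>z. ?u s z - ?u t z) \<le> K * (\<bar>s - t\<bar> * P)\<^sup>2" for s
    proof -
      let ?e = "\<lambda>s \<eta>. 1 * exp (\<i> * of_real (s * freq \<omega> \<eta>))"
      have ec: "continuous_on {lo..hi} (?e s)" for s by (rule mode_wave_profile_continuous[OF lo(1) one])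
      have mc: "continuous_on {lo..hi} (\<lambda>\<eta>. (- 1) * ?e t \<eta>)" by (intro continuous_on_mult continuous_on_const ec)
      have "(\<lambda>z. ?u s z - ?u t z) = mode_int airy \<omega> lo hi (\<lambda>\<eta>. ?e s \<eta> + (- 1) * ?e t \<eta>)"
        unfolding mode_wave_def by (rule ext) (simp only: mode_int_add[OF lo(1) airy_continuous ec mc] mode_int_cmult, simp)
      moreover have "\<forall>\<eta>\<in>{lo..hi}. norm (?e s \<eta> + (- 1) * ?e t \<eta>) \<le> \<bar>s - t\<bar> * P"
      proof
        fix \<eta> assume e: "\<eta> \<in> {lo..hi}"
        have "norm (?e s \<eta> + (- 1) * ?e t \<eta>) \<le> \<bar>s - t\<bar> * \<bar>freq \<omega> \<eta>\<bar>"
          using iexp_remainders(1)[of s "freq \<omega> \<eta>" t] by simp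
        also have "\<dots> \<le> \<bar>s - t\<bar> * P" using P(2) e by (intro mult_left_mono) (auto simp: norm_mult)
        finally show "norm (?e s \<eta> + (- 1) * ?e t \<eta>) \<le> \<bar>s - t\<bar> * P" .
      qed
      ultimately show ?thesis using K(2)[OF continuous_on_add[OF ec mc]] by simp
    qed
    have "((\<lambda>s. K * (\<bar>s - t\<bar> * P)\<^sup>2) \<longlongrightarrow> K * (\<bar>t - t\<bar> * P)\<^sup>2) (at t)" by (intro tendsto_intros)
    then have lim: "((\<lambda>s. K * (\<bar>s - t\<bar> * P)\<^sup>2) \<longlongrightarrow> 0) (at t)" by simp
    show "((\<lambda>s. n2 (\<lambda>z. ?u s z - ?u t z)) \<longlongrightarrow> 0) (at t)"
      by (rule tendsto_sandwich[OF _ _ tendsto_const lim]) (auto intro!: always_eventually simp: n2_nonneg b)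
  qed
  have eq: "\<exists>p :: real \<Rightarrow> complex.
           (\<forall>t. ((\<lambda>s. L2_inner (?u s) v) has_vector_derivative p t) (at t)) \<and>
           (\<forall>t. (p has_vector_derivative - L2_inner (?u t) Av) (at t)) \<and>
           p 0 = L2_inner (mode_wave \<omega> lo hi ?c1 0) v" if v: "neg_Friedlander_D v Av" for v Av
  proof (intro exI conjI allI)
    have vL: "v \<in> L2_Omega" using v by (simp add: neg_Friedlander_D_def H10_def)
    let ?p = "\<lambda>t. L2_inner (mode_wave \<omega> lo hi ?c1 t) v"
    show "((\<lambda>s. L2_inner (?u s) v) has_vector_derivative ?p t) (at t)" for t
      using mode_wave_time_derivative[OF lo om one vL, of t] by simp
    show "(?p has_vector_derivative - L2_inner (?u t) Av) (at t)" for t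
    proof -
      let ?e = "\<lambda>\<eta>. 1 * exp (\<i> * of_real (t * freq \<omega> \<eta>))"
      have ec: "continuous_on {lo..hi} ?e" by (rule mode_wave_profile_continuous[OF lo(1) one])
      have "mode_wave \<omega> lo hi (\<lambda>\<eta>. \<i> * of_real (freq \<omega> \<eta>) * ?c1 \<eta>) t = (\<lambda>z. (- 1) * mode_int airy \<omega> lo hi (\<lambda>\<eta>. of_real ((freq \<omega> \<eta>)\<^sup>2) * ?e \<eta>) z)"
        unfolding mode_wave_def mode_int_cmult[symmetric]
        by (rule ext, rule mode_int_cong) (simp add: power2_eq_square algebra_simps)
      then have "L2_inner (mode_wave \<omega> lo hi (\<lambda>\<eta>. \<i> * of_real (freq \<omega> \<eta>) * ?c1 \<eta>) t) v = - L2_inner (?u t) Av"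
        using mode_green[OF v step lo om z ec] by (simp only: L2_inner_cmult_left) (simp add: mode_wave_def)
      then show ?thesis using mode_wave_time_derivative[OF lo om c1 vL, of t] by simp
    qed
  qed simp
  show ?thesis unfolding wave_solution_def using meas u1L[of 0] uL cont eq by blast
qed

lemma wave_solution_add:
  assumes u: "wave_solution u u1" and w: "wave_solution w w1"
  shows "wave_solution (\<lambda>t z. u t z + w t z) (\<lambda>z. u1 z + w1 z)"
proof -
  have uL: "u t \<in> L2_Omega" and wL: "w t \<in> L2_Omega" and u1L: "u1 \<in> L2_Omega" and w1L: "w1 \<in> L2_Omega" for t
    using u w by (auto simp: wave_solution_def)
  have meas: "(\<lambda>(t, z). u t z + w t z) \<in> borel_measurable (lborel \<Otimes>\<^sub>M M\<Omega>)"
  proof -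
    have "(\<lambda>(t, z). u t z) \<in> borel_measurable (lborel \<Otimes>\<^sub>M M\<Omega>)" "(\<lambda>(t, z). w t z) \<in> borel_measurable (lborel \<Otimes>\<^sub>M M\<Omega>)"
      using u w by (auto simp: wave_solution_def)
    from borel_measurable_add[OF this] show ?thesis by (simp add: split_beta)
  qed
  have cont: "((\<lambda>s. Lr_norm 2 (\<lambda>z. (u s z + w s z) - (u t z + w t z))) \<longlongrightarrow> 0) (at t)" for t
  proof (subst Lr2_tendsto_0_iff[OF L2_diff[OF L2_add(1)[OF uL wL] L2_add(1)[OF uL wL]]])
    have a: "((\<lambda>s. n2 (\<lambda>z. u s z - u t z)) \<longlongrightarrow> 0) (at t)" "((\<lambda>s. n2 (\<lambda>z. w s z - w t z)) \<longlongrightarrow> 0) (at t)"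
    proof -
      have "((\<lambda>s. Lr_norm 2 (\<lambda>z. u s z - u t z)) \<longlongrightarrow> 0) (at t)" "((\<lambda>s. Lr_norm 2 (\<lambda>z. w s z - w t z)) \<longlongrightarrow> 0) (at t)"
        using u w unfolding wave_solution_def by blast+
      then show "((\<lambda>s. n2 (\<lambda>z. u s z - u t z)) \<longlongrightarrow> 0) (at t)" "((\<lambda>s. n2 (\<lambda>z. w s z - w t z)) \<longlongrightarrow> 0) (at t)"
        by (simp_all only: Lr2_tendsto_0_iff[OF L2_diff[OF uL uL]] Lr2_tendsto_0_iff[OF L2_diff[OF wL wL]])
    qed
    have "((\<lambda>s. 2 * n2 (\<lambda>z. u s z - u t z) + 2 * n2 (\<lambda>z. w s z - w t z)) \<longlongrightarrow> 2 * 0 + 2 * 0) (at t)"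
      by (intro tendsto_intros a)
    then have lim: "((\<lambda>s. 2 * n2 (\<lambda>z. u s z - u t z) + 2 * n2 (\<lambda>z. w s z - w t z)) \<longlongrightarrow> 0) (at t)" by simp
    have le: "n2 (\<lambda>z. (u s z + w s z) - (u t z + w t z)) \<le> 2 * n2 (\<lambda>z. u s z - u t z) + 2 * n2 (\<lambda>z. w s z - w t z)" for s
    proof -
      have "(\<lambda>z. (u s z + w s z) - (u t z + w t z)) = (\<lambda>z. (u s z - u t z) + (w s z - w t z))" by auto
      then show ?thesis using L2_add(2)[OF L2_diff[OF uL uL] L2_diff[OF wL wL], of s t s t] by simp
    qed
    show "((\<lambda>s. n2 (\<lambda>z. (u s z + w s z) - (u t z + w t z))) \<longlongrightarrow> 0) (at t)"
      by (rule tendsto_sandwich[OF _ _ tendsto_const lim]) (auto intro!: always_eventually simp: n2_nonneg le)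
  qed
  have eq: "\<exists>p :: real \<Rightarrow> complex.
           (\<forall>t. ((\<lambda>s. L2_inner (\<lambda>z. u s z + w s z) v) has_vector_derivative p t) (at t)) \<and>
           (\<forall>t. (p has_vector_derivative - L2_inner (\<lambda>z. u t z + w t z) Av) (at t)) \<and>
           p 0 = L2_inner (\<lambda>z. u1 z + w1 z) v" if v: "neg_Friedlander_D v Av" for v Av
  proof -
    have vL: "v \<in> L2_Omega" "Av \<in> L2_Omega" using v by (auto simp: neg_Friedlander_D_def H10_def)
    obtain p where p: "\<And>t. ((\<lambda>s. L2_inner (u s) v) has_vector_derivative p t) (at t)"
        "\<And>t. (p has_vector_derivative - L2_inner (u t) Av) (at t)" "p 0 = L2_inner u1 v"
      using u v unfolding wave_solution_def by blast
    obtain q where q: "\<And>t. ((\<lambda>s. L2_inner (w s) v) has_vector_derivative q t) (at t)"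
        "\<And>t. (q has_vector_derivative - L2_inner (w t) Av) (at t)" "q 0 = L2_inner w1 v"
      using w v unfolding wave_solution_def by blast
    show ?thesis
    proof (intro exI conjI allI)
      show "((\<lambda>s. L2_inner (\<lambda>z. u s z + w s z) v) has_vector_derivative p t + q t) (at t)" for t
        unfolding L2_inner_add_left[OF uL wL vL(1)] by (rule has_vector_derivative_add[OF p(1) q(1)])
      show "((\<lambda>t. p t + q t) has_vector_derivative - L2_inner (\<lambda>z. u t z + w t z) Av) (at t)" for t
        unfolding L2_inner_add_left[OF uL wL vL(2)] minus_add_distrib by (rule has_vector_derivative_add[OF p(2) q(2)])
      show "p 0 + q 0 = L2_inner (\<lambda>z. u1 z + w1 z) v" by (simp add: L2_inner_add_left[OF u1L w1L vL(1)] p q)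
    qed
  qed
  show ?thesis unfolding wave_solution_def using meas L2_add(1)[OF u1L w1L] L2_add(1)[OF uL wL] cont eq by blast
qed

lemma wave_solution_zero: "wave_solution (\<lambda>t z. 0) (\<lambda>z. 0)"
proof -
  have "Lr_norm 2 (\<lambda>z. 0) = 0" using Lr2_n2[OF L2_zero] by (simp add: n2_def)
  moreover have "L2_inner (\<lambda>z. 0) v = 0" for v by (simp add: L2_inner_def)
  ultimately show ?thesis unfolding wave_solution_def
    by (auto simp: L2_zero intro!: exI[of _ "\<lambda>t. 0"] derivative_intros)
qed

lemma wave_solution_sum:
  "finite I \<Longrightarrow> (\<And>k. k \<in> I \<Longrightarrow> wave_solution (u k) (u1 k)) \<Longrightarrow>
   wave_solution (\<lambda>t z. \<Sum>k\<in>I. u k t z) (\<lambda>z. \<Sum>k\<in>I. u1 k z)"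
proof (induction I rule: finite_induct)
  case empty then show ?case by (simp add: wave_solution_zero)
next
  case (insert k I)
  have "wave_solution (\<lambda>t z. u k t z + (\<Sum>k\<in>I. u k t z)) (\<lambda>z. u1 k z + (\<Sum>k\<in>I. u1 k z))"
    by (rule wave_solution_add) (use insert in auto)
  then show ?case using insert by simp
qed

section \<open>Orthogonality of the modes and the norm of a superposition\<close>

lemma airy_limits_at_top:
  "((\<lambda>s. airy (s - w)) \<longlongrightarrow> 0) at_top" "((\<lambda>s. airy' (s - w)) \<longlongrightarrow> 0) at_top"
  "((\<lambda>s. (s - w) * (airy (s - w))\<^sup>2) \<longlongrightarrow> 0) at_top"
proof -
  obtain C where C: "C > 0" "\<And>s. s \<ge> 0 \<Longrightarrow> \<bar>airy s\<bar> \<le> C * exp (- s) \<and> \<bar>airy' s\<bar> \<le> C * exp (- s)"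
    using airy_decay by blast
  have shift: "filterlim (\<lambda>s. s - w) at_top at_top" for w :: real
    using filterlim_tendsto_add_at_top[OF tendsto_const filterlim_ident, of "- w"] by simp
  have e: "((\<lambda>s::real. exp (- s)) \<longlongrightarrow> 0) at_top"
    by (intro filterlim_compose[OF exp_at_bot] filterlim_uminus_at_bot_at_top)
  have lim: "((\<lambda>s. K * exp (- s)) \<longlongrightarrow> 0) at_top" for K :: real by (rule tendsto_mult_right_zero[OF e])
  have "(airy \<longlongrightarrow> 0) at_top"
    by (rule tendsto_0_le[OF e, of _ C]) (use C in \<open>auto intro!: eventually_at_top_linorderI[of 0] simp: mult.commute\<close>)
  from filterlim_compose[OF this shift] show "((\<lambda>s. airy (s - w)) \<longlongrightarrow> 0) at_top" .
  have "(airy' \<longlongrightarrow> 0) at_top"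
    by (rule tendsto_0_le[OF e, of _ C]) (use C in \<open>auto intro!: eventually_at_top_linorderI[of 0] simp: mult.commute\<close>)
  from filterlim_compose[OF this shift] show "((\<lambda>s. airy' (s - w)) \<longlongrightarrow> 0) at_top" .
  have "((\<lambda>s. s * (airy s)\<^sup>2) \<longlongrightarrow> 0) at_top"
  proof (rule tendsto_0_le[OF e, of _ "C\<^sup>2"], rule eventually_at_top_linorderI[of 0])
    fix s :: real assume s: "s \<ge> 0"
    have "\<bar>airy s\<bar>\<^sup>2 \<le> (C * exp (- s))\<^sup>2" using C(2)[OF s] by (intro power_mono) auto
    moreover have "s \<le> exp s" using exp_ge_add_one_self[of s] by linarith
    ultimately have "s * (airy s)\<^sup>2 \<le> exp s * (C * exp (- s))\<^sup>2" using s by (intro mult_mono) auto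
    also have "\<dots> = C\<^sup>2 * (exp s * exp (- s) * exp (- s))" by (simp only: power_mult_distrib power2_eq_square mult_ac)
    also have "exp s * exp (- s) * exp (- s) = exp (- s)" by (simp add: mult_exp_exp)
    finally show "norm (s * (airy s)\<^sup>2) \<le> norm (exp (- s)) * C\<^sup>2" using s by (simp add: mult.commute)
  qed
  from filterlim_compose[OF this shift] show "((\<lambda>s. (s - w) * (airy (s - w))\<^sup>2) \<longlongrightarrow> 0) at_top" .
qed

lemma airy_shift_deriv:
  "((\<lambda>s. airy (s - w)) has_real_derivative airy' (s - w)) (at s)"
  "((\<lambda>s. airy' (s - w)) has_real_derivative (s - w) * airy (s - w)) (at s)"
proof -
  have d: "((\<lambda>s. s - w) has_real_derivative 1) (at s)" by (auto intro!: derivative_eq_intros)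
  show "((\<lambda>s. airy (s - w)) has_real_derivative airy' (s - w)) (at s)" using DERIV_chain2[OF airy_deriv d] by simp
  show "((\<lambda>s. airy' (s - w)) has_real_derivative (s - w) * airy (s - w)) (at s)" using DERIV_chain2[OF airy'_deriv d] by simp
qed

text \<open>A primitive of the product of two shifted Airy functions: the Wronskian divided by the difference of the shifts, respectively its
limit for equal shifts.\<close>

definition airy_prim :: "real \<Rightarrow> real \<Rightarrow> real \<Rightarrow> real" where
  "airy_prim v w s = (if v = w then (s - w) * (airy (s - w))\<^sup>2 - (airy' (s - w))\<^sup>2
     else (airy (s - v) * airy' (s - w) - airy' (s - v) * airy (s - w)) / (v - w))"

lemma airy_prim_deriv: "(airy_prim v w has_real_derivative airy (s - v) * airy (s - w)) (at s)"
proof (cases "v = w")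
  case True
  have "((\<lambda>s. (s - w) * (airy (s - w))\<^sup>2 - (airy' (s - w))\<^sup>2) has_real_derivative airy (s - w) * airy (s - w)) (at s)"
    by (auto intro!: derivative_eq_intros airy_shift_deriv simp: power2_eq_square algebra_simps)
  then show ?thesis using True by (simp add: airy_prim_def[abs_def])
next
  case False
  have "((\<lambda>s. (airy (s - v) * airy' (s - w) - airy' (s - v) * airy (s - w)) / (v - w)) has_real_derivative
      ((airy' (s - v) * airy' (s - w) + (s - w) * airy (s - w) * airy (s - v)) - ((s - v) * airy (s - v) * airy (s - w) + airy' (s - w) * airy' (s - v))) / (v - w)) (at s)"
    by (intro DERIV_cdivide DERIV_diff DERIV_mult airy_shift_deriv)
  moreover have "((airy' (s - v) * airy' (s - w) + (s - w) * airy (s - w) * airy (s - v)) - ((s - v) * airy (s - v) * airy (s - w) + airy' (s - w) * airy' (s - v))) = (v - w) * (airy (s - v) * airy (s - w))"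
    by (simp add: algebra_simps)
  ultimately show ?thesis using False by (simp add: airy_prim_def[abs_def])
qed

lemma airy_prim_limit: "(airy_prim v w \<longlongrightarrow> 0) at_top"
proof (cases "v = w")
  case True
  have "((\<lambda>s. (s - w) * (airy (s - w))\<^sup>2 - (airy' (s - w))\<^sup>2) \<longlongrightarrow> 0 - 0\<^sup>2) at_top"
    by (intro tendsto_diff tendsto_power airy_limits_at_top)
  then show ?thesis using True by (simp add: airy_prim_def[abs_def])
next
  case False
  have "((\<lambda>s. (airy (s - v) * airy' (s - w) - airy' (s - v) * airy (s - w)) / (v - w)) \<longlongrightarrow> (0 * 0 - 0 * 0) / (v - w)) at_top"
    by (intro tendsto_divide tendsto_diff tendsto_mult airy_limits_at_top tendsto_const) (use False in auto)
  then show ?thesis using False by (simp add: airy_prim_def[abs_def])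
qed

text \<open>At \<open>s = 0\<close> the primitive of a mixed product vanishes because both shifts are zeros, while for equal shifts it
equals \<open>- A'^2\<close>; at infinity everything decays. The factor \<open>1 / r\<close> comes from the substitution \<open>s = r x\<close>.\<close>

lemma airy_modes_orthogonal:
  fixes \<omega> \<beta> :: "'i \<Rightarrow> real"
  assumes I: "finite I" "inj_on \<omega> I" and z: "\<And>k. k \<in> I \<Longrightarrow> airy (- \<omega> k) = 0" and r: "r > 0"
  shows "(\<integral>\<^sup>+x. ennreal ((\<Sum>k\<in>I. \<beta> k * airy (r * x - \<omega> k))\<^sup>2) * indicator {0..} x \<partial>lborel)
    = ennreal ((1 / r) * (\<Sum>k\<in>I. (\<beta> k)\<^sup>2 * (airy' (- \<omega> k))\<^sup>2))"
proof -
  define H where "H = (\<lambda>x. (1 / r) * (\<Sum>j\<in>I. \<Sum>k\<in>I. \<beta> j * \<beta> k * airy_prim (\<omega> j) (\<omega> k) (r * x)))"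
  have am: "airy \<in> borel_measurable borel" by (rule borel_measurable_continuous_onI[OF airy_continuous])
  have "(\<integral>\<^sup>+x. ennreal ((\<Sum>k\<in>I. \<beta> k * airy (r * x - \<omega> k))\<^sup>2) * indicator {0..} x \<partial>lborel) = ennreal (0 - H 0)"
  proof (rule nn_integral_FTC_atLeast)
    show "(\<lambda>x. (\<Sum>k\<in>I. \<beta> k * airy (r * x - \<omega> k))\<^sup>2) \<in> borel_measurable borel"
      using am by measurable
    show "(H has_real_derivative (\<Sum>k\<in>I. \<beta> k * airy (r * x - \<omega> k))\<^sup>2) (at x)" for x
    proof -
      have p: "((\<lambda>x. airy_prim v w (r * x)) has_real_derivative airy (r * x - v) * airy (r * x - w) * r) (at x)" for v w
        by (rule DERIV_chain2[OF airy_prim_deriv]) (auto intro!: derivative_eq_intros)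
      have "(H has_real_derivative (1 / r) * (\<Sum>j\<in>I. \<Sum>k\<in>I. \<beta> j * \<beta> k * (airy (r * x - \<omega> j) * airy (r * x - \<omega> k) * r))) (at x)"
        unfolding H_def by (intro DERIV_cmult DERIV_sum p)
      moreover have "(1 / r) * (\<Sum>j\<in>I. \<Sum>k\<in>I. \<beta> j * \<beta> k * (airy (r * x - \<omega> j) * airy (r * x - \<omega> k) * r)) = (\<Sum>k\<in>I. \<beta> k * airy (r * x - \<omega> k))\<^sup>2"
      proof -
        have "(\<Sum>k\<in>I. \<beta> k * airy (r * x - \<omega> k))\<^sup>2 = (\<Sum>j\<in>I. \<Sum>k\<in>I. (\<beta> j * airy (r * x - \<omega> j)) * (\<beta> k * airy (r * x - \<omega> k)))"
          by (simp only: power2_eq_square sum_product)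
        moreover have "(1 / r) * (\<beta> j * \<beta> k * (airy (r * x - \<omega> j) * airy (r * x - \<omega> k) * r)) = (\<beta> j * airy (r * x - \<omega> j)) * (\<beta> k * airy (r * x - \<omega> k))" for j k
          using r by simp
        ultimately show ?thesis by (simp only: sum_distrib_left)
      qed
      ultimately show ?thesis by simp
    qed
    have "((\<lambda>x. airy_prim v w (r * x)) \<longlongrightarrow> 0) at_top" for v w
      by (rule filterlim_compose[OF airy_prim_limit filterlim_tendsto_pos_mult_at_top[OF tendsto_const r filterlim_ident]])
    then have "(H \<longlongrightarrow> (1 / r) * (\<Sum>j\<in>I. \<Sum>k\<in>I. \<beta> j * \<beta> k * 0)) at_top"
      unfolding H_def by (intro tendsto_intros)
    then show "(H \<longlongrightarrow> 0) at_top" by simp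
  qed auto
  also have "0 - H 0 = (1 / r) * (\<Sum>k\<in>I. (\<beta> k)\<^sup>2 * (airy' (- \<omega> k))\<^sup>2)"
  proof -
    have "airy_prim (\<omega> j) (\<omega> k) 0 = (if j = k then - (airy' (- \<omega> k))\<^sup>2 else 0)" if "j \<in> I" "k \<in> I" for j k
      using that z inj_onD[OF I(2), of j k] by (auto simp: airy_prim_def)
    then have "(\<Sum>j\<in>I. \<Sum>k\<in>I. \<beta> j * \<beta> k * airy_prim (\<omega> j) (\<omega> k) 0) = (\<Sum>j\<in>I. \<Sum>k\<in>I. if j = k then - ((\<beta> k)\<^sup>2 * (airy' (- \<omega> k))\<^sup>2) else 0)"
      by (intro sum.cong refl) (auto simp: power2_eq_square)
    also have "\<dots> = - (\<Sum>k\<in>I. (\<beta> k)\<^sup>2 * (airy' (- \<omega> k))\<^sup>2)"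
      using I(1) by (simp add: sum_negf)
    finally show ?thesis by (simp add: H_def)
  qed
  finally show ?thesis .
qed

lemma ft_sum:
  assumes "\<And>k. k \<in> I \<Longrightarrow> integrable lborel (q k)"
  shows "ft (\<lambda>\<eta>. \<Sum>k\<in>I. q k \<eta>) y = (\<Sum>k\<in>I. ft (q k) y)"
  unfolding ft_def sum_distrib_left
  by (rule Bochner_Integration.integral_sum) (rule ft_integrand_integrable[OF assms])

text \<open>For a fixed \<open>\<eta>\<close> the sum over \<open>k\<close> is an orthogonal sum in \<open>x\<close>, so its square integral is a sum of squares although the modes
overlap heavily; only those \<open>k\<close> contribute whose interval contains \<open>\<eta>\<close>.\<close>

lemma mode_sum_norm:
  fixes \<omega> lo hi :: "'i \<Rightarrow> real" and b :: "'i \<Rightarrow> real \<Rightarrow> real" and \<gamma> :: complex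
  assumes I: "finite I" "inj_on \<omega> I" and z: "\<And>k. k \<in> I \<Longrightarrow> airy (- \<omega> k) = 0"
    and m: "m > 0" and lh: "\<And>k. k \<in> I \<Longrightarrow> m \<le> lo k \<and> lo k \<le> hi k"
    and bc: "\<And>k. k \<in> I \<Longrightarrow> continuous_on {lo k..hi k} (b k)"
    and bP: "\<And>k \<eta>. k \<in> I \<Longrightarrow> \<eta> \<in> {lo k..hi k} \<Longrightarrow> \<bar>b k \<eta>\<bar> \<le> P" and P: "P \<ge> 0"
    and D: "\<And>k. k \<in> I \<Longrightarrow> (airy' (- \<omega> k))\<^sup>2 \<le> D" "D \<ge> 0" and g: "norm \<gamma> = 1"
  defines "U \<equiv> (\<lambda>z. \<Sum>k\<in>I. mode_int airy (\<omega> k) (lo k) (hi k) (\<lambda>\<eta>. \<gamma> * of_real (b k \<eta>)) z)"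
  shows "U \<in> L2_Omega" "n2 U \<le> 2 * pi * (m powr (-2/3) * P\<^sup>2 * D * (\<Sum>k\<in>I. hi k - lo k))"
proof -
  define q where "q = (\<lambda>k x \<eta>. indicator {lo k..hi k} \<eta> *\<^sub>R ((\<gamma> * of_real (b k \<eta>)) * of_real (airy (\<eta> powr (2/3) * x - \<omega> k))))"
  have lo: "0 < lo k" if "k \<in> I" for k using lh[OF that] m by linarith
  have pc: "continuous_on {lo k..hi k} (\<lambda>\<eta>. \<gamma> * of_real (b k \<eta>))" if "k \<in> I" for k
    by (intro continuous_intros bc that)
  have qc: "continuous_on {lo k..hi k} (\<lambda>\<eta>. (\<gamma> * of_real (b k \<eta>)) * of_real (airy (\<eta> powr (2/3) * x - \<omega> k)))" if "k \<in> I" for k x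
  proof -
    have "continuous_on {lo k..hi k} (\<lambda>\<eta>. airy (\<eta> powr (2/3) * x - \<omega> k))"
      by (rule continuous_on_compose2[OF airy_continuous]) (use lo[OF that] in \<open>auto intro!: continuous_intros\<close>)
    then show ?thesis by (intro continuous_intros bc that)
  qed
  have qi: "integrable lborel (q k x)" if "k \<in> I" for k x
    using borel_integrable_atLeastAtMost'[OF qc[OF that]] by (simp add: set_integrable_def q_def)
  have qi2: "integrable lborel (\<lambda>\<eta>. (norm (q k x \<eta>))\<^sup>2)" if "k \<in> I" for k x
  proof -
    have "continuous_on {lo k..hi k} (\<lambda>\<eta>. (norm ((\<gamma> * of_real (b k \<eta>)) * of_real (airy (\<eta> powr (2/3) * x - \<omega> k))))\<^sup>2)"
      by (rule continuous_on_power[OF continuous_on_norm[OF qc[OF that]]])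
    from borel_integrable_atLeastAtMost'[OF this]
    have "integrable lborel (\<lambda>\<eta>. indicator {lo k..hi k} \<eta> *\<^sub>R (norm ((\<gamma> * of_real (b k \<eta>)) * of_real (airy (\<eta> powr (2/3) * x - \<omega> k))))\<^sup>2)"
      by (simp add: set_integrable_def)
    moreover have "(\<lambda>\<eta>. indicator {lo k..hi k} \<eta> *\<^sub>R (norm ((\<gamma> * of_real (b k \<eta>)) * of_real (airy (\<eta> powr (2/3) * x - \<omega> k))))\<^sup>2) = (\<lambda>\<eta>. (norm (q k x \<eta>))\<^sup>2)"
      by (rule ext) (simp add: q_def indicator_def)
    ultimately show ?thesis by simp
  qed
  define Q where "Q = (\<lambda>x \<eta>. \<Sum>k\<in>I. q k x \<eta>)"
  have Qi: "integrable lborel (Q x)" for x unfolding Q_def by (intro Bochner_Integration.integrable_sum qi)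
  have Qm: "Q x \<in> borel_measurable borel" for x using Qi[of x] by auto
  have Qi2: "integrable lborel (\<lambda>\<eta>. (norm (Q x \<eta>))\<^sup>2)" for x
  proof (rule Bochner_Integration.integrable_bound)
    show "integrable lborel (\<lambda>\<eta>. (\<Sum>k\<in>I. (norm (q k x \<eta>))\<^sup>2) * real (card I))"
      by (intro integrable_mult_left Bochner_Integration.integrable_sum qi2)
    show "(\<lambda>\<eta>. (norm (Q x \<eta>))\<^sup>2) \<in> borel_measurable lborel" using Qm[of x] by measurable
    show "AE \<eta> in lborel. norm ((norm (Q x \<eta>))\<^sup>2) \<le> norm ((\<Sum>k\<in>I. (norm (q k x \<eta>))\<^sup>2) * real (card I))"
    proof (rule AE_I2)
      fix \<eta>
      have "(norm (Q x \<eta>))\<^sup>2 \<le> (\<Sum>k\<in>I. norm (q k x \<eta>))\<^sup>2" unfolding Q_def by (intro power_mono norm_sum) auto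
      also have "\<dots> \<le> (\<Sum>k\<in>I. (norm (q k x \<eta>))\<^sup>2) * real (card I)" by (rule sum_squared_le_sum_of_squares)
      finally show "norm ((norm (Q x \<eta>))\<^sup>2) \<le> norm ((\<Sum>k\<in>I. (norm (q k x \<eta>))\<^sup>2) * real (card I))" by simp
    qed
  qed
  have qm2: "(\<lambda>(x, \<eta>). q k x \<eta>) \<in> borel_measurable borel" if "k \<in> I" for k
  proof -
    have pm [measurable]: "(\<lambda>\<eta>. indicator {lo k..hi k} \<eta> *\<^sub>R (\<gamma> * of_real (b k \<eta>))) \<in> borel_measurable borel"
      by (rule indicator_continuous_measurable[OF pc[OF that]])
    have am [measurable]: "airy \<in> borel_measurable borel" by (rule borel_measurable_continuous_onI[OF airy_continuous])
    have e: "q k x \<eta> = (indicator {lo k..hi k} \<eta> *\<^sub>R (\<gamma> * of_real (b k \<eta>))) * of_real (airy (\<eta> powr (2/3) * x - \<omega> k))" for x \<eta>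
      by (simp add: q_def)
    show ?thesis unfolding e borel_prod[symmetric] by measurable
  qed
  have Qm2: "(\<lambda>(x, \<eta>). Q x \<eta>) \<in> borel_measurable borel"
    unfolding Q_def split_beta by (rule borel_measurable_sum, rule qm2[unfolded split_beta])
  have Uc: "continuous_on UNIV U" unfolding U_def
    by (intro continuous_on_sum mode_int_continuous[OF lo airy_continuous pc])
  have Um: "U \<in> borel_measurable borel" by (rule borel_measurable_continuous_onI[OF Uc])
  have Uft: "U (x, y) = ft (Q x) y" for x y
    unfolding U_def Q_def by (subst ft_sum[OF qi], assumption, rule sum.cong[OF refl]) (simp only: mode_int_ft[OF lo airy_continuous pc] q_def)
  have meas2: "(\<lambda>(x, \<eta>). ennreal ((norm (Q x \<eta>))\<^sup>2) * indicator {0<..} x) \<in> borel_measurable (lborel \<Otimes>\<^sub>M lborel)"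
  proof -
    have [measurable]: "(\<lambda>p. case_prod Q p) \<in> borel_measurable (borel \<Otimes>\<^sub>M borel)" using Qm2 by (simp add: borel_prod)
    have "(\<lambda>p. ennreal ((norm (case_prod Q p))\<^sup>2) * indicator {0<..} (fst p)) \<in> borel_measurable (borel \<Otimes>\<^sub>M borel)" by measurable
    then show ?thesis by (simp add: split_beta lborel_prod borel_prod)
  qed
  have inner: "(\<integral>\<^sup>+x. ennreal ((norm (Q x \<eta>))\<^sup>2) * indicator {0<..} x \<partial>lborel) \<le> ennreal (m powr (-2/3) * P\<^sup>2 * D) * (\<Sum>k\<in>I. indicator {lo k..hi k} \<eta>)" for \<eta>
  proof (cases "\<eta> \<ge> m")
    case False
    then have "Q x \<eta> = 0" for x using lh by (force simp: Q_def q_def intro!: sum.neutral)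
    then show ?thesis by simp
  next
    case True
    define \<beta> where "\<beta> = (\<lambda>k. indicator {lo k..hi k} \<eta> * b k \<eta>)"
    define r where "r = \<eta> powr (2/3)"
    have r: "r > 0" using True m by (simp add: r_def)
    have "Q x \<eta> = \<gamma> * of_real (\<Sum>k\<in>I. \<beta> k * airy (r * x - \<omega> k))" for x
      unfolding Q_def q_def \<beta>_def r_def of_real_sum sum_distrib_left
      by (intro sum.cong refl) (auto simp: indicator_def)
    then have nQ: "norm (Q x \<eta>) = \<bar>\<Sum>k\<in>I. \<beta> k * airy (r * x - \<omega> k)\<bar>" for x
      by (simp only: norm_mult g norm_of_real mult_1)
    have "(\<integral>\<^sup>+x. ennreal ((norm (Q x \<eta>))\<^sup>2) * indicator {0<..} x \<partial>lborel)
       \<le> (\<integral>\<^sup>+x. ennreal ((\<Sum>k\<in>I. \<beta> k * airy (r * x - \<omega> k))\<^sup>2) * indicator {0..} x \<partial>lborel)"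
      unfolding nQ by (intro nn_integral_mono) (auto simp: indicator_def)
    also have "\<dots> = ennreal ((1 / r) * (\<Sum>k\<in>I. (\<beta> k)\<^sup>2 * (airy' (- \<omega> k))\<^sup>2))"
      by (rule airy_modes_orthogonal[OF I z r])
    also have "\<dots> \<le> ennreal ((m powr (-2/3) * P\<^sup>2 * D) * (\<Sum>k\<in>I. indicator {lo k..hi k} \<eta>))"
    proof (rule ennreal_leI)
      have "(\<beta> k)\<^sup>2 * (airy' (- \<omega> k))\<^sup>2 \<le> (P\<^sup>2 * D) * indicator {lo k..hi k} \<eta>" if k: "k \<in> I" for k
      proof (cases "\<eta> \<in> {lo k..hi k}")
        case True
        have "(b k \<eta>)\<^sup>2 \<le> P\<^sup>2" using bP[OF k True] P by (metis abs_le_square_iff abs_of_nonneg)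
        then show ?thesis using True D(1)[OF k] P by (auto simp: \<beta>_def intro!: mult_mono)
      qed (simp add: \<beta>_def)
      then have s: "(\<Sum>k\<in>I. (\<beta> k)\<^sup>2 * (airy' (- \<omega> k))\<^sup>2) \<le> (P\<^sup>2 * D) * (\<Sum>k\<in>I. indicator {lo k..hi k} \<eta>)"
        unfolding sum_distrib_left by (rule sum_mono)
      have "1 / r = \<eta> powr (-2/3)" using True m by (simp add: r_def powr_minus_divide)
      also have "\<dots> \<le> m powr (-2/3)" using True m by (intro powr_mono2') auto
      finally have r2: "1 / r \<le> m powr (-2/3)" .
      have "(1 / r) * (\<Sum>k\<in>I. (\<beta> k)\<^sup>2 * (airy' (- \<omega> k))\<^sup>2) \<le> m powr (-2/3) * ((P\<^sup>2 * D) * (\<Sum>k\<in>I. indicator {lo k..hi k} \<eta>))"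
        using r by (intro mult_mono r2 s sum_nonneg) auto
      then show "(1 / r) * (\<Sum>k\<in>I. (\<beta> k)\<^sup>2 * (airy' (- \<omega> k))\<^sup>2) \<le> (m powr (-2/3) * P\<^sup>2 * D) * (\<Sum>k\<in>I. indicator {lo k..hi k} \<eta>)"
        by (simp only: mult.assoc)
    qed
    also have "\<dots> = ennreal (m powr (-2/3) * P\<^sup>2 * D) * (\<Sum>k\<in>I. indicator {lo k..hi k} \<eta>)"
    proof -
      have "ennreal (\<Sum>k\<in>I. indicator {lo k..hi k} \<eta>) = (\<Sum>k\<in>I. indicator {lo k..hi k} \<eta>)"
        by (subst sum_ennreal[symmetric]) (simp_all only: ennreal_indicator indicator_pos_le)
      then show ?thesis using D(2) by (subst ennreal_mult) (auto intro!: sum_nonneg)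
    qed
    finally show ?thesis .
  qed
  define B where "B = m powr (-2/3) * P\<^sup>2 * D"
  have B0: "B \<ge> 0" using D(2) by (simp add: B_def)
  have S0: "(\<Sum>k\<in>I. hi k - lo k) \<ge> 0" using lh by (intro sum_nonneg) auto
  have "(\<integral>\<^sup>+z. ennreal ((norm (U z))\<^sup>2) \<partial>M\<Omega>) \<le> ennreal (2 * pi) * (\<integral>\<^sup>+x. (\<integral>\<^sup>+\<eta>. ennreal ((norm (Q x \<eta>))\<^sup>2) \<partial>lborel) * indicator {0<..} x \<partial>lborel)"
    by (rule plancherel_Omega[OF Qm2 Qi Qi2 Um Uft])
  also have "(\<integral>\<^sup>+x. (\<integral>\<^sup>+\<eta>. ennreal ((norm (Q x \<eta>))\<^sup>2) \<partial>lborel) * indicator {0<..} x \<partial>lborel)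
     = (\<integral>\<^sup>+x. \<integral>\<^sup>+\<eta>. ennreal ((norm (Q x \<eta>))\<^sup>2) * indicator {0<..} x \<partial>lborel \<partial>lborel)"
    by (intro nn_integral_cong nn_integral_multc[symmetric]) (use Qm in measurable)
  also have "\<dots> = (\<integral>\<^sup>+\<eta>. \<integral>\<^sup>+x. ennreal ((norm (Q x \<eta>))\<^sup>2) * indicator {0<..} x \<partial>lborel \<partial>lborel)"
    by (rule lborel_pair.Fubini'[symmetric, OF meas2])
  also have "ennreal (2 * pi) * \<dots> \<le> ennreal (2 * pi) * (\<integral>\<^sup>+\<eta>. ennreal B * (\<Sum>k\<in>I. indicator {lo k..hi k} \<eta>) \<partial>lborel)"
    unfolding B_def by (intro mult_left_mono nn_integral_mono inner) auto
  also have "(\<integral>\<^sup>+\<eta>. ennreal B * (\<Sum>k\<in>I. indicator {lo k..hi k} \<eta>) \<partial>lborel) = ennreal B * (\<Sum>k\<in>I. \<integral>\<^sup>+\<eta>. indicator {lo k..hi k} \<eta> \<partial>lborel)"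
    by (subst nn_integral_cmult, measurable, subst nn_integral_sum) auto
  also have "(\<Sum>k\<in>I. \<integral>\<^sup>+\<eta>. indicator {lo k..hi k} \<eta> \<partial>lborel) = (\<Sum>k\<in>I. ennreal (hi k - lo k))"
    using lh by (intro sum.cong refl) simp
  also have "\<dots> = ennreal (\<Sum>k\<in>I. hi k - lo k)" using lh by (intro sum_ennreal) auto
  also have "ennreal (2 * pi) * (ennreal B * ennreal (\<Sum>k\<in>I. hi k - lo k)) = ennreal (2 * pi * (B * (\<Sum>k\<in>I. hi k - lo k)))"
    using B0 S0 by (simp add: ennreal_mult)
  finally have fin: "(\<integral>\<^sup>+z. ennreal ((norm (U z))\<^sup>2) \<partial>M\<Omega>) \<le> ennreal (2 * pi * (B * (\<Sum>k\<in>I. hi k - lo k)))" .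
  note Um' = measurable_M\<Omega>[OF Um]
  show "U \<in> L2_Omega" by (rule L2_OmegaI_bound(1)[OF Um' fin])
  have "2 * pi * (B * (\<Sum>k\<in>I. hi k - lo k)) \<ge> 0" using B0 S0 by simp
  from L2_OmegaI_bound(2)[OF Um' fin this] show "n2 U \<le> 2 * pi * (m powr (-2/3) * P\<^sup>2 * D * (\<Sum>k\<in>I. hi k - lo k))"
    by (simp only: B_def)
qed

section \<open>Choice of the modes and alignment of their phases\<close>

text \<open>Expansion of \<open>sqrt (1 + v^2)\<close> as a function of \<open>v^3\<close> rather than \<open>v\<close>. The frequency is
\<open>\<eta> sqrt (1 + \<omega> \<eta>^(-2/3))\<close>, and in terms of \<open>v = sqrt \<omega> \<eta>^(-1/3)\<close> the quantity \<open>v^3\<close> is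
\<open>3/2 \<zeta> / \<eta>\<close>, where \<open>\<zeta>\<close> is almost an arithmetic progression in \<open>k\<close>.\<close>

lemma eikonal_taylor:
  fixes v v0 :: real
  assumes v: "0 \<le> v" "v \<le> v0" "0 < v0" "v0 \<le> 1"
  shows "\<bar>sqrt (1 + v\<^sup>2) - sqrt (1 + v0\<^sup>2) - (v ^ 3 - v0 ^ 3) / (3 * v0 * sqrt (1 + v0\<^sup>2))\<bar> \<le> 4 * (v - v0)\<^sup>2"
proof -
  define S where "S = sqrt (1 + v\<^sup>2)"
  define S0 where "S0 = sqrt (1 + v0\<^sup>2)"
  define \<Delta> where "\<Delta> = v - v0"
  have sq: "S\<^sup>2 = 1 + v\<^sup>2" "S0\<^sup>2 = 1 + v0\<^sup>2" by (simp_all add: S_def S0_def)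
  have S1: "S \<ge> 1" "S0 \<ge> 1" by (simp_all add: S_def S0_def)
  have S0b: "S0 \<le> 3/2"
  proof -
    have "v0\<^sup>2 \<le> 1" using v by (simp add: power_le_one)
    then have "S0\<^sup>2 \<le> (3/2)\<^sup>2" unfolding sq by (simp add: power2_eq_square)
    then show ?thesis by (rule power2_le_imp_le) simp
  qed
  have dS: "(S - S0) * (S + S0) = \<Delta> * (v + v0)"
  proof -
    have "(S - S0) * (S + S0) = S\<^sup>2 - S0\<^sup>2" by (simp add: power2_eq_square algebra_simps)
    also have "\<dots> = \<Delta> * (v + v0)" unfolding sq \<Delta>_def by (simp add: power2_eq_square algebra_simps)
    finally show ?thesis .
  qed
  have \<Delta>b: "\<bar>\<Delta>\<bar> \<le> v0" using v by (auto simp: \<Delta>_def)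
  have dSb: "\<bar>S - S0\<bar> \<le> \<bar>\<Delta>\<bar> * v0"
  proof -
    have "\<bar>S - S0\<bar> * 2 \<le> \<bar>S - S0\<bar> * (S + S0)" using S1 by (intro mult_left_mono) auto
    also have "\<dots> = \<bar>(S - S0) * (S + S0)\<bar>" using S1 by (simp add: abs_mult)
    also have "\<dots> = \<bar>\<Delta>\<bar> * (v + v0)" unfolding dS using v by (simp add: abs_mult)
    also have "\<dots> \<le> \<bar>\<Delta>\<bar> * (2 * v0)" using v by (intro mult_left_mono) auto
    finally show ?thesis by simp
  qed
  define Num where "Num = 3 * v0 * S0 - 2 * S0 * (v + 2 * v0)"
  define R where "R = 3 * v0\<^sup>2 + \<Delta> * (v + 2 * v0)"
  have id: "((S - S0) - (v ^ 3 - v0 ^ 3) / (3 * v0 * S0)) * ((S + S0) * (3 * v0 * S0)) = \<Delta> * (\<Delta> * Num - (S - S0) * R)"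
  proof -
    have cube: "v ^ 3 - v0 ^ 3 = \<Delta> * R" unfolding R_def \<Delta>_def by (simp add: power3_eq_cube power2_eq_square algebra_simps)
    have "((S - S0) - (v ^ 3 - v0 ^ 3) / (3 * v0 * S0)) * ((S + S0) * (3 * v0 * S0))
       = ((S - S0) * (S + S0)) * (3 * v0 * S0) - (S + S0) * (v ^ 3 - v0 ^ 3)"
      using v S1 by (simp add: field_simps)
    also have "\<dots> = \<Delta> * ((v + v0) * (3 * v0 * S0) - (S + S0) * R)"
      unfolding dS cube by (simp add: algebra_simps)
    also have "(v + v0) * (3 * v0 * S0) - (S + S0) * R = \<Delta> * Num - (S - S0) * R"
      unfolding Num_def R_def \<Delta>_def by (simp add: algebra_simps power2_eq_square)
    finally show ?thesis .
  qed
  have Nb: "\<bar>Num\<bar> \<le> 27/2 * v0"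
  proof -
    have "0 \<le> 3 * v0 * S0" "3 * v0 * S0 \<le> 3 * v0 * (3/2)" using v S1 S0b by (auto intro!: mult_left_mono)
    moreover have "0 \<le> 2 * S0 * (v + 2 * v0)" using v S1 by simp
    moreover have "2 * S0 * (v + 2 * v0) \<le> 2 * (3/2) * (3 * v0)"
      using v S1 S0b by (intro mult_mono) auto
    ultimately show ?thesis unfolding Num_def by linarith
  qed
  have Rb: "\<bar>R\<bar> \<le> 6 * v0"
  proof -
    have "v0\<^sup>2 \<le> v0" using v by (simp add: power2_eq_square mult_left_le)
    moreover have "\<bar>\<Delta> * (v + 2 * v0)\<bar> \<le> 1 * (3 * v0)" unfolding abs_mult using \<Delta>b v by (intro mult_mono) auto
    ultimately show ?thesis unfolding R_def by (smt (verit) zero_le_power2)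
  qed
  have main: "\<bar>\<Delta> * Num - (S - S0) * R\<bar> \<le> \<bar>\<Delta>\<bar> * (24 * v0)"
  proof -
    have "\<bar>\<Delta> * Num - (S - S0) * R\<bar> \<le> \<bar>\<Delta>\<bar> * \<bar>Num\<bar> + \<bar>S - S0\<bar> * \<bar>R\<bar>"
      unfolding abs_mult[symmetric] by (rule abs_triangle_ineq4)
    also have "\<dots> \<le> \<bar>\<Delta>\<bar> * (27/2 * v0) + (\<bar>\<Delta>\<bar> * 1) * (6 * v0)"
    proof (intro add_mono mult_mono Nb Rb)
      show "\<bar>S - S0\<bar> \<le> \<bar>\<Delta>\<bar> * 1" using dSb v by (meson abs_ge_zero mult_left_mono order_trans)
    qed (use v in auto)
    also have "\<dots> \<le> \<bar>\<Delta>\<bar> * (24 * v0)" using v by (simp add: algebra_simps)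
    finally show ?thesis .
  qed
  have den: "6 * v0 \<le> (S + S0) * (3 * v0 * S0)"
  proof -
    have "2 * (3 * v0 * 1) \<le> (S + S0) * (3 * v0 * S0)" using v S1 by (intro mult_mono mult_left_mono) auto
    then show ?thesis by simp
  qed
  let ?E = "(S - S0) - (v ^ 3 - v0 ^ 3) / (3 * v0 * S0)"
  have "\<bar>?E\<bar> * (6 * v0) \<le> \<bar>?E\<bar> * ((S + S0) * (3 * v0 * S0))" by (intro mult_left_mono den) simp
  also have "\<dots> = \<bar>?E * ((S + S0) * (3 * v0 * S0))\<bar>" using v S1 by (simp add: abs_mult)
  also have "\<dots> = \<bar>\<Delta>\<bar> * \<bar>\<Delta> * Num - (S - S0) * R\<bar>" unfolding id by (simp add: abs_mult)
  also have "\<dots> \<le> \<bar>\<Delta>\<bar> * (\<bar>\<Delta>\<bar> * (24 * v0))" by (intro mult_left_mono main) simp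
  also have "\<dots> = (4 * \<Delta>\<^sup>2) * (6 * v0)" by (simp add: power2_eq_square)
  finally have "\<bar>?E\<bar> \<le> 4 * \<Delta>\<^sup>2" using v by (simp add: mult_le_cancel_right)
  then show ?thesis by (simp add: S_def S0_def \<Delta>_def)
qed

text \<open>The zeros supplied by \<open>airy_zeros\<close> together with the scale \<open>\<epsilon>\<close> and the relative width \<open>\<delta>\<close> of the frequency band. The frequency scale
is \<open>h = \<epsilon>^6\<close> and the caustic lies at \<open>x = \<epsilon>^2\<close>. The conditions \<open>small\<close> ensure that the zeros in use have large index, so that their
asymptotics are accurate.\<close>

locale gallery =
  fixes \<theta> C :: real and k0 :: nat and \<omega> :: "nat \<Rightarrow> real" and \<epsilon> \<delta> :: real
  assumes zeros: "\<And>k. k \<ge> k0 \<Longrightarrow> \<omega> k \<ge> 1 \<and> airy (- \<omega> k) = 0 \<and>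
     \<bar>liou_zeta (\<omega> k) - (real k * pi - \<theta>)\<bar> \<le> C / real k \<and> (airy' (- \<omega> k))\<^sup>2 \<le> C * sqrt (\<omega> k)"
    and C: "C > 0" and eps: "0 < \<epsilon>" "\<epsilon> \<le> 1/80" and delta: "0 < \<delta>" "\<delta> \<le> 1/4"
    and small: "2 + \<bar>\<theta>\<bar> \<le> 1 / (4 * \<epsilon> ^ 3)" "real k0 \<le> 1 / (16 * \<epsilon> ^ 3)" "160 * C * \<epsilon>\<^sup>2 \<le> 1"
begin

text \<open>A mode has its turning point at \<open>x = \<epsilon>^2\<close> if \<open>\<zeta> = \<sigma> \<eta>\<close>. The interval from \<open>lo k\<close> to \<open>hi k\<close> consists of the \<open>\<eta>\<close> for which
\<open>\<sigma> \<eta>\<close> exceeds \<open>k \<pi> - \<theta>\<close> by an amount between \<open>1\<close> and \<open>L\<close>: the turning point then lies just below \<open>\<epsilon>^2\<close>, so that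
at \<open>x = \<epsilon>^2\<close> the profile is past its last zero and has not yet decayed. The choice of \<open>L\<close> keeps the quadratic phase error bounded, and \<open>J\<close> collects
the \<open>k\<close> for which \<open>\<eta>\<close> stays in the band \<open>(1 - \<delta>) / h \<le> \<eta> \<le> 1 / h\<close>. \<open>F1\<close> is the derivative of the frequency with respect to \<open>\<zeta>\<close> at the common turning
point.\<close>

definition "\<sigma> = 2/3 * \<epsilon> ^ 3"

definition "L = 1 / (40 * \<epsilon>)"

definition "J = {k::nat. 2/3 * (1 - \<delta>) / \<epsilon> ^ 3 - 1 \<le> real k * pi - \<theta> \<and> real k * pi - \<theta> \<le> 2/3 / \<epsilon> ^ 3 - L}"

definition "lo k = (real k * pi - \<theta> + 1) / \<sigma>"

definition "hi k = (real k * pi - \<theta> + L) / \<sigma>"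

definition "F1 = 1 / (2 * \<epsilon> * sqrt (1 + \<epsilon>\<^sup>2))"

lemma sigma_pos: "\<sigma> > 0" using eps by (simp add: \<sigma>_def)

lemma L_ge: "L \<ge> 2" using eps by (simp add: L_def field_simps)

lemma eps3: "\<epsilon> ^ 3 > 0" using eps by simp

lemma eps_cube_inv: "1 / \<epsilon> ^ 3 \<ge> 8"
proof -
  have "\<epsilon> ^ 3 \<le> (1/80) ^ 3" using eps by (intro power_mono) auto
  also have "\<dots> \<le> 1/8" by (simp add: power3_eq_cube)
  finally show ?thesis using eps3 by (simp add: field_simps)
qed

lemma J_lower:
  assumes "k \<in> J"
  shows "real k * pi - \<theta> \<ge> 1 / (2 * \<epsilon> ^ 3) - 1" "real k \<ge> 1 / (16 * \<epsilon> ^ 3)" "k \<ge> k0" "real k > 0"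
proof -
  define E where "E = 1 / \<epsilon> ^ 3"
  have E: "E \<ge> 8" using eps_cube_inv by (simp add: E_def)
  have a: "2/3 * (1 - \<delta>) * E - 1 \<le> real k * pi - \<theta>" using assms by (simp add: J_def E_def)
  have "2/3 * (3/4) * E \<le> 2/3 * (1 - \<delta>) * E" using E delta by (intro mult_right_mono) auto
  then have b: "E / 2 - 1 \<le> real k * pi - \<theta>" using a by linarith
  then show "real k * pi - \<theta> \<ge> 1 / (2 * \<epsilon> ^ 3) - 1" by (simp add: E_def)
  have s: "2 + \<bar>\<theta>\<bar> \<le> E / 4" using small(1) by (simp add: E_def)
  have "E / 4 \<le> real k * pi" using b s by linarith
  also have "\<dots> \<le> real k * 4" using pi_less_4 by (intro mult_left_mono) auto
  finally have k: "E / 16 \<le> real k" by simp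
  then show k': "real k \<ge> 1 / (16 * \<epsilon> ^ 3)" by (simp add: E_def)
  show "k \<ge> k0" using k' small(2) by linarith
  show "real k > 0" using k E by linarith
qed

lemma zeta_near: "k \<in> J \<Longrightarrow> \<bar>liou_zeta (\<omega> k) - (real k * pi - \<theta>)\<bar> \<le> 16 * C * \<epsilon> ^ 3"
proof -
  assume k: "k \<in> J"
  have "\<bar>liou_zeta (\<omega> k) - (real k * pi - \<theta>)\<bar> \<le> C / real k" using zeros J_lower(3)[OF k] by blast
  also have "\<dots> \<le> C / (1 / (16 * \<epsilon> ^ 3))"
    using J_lower(2,4)[OF k] C eps3 by (intro divide_left_mono) auto
  finally show ?thesis by (simp add: mult_ac)
qed

lemma C_eps3: "16 * C * \<epsilon> ^ 3 \<le> 1 / 10"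
proof -
  have "16 * C * \<epsilon> ^ 3 = (160 * C * \<epsilon>\<^sup>2) * (\<epsilon> / 10)" by (simp add: power3_eq_cube power2_eq_square)
  also have "\<dots> \<le> 1 * (1 / 10)" using small(3) eps C by (intro mult_mono) auto
  finally show ?thesis by simp
qed

lemma eta_window:
  assumes k: "k \<in> J" and e: "\<eta> \<in> {lo k..hi k}"
  shows "real k * pi - \<theta> + 1 \<le> \<sigma> * \<eta>" "\<sigma> * \<eta> \<le> real k * pi - \<theta> + L"
    "(1 - \<delta>) / \<epsilon> ^ 6 \<le> \<eta>" "\<eta> \<le> 1 / \<epsilon> ^ 6"
proof -
  have a: "(real k * pi - \<theta> + 1) / \<sigma> \<le> \<eta>" "\<eta> \<le> (real k * pi - \<theta> + L) / \<sigma>" using e by (auto simp: lo_def hi_def)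
  show b: "real k * pi - \<theta> + 1 \<le> \<sigma> * \<eta>" "\<sigma> * \<eta> \<le> real k * pi - \<theta> + L"
    using a sigma_pos by (simp_all add: field_simps)
  have j: "2/3 * (1 - \<delta>) / \<epsilon> ^ 3 - 1 \<le> real k * pi - \<theta>" "real k * pi - \<theta> \<le> 2/3 / \<epsilon> ^ 3 - L" using k by (auto simp: J_def)
  have e6: "\<epsilon> ^ 6 = \<epsilon> ^ 3 * \<epsilon> ^ 3" by (simp flip: power_add)
  have e6': "\<epsilon> ^ 3 * (\<epsilon> ^ 3 * \<eta>) = \<eta> * \<epsilon> ^ 6" by (simp only: e6 mult_ac)
  have e60: "\<epsilon> ^ 6 > 0" using eps by simp
  have "2/3 * (1 - \<delta>) / \<epsilon> ^ 3 \<le> 2/3 * \<epsilon> ^ 3 * \<eta>" using b(1) j(1) unfolding \<sigma>_def by linarith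
  then have "(1 - \<delta>) \<le> \<epsilon> ^ 3 * (\<epsilon> ^ 3 * \<eta>)" using eps3 by (simp add: field_simps)
  then show "(1 - \<delta>) / \<epsilon> ^ 6 \<le> \<eta>" unfolding e6' pos_divide_le_eq[OF e60] .
  have "2/3 * \<epsilon> ^ 3 * \<eta> \<le> 2/3 / \<epsilon> ^ 3" using b(2) j(2) unfolding \<sigma>_def by linarith
  then have "\<epsilon> ^ 3 * (\<epsilon> ^ 3 * \<eta>) \<le> 1" using eps3 by (simp add: field_simps)
  then show "\<eta> \<le> 1 / \<epsilon> ^ 6" unfolding e6' pos_le_divide_eq[OF e60] .
qed

lemma lo_le_hi: "lo k \<le> hi k"
  unfolding lo_def hi_def using L_ge sigma_pos by (intro divide_right_mono) auto

lemma lo_lower: "k \<in> J \<Longrightarrow> 1 / (2 * \<epsilon> ^ 6) \<le> lo k"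
proof -
  assume k: "k \<in> J"
  have "(1/2) / \<epsilon> ^ 6 \<le> (1 - \<delta>) / \<epsilon> ^ 6" using delta eps by (intro divide_right_mono) auto
  then show ?thesis using eta_window(3)[OF k, of "lo k"] lo_le_hi[of k] by simp
qed

lemma cube_le: "0 \<le> (y::real) \<Longrightarrow> x ^ 3 \<le> y ^ 3 \<Longrightarrow> x \<le> y"
  using power_mono_iff[of x y 3] power_le_imp_le_base[of x 2 y] by (simp add: numeral_3_eq_3)

text \<open>In the coordinates \<open>x = sqrt \<omega>\<close> and \<open>p = \<eta>^(1/3)\<close> all fractional powers become polynomials.\<close>

lemma root_coordinates:
  assumes k: "k \<in> J" and e: "\<eta> \<in> {lo k..hi k}"
  obtains x p where "x = sqrt (\<omega> k)" "\<omega> k = x\<^sup>2" "liou_zeta (\<omega> k) = 2/3 * x ^ 3" "p > 0" "p ^ 3 = \<eta>"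
    "\<eta> powr (2/3) = p\<^sup>2" "\<eta> powr (4/3) = p ^ 4" "x \<ge> 1 / (2 * \<epsilon>)" "x \<le> \<epsilon> * p" "p \<le> 1 / \<epsilon>\<^sup>2"
    "(\<epsilon> * p) ^ 3 - x ^ 3 \<le> 3 * L" "\<sigma> * \<eta> = 2/3 * (\<epsilon> * p) ^ 3"
proof -
  note w = eta_window[OF k e]
  define x where "x = sqrt (\<omega> k)"
  define p where "p = \<eta> powr (1/3)"
  have om: "\<omega> k \<ge> 1" using zeros J_lower(3)[OF k] by blast
  have x0: "x \<ge> 0" using om by (simp add: x_def)
  have e0: "\<eta> > 0"
  proof -
    have "0 < 1 / (2 * \<epsilon> ^ 6)" using eps by simp
    then have "0 < lo k" using lo_lower[OF k] by linarith
    then show ?thesis using e by auto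
  qed
  have p0: "p > 0" using e0 by (simp add: p_def)
  have p3: "p ^ 3 = \<eta>" using e0 by (simp add: p_def powr_power)
  have p2: "\<eta> powr (2/3) = p\<^sup>2" using e0 by (simp add: p_def powr_power)
  have p4: "\<eta> powr (4/3) = p ^ 4" using e0 by (simp add: p_def powr_power)
  have x2: "\<omega> k = x\<^sup>2" using om by (simp add: x_def)
  have zx: "liou_zeta (\<omega> k) = 2/3 * x ^ 3"
  proof -
    have "\<omega> k powr (3/2) = (\<omega> k powr (1/2)) ^ 3" using om by (simp add: powr_power)
    then show ?thesis using om by (simp add: liou_zeta_def x_def powr_half_sqrt)
  qed
  have sig: "\<sigma> * \<eta> = 2/3 * (\<epsilon> * p) ^ 3" by (simp add: \<sigma>_def power_mult_distrib p3)
  have z: "\<bar>liou_zeta (\<omega> k) - (real k * pi - \<theta>)\<bar> \<le> 1/10" using zeta_near[OF k] C_eps3 by linarith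
  have "x ^ 3 \<le> (\<epsilon> * p) ^ 3" using z w(1) zx sig by linarith
  moreover have "0 \<le> \<epsilon> * p" using p0 eps by simp
  ultimately have xp: "x \<le> \<epsilon> * p" using cube_le by blast
  have d3: "(\<epsilon> * p) ^ 3 - x ^ 3 \<le> 3 * L" using z w(2) zx sig L_ge by linarith
  have x_low: "x \<ge> 1 / (2 * \<epsilon>)"
  proof (rule cube_le[OF x0])
    have "liou_zeta (\<omega> k) \<ge> 1 / (2 * \<epsilon> ^ 3) - 2" using z J_lower(1)[OF k] by linarith
    moreover have "2 \<le> 1 / (4 * \<epsilon> ^ 3)" using small(1) by linarith
    ultimately have "1 / (2 * \<epsilon> ^ 3) - 1 / (4 * \<epsilon> ^ 3) \<le> 2/3 * x ^ 3" using zx by linarith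
    moreover have "1 / (2 * \<epsilon> ^ 3) - 1 / (4 * \<epsilon> ^ 3) = (1/4) * (1 / \<epsilon> ^ 3)" using eps by (simp add: field_simps)
    moreover have "(1 / (2 * \<epsilon>)) ^ 3 = (1/8) * (1 / \<epsilon> ^ 3)" by (simp add: power_divide power_mult_distrib)
    moreover have "1 / \<epsilon> ^ 3 > 0" using eps3 by simp
    ultimately show "(1 / (2 * \<epsilon>)) ^ 3 \<le> x ^ 3" by linarith
  qed
  have pu: "p \<le> 1 / \<epsilon>\<^sup>2"
  proof (rule cube_le)
    have "(1 / \<epsilon>\<^sup>2) ^ 3 = 1 / \<epsilon> ^ 6" by (simp add: power_divide flip: power_mult)
    then show "p ^ 3 \<le> (1 / \<epsilon>\<^sup>2) ^ 3" using w(4) p3 by simp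
  qed simp
  show ?thesis by (rule that[OF x_def x2 zx p0 p3 p2 p4 x_low xp pu d3 sig])
qed

text \<open>On \<open>\<epsilon>^2 \<le> x \<le> \<epsilon>^2 + \<epsilon>^4\<close> the argument of the profile lies in the interval from \<open>0\<close> to \<open>2\<close>, where \<open>airy\<close> is at least
\<open>airy 2\<close>. The part coming from \<open>x = \<epsilon>^2\<close> is controlled by \<open>L\<close>, the rest by \<open>\<eta>^(2/3) \<epsilon>^4 \<le> 1\<close>.\<close>

lemma turning_point_window:
  assumes k: "k \<in> J" and e: "\<eta> \<in> {lo k..hi k}" and x: "\<epsilon>\<^sup>2 \<le> x" "x \<le> \<epsilon>\<^sup>2 + \<epsilon> ^ 4"
  shows "0 \<le> \<eta> powr (2/3) * x - \<omega> k" "\<eta> powr (2/3) * x - \<omega> k \<le> 2"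
proof -
  obtain y p where c: "\<omega> k = y\<^sup>2" "p > 0" "\<eta> powr (2/3) = p\<^sup>2" "y \<ge> 1 / (2 * \<epsilon>)" "y \<le> \<epsilon> * p" "p \<le> 1 / \<epsilon>\<^sup>2"
    "(\<epsilon> * p) ^ 3 - y ^ 3 \<le> 3 * L" using root_coordinates[OF k e] by metis
  have y0: "y > 0" using c(4) eps by (smt (verit) divide_pos_pos)
  have "y\<^sup>2 \<le> (\<epsilon> * p)\<^sup>2" using c(5) y0 by (intro power_mono) auto
  also have "\<dots> = p\<^sup>2 * \<epsilon>\<^sup>2" by (simp add: power_mult_distrib)
  finally have a: "y\<^sup>2 \<le> p\<^sup>2 * \<epsilon>\<^sup>2" .
  have "p\<^sup>2 * \<epsilon>\<^sup>2 \<le> p\<^sup>2 * x" using x by (intro mult_left_mono) auto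
  then show "0 \<le> \<eta> powr (2/3) * x - \<omega> k" using a by (simp add: c(1,3))
  have "p\<^sup>2 * x \<le> p\<^sup>2 * \<epsilon>\<^sup>2 + p\<^sup>2 * \<epsilon> ^ 4" using mult_left_mono[OF x(2), of "p\<^sup>2"] by (simp add: distrib_left)
  moreover have "p\<^sup>2 * \<epsilon> ^ 4 \<le> 1"
  proof -
    have "p * \<epsilon>\<^sup>2 \<le> 1" using c(6) eps by (simp add: pos_le_divide_eq)
    then have "(p * \<epsilon>\<^sup>2)\<^sup>2 \<le> 1" using c(2) by (simp add: power_le_one)
    then show ?thesis by (simp add: power_mult_distrib flip: power_mult)
  qed
  moreover have "p\<^sup>2 * \<epsilon>\<^sup>2 - y\<^sup>2 \<le> 1"
  proof -
    let ?q = "\<epsilon> * p"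
    have "(?q\<^sup>2 - y\<^sup>2) * y \<le> ?q ^ 3 - y ^ 3"
    proof -
      have "?q ^ 3 - y ^ 3 - (?q\<^sup>2 - y\<^sup>2) * y = ?q\<^sup>2 * (?q - y)" by (simp add: power3_eq_cube power2_eq_square algebra_simps)
      moreover have "?q\<^sup>2 * (?q - y) \<ge> 0" using c(5) by simp
      ultimately show ?thesis by linarith
    qed
    then have m: "(?q\<^sup>2 - y\<^sup>2) * y \<le> 3 * L" using c(7) by linarith
    have "?q\<^sup>2 - y\<^sup>2 \<ge> 0" using a by (simp add: power_mult_distrib mult.commute)
    then have "(?q\<^sup>2 - y\<^sup>2) * (1 / (2 * \<epsilon>)) \<le> (?q\<^sup>2 - y\<^sup>2) * y" using c(4) by (intro mult_left_mono)
    then have "(?q\<^sup>2 - y\<^sup>2) * (1 / (2 * \<epsilon>)) \<le> 3 / (40 * \<epsilon>)" using m by (simp add: L_def)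
    from mult_right_mono[OF this, of "2 * \<epsilon>"] have "?q\<^sup>2 - y\<^sup>2 \<le> 6 / 40" using eps by simp
    then show ?thesis by (simp add: power_mult_distrib mult.commute)
  qed
  ultimately show "\<eta> powr (2/3) * x - \<omega> k \<le> 2" by (simp add: c(1,3))
qed

lemma omega_upper: "k \<in> J \<Longrightarrow> sqrt (\<omega> k) \<le> 1 / \<epsilon>"
proof -
  assume k: "k \<in> J"
  obtain x p where c: "x = sqrt (\<omega> k)" "x \<le> \<epsilon> * p" "p \<le> 1 / \<epsilon>\<^sup>2" proof -
    have "lo k \<in> {lo k..hi k}" using lo_le_hi by simp
    from root_coordinates[OF k this] show ?thesis using that by metis
  qed
  have "\<epsilon> * p \<le> \<epsilon> * (1 / \<epsilon>\<^sup>2)" using c(3) eps by (intro mult_left_mono) auto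
  then have "x \<le> \<epsilon> * (1 / \<epsilon>\<^sup>2)" using c(2) by linarith
  also have "\<dots> = 1 / \<epsilon>" using eps by (simp add: power2_eq_square)
  finally show ?thesis using c(1) by simp
qed

text \<open>The Taylor error is \<open>4 \<eta> (v - \<epsilon>)^2\<close>. From \<open>\<sigma> \<eta> - \<zeta> \<le> 2 L\<close> one gets \<open>\<epsilon> - v = O(L / (\<eta> \<epsilon>^2))\<close>, so the error is small
because \<open>L\<close> is a small multiple of \<open>1 / \<epsilon>\<close> and \<open>\<eta>\<close> is of size \<open>\<epsilon>^(-6)\<close>.\<close>

lemma freq_approx:
  assumes k: "k \<in> J" and e: "\<eta> \<in> {lo k..hi k}"
  shows "\<bar>freq (\<omega> k) \<eta> - (\<eta> * sqrt (1 + \<epsilon>\<^sup>2) + F1 * (liou_zeta (\<omega> k) - \<sigma> * \<eta>))\<bar> \<le> 1/20"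
    "\<eta> \<le> freq (\<omega> k) \<eta>" "freq (\<omega> k) \<eta> \<le> \<eta> * (1 + \<epsilon>\<^sup>2)"
proof -
  obtain x p where c: "x = sqrt (\<omega> k)" "\<omega> k = x\<^sup>2" "liou_zeta (\<omega> k) = 2/3 * x ^ 3" "p > 0" "p ^ 3 = \<eta>"
    "\<eta> powr (4/3) = p ^ 4" "x \<ge> 1 / (2 * \<epsilon>)" "x \<le> \<epsilon> * p"
    "(\<epsilon> * p) ^ 3 - x ^ 3 \<le> 3 * L" "\<sigma> * \<eta> = 2/3 * (\<epsilon> * p) ^ 3" using root_coordinates[OF k e] by metis
  have x0: "x > 0" using c(7) eps by (smt (verit) divide_pos_pos)
  define v where "v = x / p"
  have v: "0 \<le> v" "v \<le> \<epsilon>" using x0 c(4,8) by (auto simp: v_def pos_divide_le_eq)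
  have xv: "x = v * p" using c(4) by (simp add: v_def)
  have eta0: "\<eta> > 0" using c(4,5) by auto
  have fr: "freq (\<omega> k) \<eta> = \<eta> * sqrt (1 + v\<^sup>2)"
  proof -
    have "\<omega> k * \<eta> powr (4/3) = (v * p)\<^sup>2 * p ^ 4" by (simp only: c(2,6) xv)
    also have "\<dots> = (p ^ 3)\<^sup>2 * v\<^sup>2" by (simp add: power_mult_distrib mult_ac flip: power_mult power_add)
    finally have "\<eta>\<^sup>2 + \<omega> k * \<eta> powr (4/3) = \<eta>\<^sup>2 * (1 + v\<^sup>2)" by (simp add: c(5) distrib_left)
    then show ?thesis using eta0 by (simp add: freq_def real_sqrt_mult)
  qed
  have F: "F1 * (liou_zeta (\<omega> k) - \<sigma> * \<eta>) = \<eta> * ((v ^ 3 - \<epsilon> ^ 3) / (3 * \<epsilon> * sqrt (1 + \<epsilon>\<^sup>2)))"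
  proof -
    have d: "liou_zeta (\<omega> k) - \<sigma> * \<eta> = 2/3 * (\<eta> * (v ^ 3 - \<epsilon> ^ 3))"
      unfolding c(3,10) xv by (simp add: power_mult_distrib c(5) algebra_simps)
    show ?thesis unfolding d F1_def by simp
  qed
  have "\<bar>freq (\<omega> k) \<eta> - (\<eta> * sqrt (1 + \<epsilon>\<^sup>2) + F1 * (liou_zeta (\<omega> k) - \<sigma> * \<eta>))\<bar>
     = \<bar>\<eta> * (sqrt (1 + v\<^sup>2) - sqrt (1 + \<epsilon>\<^sup>2) - (v ^ 3 - \<epsilon> ^ 3) / (3 * \<epsilon> * sqrt (1 + \<epsilon>\<^sup>2)))\<bar>"
    unfolding fr F by (simp add: algebra_simps)
  also have "\<dots> = \<eta> * \<bar>sqrt (1 + v\<^sup>2) - sqrt (1 + \<epsilon>\<^sup>2) - (v ^ 3 - \<epsilon> ^ 3) / (3 * \<epsilon> * sqrt (1 + \<epsilon>\<^sup>2))\<bar>"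
    using eta0 by (simp add: abs_mult)
  also have "\<dots> \<le> \<eta> * (4 * (v - \<epsilon>)\<^sup>2)" using eta0 v eps by (intro mult_left_mono eikonal_taylor) auto
  also have "\<dots> \<le> 1/20"
  proof -
    define d where "d = \<epsilon> - v"
    have d0: "d \<ge> 0" using v by (simp add: d_def)
    have "\<eta> * (\<epsilon> ^ 3 - v ^ 3) \<le> 3 * L" using c(9) unfolding xv by (simp add: power_mult_distrib c(5) algebra_simps)
    moreover have "\<epsilon>\<^sup>2 * d \<le> \<epsilon> ^ 3 - v ^ 3"
    proof -
      have "\<epsilon> ^ 3 - v ^ 3 - \<epsilon>\<^sup>2 * d = v * (\<epsilon> - v) * (\<epsilon> + v)" by (simp add: d_def power3_eq_cube power2_eq_square algebra_simps)
      moreover have "v * (\<epsilon> - v) * (\<epsilon> + v) \<ge> 0" using v eps by simp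
      ultimately show ?thesis by linarith
    qed
    ultimately have "\<eta> * (\<epsilon>\<^sup>2 * d) \<le> 3 * L" using eta0 by (meson less_imp_le mult_left_mono order_trans)
    then have q: "\<eta> * \<epsilon> ^ 3 * d \<le> 3 / 40" using eps by (simp add: L_def field_simps power2_eq_square power3_eq_cube)
    have "0 \<le> \<eta> * \<epsilon> ^ 3 * d" using eta0 eps d0 by simp
    then have "(\<eta> * \<epsilon> ^ 3 * d)\<^sup>2 \<le> (3/40)\<^sup>2" using q by (intro power_mono)
    then have q2: "(\<eta> * \<epsilon> ^ 6) * (\<eta> * d\<^sup>2) \<le> 9/1600" by (simp add: power_mult_distrib power2_eq_square mult_ac flip: power_add power_mult)
    have "1 / (2 * \<epsilon> ^ 6) \<le> \<eta>" using lo_lower[OF k] e by auto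
    then have "1/2 \<le> \<eta> * \<epsilon> ^ 6" using eps by (simp add: field_simps)
    then have "1/2 * (\<eta> * d\<^sup>2) \<le> (\<eta> * \<epsilon> ^ 6) * (\<eta> * d\<^sup>2)" using eta0 by (intro mult_right_mono) auto
    then have "\<eta> * d\<^sup>2 \<le> 9/800" using q2 by linarith
    moreover have "(v - \<epsilon>)\<^sup>2 = d\<^sup>2" by (simp add: d_def power2_commute)
    ultimately show ?thesis by simp
  qed
  finally show "\<bar>freq (\<omega> k) \<eta> - (\<eta> * sqrt (1 + \<epsilon>\<^sup>2) + F1 * (liou_zeta (\<omega> k) - \<sigma> * \<eta>))\<bar> \<le> 1/20" .
  have "1 \<le> sqrt (1 + v\<^sup>2)" by simp
  then show "\<eta> \<le> freq (\<omega> k) \<eta>" unfolding fr using eta0 by simp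
  have "v\<^sup>2 \<le> \<epsilon>\<^sup>2" using v by (intro power_mono) auto
  moreover have "(1 + \<epsilon>\<^sup>2)\<^sup>2 = 1 + 2 * \<epsilon>\<^sup>2 + (\<epsilon>\<^sup>2)\<^sup>2" by (simp add: power2_sum)
  moreover have "0 \<le> \<epsilon>\<^sup>2" "0 \<le> (\<epsilon>\<^sup>2)\<^sup>2" by simp_all
  ultimately have "1 + v\<^sup>2 \<le> (1 + \<epsilon>\<^sup>2)\<^sup>2" by linarith
  then have "sqrt (1 + v\<^sup>2) \<le> 1 + \<epsilon>\<^sup>2" by (rule real_le_lsqrt[rotated 1]) (simp_all add: add_nonneg_nonneg)
  then show "freq (\<omega> k) \<eta> \<le> \<eta> * (1 + \<epsilon>\<^sup>2)" unfolding fr using eta0 by (intro mult_left_mono) auto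
qed

text \<open>The focus at time \<open>t\<close> is at \<open>y = - Y t n\<close>. The second summand absorbs the part of the error \<open>t F1 - 2 n\<close> that is linear in \<open>\<eta>\<close>.\<close>

definition "Y t n = t * (sqrt (1 + \<epsilon>\<^sup>2) - \<sigma> * F1) + (t * F1 - 2 * real n) * \<sigma>"

lemma F1_pos: "F1 > 0" using eps by (simp add: F1_def add_pos_nonneg)

lemma F1_upper: "F1 \<le> 1 / (2 * \<epsilon>)"
proof -
  have "2 * \<epsilon> * 1 \<le> 2 * \<epsilon> * sqrt (1 + \<epsilon>\<^sup>2)" using eps by (intro mult_left_mono) auto
  moreover have "0 < sqrt (1 + \<epsilon>\<^sup>2)" by (simp add: add_pos_nonneg)
  ultimately show ?thesis unfolding F1_def using eps by (intro divide_left_mono) auto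
qed

text \<open>With \<open>t F1 = 2 n + e\<close>, \<open>\<bar>e\<bar> \<le> \<epsilon>\<close>, the phase \<open>t F1 \<zeta>\<close> is \<open>2 n (k \<pi> - \<theta>)\<close> up to the error of the zeros and the term
\<open>e (\<zeta> - \<sigma> \<eta>)\<close>, which is bounded since \<open>\<zeta> - \<sigma> \<eta>\<close> is \<open>O(L)\<close>. The multiple of \<open>2 \<pi>\<close> disappears in the exponential and
\<open>2 n \<theta>\<close> is common to all modes.\<close>

lemma phase_alignment:
  assumes k: "k \<in> J" and e: "\<eta> \<in> {lo k..hi k}" and t: "0 \<le> t" "t \<le> 1" "\<bar>t * F1 - 2 * real n\<bar> \<le> \<epsilon>"
  shows "\<bar>t * freq (\<omega> k) \<eta> - \<eta> * Y t n + 2 * real n * \<theta> - 2 * pi * real (n * k)\<bar> \<le> 1/2"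
proof -
  define z where "z = liou_zeta (\<omega> k)"
  define err where "err = freq (\<omega> k) \<eta> - (\<eta> * sqrt (1 + \<epsilon>\<^sup>2) + F1 * (z - \<sigma> * \<eta>))"
  define \<kappa> where "\<kappa> = z - (real k * pi - \<theta>)"
  define ee where "ee = t * F1 - 2 * real n"
  have id: "t * freq (\<omega> k) \<eta> - \<eta> * Y t n + 2 * real n * \<theta> - 2 * pi * real (n * k) = t * err + 2 * real n * \<kappa> + ee * (z - \<sigma> * \<eta>)"
    unfolding err_def \<kappa>_def ee_def Y_def by (simp add: algebra_simps)
  have 1: "\<bar>t * err\<bar> \<le> 1 * (1/20)" unfolding abs_mult using freq_approx(1)[OF k e] t by (intro mult_mono) (auto simp: err_def z_def)
  have 2: "\<bar>2 * real n * \<kappa>\<bar> \<le> 1/10"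
  proof -
    have "t * F1 \<le> 1 * (1 / (2 * \<epsilon>))" using t F1_upper F1_pos by (intro mult_mono) auto
    moreover have "\<epsilon> \<le> 1 / (2 * \<epsilon>)"
    proof -
      have "\<epsilon> * (2 * \<epsilon>) \<le> 1 * 1" using eps by (intro mult_mono) auto
      then show ?thesis using eps by (simp add: pos_le_divide_eq)
    qed
    moreover have "1 / (2 * \<epsilon>) + 1 / (2 * \<epsilon>) = 1 / \<epsilon>" using eps by (simp add: field_simps)
    ultimately have "2 * real n \<le> 1 / \<epsilon>" using t(3) by linarith
    then have "\<bar>2 * real n\<bar> * \<bar>\<kappa>\<bar> \<le> (1 / \<epsilon>) * (16 * C * \<epsilon> ^ 3)"
      using zeta_near[OF k] eps by (intro mult_mono) (auto simp: \<kappa>_def z_def)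
    also have "\<dots> = (160 * C * \<epsilon>\<^sup>2) / 10" using eps by (simp add: power3_eq_cube power2_eq_square)
    also have "\<dots> \<le> 1 / 10" using small(3) by simp
    finally show ?thesis by (simp add: abs_mult)
  qed
  have 3: "\<bar>ee * (z - \<sigma> * \<eta>)\<bar> \<le> 1/20"
  proof -
    have "\<bar>z - \<sigma> * \<eta>\<bar> \<le> 2 * L"
      using zeta_near[OF k] C_eps3 eta_window(1,2)[OF k e] L_ge unfolding z_def by linarith
    then have "\<bar>ee\<bar> * \<bar>z - \<sigma> * \<eta>\<bar> \<le> \<epsilon> * (2 * L)" using t(3) eps by (intro mult_mono) (auto simp: ee_def)
    also have "\<dots> = 1/20" using eps by (simp add: L_def)
    finally show ?thesis by (simp add: abs_mult)
  qed
  show ?thesis unfolding id using 1 2 3 by linarith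
qed

lemma finite_J: "finite J"
proof (rule finite_subset)
  show "J \<subseteq> {k. k \<le> nat \<lceil>2/3 / \<epsilon> ^ 3 + \<bar>\<theta>\<bar>\<rceil>}"
  proof
    fix k assume k: "k \<in> J"
    have "real k * 1 \<le> real k * pi" using pi_ge_two by (intro mult_left_mono) auto
    then have "real k \<le> 2/3 / \<epsilon> ^ 3 + \<bar>\<theta>\<bar>" using k L_ge by (auto simp: J_def)
    then show "k \<in> {k. k \<le> nat \<lceil>2/3 / \<epsilon> ^ 3 + \<bar>\<theta>\<bar>\<rceil>}" by simp linarith
  qed
qed simp

lemma inj_omega: "inj_on \<omega> J"
proof (rule inj_onI)
  fix j k assume jk: "j \<in> J" "k \<in> J" "\<omega> j = \<omega> k"
  have "\<bar>real j * pi - real k * pi\<bar> \<le> 1/5" using zeta_near[OF jk(1), unfolded jk(3)] zeta_near[OF jk(2)] C_eps3 by linarith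
  then have "\<bar>real j - real k\<bar> * pi \<le> 1/5" by (simp add: abs_mult flip: left_diff_distrib)
  moreover have "\<bar>real j - real k\<bar> * 1 \<le> \<bar>real j - real k\<bar> * pi" using pi_ge_two by (intro mult_left_mono) auto
  ultimately have "\<bar>real j - real k\<bar> * 1 \<le> 1/5" by (rule order_trans[rotated])
  then have "\<bar>real j - real k\<bar> < 1" by simp
  then show "j = k" by linarith
qed

lemma card_J_lower:
  assumes "1 / (40 * \<epsilon>) + 8 \<le> \<delta> / (3 * \<epsilon> ^ 3)"
  shows "real (card J) \<ge> \<delta> / (12 * \<epsilon> ^ 3)"
proof -
  define A where "A = (2/3 * (1 - \<delta>) / \<epsilon> ^ 3 - 1 + \<theta>) / pi"
  define B where "B = (2/3 / \<epsilon> ^ 3 - L + \<theta>) / pi"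
  have A0: "A \<ge> 0"
  proof -
    define E where "E = 1 / \<epsilon> ^ 3"
    have E: "E \<ge> 8" using eps_cube_inv by (simp add: E_def)
    have "2/3 * (3/4) * E \<le> 2/3 * (1 - \<delta>) * E" using E delta by (intro mult_right_mono) auto
    moreover have "2 + \<bar>\<theta>\<bar> \<le> E / 4" using small(1) by (simp add: E_def)
    ultimately have "2/3 * (1 - \<delta>) * E - 1 + \<theta> \<ge> 0" using E by linarith
    then show ?thesis by (simp add: A_def E_def)
  qed
  have sub: "{nat \<lceil>A\<rceil>..<nat \<lceil>A\<rceil> + nat \<lfloor>B - A\<rfloor>} \<subseteq> J"
  proof
    fix k assume k: "k \<in> {nat \<lceil>A\<rceil>..<nat \<lceil>A\<rceil> + nat \<lfloor>B - A\<rfloor>}"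
    then have "A \<le> real k" using A0 by (simp add: nat_le_iff le_nat_iff) linarith
    moreover have "real k \<le> B" using k A0 by (simp add: nat_le_iff) linarith
    ultimately have "A * pi \<le> real k * pi" "real k * pi \<le> B * pi" by (auto intro: mult_right_mono)
    then show "k \<in> J" by (simp add: J_def A_def B_def)
  qed
  have "nat \<lfloor>B - A\<rfloor> \<le> card J" using card_mono[OF finite_J sub] by simp
  then have c: "B - A - 1 \<le> real (card J)" by linarith
  have "(B - A) * pi = 2/3 * \<delta> / \<epsilon> ^ 3 - L + 1" using eps3 by (simp add: A_def B_def field_simps)
  moreover have "2/3 * \<delta> / \<epsilon> ^ 3 = 2 * (\<delta> / (3 * \<epsilon> ^ 3))" by simp
  ultimately have b: "(B - A) * pi \<ge> \<delta> / (3 * \<epsilon> ^ 3) + 8" using assms by (simp add: L_def)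
  have pos: "\<delta> / (3 * \<epsilon> ^ 3) > 0" using delta eps3 by simp
  have "B - A \<ge> 0"
  proof (rule ccontr)
    assume "\<not> B - A \<ge> 0"
    then have "(B - A) * pi < 0" by (simp add: mult_neg_pos)
    then show False using b pos by linarith
  qed
  then have "(B - A) * pi \<le> (B - A) * 4" using pi_less_4 by (intro mult_left_mono) auto
  then have "4 * (B - A) \<ge> \<delta> / (3 * \<epsilon> ^ 3) + 8" using b by linarith
  moreover have "X \<le> 4 * real (card J)" if "X + 8 \<le> 4 * (B - A)" for X :: real
  proof -
    have "4 * (B - A - 1) \<le> 4 * real (card J)" using c by (rule mult_left_mono) simp
    then have "4 * (B - A) - 4 \<le> 4 * real (card J)" by (simp only: right_diff_distrib mult_1_right)
    moreover have "X \<le> 4 * (B - A) - 4" using that by (simp only: le_diff_eq)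
    ultimately show ?thesis by (rule order_trans[rotated])
  qed
  ultimately have "4 * real (card J) \<ge> \<delta> / (3 * \<epsilon> ^ 3)" by blast
  moreover have "\<delta> / (3 * \<epsilon> ^ 3) = 4 * (\<delta> / (12 * \<epsilon> ^ 3))" by simp
  ultimately show ?thesis by linarith
qed

text \<open>The total mass of amplitudes, which is the height of the wave at a focus up to constants.\<close>

definition "\<Lambda> = (\<Sum>k\<in>J. hi k - lo k)"

text \<open>There are at least of the order of \<open>\<epsilon>^(-3)\<close> indices, and each interval has length \<open>(L - 1) / \<sigma>\<close>, of order \<open>\<epsilon>^(-4)\<close>.\<close>

lemma Lambda_lower:
  assumes "1 / (40 * \<epsilon>) + 8 \<le> \<delta> / (3 * \<epsilon> ^ 3)"
  shows "\<Lambda> \<ge> \<delta> / 640 / \<epsilon> ^ 7"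
proof -
  have "\<Lambda> = real (card J) * ((L - 1) / \<sigma>)" by (simp add: \<Lambda>_def hi_def lo_def flip: diff_divide_distrib)
  moreover have "(L - 1) / \<sigma> \<ge> (L / 2) / \<sigma>" using L_ge sigma_pos by (intro divide_right_mono) auto
  moreover have "(L / 2) / \<sigma> = 3 / 160 / \<epsilon> ^ 4" using eps by (simp add: L_def \<sigma>_def field_simps power3_eq_cube power4_eq_xxxx)
  ultimately have "\<Lambda> \<ge> (\<delta> / (12 * \<epsilon> ^ 3)) * (3 / 160 / \<epsilon> ^ 4)"
    using card_J_lower[OF assms] delta eps by (metis (no_types, lifting) divide_nonneg_nonneg less_imp_le mult_mono of_nat_0_le_iff zero_le_divide_iff zero_le_numeral zero_le_power)
  moreover have "(\<delta> / (12 * \<epsilon> ^ 3)) * (3 / 160 / \<epsilon> ^ 4) = \<delta> / 640 / \<epsilon> ^ 7"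
    using eps by (simp add: field_simps flip: power_add)
  ultimately show ?thesis by simp
qed

end

section \<open>Frequency truncation of a mode\<close>

lemma freq_measurable [measurable]: "freq \<omega> \<in> borel_measurable borel"
  unfolding freq_def[abs_def] by measurable

text \<open>By Fubini the multiplier acts on each exponential \<open>exp (\<i> t \<mu>)\<close>, and Fourier inversion shows that it multiplies it by
\<open>m \<mu>\<close>, which is \<open>1\<close> on the frequencies present.\<close>

lemma time_multiplier_mode:
  assumes lo: "0 < lo" and m: "continuous_on UNIV m" "\<And>x. \<bar>x\<bar> > B \<Longrightarrow> m x = 0" and mi: "integrable lborel (ft m)"
    and one: "\<And>\<eta>. \<eta> \<in> {lo..hi} \<Longrightarrow> m (freq \<omega> \<eta>) = 1"
  shows "integrable lborel (\<lambda>s. inv_Fourier m (t - s) * mode_wave \<omega> lo hi (\<lambda>_. 1) s z)"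
    "time_multiplier m (mode_wave \<omega> lo hi (\<lambda>_. 1)) t z = mode_wave \<omega> lo hi (\<lambda>_. 1) t z"
proof -
  obtain x y where z: "z = (x, y)" by (cases z)
  have sf: "sigma_finite_measure (lborel :: real measure)" by (rule lborel.sigma_finite_measure_axioms)
  have fm [measurable]: "ft m \<in> borel_measurable borel" using mi by auto
  have am [measurable]: "airy \<in> borel_measurable borel" by (rule borel_measurable_continuous_onI[OF airy_continuous])
  define G where "G = (\<lambda>\<eta>. exp (\<i> * of_real (y * \<eta>)) * (indicator {lo..hi} \<eta> *\<^sub>R complex_of_real (airy (\<eta> powr (2/3) * x - \<omega>))))"
  have Gm [measurable]: "G \<in> borel_measurable borel" unfolding G_def by measurable
  have Gi: "integrable lborel G"
  proof -
    have "continuous_on {lo..hi} (\<lambda>\<eta>. complex_of_real (airy (\<eta> powr (2/3) * x - \<omega>)))"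
      by (intro continuous_intros continuous_on_compose2[OF airy_continuous]) (use lo in auto)
    from borel_integrable_atLeastAtMost'[OF this] show ?thesis unfolding G_def
      by (intro ft_integrand_integrable) (simp add: set_integrable_def)
  qed
  have u: "mode_wave \<omega> lo hi (\<lambda>_. 1) s z = (LINT \<eta>|lborel. exp (\<i> * of_real (s * freq \<omega> \<eta>)) * G \<eta>)" for s
    unfolding mode_wave_def z mode_int_ft[OF lo airy_continuous mode_wave_profile_continuous[OF lo continuous_on_const]] ft_def G_def
    by (intro Bochner_Integration.integral_cong) (auto simp: mult_ac)
  have shift: "integrable lborel (\<lambda>s. ft m (t - s))"
    using lborel_integrable_real_affine[OF mi, of "-1" t] by simp
  have prod: "integrable (lborel \<Otimes>\<^sub>M lborel) (\<lambda>(s, \<eta>). of_real (1 / (2 * pi)) * ft m (t - s) * (exp (\<i> * of_real (s * freq \<omega> \<eta>)) * G \<eta>))"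
  proof (rule integrable_pair_product_bound[OF sf sf, where a = "\<lambda>s. 1 / (2 * pi) * norm (ft m (t - s))" and b = "\<lambda>\<eta>. norm (G \<eta>)"])
    show "integrable lborel (\<lambda>s. 1 / (2 * pi) * norm (ft m (t - s)))" using shift by auto
    show "integrable lborel (\<lambda>\<eta>. norm (G \<eta>))" using Gi by auto
    fix s \<eta> show "norm (case (s, \<eta>) of (s, \<eta>) \<Rightarrow> of_real (1 / (2 * pi)) * ft m (t - s) * (exp (\<i> * of_real (s * freq \<omega> \<eta>)) * G \<eta>)) \<le> 1 / (2 * pi) * norm (ft m (t - s)) * norm (G \<eta>)"
      using iexp_norm[of "s * freq \<omega> \<eta>"] by (simp add: norm_mult norm_divide)
  qed measurable
  have expand: "inv_Fourier m (t - s) * mode_wave \<omega> lo hi (\<lambda>_. 1) s z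
     = (LINT \<eta>|lborel. of_real (1 / (2 * pi)) * ft m (t - s) * (exp (\<i> * of_real (s * freq \<omega> \<eta>)) * G \<eta>))" for s
    unfolding u inv_Fourier_eq_ft by (rule integral_mult_right_zero[symmetric])
  show "integrable lborel (\<lambda>s. inv_Fourier m (t - s) * mode_wave \<omega> lo hi (\<lambda>_. 1) s z)"
    unfolding expand using lborel_pair.integrable_fst[OF prod] by simp
  have inner: "(LINT s|lborel. of_real (1 / (2 * pi)) * ft m (t - s) * (exp (\<i> * of_real (s * \<mu>)) * c)) = (exp (\<i> * of_real (t * \<mu>)) * m \<mu>) * c" for \<mu> c
  proof -
    have "(LINT s|lborel. of_real (1 / (2 * pi)) * ft m (t - s) * (exp (\<i> * of_real (s * \<mu>)) * c))
       = \<bar>-1\<bar> *\<^sub>R (LINT s|lborel. of_real (1 / (2 * pi)) * ft m (t - (t + (-1) * s)) * (exp (\<i> * of_real ((t + (-1) * s) * \<mu>)) * c))"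
      by (rule lborel_integral_real_affine) simp
    also have "\<dots> = (LINT s|lborel. (of_real (1 / (2 * pi)) * c * exp (\<i> * of_real (t * \<mu>))) * (ft m s * exp (- (\<i> * of_real (s * \<mu>)))))"
    proof -
      have "exp (\<i> * of_real ((t + (-1) * s) * \<mu>)) = exp (\<i> * of_real (t * \<mu>)) * exp (- (\<i> * of_real (s * \<mu>)))" for s
        by (simp add: mult_exp_exp algebra_simps)
      then show ?thesis by (simp add: mult_ac)
    qed
    also have "\<dots> = (of_real (1 / (2 * pi)) * c * exp (\<i> * of_real (t * \<mu>))) * (of_real (2 * pi) * m \<mu>)"
      by (simp only: integral_mult_right_zero ft_inversion[OF m mi])
    also have "\<dots> = (exp (\<i> * of_real (t * \<mu>)) * m \<mu>) * c" by simp
    finally show ?thesis .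
  qed
  have "time_multiplier m (mode_wave \<omega> lo hi (\<lambda>_. 1)) t z
     = (LINT s|lborel. LINT \<eta>|lborel. of_real (1 / (2 * pi)) * ft m (t - s) * (exp (\<i> * of_real (s * freq \<omega> \<eta>)) * G \<eta>))"
    unfolding time_multiplier_def expand ..
  also have "\<dots> = (LINT \<eta>|lborel. LINT s|lborel. of_real (1 / (2 * pi)) * ft m (t - s) * (exp (\<i> * of_real (s * freq \<omega> \<eta>)) * G \<eta>))"
    by (rule lborel_pair.Fubini_integral[symmetric, OF prod])
  also have "\<dots> = (LINT \<eta>|lborel. exp (\<i> * of_real (t * freq \<omega> \<eta>)) * G \<eta>)"
    unfolding inner
  proof (intro Bochner_Integration.integral_cong refl)
    fix \<eta>
    show "exp (\<i> * of_real (t * freq \<omega> \<eta>)) * m (freq \<omega> \<eta>) * G \<eta> = exp (\<i> * of_real (t * freq \<omega> \<eta>)) * G \<eta>"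
      using one[of \<eta>] by (cases "\<eta> \<in> {lo..hi}") (auto simp: G_def)
  qed
  also have "\<dots> = mode_wave \<omega> lo hi (\<lambda>_. 1) t z" by (rule u[symmetric])
  finally show "time_multiplier m (mode_wave \<omega> lo hi (\<lambda>_. 1)) t z = mode_wave \<omega> lo hi (\<lambda>_. 1) t z" .
qed

section \<open>Pairing with Gaussian bumps\<close>

lemma gaussian_shift_integrable: "e > 0 \<Longrightarrow> integrable lborel (\<lambda>y::real. exp (- (e * (y + Y))\<^sup>2 / 2))"
  using lborel_integrable_real_affine[OF gaussian_integrable[of e], of 1 Y] by (simp add: add.commute)

lemma gaussian_shift_fourier:
  assumes e: "e > 0"
  shows "(LINT y|lborel. exp (\<i> * of_real (y * \<eta>)) * of_real (exp (- (e * (y + Y))\<^sup>2 / 2)))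
    = exp (- (\<i> * of_real (Y * \<eta>))) * of_real (sqrt (2 * pi) / e * exp (- (\<eta> / e)\<^sup>2 / 2))"
proof -
  have "(LINT y|lborel. exp (\<i> * of_real (y * \<eta>)) * of_real (exp (- (e * (y + Y))\<^sup>2 / 2)))
     = \<bar>1\<bar> *\<^sub>R (LINT y|lborel. exp (\<i> * of_real ((- Y + 1 * y) * \<eta>)) * of_real (exp (- (e * ((- Y + 1 * y) + Y))\<^sup>2 / 2)))"
    by (rule lborel_integral_real_affine) simp
  also have "\<dots> = (LINT y|lborel. exp (- (\<i> * of_real (Y * \<eta>))) * (exp (\<i> * of_real (y * \<eta>)) * of_real (exp (- (e * y)\<^sup>2 / 2))))"
  proof -
    have "exp (\<i> * of_real ((- Y + 1 * y) * \<eta>)) = exp (- (\<i> * of_real (Y * \<eta>))) * exp (\<i> * of_real (y * \<eta>))" for y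
      by (simp add: mult_exp_exp algebra_simps)
    then show ?thesis by (simp add: mult_ac)
  qed
  also have "\<dots> = exp (- (\<i> * of_real (Y * \<eta>))) * of_real (sqrt (2 * pi) / e * exp (- (\<eta> / e)\<^sup>2 / 2))"
    by (simp only: integral_mult_right_zero gaussian_fourier[OF e])
  finally show ?thesis .
qed

text \<open>Fubini moves the Fourier transform to the bump, so the pairing becomes an integral of the amplitude against a positive Gaussian
and the phase of the translation.\<close>

lemma gaussian_pairing:
  assumes q: "integrable lborel q" and e: "e > 0"
  shows "integrable lborel (\<lambda>y. of_real (exp (- (e * (y + Y))\<^sup>2 / 2)) * ft q y)"
    "(LINT y|lborel. of_real (exp (- (e * (y + Y))\<^sup>2 / 2)) * ft q y)
    = (LINT \<eta>|lborel. q \<eta> * (exp (- (\<i> * of_real (Y * \<eta>))) * of_real (sqrt (2 * pi) / e * exp (- (\<eta> / e)\<^sup>2 / 2))))"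
proof -
  let ?w = "\<lambda>y. exp (- (e * (y + Y))\<^sup>2 / 2)"
  have sf: "sigma_finite_measure (lborel :: real measure)" by (rule lborel.sigma_finite_measure_axioms)
  have qm [measurable]: "q \<in> borel_measurable borel" using q by auto
  have prod: "integrable (lborel \<Otimes>\<^sub>M lborel) (\<lambda>(y, \<eta>). of_real (?w y) * (exp (\<i> * of_real (y * \<eta>)) * q \<eta>))"
  proof (rule integrable_pair_product_bound[OF sf sf, where a = ?w and b = "\<lambda>\<eta>. norm (q \<eta>)"])
    show "integrable lborel ?w" by (rule gaussian_shift_integrable[OF e])
    show "integrable lborel (\<lambda>\<eta>. norm (q \<eta>))" using q by auto
    fix y \<eta> show "norm (case (y, \<eta>) of (y, \<eta>) \<Rightarrow> of_real (?w y) * (exp (\<i> * of_real (y * \<eta>)) * q \<eta>)) \<le> ?w y * norm (q \<eta>)"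
      using iexp_norm[of "y * \<eta>"] by (simp add: norm_mult)
  qed measurable
  have expand: "of_real (?w y) * ft q y = (LINT \<eta>|lborel. of_real (?w y) * (exp (\<i> * of_real (y * \<eta>)) * q \<eta>))" for y
    unfolding ft_def by (rule integral_mult_right_zero[symmetric])
  show "integrable lborel (\<lambda>y. of_real (?w y) * ft q y)"
    unfolding expand using lborel_pair.integrable_fst[OF prod] by simp
  have "(LINT y|lborel. of_real (?w y) * ft q y) = (LINT \<eta>|lborel. LINT y|lborel. of_real (?w y) * (exp (\<i> * of_real (y * \<eta>)) * q \<eta>))"
    unfolding expand by (rule lborel_pair.Fubini_integral[symmetric, OF prod])
  also have "\<dots> = (LINT \<eta>|lborel. LINT y|lborel. q \<eta> * (exp (\<i> * of_real (y * \<eta>)) * of_real (?w y)))"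
    by (simp only: mult_ac)
  also have "\<dots> = (LINT \<eta>|lborel. q \<eta> * (exp (- (\<i> * of_real (Y * \<eta>))) * of_real (sqrt (2 * pi) / e * exp (- (\<eta> / e)\<^sup>2 / 2))))"
    by (simp only: integral_mult_right_zero gaussian_shift_fourier[OF e])
  finally show "(LINT y|lborel. of_real (?w y) * ft q y)
    = (LINT \<eta>|lborel. q \<eta> * (exp (- (\<i> * of_real (Y * \<eta>))) * of_real (sqrt (2 * pi) / e * exp (- (\<eta> / e)\<^sup>2 / 2))))" .
qed

section \<open>Lower bounds for Lebesgue norms\<close>

lemma ennreal_powr_mono: "a \<le> b \<Longrightarrow> p \<ge> 0 \<Longrightarrow> ennreal_powr a p \<le> ennreal_powr b p"
proof (cases "b = \<infinity>")
  case False
  assume h: "a \<le> b" "p \<ge> 0"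
  obtain b' where b': "b' \<ge> 0" "b = ennreal b'" using False by (cases b) auto
  obtain a' where a': "a' \<ge> 0" "a = ennreal a'" using h(1) b' by (cases a) (auto simp: top_unique)
  have "a' \<le> b'" using h(1) unfolding a'(2) b'(2) by (subst (asm) ennreal_le_iff[OF b'(1)])
  then have "a' powr p \<le> b' powr p" using a'(1) h(2) by (intro powr_mono2)
  then show ?thesis using a' b' by (simp add: ennreal_powr_def ennreal_leI)
qed (simp add: ennreal_powr_def)

lemma ennreal_powr_ennreal: "a \<ge> 0 \<Longrightarrow> ennreal_powr (ennreal a) p = ennreal (a powr p)"
  by (simp add: ennreal_powr_def)

text \<open>The exponent arithmetic for the threshold \<open>l = A / (2 W)\<close> of the next lemma, with \<open>B = A / 2\<close>.\<close>

lemma concentration_exponent: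
  fixes B W \<rho> :: real
  assumes "B > 0" "W > 0" "\<rho> \<ge> 1"
  shows "B * W powr (- (1 - 1 / \<rho>)) = (B * (B / W) powr (\<rho> - 1)) powr (1 / \<rho>)"
proof -
  define b w where "b = ln B" and "w = ln W"
  have B: "B = exp b" and W: "W = exp w" using assms by (simp_all add: b_def w_def)
  have ep: "exp x powr y = exp (y * x)" for x y :: real by (simp add: powr_def)
  show ?thesis unfolding B W exp_diff[symmetric] ep exp_add[symmetric]
    by (rule arg_cong[where f = exp]) (use assms in \<open>simp add: field_simps\<close>)
qed

text \<open>Hoelder's inequality with a constant \<open>1/2\<close>, for weights between \<open>0\<close> and \<open>1\<close>. For finite \<open>r\<close> and every threshold
\<open>l\<close> one has \<open>f w \<le> l w + l^(1-r) f^r\<close>, and \<open>l = A / (2 W)\<close> makes the first term at most half of the total.\<close>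

lemma Lp_norm_lower_concentration:
  fixes f w :: "'a \<Rightarrow> real" and M :: "'a measure"
  assumes r: "1 \<le> r" and fm: "f \<in> borel_measurable M" and wm: "w \<in> borel_measurable M"
    and f0: "\<And>z. 0 \<le> f z" and w01: "\<And>z. 0 \<le> w z \<and> w z \<le> 1"
    and W: "(\<integral>\<^sup>+z. ennreal (w z) \<partial>M) \<le> ennreal W" "W > 0"
    and A: "ennreal A \<le> (\<integral>\<^sup>+z. ennreal (f z * w z) \<partial>M)" "A > 0"
  shows "ennreal (A / 2 * W powr (- (1 - enn2real (1 / r)))) \<le> Lp_norm r M (\<lambda>z. ennreal (f z))"
proof (cases "r = \<infinity>")
  case True
  then have i: "enn2real (1 / r) = 0" by simp
  have L: "Lp_norm r M (\<lambda>z. ennreal (f z)) = esssup M (\<lambda>z. ennreal (f z))" using True by (simp add: Lp_norm_def)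
  show ?thesis
  proof (cases "esssup M (\<lambda>z. ennreal (f z)) = \<infinity>")
    case True then show ?thesis by (simp add: L)
  next
    case False
    then obtain S where S: "S \<ge> 0" "esssup M (\<lambda>z. ennreal (f z)) = ennreal S" by (cases "esssup M (\<lambda>z. ennreal (f z))") auto
    have "AE z in M. ennreal (f z * w z) \<le> ennreal S * ennreal (w z)"
      using esssup_AE[where M = M and f = "\<lambda>z. ennreal (f z)"]
    proof eventually_elim
      case (elim z)
      then have "f z \<le> S" using S by (simp add: ennreal_le_iff)
      then have "f z * w z \<le> S * w z" using w01 by (intro mult_right_mono) auto
      then show ?case using S(1) w01[of z] by (simp add: ennreal_leI flip: ennreal_mult)
    qed
    then have "(\<integral>\<^sup>+z. ennreal (f z * w z) \<partial>M) \<le> (\<integral>\<^sup>+z. ennreal S * ennreal (w z) \<partial>M)" by (rule nn_integral_mono_AE)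
    also have "\<dots> = ennreal S * (\<integral>\<^sup>+z. ennreal (w z) \<partial>M)" by (rule nn_integral_cmult) (use wm in measurable)
    also have "\<dots> \<le> ennreal S * ennreal W" by (intro mult_left_mono W) simp
    finally have "ennreal A \<le> ennreal (S * W)" using A(1) S(1) W(2) by (simp add: ennreal_mult)
    then have "A \<le> S * W" using S(1) W(2) by (simp add: ennreal_le_iff)
    then have "A / W \<le> S" using W(2) by (simp add: pos_divide_le_eq)
    moreover have "A / 2 * W powr (- 1) \<le> A / W"
    proof -
      have "W powr (- 1) = inverse W" using W(2) powr_minus[of W 1] by (simp only: powr_one)
      then have "A / 2 * W powr (- 1) = (A / W) / 2" by (simp only: divide_inverse mult_ac)
      moreover have "x / 2 \<le> x" if "0 \<le> x" for x :: real using that by simp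
      ultimately show ?thesis using A(2) W(2) by (metis divide_nonneg_pos less_imp_le)
    qed
    ultimately have "A / 2 * W powr (- 1) \<le> S" by (rule order_trans[rotated])
    then show ?thesis unfolding L S(2) i by (intro ennreal_leI) simp
  qed
next
  case False
  then obtain \<rho> where rho: "r = ennreal \<rho>" "\<rho> \<ge> 0" by (cases r) auto
  have rho1: "\<rho> \<ge> 1" using r rho by (metis ennreal_1 ennreal_le_iff)
  have i: "enn2real (1 / r) = 1 / \<rho>" using rho rho1 divide_ennreal[of 1 \<rho>] by (simp del: divide_ennreal)
  define I where "I = (\<integral>\<^sup>+z. ennreal (f z powr \<rho>) \<partial>M)"
  have L: "Lp_norm r M (\<lambda>z. ennreal (f z)) = ennreal_powr I (1 / \<rho>)"
    using rho f0 by (simp add: Lp_norm_def I_def ennreal_powr_ennreal)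
  show ?thesis
  proof (cases "I = \<infinity>")
    case True then show ?thesis by (simp add: L ennreal_powr_def)
  next
    case False
    then obtain v where v: "v \<ge> 0" "I = ennreal v" by (cases I) auto
    define l where "l = A / (2 * W)"
    have l: "l > 0" using A W by (simp add: l_def)
    \<comment> \<open>where \<open>f \<le> l\<close> the first term suffices, elsewhere \<open>f = f powr (1 - \<rho>) * f powr \<rho>\<close> does\<close>
    have pw: "f z * w z \<le> l * w z + l powr (1 - \<rho>) * f z powr \<rho>" for z
    proof (cases "f z \<le> l")
      case True
      then have "f z * w z \<le> l * w z" using w01 by (intro mult_right_mono) auto
      then show ?thesis by (simp add: add_increasing2)
    next
      case False
      then have fl: "f z > l" "f z > 0" using l by auto
      have "f z = f z powr (1 - \<rho>) * f z powr \<rho>" using fl by (simp flip: powr_add)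
      also have "\<dots> \<le> l powr (1 - \<rho>) * f z powr \<rho>"
        using fl l rho1 by (intro mult_right_mono powr_mono2') auto
      finally have "f z \<le> l powr (1 - \<rho>) * f z powr \<rho>" .
      moreover have "f z * w z \<le> f z * 1" using w01 fl by (intro mult_left_mono) auto
      moreover have "0 \<le> l * w z" using l w01[of z] by simp
      ultimately show ?thesis by linarith
    qed
    have "ennreal A \<le> (\<integral>\<^sup>+z. ennreal l * ennreal (w z) + ennreal (l powr (1 - \<rho>)) * ennreal (f z powr \<rho>) \<partial>M)"
    proof (rule order_trans[OF A(1) nn_integral_mono])
      fix z
      show "ennreal (f z * w z) \<le> ennreal l * ennreal (w z) + ennreal (l powr (1 - \<rho>)) * ennreal (f z powr \<rho>)"
        using pw[of z] l w01[of z] by (simp add: ennreal_leI flip: ennreal_mult ennreal_plus)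
    qed
    also have "\<dots> = ennreal l * (\<integral>\<^sup>+z. ennreal (w z) \<partial>M) + ennreal (l powr (1 - \<rho>)) * I"
      unfolding I_def by (subst nn_integral_add) (use fm wm in \<open>auto simp: nn_integral_cmult\<close>)
    also have "\<dots> \<le> ennreal l * ennreal W + ennreal (l powr (1 - \<rho>)) * ennreal v"
      unfolding v(2) by (intro add_mono mult_left_mono W) auto
    also have "\<dots> = ennreal (l * W + l powr (1 - \<rho>) * v)" using l W v by (simp flip: ennreal_mult ennreal_plus)
    finally have "A \<le> l * W + l powr (1 - \<rho>) * v" using l W v by (subst (asm) ennreal_le_iff) auto
    moreover have "l * W = A / 2" using W by (simp add: l_def)
    ultimately have h: "A / 2 \<le> l powr (1 - \<rho>) * v" by linarith
    have "A / 2 * l powr (\<rho> - 1) \<le> (l powr (1 - \<rho>) * v) * l powr (\<rho> - 1)" using h by (intro mult_right_mono) auto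
    also have "\<dots> = v * (l powr (1 - \<rho>) * l powr (\<rho> - 1))" by (simp only: mult_ac)
    also have "l powr (1 - \<rho>) * l powr (\<rho> - 1) = 1" using l by (simp flip: powr_add)
    finally have vl: "A / 2 * l powr (\<rho> - 1) \<le> v" by simp
    have "A / 2 * W powr (- (1 - 1 / \<rho>)) = (A / 2 * l powr (\<rho> - 1)) powr (1 / \<rho>)"
      using concentration_exponent[of "A / 2" W \<rho>] A W rho1 by (simp only: l_def divide_divide_eq_left)
    also have "\<dots> \<le> v powr (1 / \<rho>)" using vl rho1 A by (intro powr_mono2) auto
    finally show ?thesis unfolding L v(2) i ennreal_powr_ennreal[OF v(1)] by (rule ennreal_leI)
  qed
qed

text \<open>Chebyshev's inequality. The minorant \<open>s\<close>, an indicator function in the application, carries the measurability, since \<open>g\<close> is itself a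
norm in the space variables.\<close>

lemma Lp_norm_lower_on_set:
  fixes g :: "real \<Rightarrow> ennreal"
  assumes q: "1 \<le> q" "q \<noteq> \<infinity>" and c: "c \<ge> 0" and T: "T \<ge> 0"
    and s: "s \<in> borel_measurable borel" "\<And>t. s t \<noteq> 0 \<Longrightarrow> s t \<le> 1 \<and> t \<in> {-t0..t0} \<and> ennreal c \<le> g t"
    and sT: "ennreal T \<le> (\<integral>\<^sup>+t. s t \<partial>lborel)"
  shows "ennreal (T powr (enn2real (1 / q)) * c) \<le> Lp_norm q (restrict_space lborel {-t0..t0}) g"
proof -
  obtain \<kappa> where k: "q = ennreal \<kappa>" "\<kappa> \<ge> 0" using q(2) by (cases q) auto
  have k1: "\<kappa> \<ge> 1" using q k by (metis ennreal_1 ennreal_le_iff)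
  have i: "enn2real (1 / q) = 1 / \<kappa>" using k k1 divide_ennreal[of 1 \<kappa>] by (simp del: divide_ennreal)
  have "ennreal (c powr \<kappa> * T) = ennreal (c powr \<kappa>) * ennreal T" by (rule ennreal_mult) (use T in auto)
  also have "\<dots> \<le> ennreal (c powr \<kappa>) * (\<integral>\<^sup>+t. s t \<partial>lborel)" by (intro mult_left_mono sT) auto
  also have "\<dots> = (\<integral>\<^sup>+t. ennreal (c powr \<kappa>) * s t \<partial>lborel)" by (rule nn_integral_cmult[symmetric]) (use s(1) in simp)
  also have "\<dots> \<le> (\<integral>\<^sup>+t. ennreal_powr (g t) \<kappa> * indicator {-t0..t0} t \<partial>lborel)"
  proof (rule nn_integral_mono)
    fix t
    show "ennreal (c powr \<kappa>) * s t \<le> ennreal_powr (g t) \<kappa> * indicator {-t0..t0} t"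
    proof (cases "s t = 0")
      case False
      then have st: "s t \<le> 1" "t \<in> {-t0..t0}" "ennreal c \<le> g t" using s(2) by blast+
      have "ennreal (c powr \<kappa>) \<le> ennreal_powr (g t) \<kappa>"
        using ennreal_powr_mono[OF st(3), of \<kappa>] k(2) by (simp add: ennreal_powr_ennreal c)
      then have "ennreal (c powr \<kappa>) * s t \<le> ennreal_powr (g t) \<kappa> * 1" using st(1) by (intro mult_mono) auto
      then show ?thesis using st(2) by simp
    qed simp
  qed
  also have "\<dots> = (\<integral>\<^sup>+t. ennreal_powr (g t) \<kappa> \<partial>restrict_space lborel {-t0..t0})"
    by (rule nn_integral_restrict_space[symmetric]) simp
  finally have "ennreal_powr (ennreal (c powr \<kappa> * T)) (1 / \<kappa>) \<le> Lp_norm q (restrict_space lborel {-t0..t0}) g"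
    using k k1 q(2) by (auto simp: Lp_norm_def intro!: ennreal_powr_mono)
  moreover have "(c powr \<kappa> * T) powr (1 / \<kappa>) = T powr (1 / \<kappa>) * c"
    using c T k1 by (simp add: powr_mult powr_powr)
  ultimately show ?thesis unfolding i using T by (simp add: ennreal_powr_ennreal)
qed

text \<open>How the limit \<open>\<epsilon> \<rightarrow> 0\<close> turns an inequality into a condition on exponents.\<close>

lemma powr_bounded_near_zero_imp_nonneg:
  fixes E K \<epsilon>0 :: real
  assumes "\<epsilon>0 > 0" "\<And>\<epsilon>. 0 < \<epsilon> \<Longrightarrow> \<epsilon> < \<epsilon>0 \<Longrightarrow> \<epsilon> powr E \<le> K"
  shows "E \<ge> 0"
proof (rule ccontr)
  assume "\<not> E \<ge> 0"
  then have E: "E < 0" by simp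
  define b where "b = (\<bar>K\<bar> + 1) powr (1 / E)"
  have b: "b > 0" by (simp add: b_def)
  define \<epsilon> where "\<epsilon> = min (\<epsilon>0 / 2) b"
  have e: "0 < \<epsilon>" "\<epsilon> < \<epsilon>0" "\<epsilon> \<le> b" using assms(1) b by (auto simp: \<epsilon>_def)
  have "\<bar>K\<bar> + 1 = b powr E" using E by (simp add: b_def powr_powr)
  also have "\<dots> \<le> \<epsilon> powr E" using e E by (intro powr_mono2') auto
  also have "\<dots> \<le> K" using assms(2)[OF e(1,2)] .
  finally show False by linarith
qed

section \<open>The refocusing wave\<close>

text \<open>What Fourier inversion needs to know about the rescaled truncation.\<close>

lemma time_cutoff_integrable_transform:
  fixes chi :: "real \<Rightarrow> real"
  assumes chi: "chi \<in> Cc_infinity UNIV" and h: "h > 0"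
  obtains B where "\<And>x. \<bar>x\<bar> > B \<Longrightarrow> complex_of_real (chi (h * x)) = 0"
    "continuous_on UNIV (\<lambda>\<tau>. complex_of_real (chi (h * \<tau>)))"
    "integrable lborel (ft (\<lambda>\<tau>. complex_of_real (chi (h * \<tau>))))"
proof -
  have sm: "smooth chi" and cpt: "compact (closure {x. chi x \<noteq> 0})" using chi by (auto simp: Cc_infinity_def)
  obtain B where B: "\<And>x. x \<in> closure {x. chi x \<noteq> 0} \<Longrightarrow> norm x \<le> B"
    using compact_imp_bounded[OF cpt] bounded_iff by blast
  have zero: "complex_of_real (chi (h * x)) = 0" if "\<bar>x\<bar> > B / h" for x
  proof -
    have "\<bar>h * x\<bar> > B" using that h by (simp add: abs_mult pos_divide_less_eq mult.commute)
    then show ?thesis using B[of "h * x"] closure_subset[of "{x. chi x \<noteq> 0}"] by auto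
  qed
  define m where "m = (\<lambda>\<tau>. complex_of_real (chi (h * \<tau> + 0)))"
  have "smooth (\<lambda>\<tau>. chi (h * \<tau> + 0))" by (rule smooth_compose_affine[OF bounded_linear_mult_right sm])
  then have m: "smooth m" unfolding m_def by (rule smooth_bounded_linear[OF bounded_linear_of_real])
  have vd: "(f has_vector_derivative frechet_derivative f (at x) 1) (at x)" if "smooth f" for f :: "real \<Rightarrow> complex" and x
  proof -
    have "frechet_derivative f (at x) = (\<lambda>t. t *\<^sub>R frechet_derivative f (at x) 1)"
      by (rule ext, rule has_derivative_real_scale[OF smooth_has_derivative[OF that]])
    then show ?thesis using smooth_has_derivative[OF that, of x] by (simp add: has_vector_derivative_def)
  qed
  have m1: "smooth (\<lambda>x. frechet_derivative m (at x) 1)" by (rule smooth_derivative[OF m])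
  have "integrable lborel (ft m)"
    by (rule ft_integrable_C2[OF vd[OF m] vd[OF m1] smooth_continuous[OF smooth_derivative[OF m1]], of "B / h"])
       (use zero in \<open>simp add: m_def\<close>)
  then show ?thesis using that[of "B / h"] zero smooth_continuous[OF m] by (simp add: m_def)
qed

lemma cos_ge_half:
  fixes x :: real
  assumes "\<bar>x\<bar> \<le> 1/2" shows "cos x \<ge> 1/2"
proof -
  have "cos (pi / 3) \<le> cos \<bar>x\<bar>" using assms pi_gt3 by (intro cos_monotone_0_pi_le) auto
  then show ?thesis by (simp add: cos_60)
qed

context gallery
begin

lemma lo_pos: "k \<in> J \<Longrightarrow> 0 < lo k"
  using lo_lower[of k] eps by (smt (verit) divide_pos_pos zero_less_power)

lemma omega_pos: "k \<in> J \<Longrightarrow> \<omega> k \<ge> 0" "k \<in> J \<Longrightarrow> airy (- \<omega> k) = 0"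
  using zeros[OF J_lower(3)] by force+

text \<open>Consecutive zeros, each with its own interval of \<open>\<eta>\<close>, all with amplitude \<open>1\<close>.\<close>

definition "beam t z = (\<Sum>k\<in>J. mode_wave (\<omega> k) (lo k) (hi k) (\<lambda>_. 1) t z)"

definition "beam_velocity z = (\<Sum>k\<in>J. mode_wave (\<omega> k) (lo k) (hi k) (\<lambda>\<eta>. \<i> * of_real (freq (\<omega> k) \<eta>)) 0 z)"

lemma beam_solution:
  fixes s :: "real \<Rightarrow> real"
  assumes step: "smooth s" "\<And>x. x \<le> 1/2 \<Longrightarrow> s x = 0" "\<And>x. x \<ge> 1 \<Longrightarrow> s x = 1"
  shows "wave_solution beam beam_velocity"
  unfolding beam_def[abs_def] beam_velocity_def[abs_def]
  by (rule wave_solution_sum[OF finite_J], rule mode_wave_solution[OF step lo_pos lo_le_hi omega_pos])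

text \<open>Here \<open>D = C / \<epsilon>\<close> bounds \<open>A'^2\<close> at the zeros, since \<open>sqrt \<omega> \<le> 1 / \<epsilon>\<close>, and the factor \<open>\<eta>^(-2/3)\<close> from orthogonality is \<open>O(\<epsilon>^4)\<close>.\<close>

lemma beam_norm_general:
  assumes b: "\<And>k. k \<in> J \<Longrightarrow> continuous_on {lo k..hi k} (b k)"
    and bP: "\<And>k \<eta>. k \<in> J \<Longrightarrow> \<eta> \<in> {lo k..hi k} \<Longrightarrow> \<bar>b k \<eta>\<bar> \<le> P" and P: "P \<ge> 0"
  shows "Lr_norm 2 (\<lambda>z. \<Sum>k\<in>J. mode_int airy (\<omega> k) (lo k) (hi k) (\<lambda>\<eta>. 1 * of_real (b k \<eta>)) z)
     \<le> ennreal (P * sqrt (4 * pi * C * \<epsilon> ^ 3 * \<Lambda>))"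
proof -
  let ?U = "\<lambda>z. \<Sum>k\<in>J. mode_int airy (\<omega> k) (lo k) (hi k) (\<lambda>\<eta>. 1 * of_real (b k \<eta>)) z"
  let ?m = "1 / (2 * \<epsilon> ^ 6)"
  have m0: "?m > 0" using eps by simp
  have lh: "?m \<le> lo k \<and> lo k \<le> hi k" if "k \<in> J" for k using lo_lower[OF that] lo_le_hi by simp
  have D: "(airy' (- \<omega> k))\<^sup>2 \<le> C / \<epsilon>" if "k \<in> J" for k
  proof -
    have "(airy' (- \<omega> k))\<^sup>2 \<le> C * sqrt (\<omega> k)" using zeros[OF J_lower(3)[OF that]] by blast
    also have "\<dots> \<le> C * (1 / \<epsilon>)" using omega_upper[OF that] C by (intro mult_left_mono) auto
    finally show "(airy' (- \<omega> k))\<^sup>2 \<le> C / \<epsilon>" by simp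
  qed
  have D0: "C / \<epsilon> \<ge> 0" using C eps by simp
  have g: "norm (1 :: complex) = 1" by simp
  note nrm = mode_sum_norm[OF finite_J inj_omega omega_pos(2) m0 lh b bP P D D0 g]
  have L0: "\<Lambda> \<ge> 0" unfolding \<Lambda>_def using lo_le_hi by (intro sum_nonneg) auto
  have "?m powr (-2/3) \<le> 2 * \<epsilon> ^ 4"
  proof -
    have inv: "(1 / X) powr (-2/3) = X powr (2/3)" if "X > 0" for X :: real using that by (simp add: powr_def ln_div)
    have "(\<epsilon> powr 6) powr (2/3) = \<epsilon> powr 4" by (simp add: powr_powr)
    then have e4: "(\<epsilon> ^ 6) powr (2/3) = \<epsilon> ^ 4" using eps by (simp add: powr_numeral)
    have "?m powr (-2/3) = (2 * \<epsilon> ^ 6) powr (2/3)" by (rule inv) (use eps in simp)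
    also have "\<dots> = 2 powr (2/3) * (\<epsilon> ^ 6) powr (2/3)" by (rule powr_mult)
    finally have "?m powr (-2/3) = 2 powr (2/3) * \<epsilon> ^ 4" unfolding e4 .
    moreover have "(2::real) powr (2/3) \<le> 2 powr 1" by (intro powr_mono) auto
    ultimately show ?thesis using eps by simp
  qed
  then have "2 * pi * (?m powr (-2/3) * P\<^sup>2 * (C / \<epsilon>) * (\<Sum>k\<in>J. hi k - lo k)) \<le> 2 * pi * (2 * \<epsilon> ^ 4 * P\<^sup>2 * (C / \<epsilon>) * (\<Sum>k\<in>J. hi k - lo k))"
    using C eps L0 by (intro mult_left_mono mult_right_mono) (auto simp: \<Lambda>_def)
  also have "\<dots> = P\<^sup>2 * (4 * pi * C * \<epsilon> ^ 3 * \<Lambda>)"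
    using eps by (simp add: \<Lambda>_def power_eq_if field_simps)
  finally have "n2 ?U \<le> P\<^sup>2 * (4 * pi * C * \<epsilon> ^ 3 * \<Lambda>)" using nrm(2) by (rule order_trans[rotated])
  then have "sqrt (n2 ?U) \<le> P * sqrt (4 * pi * C * \<epsilon> ^ 3 * \<Lambda>)"
    using P by (intro order_trans[OF real_sqrt_le_mono[of "n2 ?U"]]) (auto simp: real_sqrt_mult)
  then show ?thesis using Lr2_n2[OF nrm(1)] by (simp add: ennreal_leI)
qed

lemma beam_data_norms:
  "Lr_norm 2 (beam 0) \<le> ennreal (sqrt (4 * pi * C * \<epsilon> ^ 3 * \<Lambda>))"
  "Lr_norm 2 (\<lambda>z. of_real (\<epsilon> ^ 6) * (- \<i> * beam_velocity z)) \<le> ennreal (2 * sqrt (4 * pi * C * \<epsilon> ^ 3 * \<Lambda>))"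
proof -
  have 1: "beam 0 = (\<lambda>z. \<Sum>k\<in>J. mode_int airy (\<omega> k) (lo k) (hi k) (\<lambda>\<eta>. 1 * of_real 1) z)"
    by (simp add: fun_eq_iff beam_def mode_wave_def)
  show "Lr_norm 2 (beam 0) \<le> ennreal (sqrt (4 * pi * C * \<epsilon> ^ 3 * \<Lambda>))"
    unfolding 1 using beam_norm_general[of "\<lambda>_ _. 1" 1] by simp
  have v: "of_real (\<epsilon> ^ 6) * (- \<i> * mode_wave (\<omega> k) (lo k) (hi k) (\<lambda>\<eta>. \<i> * of_real (freq (\<omega> k) \<eta>)) 0 z)
     = mode_int airy (\<omega> k) (lo k) (hi k) (\<lambda>\<eta>. 1 * of_real (\<epsilon> ^ 6 * freq (\<omega> k) \<eta>)) z" for k z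
    unfolding mode_wave_def mode_int_cmult[symmetric] by (rule mode_int_cong) simp
  have 2: "(\<lambda>z. of_real (\<epsilon> ^ 6) * (- \<i> * beam_velocity z))
     = (\<lambda>z. \<Sum>k\<in>J. mode_int airy (\<omega> k) (lo k) (hi k) (\<lambda>\<eta>. 1 * of_real (\<epsilon> ^ 6 * freq (\<omega> k) \<eta>)) z)"
    unfolding beam_velocity_def sum_distrib_left v ..
  show "Lr_norm 2 (\<lambda>z. of_real (\<epsilon> ^ 6) * (- \<i> * beam_velocity z)) \<le> ennreal (2 * sqrt (4 * pi * C * \<epsilon> ^ 3 * \<Lambda>))"
    unfolding 2
  proof (rule beam_norm_general)
    fix k assume k: "k \<in> J"
    show "continuous_on {lo k..hi k} (\<lambda>\<eta>. \<epsilon> ^ 6 * freq (\<omega> k) \<eta>)"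
      unfolding freq_def using lo_pos[OF k] by (intro continuous_intros) auto
    fix \<eta> assume e: "\<eta> \<in> {lo k..hi k}"
    have "0 < \<eta>" using e lo_pos[OF k] by auto
    then have "0 \<le> freq (\<omega> k) \<eta>" using freq_approx(2)[OF k e] by linarith
    moreover have "freq (\<omega> k) \<eta> \<le> (1 / \<epsilon> ^ 6) * 2"
    proof -
      have "\<epsilon>\<^sup>2 \<le> 1" using eps by (intro power_le_one) auto
      then have "\<eta> * (1 + \<epsilon>\<^sup>2) \<le> (1 / \<epsilon> ^ 6) * 2" using eta_window(4)[OF k e] \<open>0 < \<eta>\<close> eps by (intro mult_mono) auto
      then show ?thesis using freq_approx(3)[OF k e] by linarith
    qed
    ultimately show "\<bar>\<epsilon> ^ 6 * freq (\<omega> k) \<eta>\<bar> \<le> 2" using eps by (simp add: abs_mult field_simps)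
  qed simp
qed

lemma beam_frequency_localized:
  fixes chi :: "real \<Rightarrow> real"
  assumes chi: "chi \<in> Cc_infinity UNIV" and one: "\<And>\<tau>. 1 - \<delta> \<le> \<tau> \<Longrightarrow> \<tau> \<le> 1 + \<epsilon>\<^sup>2 \<Longrightarrow> chi \<tau> = 1"
  shows "time_multiplier (\<lambda>\<tau>. of_real (chi (\<epsilon> ^ 6 * \<tau>))) beam = beam"
proof (intro ext)
  fix t z
  let ?m = "\<lambda>\<tau>. complex_of_real (chi (\<epsilon> ^ 6 * \<tau>))"
  have e6: "\<epsilon> ^ 6 > 0" using eps by simp
  obtain B where B: "\<And>x. \<bar>x\<bar> > B \<Longrightarrow> ?m x = 0" and c: "continuous_on UNIV ?m" and i: "integrable lborel (ft ?m)"
    using time_cutoff_integrable_transform[OF chi e6] by blast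
  have m1: "?m (freq (\<omega> k) \<eta>) = 1" if k: "k \<in> J" and e: "\<eta> \<in> {lo k..hi k}" for k \<eta>
  proof -
    have "1 - \<delta> \<le> \<epsilon> ^ 6 * \<eta>" "\<epsilon> ^ 6 * \<eta> \<le> 1" using eta_window(3,4)[OF k e] e6 by (simp_all add: field_simps)
    moreover have "\<epsilon> ^ 6 * \<eta> \<le> \<epsilon> ^ 6 * freq (\<omega> k) \<eta>" using freq_approx(2)[OF k e] e6 by (intro mult_left_mono) auto
    moreover have "\<epsilon> ^ 6 * freq (\<omega> k) \<eta> \<le> (\<epsilon> ^ 6 * \<eta>) * (1 + \<epsilon>\<^sup>2)"
      using freq_approx(3)[OF k e] e6 by (metis mult.assoc mult_left_mono less_imp_le)
    moreover have "(\<epsilon> ^ 6 * \<eta>) * (1 + \<epsilon>\<^sup>2) \<le> 1 * (1 + \<epsilon>\<^sup>2)" using calculation(2) by (intro mult_right_mono) auto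
    ultimately have "1 - \<delta> \<le> \<epsilon> ^ 6 * freq (\<omega> k) \<eta>" "\<epsilon> ^ 6 * freq (\<omega> k) \<eta> \<le> 1 + \<epsilon>\<^sup>2"
      by (meson order_trans, metis mult_1 order_trans)
    then show ?thesis using one by simp
  qed
  note tm = time_multiplier_mode[OF lo_pos c B i m1]
  have "time_multiplier ?m beam t z = (\<Sum>k\<in>J. time_multiplier ?m (mode_wave (\<omega> k) (lo k) (hi k) (\<lambda>_. 1)) t z)"
    unfolding time_multiplier_def beam_def sum_distrib_left
    by (rule Bochner_Integration.integral_sum) (rule tm(1))
  also have "\<dots> = beam t z" unfolding beam_def by (intro sum.cong refl tm(2))
  finally show "time_multiplier ?m beam t z = beam t z" .
qed

text \<open>After pairing in \<open>y\<close>, every mode contributes an integral over \<open>\<eta>\<close> whose integrand is, up to the common factor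
\<open>exp (- 2 \<i> n \<theta>)\<close>, a positive quantity times \<open>exp (\<i> p)\<close> with \<open>p\<close> within \<open>1/2\<close> of a multiple of \<open>2 \<pi>\<close>. All real parts are
bounded below, so the contributions add up without cancellation.\<close>

lemma beam_concentration:
  assumes x: "\<epsilon>\<^sup>2 \<le> x" "x \<le> \<epsilon>\<^sup>2 + \<epsilon> ^ 4" and t: "0 \<le> t" "t \<le> 1" "\<bar>t * F1 - 2 * real n\<bar> \<le> \<epsilon>"
  shows "ennreal (\<Lambda> * (1/2 * airy 2 * (sqrt (2 * pi) * \<epsilon> ^ 6 * exp (- 1/2))))
     \<le> (\<integral>\<^sup>+y. ennreal (norm (beam t (x, y)) * exp (- (1 / \<epsilon> ^ 6 * (y + Y t n))\<^sup>2 / 2)) \<partial>lborel)"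
proof -
  let ?e = "1 / \<epsilon> ^ 6"
  let ?w = "\<lambda>y. exp (- (?e * (y + Y t n))\<^sup>2 / 2)"
  let ?c = "\<lambda>\<eta>. sqrt (2 * pi) / ?e * exp (- (\<eta> / ?e)\<^sup>2 / 2)"
  \<comment> \<open>undoes the phase \<open>- 2 n \<theta>\<close> common to all modes\<close>
  let ?ph = "exp (\<i> * of_real (2 * real n * \<theta>))"
  have e0: "?e > 0" using eps by simp
  define Q where "Q = (\<lambda>k \<eta>. (1 * exp (\<i> * of_real (t * freq (\<omega> k) \<eta>))) * complex_of_real (airy (\<eta> powr (2/3) * x - \<omega> k)))"
  define q where "q = (\<lambda>k \<eta>. indicator {lo k..hi k} \<eta> *\<^sub>R Q k \<eta>)"
  define G where "G = (\<lambda>k \<eta>. q k \<eta> * (exp (- (\<i> * of_real (Y t n * \<eta>))) * of_real (?c \<eta>)))"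
  have Qc: "continuous_on {lo k..hi k} (Q k)" if "k \<in> J" for k
    unfolding Q_def using lo_pos[OF that]
    by (intro continuous_intros freq_continuous continuous_on_compose2[OF airy_continuous]) auto
  have qi: "integrable lborel (q k)" if "k \<in> J" for k
    using borel_integrable_atLeastAtMost'[OF Qc[OF that]] by (simp add: q_def set_integrable_def)
  have Gi: "integrable lborel (G k)" if "k \<in> J" for k
  proof -
    have "continuous_on {lo k..hi k} (\<lambda>\<eta>. Q k \<eta> * (exp (- (\<i> * of_real (Y t n * \<eta>))) * of_real (?c \<eta>)))"
      by (intro continuous_intros Qc that) (use eps in auto)
    from borel_integrable_atLeastAtMost'[OF this] show ?thesis by (simp add: G_def q_def set_integrable_def)
  qed
  have u: "mode_wave (\<omega> k) (lo k) (hi k) (\<lambda>_. 1) t (x, y) = ft (q k) y" if "k \<in> J" for k y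
    unfolding mode_wave_def q_def Q_def
    by (rule mode_int_ft[OF lo_pos[OF that] airy_continuous mode_wave_profile_continuous[OF lo_pos[OF that] continuous_on_const]])
  have beam: "beam t (x, y) = (\<Sum>k\<in>J. ft (q k) y)" for y unfolding beam_def by (intro sum.cong refl u)
  note gp = gaussian_pairing[OF qi e0]
  have bi: "integrable lborel (\<lambda>y. of_real (?w y) * beam t (x, y))"
    unfolding beam sum_distrib_left by (rule Bochner_Integration.integrable_sum) (rule gp(1))
  define P where "P = (LINT y|lborel. of_real (?w y) * beam t (x, y))"
  have "P = (\<Sum>k\<in>J. LINT y|lborel. of_real (?w y) * ft (q k) y)"
    unfolding P_def beam sum_distrib_left by (rule Bochner_Integration.integral_sum) (rule gp(1))
  also have "\<dots> = (\<Sum>k\<in>J. LINT \<eta>|lborel. G k \<eta>)" unfolding G_def by (intro sum.cong refl gp(2))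
  finally have P: "P = (\<Sum>k\<in>J. LINT \<eta>|lborel. G k \<eta>)" .
  define m where "m = 1/2 * airy 2 * (sqrt (2 * pi) * \<epsilon> ^ 6 * exp (- 1/2))"
  \<comment> \<open>the choice of \<open>m\<close>: \<open>1/2\<close> from the phase, \<open>airy 2\<close> from the profile and \<open>exp (- 1/2)\<close> from the Gaussian, where \<open>\<eta> h \<le> 1\<close>\<close>
  have mode: "m * (hi k - lo k) \<le> Re (?ph * (LINT \<eta>|lborel. G k \<eta>))" if k: "k \<in> J" for k
  proof -
    have pt: "indicator {lo k..hi k} \<eta> * m \<le> Re (?ph * G k \<eta>)" for \<eta>
    proof (cases "\<eta> \<in> {lo k..hi k}")
      case False then show ?thesis by (simp add: G_def q_def)
    next
      case e: True
      define a where "a = airy (\<eta> powr (2/3) * x - \<omega> k)"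
      define p where "p = t * freq (\<omega> k) \<eta> - \<eta> * Y t n + 2 * real n * \<theta>"
      have a: "airy 2 \<le> a" unfolding a_def
        using turning_point_window[OF k e x] by (intro airy_antimono) auto
      have a2: "0 \<le> airy 2" using airy_pos_decreasing(1)[of 2] by simp
      have cp: "1/2 \<le> cos p"
      proof -
        have "1/2 \<le> cos (p - 2 * pi * real (n * k))"
          using phase_alignment[OF k e t] by (intro cos_ge_half) (simp add: p_def)
        also have "\<dots> = cos p" using cos.minus_of_nat[of p "n * k"] by (simp add: mult_ac)
        finally show ?thesis .
      qed
      have c: "sqrt (2 * pi) * \<epsilon> ^ 6 * exp (- 1/2) \<le> ?c \<eta>"
      proof -
        have "0 \<le> \<eta> * \<epsilon> ^ 6" using e lo_pos[OF k] eps by auto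
        moreover have "\<eta> * \<epsilon> ^ 6 \<le> 1" using eta_window(4)[OF k e] eps by (simp add: field_simps)
        ultimately have "(\<eta> * \<epsilon> ^ 6)\<^sup>2 \<le> 1" by (simp add: power_le_one)
        then have "exp (- 1/2) \<le> exp (- (\<eta> * \<epsilon> ^ 6)\<^sup>2 / 2)" by simp
        then show ?thesis using eps by (simp add: mult_left_mono)
      qed
      have "?ph * G k \<eta> = exp (\<i> * of_real p) * of_real (a * ?c \<eta>)"
      proof -
        have "exp (\<i> * of_real p) = ?ph * exp (\<i> * of_real (t * freq (\<omega> k) \<eta>)) * exp (- (\<i> * of_real (Y t n * \<eta>)))"
          unfolding mult_exp_exp p_def by (simp add: algebra_simps)
        then show ?thesis using e by (simp add: G_def q_def Q_def a_def mult_ac)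
      qed
      then have "Re (?ph * G k \<eta>) = cos p * (a * ?c \<eta>)"
        by (simp add: Re_exp del: of_real_mult of_real_divide)
      moreover have "1/2 * (airy 2 * (sqrt (2 * pi) * \<epsilon> ^ 6 * exp (- 1/2))) \<le> cos p * (a * ?c \<eta>)"
        by (intro mult_mono cp a c) (use a a2 cp eps in auto)
      ultimately show ?thesis using e by (simp add: m_def)
    qed
    have "integrable lborel (\<lambda>\<eta>. indicator {lo k..hi k} \<eta> * m)"
      using borel_integrable_atLeastAtMost'[OF continuous_on_const, of "lo k" "hi k" m] by (simp add: set_integrable_def)
    note im = this
    have "m * (hi k - lo k) = (LINT \<eta>|lborel. indicator {lo k..hi k} \<eta> * m)"
      using lo_le_hi[of k] by simp
    also have "\<dots> \<le> (LINT \<eta>|lborel. Re (?ph * G k \<eta>))"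
      by (rule integral_mono[OF im _ pt]) (use Gi[OF k] in auto)
    also have "\<dots> = Re (?ph * (LINT \<eta>|lborel. G k \<eta>))"
      using Gi[OF k] by (subst integral_mult_right_zero[symmetric], subst integral_Re) auto
    finally show ?thesis .
  qed
  have "\<Lambda> * m = (\<Sum>k\<in>J. m * (hi k - lo k))" unfolding \<Lambda>_def by (simp add: sum_distrib_left mult.commute)
  also have "\<dots> \<le> (\<Sum>k\<in>J. Re (?ph * (LINT \<eta>|lborel. G k \<eta>)))" by (rule sum_mono) (rule mode)
  also have "\<dots> = Re (?ph * P)" unfolding P sum_distrib_left Re_sum ..
  also have "\<dots> \<le> norm (?ph * P)" by (rule complex_Re_le_cmod)
  also have "\<dots> = norm P" unfolding norm_mult iexp_norm by simp
  also have "\<dots> \<le> (LINT y|lborel. norm (of_real (?w y) * beam t (x, y)))" unfolding P_def by (rule integral_norm_bound)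
  also have "\<dots> = (LINT y|lborel. norm (beam t (x, y)) * ?w y)" by (simp add: norm_mult mult.commute)
  finally have le: "\<Lambda> * m \<le> (LINT y|lborel. norm (beam t (x, y)) * ?w y)" .
  have ni: "integrable lborel (\<lambda>y. norm (beam t (x, y)) * ?w y)"
    using integrable_norm[OF bi] by (simp add: norm_mult mult.commute)
  show ?thesis unfolding m_def[symmetric]
    by (subst nn_integral_eq_integral[OF ni]) (use le in \<open>auto intro: ennreal_leI\<close>)
qed

end

lemma gaussian_shift_total:
  assumes e: "e > 0"
  shows "(LINT y|lborel. exp (- (e * (y + Y))\<^sup>2 / 2)) = sqrt (2 * pi) / e"
proof -
  have "complex_of_real (LINT y|lborel. exp (- (e * (y + Y))\<^sup>2 / 2)) = (LINT y|lborel. exp (\<i> * of_real (y * 0)) * of_real (exp (- (e * (y + Y))\<^sup>2 / 2)))"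
    by (simp flip: integral_complex_of_real del: of_real_exp)
  also have "\<dots> = complex_of_real (sqrt (2 * pi) / e)"
    unfolding gaussian_shift_fourier[OF e] by simp
  finally show ?thesis by (simp only: of_real_eq_iff)
qed

context gallery
begin

lemma beam_measurable [measurable]: "beam t \<in> borel_measurable borel"
proof (rule borel_measurable_continuous_onI)
  have "continuous_on UNIV (\<lambda>z. mode_wave (\<omega> k) (lo k) (hi k) (\<lambda>_. 1) (fst (t, z)) (snd (t, z)))" if "k \<in> J" for k
    by (rule continuous_on_compose2[OF mode_wave_jointly_continuous[OF lo_pos[OF that] continuous_on_const]])
       (auto intro: continuous_intros)
  then show "continuous_on UNIV (beam t)" unfolding beam_def[abs_def] by (intro continuous_on_sum) simp
qed

text \<open>A bump adapted to the focus: width \<open>\<epsilon>^4\<close> in \<open>x\<close> and \<open>\<epsilon>^6\<close> in \<open>y\<close>, around \<open>y = - Y t n\<close>.\<close>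

definition packet :: "real \<Rightarrow> nat \<Rightarrow> real \<times> real \<Rightarrow> real" where
  "packet t n z = indicator {\<epsilon>\<^sup>2..\<epsilon>\<^sup>2 + \<epsilon> ^ 4} (fst z) * exp (- (1 / \<epsilon> ^ 6 * (snd z + Y t n))\<^sup>2 / 2)"

lemma packet_measurable [measurable]: "packet t n \<in> borel_measurable borel"
  unfolding packet_def[abs_def] borel_prod[symmetric] by measurable

lemma packet_bounds: "0 \<le> packet t n z \<and> packet t n z \<le> 1"
  by (auto simp: packet_def indicator_def)

lemma packet_mass: "(\<integral>\<^sup>+z. ennreal (packet t n z) \<partial>M\<Omega>) \<le> ennreal (sqrt (2 * pi) * \<epsilon> ^ 10)"
proof -
  let ?I = "{\<epsilon>\<^sup>2..\<epsilon>\<^sup>2 + \<epsilon> ^ 4}"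
  have e0: "1 / \<epsilon> ^ 6 > 0" using eps by simp
  have y: "(\<integral>\<^sup>+y. ennreal (packet t n (x, y)) \<partial>lborel) = ennreal (sqrt (2 * pi) * \<epsilon> ^ 6) * indicator ?I x" for x
  proof -
    have "(\<integral>\<^sup>+y. ennreal (exp (- (1 / \<epsilon> ^ 6 * (y + Y t n))\<^sup>2 / 2)) \<partial>lborel) = ennreal (sqrt (2 * pi) * \<epsilon> ^ 6)"
      by (subst nn_integral_eq_integral[OF gaussian_shift_integrable[OF e0]])
         (simp_all add: gaussian_shift_total[OF e0, simplified])
    then show ?thesis by (cases "x \<in> ?I") (simp_all add: packet_def)
  qed
  have "(\<integral>\<^sup>+z. ennreal (packet t n z) \<partial>M\<Omega>) = (\<integral>\<^sup>+x. (ennreal (sqrt (2 * pi) * \<epsilon> ^ 6) * indicator ?I x) * indicator {0<..} x \<partial>lborel)"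
    by (subst nn_integral_M\<Omega>) (measurable, simp only: y)
  also have "\<dots> \<le> (\<integral>\<^sup>+x. ennreal (sqrt (2 * pi) * \<epsilon> ^ 6) * indicator ?I x \<partial>lborel)"
    by (intro nn_integral_mono) (simp add: indicator_def)
  also have "\<dots> = ennreal (sqrt (2 * pi) * \<epsilon> ^ 6) * ennreal (\<epsilon> ^ 4)"
    using eps by (subst nn_integral_cmult_indicator) auto
  also have "\<dots> = ennreal (sqrt (2 * pi) * \<epsilon> ^ 6 * \<epsilon> ^ 4)" using eps by (intro ennreal_mult[symmetric]) auto
  also have "sqrt (2 * pi) * \<epsilon> ^ 6 * \<epsilon> ^ 4 = sqrt (2 * pi) * \<epsilon> ^ 10" by (simp add: mult.assoc flip: power_add)
  finally show ?thesis .
qed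

definition "overlap = \<epsilon> ^ 4 * (\<Lambda> * (1/2 * airy 2 * (sqrt (2 * pi) * \<epsilon> ^ 6 * exp (- 1/2))))"

lemma packet_overlap:
  assumes t: "0 \<le> t" "t \<le> 1" "\<bar>t * F1 - 2 * real n\<bar> \<le> \<epsilon>"
  shows "ennreal overlap \<le> (\<integral>\<^sup>+z. ennreal (norm (beam t z) * packet t n z) \<partial>M\<Omega>)"
proof -
  let ?I = "{\<epsilon>\<^sup>2..\<epsilon>\<^sup>2 + \<epsilon> ^ 4}"
  let ?m = "\<Lambda> * (1/2 * airy 2 * (sqrt (2 * pi) * \<epsilon> ^ 6 * exp (- 1/2)))"
  have "ennreal overlap = ennreal ?m * ennreal (\<epsilon> ^ 4)"
    unfolding overlap_def by (subst mult.commute, rule ennreal_mult'') (use eps in simp)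
  also have "\<dots> = (\<integral>\<^sup>+x. ennreal ?m * indicator ?I x \<partial>lborel)"
    using eps by (subst nn_integral_cmult_indicator) auto
  also have "\<dots> \<le> (\<integral>\<^sup>+x. (\<integral>\<^sup>+y. ennreal (norm (beam t (x, y)) * packet t n (x, y)) \<partial>lborel) * indicator {0<..} x \<partial>lborel)"
  proof (rule nn_integral_mono)
    fix x
    show "ennreal ?m * indicator ?I x \<le> (\<integral>\<^sup>+y. ennreal (norm (beam t (x, y)) * packet t n (x, y)) \<partial>lborel) * indicator {0<..} x"
    proof (cases "x \<in> ?I")
      case True
      then have "x > 0" using eps by (smt (verit) atLeastAtMost_iff zero_less_power)
      moreover have "packet t n (x, y) = exp (- (1 / \<epsilon> ^ 6 * (y + Y t n))\<^sup>2 / 2)" for y using True by (simp add: packet_def)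
      ultimately show ?thesis using beam_concentration[OF _ _ t, of x] True by simp
    qed simp
  qed
  also have "\<dots> = (\<integral>\<^sup>+z. ennreal (norm (beam t z) * packet t n z) \<partial>M\<Omega>)"
    by (rule nn_integral_M\<Omega>[symmetric]) measurable
  finally show ?thesis .
qed

lemma beam_Lr_lower:
  assumes r: "1 \<le> r" and L: "\<Lambda> > 0" and t: "0 \<le> t" "t \<le> 1" "\<bar>t * F1 - 2 * real n\<bar> \<le> \<epsilon>"
  shows "ennreal (overlap / 2 * (sqrt (2 * pi) * \<epsilon> ^ 10) powr (- (1 - enn2real (1 / r)))) \<le> Lr_norm r (beam t)"
  unfolding Lr_norm_def
proof (rule Lp_norm_lower_concentration[OF r, where w = "packet t n"])
  show "(\<lambda>z. norm (beam t z)) \<in> borel_measurable M\<Omega>" by (rule measurable_M\<Omega>) measurable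
  show "packet t n \<in> borel_measurable M\<Omega>" by (rule measurable_M\<Omega>) measurable
  show "0 < overlap" using L eps airy_pos_decreasing(1)[of 2] by (simp add: overlap_def)
qed (use packet_bounds packet_mass packet_overlap[OF t] eps in auto)

text \<open>The windows \<open>\<bar>t F1 - 2 n\<bar> \<le> \<epsilon>\<close> are disjoint and have length \<open>2 \<epsilon> / F1\<close>. About \<open>t1 F1 / 2\<close> of them fit into the time interval, so the number
\<open>F1\<close> cancels from the total length.\<close>

lemma beam_Lq_lower:
  assumes r: "1 \<le> r" and q: "1 \<le> q" "q \<noteq> \<infinity>" and L: "\<Lambda> > 0"
    and t1: "0 < t1" "t1 \<le> 1" "t1 \<le> t0" "\<epsilon> \<le> t1 / 18"
  shows "ennreal ((t1 * \<epsilon> / 2) powr enn2real (1 / q) * (overlap / 2 * (sqrt (2 * pi) * \<epsilon> ^ 10) powr (- (1 - enn2real (1 / r)))))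
     \<le> LqLr_norm q r t0 beam"
proof -
  define N where "N = nat \<lfloor>(t1 * F1 - 1) / 2\<rfloor>"
  define I where "I = (\<lambda>n::nat. {(2 * real n - \<epsilon>) / F1..(2 * real n + \<epsilon>) / F1})"
  define S where "S = (\<Union>n\<in>{1..N}. I n)"
  have inI: "t \<in> I n \<longleftrightarrow> \<bar>t * F1 - 2 * real n\<bar> \<le> \<epsilon>" for t n
    unfolding I_def using F1_pos by (auto simp: pos_divide_le_eq pos_le_divide_eq abs_le_iff)
  have F1l: "F1 \<ge> 1 / (3 * \<epsilon>)"
  proof -
    have "\<epsilon>\<^sup>2 \<le> 1" using eps by (intro power_le_one) auto
    then have "sqrt (1 + \<epsilon>\<^sup>2) \<le> 3/2" by (intro real_le_lsqrt) (auto simp: power2_eq_square)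
    then have "2 * \<epsilon> * sqrt (1 + \<epsilon>\<^sup>2) \<le> 2 * \<epsilon> * (3/2)" using eps by (intro mult_left_mono) auto
    moreover have "0 < sqrt (1 + \<epsilon>\<^sup>2)" by (simp add: add_pos_nonneg)
    ultimately show ?thesis unfolding F1_def using eps by (intro divide_left_mono) auto
  qed
  have "t1 * F1 \<ge> t1 * (1 / (3 * \<epsilon>))" using F1l t1 by (intro mult_left_mono) auto
  moreover have "t1 * (1 / (3 * \<epsilon>)) \<ge> 6" using t1 eps by (simp add: field_simps)
  ultimately have tF: "t1 * F1 \<ge> 6" by linarith
  have N: "real N \<ge> t1 * F1 / 4" "2 * real N \<le> t1 * F1 - 1"
  proof -
    define v where "v = t1 * F1"
    define x where "x = (v - 1) / 2"
    have v6: "6 \<le> v" using tF by (simp add: v_def)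
    have "0 \<le> \<lfloor>x\<rfloor>" using v6 by (simp add: x_def)
    then have "real N = of_int \<lfloor>x\<rfloor>" by (simp add: N_def x_def v_def)
    then have "x - 1 < real N" "real N \<le> x" by linarith+
    then have "v / 4 \<le> real N" "2 * real N \<le> v - 1" using v6 by (simp_all add: x_def field_simps)
    then show "real N \<ge> t1 * F1 / 4" "2 * real N \<le> t1 * F1 - 1" by (simp_all add: v_def)
  qed
  have good: "0 \<le> t \<and> t \<le> t1" if "n \<in> {1..N}" "t \<in> I n" for n t
  proof -
    have n: "1 \<le> real n" "real n \<le> real N" using that(1) by auto
    have b: "\<bar>t * F1 - 2 * real n\<bar> \<le> \<epsilon>" using that(2) inI by blast
    have "0 \<le> t * F1" "t * F1 \<le> t1 * F1" using b n N(2) eps by linarith+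
    then show ?thesis using F1_pos by (simp add: zero_le_mult_iff)
  qed
  have disj: "disjoint_family_on I {1..N}"
  proof (unfold disjoint_family_on_def, intro ballI impI)
    fix m n assume "m \<noteq> (n::nat)"
    then have "1 \<le> \<bar>real m - real n\<bar>" by linarith
    then have "\<not> (\<bar>x - 2 * real m\<bar> \<le> \<epsilon> \<and> \<bar>x - 2 * real n\<bar> \<le> \<epsilon>)" for x using eps by linarith
    then show "I m \<inter> I n = {}" using inI by blast
  qed
  have em: "emeasure lborel (I n) = ennreal (2 * \<epsilon> / F1)" for n
  proof -
    have "(2 * real n - \<epsilon>) / F1 \<le> (2 * real n + \<epsilon>) / F1" using eps F1_pos by (intro divide_right_mono) auto
    then show ?thesis unfolding I_def by (simp add: diff_divide_distrib add_divide_distrib)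
  qed
  have Sm: "S \<in> sets lborel" unfolding S_def I_def by auto
  have meas: "ennreal (t1 * \<epsilon> / 2) \<le> (\<integral>\<^sup>+t. indicator S t \<partial>lborel)"
  proof -
    define c where "c = 2 * \<epsilon> / F1"
    have c0: "0 \<le> c" using eps F1_pos by (simp add: c_def)
    have "emeasure lborel S = (\<Sum>n\<in>{1..N}. emeasure lborel (I n))"
      unfolding S_def by (rule sum_emeasure[symmetric, OF _ disj]) (auto simp: I_def)
    also have "\<dots> = ennreal (real N * c)"
      unfolding em c_def[symmetric] using c0 by (simp add: ennreal_of_nat_eq_real_of_nat ennreal_mult)
    finally have S: "emeasure lborel S = ennreal (real N * c)" .
    have "t1 * F1 / 4 * c \<le> real N * c" by (rule mult_right_mono[OF N(1) c0])
    moreover have "t1 * F1 / 4 * c = t1 * \<epsilon> / 2" unfolding c_def using F1_pos by simp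
    ultimately have "t1 * \<epsilon> / 2 \<le> real N * c" by (simp only:)
    then show ?thesis unfolding nn_integral_indicator[OF Sm] S by (rule ennreal_leI)
  qed
  show ?thesis unfolding LqLr_norm_def
  proof (rule Lp_norm_lower_on_set[OF q _ _ _ _ meas])
    show "(indicator S :: real \<Rightarrow> ennreal) \<in> borel_measurable borel" using Sm by simp
    fix t assume "indicator S t \<noteq> (0 :: ennreal)"
    then obtain n where n: "n \<in> {1..N}" "t \<in> I n" by (auto simp: S_def indicator_def split: if_splits)
    have t: "0 \<le> t" "t \<le> 1" "t \<in> {- t0..t0}" "\<bar>t * F1 - 2 * real n\<bar> \<le> \<epsilon>" using good[OF n] t1 n(2) inI by auto
    show "indicator S t \<le> (1 :: ennreal) \<and> t \<in> {- t0..t0} \<and>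
       ennreal (overlap / 2 * (sqrt (2 * pi) * \<epsilon> ^ 10) powr (- (1 - enn2real (1 / r)))) \<le> Lr_norm r (beam t)"
      using t(3) beam_Lr_lower[OF r L t(1,2,4)] by (simp add: indicator_def)
    next
    show "0 \<le> overlap / 2 * (sqrt (2 * pi) * \<epsilon> ^ 10) powr (- (1 - enn2real (1 / r)))"
      using L airy_pos_decreasing(1)[of 2] eps by (simp add: overlap_def)
  qed (use t1 eps in auto)
qed

end

section \<open>Consequences of the Strichartz estimate\<close>

text \<open>All smallness conditions hold for \<open>\<epsilon>\<close> below a threshold, because each becomes \<open>\<epsilon> c \<le> 1\<close> for some constant \<open>c\<close> after estimating
higher powers of \<open>\<epsilon>\<close> by \<open>\<epsilon>\<close>.\<close>

lemma small_parameters: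
  assumes "C > 0" "\<delta> > (0::real)" "\<delta> \<le> 1/4" "t1 > 0"
  obtains \<epsilon>0 :: real where "\<epsilon>0 > 0"
    "\<And>\<epsilon>. 0 < \<epsilon> \<Longrightarrow> \<epsilon> < \<epsilon>0 \<Longrightarrow> \<epsilon> \<le> 1/80 \<and> 2 + \<bar>\<theta>\<bar> \<le> 1 / (4 * \<epsilon> ^ 3) \<and> real k0 \<le> 1 / (16 * \<epsilon> ^ 3) \<and> 160 * C * \<epsilon>\<^sup>2 \<le> 1
       \<and> 1 / (40 * \<epsilon>) + 8 \<le> \<delta> / (3 * \<epsilon> ^ 3) \<and> \<epsilon>\<^sup>2 \<le> \<delta> \<and> \<epsilon> \<le> t1 / 18"
proof -
  define K where "K = 80 + 8 + 4 * \<bar>\<theta>\<bar> + 16 * real k0 + 160 * C + 27 / \<delta> + 18 / t1"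
  have K: "K \<ge> 80" "K \<ge> 8 + 4 * \<bar>\<theta>\<bar>" "K \<ge> 16 * real k0" "K \<ge> 160 * C" "K \<ge> 27 / \<delta>" "K \<ge> 18 / t1"
    unfolding K_def using assms by (auto intro!: add_nonneg_nonneg add_increasing add_increasing2)
  show ?thesis
  proof (rule that[of "1 / K"])
    show "1 / K > 0" using K(1) by simp
    fix \<epsilon> :: real assume e: "0 < \<epsilon>" "\<epsilon> < 1 / K"
    have eK: "\<epsilon> * K < 1" using e K(1) by (simp add: field_simps)
    have b: "\<epsilon> * c \<le> 1" if "c \<le> K" for c
    proof -
      have "\<epsilon> * c \<le> \<epsilon> * K" using that e by (intro mult_left_mono) auto
      then show ?thesis using eK by linarith
    qed
    have e1: "\<epsilon> \<le> 1/80" using b[OF K(1)] by simp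
    have e2: "\<epsilon>\<^sup>2 \<le> \<epsilon>" using e e1 by (simp add: power2_eq_square mult_left_le)
    have e3: "\<epsilon> ^ 3 \<le> \<epsilon>" using e e1 power_decreasing[of 1 3 \<epsilon>] by simp
    have p3: "\<epsilon> ^ 3 > 0" using e by simp
    have c3: "\<epsilon> ^ 3 * c \<le> 1" if "c \<le> K" "c \<ge> 0" for c using mult_right_mono[OF e3 that(2)] b[OF that(1)] by linarith
    have d: "27 * \<epsilon> \<le> \<delta>" using b[OF K(5)] assms(2) by (simp add: pos_divide_le_eq mult.commute)
    have "2 + \<bar>\<theta>\<bar> \<le> 1 / (4 * \<epsilon> ^ 3)" using c3[OF K(2)] p3 by (simp add: pos_le_divide_eq algebra_simps)
    moreover have "real k0 \<le> 1 / (16 * \<epsilon> ^ 3)" using c3[OF K(3)] p3 by (simp add: pos_le_divide_eq algebra_simps)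
    moreover have "160 * C * \<epsilon>\<^sup>2 \<le> 1"
    proof -
      have "160 * C * \<epsilon>\<^sup>2 \<le> 160 * C * \<epsilon>" using e2 assms(1) by (intro mult_left_mono) auto
      also have "\<dots> \<le> 1" using b[OF K(4)] by (simp only: mult_ac)
      finally show ?thesis .
    qed
    moreover have "1 / (40 * \<epsilon>) + 8 \<le> \<delta> / (3 * \<epsilon> ^ 3)"
    proof -
      have "(1 / (40 * \<epsilon>) + 8) * (3 * \<epsilon> ^ 3) = 3/40 * \<epsilon>\<^sup>2 + 24 * \<epsilon> ^ 3"
        using e by (simp add: power3_eq_cube power2_eq_square field_simps)
      also have "\<dots> \<le> \<delta>" using e2 e3 d e by linarith
      finally show ?thesis using p3 by (simp add: pos_le_divide_eq)
    qed
    moreover have "\<epsilon>\<^sup>2 \<le> \<delta>" using e2 d e by linarith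
    moreover have "\<epsilon> \<le> t1 / 18" using b[OF K(6)] assms(4) by (simp add: field_simps)
    ultimately show "\<epsilon> \<le> 1/80 \<and> 2 + \<bar>\<theta>\<bar> \<le> 1 / (4 * \<epsilon> ^ 3) \<and> real k0 \<le> 1 / (16 * \<epsilon> ^ 3) \<and> 160 * C * \<epsilon>\<^sup>2 \<le> 1
       \<and> 1 / (40 * \<epsilon>) + 8 \<le> \<delta> / (3 * \<epsilon> ^ 3) \<and> \<epsilon>\<^sup>2 \<le> \<delta> \<and> \<epsilon> \<le> t1 / 18" using e1 by blast
  qed
qed

text \<open>The powers of \<open>\<epsilon>\<close> are: \<open>6 \<beta>\<close> from \<open>h\<close>, \<open>\<kappa> = 1/q\<close> from the duration of the focusing, \<open>10 - 10 (1 - \<rho>)\<close> from duality with \<open>\<rho> = 1/r\<close>, against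
\<open>3/2\<close> from the data. One factor \<open>sqrt \<Lambda>\<close> cancels, and the other one contributes \<open>- 7/2\<close>.\<close>

lemma exponent_balance:
  fixes \<epsilon> \<Lambda> a b c0 D K t1 \<kappa> \<rho> :: real
  assumes e: "0 < \<epsilon>" and pos: "0 < a" "0 < b" "0 < c0" "0 < D" "0 < t1" and L: "c0 / \<epsilon> ^ 7 \<le> \<Lambda>"
    and est: "(\<epsilon> ^ 6) powr (2 * (1/2 - \<rho>) - \<kappa>) * ((t1 * \<epsilon> / 2) powr \<kappa> * (\<epsilon> ^ 10 * \<Lambda> * a * (b * \<epsilon> ^ 10) powr (- (1 - \<rho>))))
      \<le> K * sqrt (D * \<epsilon> ^ 3 * \<Lambda>)"
  shows "\<epsilon> powr (2 * (1/2 - \<rho>) - 5 * \<kappa>) \<le> K * sqrt D / ((t1 / 2) powr \<kappa> * a * b powr (- (1 - \<rho>)) * sqrt c0)"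
proof -
  define S where "S = sqrt \<Lambda>"
  define k where "k = (t1 / 2) powr \<kappa> * a * b powr (- (1 - \<rho>))"
  define E where "E = 2 * (1/2 - \<rho>) - 5 * \<kappa>"
  have pw: "\<epsilon> ^ n = \<epsilon> powr (real n)" for n using e by (simp add: powr_realpow)
  have L0: "\<Lambda> > 0" using L pos(3) e by (smt (verit) divide_pos_pos zero_less_power)
  have SS: "\<Lambda> = S * S" and S0: "S > 0" using L0 by (simp_all add: S_def)
  have kp: "k > 0" using pos by (simp add: k_def)
  have 1: "(\<epsilon> ^ 6) powr (2 * (1/2 - \<rho>) - \<kappa>) = \<epsilon> powr (6 * (2 * (1/2 - \<rho>) - \<kappa>))"
    unfolding pw powr_powr by simp
  have 2: "(t1 * \<epsilon> / 2) powr \<kappa> = (t1 / 2) powr \<kappa> * \<epsilon> powr \<kappa>"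
    using powr_mult[of "t1 / 2" \<epsilon> \<kappa>] by simp
  have 3: "(b * \<epsilon> ^ 10) powr (- (1 - \<rho>)) = b powr (- (1 - \<rho>)) * \<epsilon> powr (- 10 * (1 - \<rho>))"
    unfolding powr_mult pw powr_powr by simp
  have 4: "\<epsilon> ^ 10 = \<epsilon> powr 10" unfolding pw by simp
  have 5: "sqrt (D * \<epsilon> ^ 3 * \<Lambda>) = sqrt D * \<epsilon> powr (3/2) * S"
  proof -
    have "\<epsilon> ^ 3 = (\<epsilon> powr (3/2))\<^sup>2" unfolding pw power2_eq_square powr_add[symmetric] by simp
    then show ?thesis by (simp add: real_sqrt_mult S_def)
  qed
  have 6: "sqrt c0 * \<epsilon> powr (-7/2) \<le> S"
  proof -
    have "(sqrt c0 * \<epsilon> powr (-7/2))\<^sup>2 = c0 * \<epsilon> powr (-7)"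
      using pos(3) unfolding power_mult_distrib by (simp add: power2_eq_square flip: powr_add)
    also have "\<dots> = c0 / \<epsilon> ^ 7" unfolding pw by (simp add: powr_minus divide_inverse)
    finally show ?thesis unfolding S_def using L by (metis real_le_rsqrt)
  qed
  have "\<epsilon> powr (6 * (2 * (1/2 - \<rho>) - \<kappa>)) * \<epsilon> powr \<kappa> * \<epsilon> powr 10 * \<epsilon> powr (- 10 * (1 - \<rho>)) = \<epsilon> powr (E + 7/2 + 3/2)"
    unfolding powr_add[symmetric] by (rule arg_cong[where f = "(powr) \<epsilon>"]) (simp add: E_def algebra_simps)
  then have pE: "\<epsilon> powr (6 * (2 * (1/2 - \<rho>) - \<kappa>)) * \<epsilon> powr \<kappa> * \<epsilon> powr 10 * \<epsilon> powr (- 10 * (1 - \<rho>)) = \<epsilon> powr (E + 7/2) * \<epsilon> powr (3/2)"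
    by (simp only: powr_add)
  have "k * S * \<epsilon> powr (E + 7/2) * (\<epsilon> powr (3/2) * S)
     = k * (S * S) * (\<epsilon> powr (6 * (2 * (1/2 - \<rho>) - \<kappa>)) * \<epsilon> powr \<kappa> * \<epsilon> powr 10 * \<epsilon> powr (- 10 * (1 - \<rho>)))"
    unfolding pE by (simp only: mult_ac)
  also have "\<dots> = (\<epsilon> ^ 6) powr (2 * (1/2 - \<rho>) - \<kappa>) * ((t1 * \<epsilon> / 2) powr \<kappa> * (\<epsilon> ^ 10 * \<Lambda> * a * (b * \<epsilon> ^ 10) powr (- (1 - \<rho>))))"
    unfolding 1 2 3 SS k_def unfolding 4 by (simp only: mult_ac)
  also have "\<dots> \<le> (K * sqrt D) * (\<epsilon> powr (3/2) * S)" using est unfolding 5 by (simp only: mult_ac)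
  finally have "k * S * \<epsilon> powr (E + 7/2) \<le> K * sqrt D" by (rule mult_right_le_imp_le) (use e S0 in simp)
  moreover have "k * (sqrt c0 * \<epsilon> powr (-7/2)) * \<epsilon> powr (E + 7/2) \<le> k * S * \<epsilon> powr (E + 7/2)"
    using 6 kp by (intro mult_right_mono mult_left_mono) auto
  moreover have "k * (sqrt c0 * \<epsilon> powr (-7/2)) * \<epsilon> powr (E + 7/2) = (k * sqrt c0) * \<epsilon> powr E"
  proof -
    have "\<epsilon> powr (-7/2) * \<epsilon> powr (E + 7/2) = \<epsilon> powr E" unfolding powr_add[symmetric] by simp
    then show ?thesis by (metis mult.assoc)
  qed
  ultimately have "(k * sqrt c0) * \<epsilon> powr E \<le> K * sqrt D" by linarith
  then show ?thesis using kp pos(3) by (simp add: pos_le_divide_eq E_def k_def mult.commute)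
qed

lemma (in gallery) strichartz_on_beam:
  fixes chi :: "real \<Rightarrow> real" and q r :: ennreal
  assumes chi: "chi \<in> Cc_infinity UNIV" "eventually (\<lambda>\<tau>. chi \<tau> = 1) (nhds 1)"
    and one: "\<And>\<tau>. 1 - \<delta> \<le> \<tau> \<Longrightarrow> \<tau> \<le> 1 + \<epsilon>\<^sup>2 \<Longrightarrow> chi \<tau> = 1"
    and r: "1 \<le> r" and q: "1 \<le> q" "q \<noteq> \<infinity>"
    and t1: "0 < t1" "t1 \<le> 1" "t1 \<le> t0" "\<epsilon> \<le> t1 / 18"
    and sm: "1 / (40 * \<epsilon>) + 8 \<le> \<delta> / (3 * \<epsilon> ^ 3)"
    and Cs: "Cs > 0" and est: "\<And>h u u1. 0 < h \<Longrightarrow> h < 1 \<Longrightarrow> wave_solution u u1 \<Longrightarrow>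
       ennreal (h powr strichartz_beta q r) * LqLr_norm q r t0 (time_multiplier (\<lambda>\<tau>. of_real (chi (h * \<tau>))) u)
         \<le> ennreal Cs * (Lr_norm 2 (u 0) + Lr_norm 2 (\<lambda>z. of_real h * (- \<i> * u1 z)))"
  defines "\<kappa> \<equiv> enn2real (1 / q)" and "\<rho> \<equiv> enn2real (1 / r)"
  shows "\<epsilon> powr (2 * (1/2 - \<rho>) - 5 * \<kappa>) \<le> 3 * Cs * sqrt (4 * pi * C)
     / ((t1 / 2) powr \<kappa> * (airy 2 * sqrt (2 * pi) * exp (- 1/2) / 4) * sqrt (2 * pi) powr (- (1 - \<rho>)) * sqrt (\<delta> / 640))"
proof (rule exponent_balance)
  define NB where "NB = sqrt (4 * pi * C * \<epsilon> ^ 3 * \<Lambda>)"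
  define X where "X = (t1 * \<epsilon> / 2) powr \<kappa> * (overlap / 2 * (sqrt (2 * pi) * \<epsilon> ^ 10) powr (- (1 - \<rho>)))"
  have a2: "0 < airy 2" by (rule airy_pos_decreasing) simp
  show L: "\<delta> / 640 / \<epsilon> ^ 7 \<le> \<Lambda>" by (rule Lambda_lower[OF sm])
  have "0 < \<delta> / 640 / \<epsilon> ^ 7" using delta eps by simp
  then have L0: "\<Lambda> > 0" using L by linarith
  have h: "0 < \<epsilon> ^ 6" "\<epsilon> ^ 6 < 1" using eps by (auto intro: power_less_one_iff[THEN iffD2])
  obtain s :: "real \<Rightarrow> real" where s: "smooth s" "\<And>x. x \<le> 1/2 \<Longrightarrow> s x = 0" "\<And>x. x \<ge> 1 \<Longrightarrow> s x = 1"
    using smooth_step_exists[OF chi] by blast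
  have ws: "wave_solution beam beam_velocity" by (rule beam_solution[OF s(1)]) (use s in auto)
  have loc: "time_multiplier (\<lambda>\<tau>. of_real (chi (\<epsilon> ^ 6 * \<tau>))) beam = beam"
    by (rule beam_frequency_localized[OF chi(1)]) (rule one)
  have N0: "NB \<ge> 0" unfolding NB_def using C eps L0 by simp
  have X0: "X \<ge> 0" unfolding X_def overlap_def using L0 a2 eps by simp
  have "ennreal ((\<epsilon> ^ 6) powr strichartz_beta q r * X) = ennreal ((\<epsilon> ^ 6) powr strichartz_beta q r) * ennreal X"
    by (rule ennreal_mult) (use X0 in auto)
  also have "\<dots> \<le> ennreal ((\<epsilon> ^ 6) powr strichartz_beta q r) * LqLr_norm q r t0 beam"
    unfolding X_def \<kappa>_def \<rho>_def by (intro mult_left_mono beam_Lq_lower r q L0 t1) simp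
  also have "\<dots> \<le> ennreal Cs * (Lr_norm 2 (beam 0) + Lr_norm 2 (\<lambda>z. of_real (\<epsilon> ^ 6) * (- \<i> * beam_velocity z)))"
    using est[OF h ws] unfolding loc .
  also have "\<dots> \<le> ennreal Cs * (ennreal NB + ennreal (2 * NB))"
    unfolding NB_def by (intro mult_left_mono add_mono beam_data_norms) simp
  also have "\<dots> = ennreal (3 * Cs * NB)" using N0 Cs by (simp flip: ennreal_plus ennreal_mult) 
  finally have "(\<epsilon> ^ 6) powr strichartz_beta q r * X \<le> 3 * Cs * NB"
    by (subst (asm) ennreal_le_iff) (use N0 Cs in simp)
  moreover have "strichartz_beta q r = 2 * (1/2 - \<rho>) - \<kappa>" by (simp add: strichartz_beta_def \<kappa>_def \<rho>_def)
  moreover have "overlap / 2 = \<epsilon> ^ 10 * \<Lambda> * (airy 2 * sqrt (2 * pi) * exp (- 1/2) / 4)"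
  proof -
    have "\<epsilon> ^ 10 = \<epsilon> ^ 4 * \<epsilon> ^ 6" by (simp flip: power_add)
    then show ?thesis unfolding overlap_def by simp
  qed
  ultimately show "(\<epsilon> ^ 6) powr (2 * (1/2 - \<rho>) - \<kappa>) * ((t1 * \<epsilon> / 2) powr \<kappa> * (\<epsilon> ^ 10 * \<Lambda> * (airy 2 * sqrt (2 * pi) * exp (- 1/2) / 4) * (sqrt (2 * pi) * \<epsilon> ^ 10) powr (- (1 - \<rho>))))
    \<le> 3 * Cs * sqrt (4 * pi * C * \<epsilon> ^ 3 * \<Lambda>)"
    unfolding X_def NB_def by (simp only:)
  show "0 < airy 2 * sqrt (2 * pi) * exp (- 1/2) / 4" using a2 by simp
qed (use eps C delta t1 in auto)

lemma strichartz_exponent_bound: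
  fixes chi :: "real \<Rightarrow> real" and q r :: ennreal
  assumes chi: "chi \<in> Cc_infinity UNIV" "eventually (\<lambda>\<tau>. chi \<tau> = 1) (nhds 1)"
    and q: "1 \<le> q" "q \<noteq> \<infinity>" and r: "1 \<le> r" and str: "strichartz_estimate chi q r"
  shows "0 \<le> 2 * (1/2 - enn2real (1 / r)) - 5 * enn2real (1 / q)"
proof -
  obtain t0 Cs where t0: "t0 > 0" and Cs: "Cs > 0" and est: "\<And>h u u1. 0 < h \<Longrightarrow> h < 1 \<Longrightarrow> wave_solution u u1 \<Longrightarrow>
       ennreal (h powr strichartz_beta q r) * LqLr_norm q r t0 (time_multiplier (\<lambda>\<tau>. of_real (chi (h * \<tau>))) u)
         \<le> ennreal Cs * (Lr_norm 2 (u 0) + Lr_norm 2 (\<lambda>z. of_real h * (- \<i> * u1 z)))"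
    using str unfolding strichartz_estimate_def by blast
  obtain d where d: "d > 0" "\<And>\<tau>. \<bar>\<tau> - 1\<bar> < d \<Longrightarrow> chi \<tau> = 1"
    using chi(2) by (auto simp: eventually_nhds_metric dist_real_def)
  \<comment> \<open>the frequencies of the wave fill at most the band from \<open>1 - \<delta>\<close> to \<open>1 + \<epsilon>\<^sup>2\<close>, on which \<open>chi\<close> has to be \<open>1\<close>\<close>
  define \<delta> where "\<delta> = min (1/4) (d / 2)"
  define t1 where "t1 = min t0 1"
  have del: "0 < \<delta>" "\<delta> \<le> 1/4" "\<delta> < d" using d(1) by (auto simp: \<delta>_def min_def)
  have t1: "0 < t1" "t1 \<le> 1" "t1 \<le> t0" using t0 by (auto simp: t1_def)
  obtain \<theta> C k0 \<omega> where C: "C > 0" and z: "\<forall>k\<ge>k0. (\<omega> k :: real) \<ge> 1 \<and> airy (- \<omega> k) = 0 \<and>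
     \<bar>liou_zeta (\<omega> k) - (real k * pi - \<theta>)\<bar> \<le> C / real k \<and> (airy' (- \<omega> k))\<^sup>2 \<le> C * sqrt (\<omega> k)"
    using airy_zeros by blast
  obtain \<epsilon>0 where e0: "\<epsilon>0 > 0" "\<And>\<epsilon>. 0 < \<epsilon> \<Longrightarrow> \<epsilon> < \<epsilon>0 \<Longrightarrow> \<epsilon> \<le> 1/80 \<and> 2 + \<bar>\<theta>\<bar> \<le> 1 / (4 * \<epsilon> ^ 3) \<and> real k0 \<le> 1 / (16 * \<epsilon> ^ 3) \<and> 160 * C * \<epsilon>\<^sup>2 \<le> 1
       \<and> 1 / (40 * \<epsilon>) + 8 \<le> \<delta> / (3 * \<epsilon> ^ 3) \<and> \<epsilon>\<^sup>2 \<le> \<delta> \<and> \<epsilon> \<le> t1 / 18"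
    using small_parameters[OF C del(1,2) t1(1), of \<theta> k0] by blast
  show ?thesis
  proof (rule powr_bounded_near_zero_imp_nonneg[OF e0(1)])
    fix \<epsilon> assume e: "0 < \<epsilon>" "\<epsilon> < \<epsilon>0"
    note sm = e0(2)[OF e]
    interpret gallery \<theta> C k0 \<omega> \<epsilon> \<delta>
      by unfold_locales (use z C e del sm in auto)
    have one: "chi \<tau> = 1" if "1 - \<delta> \<le> \<tau>" "\<tau> \<le> 1 + \<epsilon>\<^sup>2" for \<tau>
      using that sm del(3) by (intro d(2)) linarith
    show "\<epsilon> powr (2 * (1/2 - enn2real (1 / r)) - 5 * enn2real (1 / q)) \<le> 3 * Cs * sqrt (4 * pi * C)
     / ((t1 / 2) powr enn2real (1 / q) * (airy 2 * sqrt (2 * pi) * exp (- 1/2) / 4) * sqrt (2 * pi) powr (- (1 - enn2real (1 / r))) * sqrt (\<delta> / 640))"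
      by (rule strichartz_on_beam[OF chi one r q t1 _ _ Cs est]) (use sm in blast)+
  qed
qed

text \<open>For \<open>q = \<infinity>\<close> both claims are trivial since \<open>r \<ge> 2\<close>; otherwise they restate the nonnegative exponent.\<close>

theorem theorem1:
  fixes chi :: "real \<Rightarrow> real" and q r :: ennreal
  assumes "chi \<in> Cc_infinity UNIV"
    and "eventually (\<lambda>\<tau>. chi \<tau> = 1) (nhds 1)"
    and "1 \<le> q" and "2 \<le> r"
    and "strichartz_estimate chi q r"
  shows "enn2real (1 / q) \<le> (1/2 - 1/10) * (1/2 - enn2real (1 / r)) \<and>
         (r = \<infinity> \<longrightarrow> 5 \<le> q)"
proof (cases "q = \<infinity>")
  case True
  have "enn2real (1 / r) \<le> 1/2"
  proof (cases "r = \<infinity>")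
    case False
    then obtain \<rho> where \<rho>: "r = ennreal \<rho>" "\<rho> \<ge> 0" by (cases r) auto
    have "\<rho> \<ge> 2" using assms(4) unfolding \<rho>(1) by (metis ennreal_le_iff ennreal_numeral \<rho>(2))
    then have "enn2real (1 / r) = 1 / \<rho>" using \<rho> divide_ennreal[of 1 \<rho>] by (simp del: divide_ennreal)
    moreover have "1 / \<rho> \<le> 1 / 2" using \<open>\<rho> \<ge> 2\<close> by (simp add: field_simps)
    ultimately show ?thesis by simp
  qed simp
  then show ?thesis using True by simp
next
  case False
  have "1 \<le> r" using assms(4) by (rule order_trans[rotated]) simp
  note bound = strichartz_exponent_bound[OF assms(1,2,3) False this assms(5)]
  have "5 \<le> q" if "r = \<infinity>"
  proof -
    obtain \<kappa> where \<kappa>: "q = ennreal \<kappa>" "\<kappa> \<ge> 0" using False by (cases q) auto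
    have k1: "\<kappa> \<ge> 1" using assms(3) unfolding \<kappa>(1) by (metis ennreal_1 ennreal_le_iff \<kappa>(2))
    then have "enn2real (1 / q) = 1 / \<kappa>" using \<kappa> divide_ennreal[of 1 \<kappa>] by (simp del: divide_ennreal)
    then have "1 / \<kappa> \<le> 1 / 5" using bound that by simp
    then have "5 \<le> \<kappa>" using k1 by (simp add: field_simps)
    then show ?thesis unfolding \<kappa>(1) by (metis ennreal_leI ennreal_numeral)
  qed
  then show ?thesis using bound by (simp add: field_simps)
qed

end
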